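(* Let $d,m\ge1$, let $W\subset\mathbb{R}^d$ be a convex body and let $\alpha_1,\dots,\alpha_m\in\mathbb{R}$ satisfy $\alpha_i+\alpha_j>-d$ for all $i,j\in\{1,\dots,m\}$. Let $(\epsilon_t)_{t>0}$ be positive real numbers with $\epsilon_t\to0$ as $t\to\infty$, such that $\lim_{t\to\infty}t\epsilon_t^d$ exists in $[0,\infty]$, and assume that $t^2\epsilon_t^d\to\infty$ as $t\to\infty$. Let the vector $\tilde L_t=(\tilde L_t^{(\alpha_1)},\dots,\tilde L_t^{(\alpha_m)})$, the matrix $C=(C_{ij})$ with $C_{ij}=|W|c_{ij}$, and the quantities $\beta_{ij}^{(t)}$ be as defined in the context, and let $X\sim\mathcal{N}(0,C)$ be a centred Gaussian vector with covariance matrix $C$. Then: (1) If $\alpha_1,\dots,\alpha_m>-\frac d4$, there is a constant $c_1>0$ such that for all $t\ge1$ large enough $$d_3(\tilde L_t,X)\le c_1\left(\epsilon_t+\max_{1\le i,j\le m}\left|\beta_{ij}^{(t)}-c_{ij}\right|+\left(t^{-1/2}\vee(t^2\epsilon_t^d)^{-1/2}\right)\right).$$ (2) If $-\frac d2<\min\{\alpha_1,\dots,\alpha_m\}\le-\frac d4$, then for any $1<p<-\frac d2\left(\min\{\alpha_1,\dots,\alpha_m\}\right)^{-1}$ there is a constant $c_2>0$ such that for all $t\ge1$ large enough $$d_3(\tilde L_t,X)\le c_2\left(\epsilon_t+\max_{1\le i,j\le m}\left|\beta_{ij}^{(t)}-c_{ij}\right|+\left(t^{-1+1/p}\vee(t^2\epsilon_t^d)^{-1+1/p}\right)\right).$$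 (3) If $\lim_{t\to\infty}t\epsilon_t^d<\infty$, then the bounds in (1) and (2) (under the respective assumptions on the $\alpha_i$ and $p$) also hold with $d_2(\tilde L_t,X)$ in place of $d_3(\tilde L_t,X)$, for different constants $c_1,c_2>0$.
   Context: A convex body is a compact convex set with non-empty interior; $|W|$ is its Lebesgue measure; $\kappa_d$ is the volume of the unit ball in $\mathbb{R}^d$; $a\vee b=\max(a,b)$; $\|\cdot\|$ is the Euclidean norm. For $t>0$, $\eta^t$ is a Poisson measure on $\mathbb{R}^d$ with intensity $t\,dx$, and $\eta^t_{|W}$ is its restriction to $W$. For $\alpha\in\mathbb{R}$, $$L_t^{(\alpha)}=L_t^{(\alpha)}(W):=\frac12\sum_{x,y\in\eta^t_{|W}}\mathbf{1}_{\{0<\|x-y\|<\epsilon_t\}}\|x-y\|^\alpha ,$$ (sum over ordered pairs of points), and $$\tilde L_t^{(\alpha_i)}:=\left(t\epsilon_t^{\alpha_i+d/2}\vee t^{3/2}\epsilon_t^{\alpha_i+d}\right)^{-1}\left(L_t^{(\alpha_i)}-\mathbb{E}L_t^{(\alpha_i)}\right).$$ Set $$\sigma_{ij}^{(1)}:=\frac{d\kappa_d}{2|\alpha_i+\alpha_j+d|},\qquad \sigma_{ij}^{(2)}:=\frac{d^2\kappa_d^2}{(\alpha_i+d)(\alpha_j+d)},\qquad \beta_{ij}^{(t)}:=\frac{\sigma_{ij}^{(1)}+\sigma_{ij}^{(2)}t\epsilon_t^d}{1\vee t\epsilon_t^d},$$ and, according to the value of $\lim_{t\to\infty}t\epsilon_t^d$: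 $c_{ij}:=\sigma_{ij}^{(1)}$ if the limit is $0$; $c_{ij}:=\sigma_{ij}^{(1)}+\theta\sigma_{ij}^{(2)}$ if the limit is $\theta\in(0,1]$; $c_{ij}:=\frac1\theta\sigma_{ij}^{(1)}+\sigma_{ij}^{(2)}$ if the limit is $\theta\in(1,\infty)$; $c_{ij}:=\sigma_{ij}^{(2)}$ if the limit is $\infty$. Distances: for $\phi:\mathbb{R}^m\to\mathbb{R}$ of class $\mathcal{C}^k$, $\|\phi^{(k)}\|_\infty$ is the maximum over all $k$-th order partial derivatives of their sup-norms. $\mathcal{H}^{(2)}_m$ is the set of $\mathcal{C}^2$ functions $h:\mathbb{R}^m\to\mathbb{R}$ with $|h(x)-h(y)|\le\|x-y\|$ for all $x,y$ and $\sup_x\|\operatorname{Hess}h(x)\|_{op}\le1$ ($\|\cdot\|_{op}$ the operator norm). $\mathcal{H}^{(3)}_m$ is the set of $\mathcal{C}^3$ functions $h:\mathbb{R}^m\to\mathbb{R}$ with $\|h^{(2)}\|_\infty\le1$ and $\|h^{(3)}\|_\infty\le1$. For $k\in\{2,3\}$, $d_k(X,Y):=\sup_{h\in\mathcal{H}^{(k)}_m}|\mathbb{E}h(X)-\mathbb{E}h(Y)|$ (for random vectors with finite first moment of the norm if $k=2$, finite second moment if $k=3$). The constants do not depend on $t$ (they may depend on all other data, including $p$ in case (2)). *)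

theory Defs
  imports "HOL-Probability.Probability"
begin

text \<open>
  A Poisson measure is a random \<open>\<sigma>\<close>-finite measure with values in the natural numbers and infinity.
  The counting probabilities are written out since \<^const>\<open>poisson_pmf\<close> needs a positive rate,
  whereas a set of intensity \<open>0\<close> (almost surely without points) is allowed here.
\<close>

locale poisson_measure = prob_space M
  for M :: "'w measure" and \<eta> :: "'w \<Rightarrow> 'a measure" and \<Lambda> :: "'a measure" +
  assumes sets_eta: "\<And>\<omega>. \<omega> \<in> space M \<Longrightarrow> sets (\<eta> \<omega>) = sets \<Lambda>"
    and sigma_finite_eta: "\<And>\<omega>. \<omega> \<in> space M \<Longrightarrow> sigma_finite_measure (\<eta> \<omega>)"
    and integer_valued: "\<And>\<omega> A. \<omega> \<in> space M \<Longrightarrow> A \<in> sets \<Lambda> \<Longrightarrow>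
          emeasure (\<eta> \<omega>) A \<in> insert \<infinity> (range of_nat)"
    and measurable_eta: "\<And>A. A \<in> sets \<Lambda> \<Longrightarrow> (\<lambda>\<omega>. emeasure (\<eta> \<omega>) A) \<in> borel_measurable M"
    and poisson_finite: "\<And>A k. A \<in> sets \<Lambda> \<Longrightarrow> emeasure \<Lambda> A < \<infinity> \<Longrightarrow>
          prob {\<omega> \<in> space M. emeasure (\<eta> \<omega>) A = of_nat k} =
            measure \<Lambda> A ^ k / fact k * exp (- measure \<Lambda> A)"
    and poisson_infinite: "\<And>A. A \<in> sets \<Lambda> \<Longrightarrow> emeasure \<Lambda> A = \<infinity> \<Longrightarrow>
          (AE \<omega> in M. emeasure (\<eta> \<omega>) A = \<infinity>)"
    and independent: "\<And>(A :: nat \<Rightarrow> 'a set) n. (\<And>i. i < n \<Longrightarrow> A i \<in> sets \<Lambda>) \<Longrightarrow>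
          disjoint_family_on A {..<n} \<Longrightarrow>
          indep_vars (\<lambda>_. borel) (\<lambda>i \<omega>. emeasure (\<eta> \<omega>) (A i)) {..<n}"

definition points :: "'a measure \<Rightarrow> 'a set" where
  "points \<mu> = {x \<in> space \<mu>. emeasure \<mu> {x} \<noteq> 0}"

definition convex_body :: "'a::euclidean_space set \<Rightarrow> bool" where
  "convex_body W \<longleftrightarrow> compact W \<and> convex W \<and> interior W \<noteq> {}"

text \<open>
  For a Poisson measure with intensity \<open>t dx\<close>, almost surely only finitely many points lie in
  a bounded \<open>W\<close> and all of them have mass one. So the value \<open>0\<close> of sums over
  infinite sets, and the fact that multiplicities are not counted, matter only on a null set.
\<close>

definition edge_sum :: "'a::euclidean_space set \<Rightarrow> real \<Rightarrow> real \<Rightarrow> 'a measure \<Rightarrow> real" where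
  "edge_sum W r \<alpha> \<mu> =
     1 / 2 * (\<Sum>(x, y) \<in> {(x, y) \<in> (points \<mu> \<inter> W) \<times> (points \<mu> \<inter> W). 0 < norm (x - y) \<and> norm (x - y) < r}.
       norm (x - y) powr \<alpha>)"

definition normalized_edge_sum ::
    "'w measure \<Rightarrow> ('w \<Rightarrow> 'a::euclidean_space measure) \<Rightarrow> 'a set \<Rightarrow> real \<Rightarrow> real \<Rightarrow> real \<Rightarrow> 'w \<Rightarrow> real" where
  "normalized_edge_sum M \<eta> W t r \<alpha> \<omega> =
     inverse (max (t * r powr (\<alpha> + real DIM('a) / 2)) (t powr (3 / 2) * r powr (\<alpha> + real DIM('a)))) *
     (edge_sum W r \<alpha> (\<eta> \<omega>) - prob_space.expectation M (\<lambda>\<omega>'. edge_sum W r \<alpha> (\<eta> \<omega>')))"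

definition normalized_edge_vector ::
    "'w measure \<Rightarrow> ('w \<Rightarrow> 'a::euclidean_space measure) \<Rightarrow> 'a set \<Rightarrow> real \<Rightarrow> real \<Rightarrow> ('m \<Rightarrow> real)
      \<Rightarrow> 'w \<Rightarrow> real ^ 'm::finite" where
  "normalized_edge_vector M \<eta> W t r \<alpha> \<omega> = (\<chi> i. normalized_edge_sum M \<eta> W t r (\<alpha> i) \<omega>)"

definition sigma1 :: "nat \<Rightarrow> real \<Rightarrow> real \<Rightarrow> real" where
  "sigma1 d a b = real d * unit_ball_vol (real d) / (2 * \<bar>a + b + real d\<bar>)"

definition sigma2 :: "nat \<Rightarrow> real \<Rightarrow> real \<Rightarrow> real" where
  "sigma2 d a b = (real d)\<^sup>2 * (unit_ball_vol (real d))\<^sup>2 / ((a + real d) * (b + real d))"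

definition cov_beta :: "nat \<Rightarrow> real \<Rightarrow> real \<Rightarrow> real \<Rightarrow> real \<Rightarrow> real" where
  "cov_beta d t r a b = (sigma1 d a b + sigma2 d a b * t * r ^ d) / max 1 (t * r ^ d)"

definition cov_lim :: "nat \<Rightarrow> ereal \<Rightarrow> real \<Rightarrow> real \<Rightarrow> real" where
  "cov_lim d \<theta> a b =
     (if \<theta> = 0 then sigma1 d a b
      else if \<theta> \<le> 1 then sigma1 d a b + real_of_ereal \<theta> * sigma2 d a b
      else if \<theta> < \<infinity> then 1 / real_of_ereal \<theta> * sigma1 d a b + sigma2 d a b
      else sigma2 d a b)"

text \<open>A Gaussian vector is one all of whose linear combinations are (possibly degenerate) normal;
  the covariance matrix may thus be singular.\<close>

definition normal_law :: "real \<Rightarrow> real \<Rightarrow> real measure" where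
  "normal_law \<mu> \<sigma> = (if \<sigma> = 0 then return borel \<mu> else density lborel (\<lambda>x. ennreal (normal_density \<mu> \<sigma> x)))"

definition gaussian_vector :: "'v measure \<Rightarrow> ('v \<Rightarrow> real ^ 'm::finite) \<Rightarrow> bool" where
  "gaussian_vector N X \<longleftrightarrow> X \<in> borel_measurable N \<and>
     (\<forall>u. \<exists>\<mu> \<sigma>. \<sigma> \<ge> 0 \<and> distr N borel (\<lambda>\<omega>. u \<bullet> X \<omega>) = normal_law \<mu> \<sigma>)"

definition centred_gaussian :: "'v measure \<Rightarrow> ('v \<Rightarrow> real ^ 'm::finite) \<Rightarrow> real ^ 'm ^ 'm \<Rightarrow> bool" where
  "centred_gaussian N X C \<longleftrightarrow> gaussian_vector N X \<and>
     (\<forall>i. prob_space.expectation N (\<lambda>\<omega>. X \<omega> $ i) = 0) \<and>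
     (\<forall>i j. prob_space.expectation N (\<lambda>\<omega>. X \<omega> $ i * X \<omega> $ j) = C $ i $ j)"

definition partial :: "'m \<Rightarrow> (real ^ 'm::finite \<Rightarrow> real) \<Rightarrow> real ^ 'm \<Rightarrow> real" where
  "partial i f x = frechet_derivative f (at x) (axis i 1)"

text \<open>The derivatives of order up to \<open>k\<close> exist (as Frechet derivatives of the lower order
  partial derivatives) and are continuous.\<close>

primrec C_k :: "nat \<Rightarrow> (real ^ 'm::finite \<Rightarrow> real) \<Rightarrow> bool" where
  "C_k 0 f \<longleftrightarrow> continuous_on UNIV f"
| "C_k (Suc k) f \<longleftrightarrow> f differentiable_on UNIV \<and> (\<forall>i. C_k k (partial i f))"

text \<open>
  \<open>foldr partial is f\<close> for a list of \<open>k\<close> indices ranges over all \<open>k\<close>-th order partial derivatives.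
\<close>

definition deriv_sup_norm :: "nat \<Rightarrow> (real ^ 'm::finite \<Rightarrow> real) \<Rightarrow> ereal" where
  "deriv_sup_norm k f = (SUP is \<in> {is :: 'm list. length is = k}. SUP x. ereal \<bar>foldr partial is f x\<bar>)"

definition hessian :: "(real ^ 'm::finite \<Rightarrow> real) \<Rightarrow> real ^ 'm \<Rightarrow> real ^ 'm ^ 'm" where
  "hessian f x = (\<chi> i j. partial i (partial j f) x)"

definition H2 :: "(real ^ 'm::finite \<Rightarrow> real) set" where
  "H2 = {h. C_k 2 h \<and> (\<forall>x y. \<bar>h x - h y\<bar> \<le> norm (x - y)) \<and>
            (SUP x. ereal (onorm (\<lambda>v. hessian h x *v v))) \<le> 1}"

definition H3 :: "(real ^ 'm::finite \<Rightarrow> real) set" where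
  "H3 = {h. C_k 3 h \<and> deriv_sup_norm 2 h \<le> 1 \<and> deriv_sup_norm 3 h \<le> 1}"

text \<open>
  Meant for random vectors for which all the expectations exist: first moments of the norm
  suffice for \<open>H2\<close>, second moments for \<open>H3\<close>.
\<close>

definition test_dist :: "(real ^ 'm::finite \<Rightarrow> real) set \<Rightarrow>
    'w measure \<Rightarrow> ('w \<Rightarrow> real ^ 'm) \<Rightarrow> 'v measure \<Rightarrow> ('v \<Rightarrow> real ^ 'm) \<Rightarrow> ereal" where
  "test_dist H M X N Y =
     (SUP h \<in> H. ereal \<bar>prob_space.expectation M (\<lambda>\<omega>. h (X \<omega>)) - prob_space.expectation N (\<lambda>\<omega>. h (Y \<omega>))\<bar>)"

definition d2 :: "'w measure \<Rightarrow> ('w \<Rightarrow> real ^ 'm::finite) \<Rightarrow> 'v measure \<Rightarrow> ('v \<Rightarrow> real ^ 'm) \<Rightarrow> ereal" where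
  "d2 = test_dist H2"

definition d3 :: "'w measure \<Rightarrow> ('w \<Rightarrow> real ^ 'm::finite) \<Rightarrow> 'v measure \<Rightarrow> ('v \<Rightarrow> real ^ 'm) \<Rightarrow> ereal" where
  "d3 = test_dist H3"

end

theory Submission
  imports Defs "HOL-Real_Asymp.Real_Asymp"
begin

text \<open>
  Replace the points in \<open>W\<close> by their cells in a dyadic grid: \<open>L\<^sub>t\<close> is an almost sure and dominated
  limit of quadratic forms \<open>F = 1/2 \<Sum> k(a,b) n\<^sub>a n\<^sub>b\<close> in independent Poisson counts \<open>n\<^sub>a\<close>.
  For such forms the Mecke formula gives \<open>E (F\<^sub>i - E F\<^sub>i) G = \<Sum>\<^sub>a \<lambda>\<^sub>a E (G(n + e\<^sub>a) - G(n)) (S\<^sub>i(a) + m\<^sub>i(a)) / 2\<close>,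
  where \<open>S\<^sub>i(a)\<close> is the increment of \<open>F\<^sub>i\<close> at \<open>a\<close> and \<open>m\<^sub>i(a)\<close> its mean: an explicit inverse of the
  Ornstein-Uhlenbeck generator, so no Malliavin calculus is needed.
  Differentiating \<open>E h(sin \<phi> F + cos \<phi> X)\<close> in \<open>\<phi>\<close> and integrating by parts on both sides leaves the
  fluctuation of a quadratic functional around the covariance and a remainder of Taylor type. The remainder
  is controlled by \<open>q\<close>-th moments of the kernel with \<open>2 \<le> q \<le> 3\<close>, which yields the exponent
  \<open>1 - q/2\<close>: \<open>q = 3\<close> if all \<open>\<alpha>\<^sub>i > -d/4\<close>, and \<open>q = min (2p) 3\<close> otherwise.

  For \<open>d2\<close> the third derivative of \<open>h\<close> is traded for a Gaussian shift estimate in directions of the range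
  of \<open>C\<close>. All increments are combinations of vectors \<open>(\<rho>\<^bsup>\<alpha>\<^sub>i\<^esup>)\<^sub>i\<close>, and these lie in that
  range even when \<open>C\<close> is singular, because the first part of the limiting covariance is the Gram matrix
  of the functions \<open>\<rho> \<mapsto> \<rho>\<^bsup>\<alpha>\<^sub>i\<^esup>\<close>.
\<close>

section \<open>Uniqueness of characteristic functions\<close>

text \<open>The obstacle is the negative exponents: third moments of the kernel are infinite once
  some \<alpha> is at most -d/3. The Taylor remainder is therefore kept as s * min 1 s, which is
  only linear for large increments s, so that a moment of order q suffices. Where third derivatives
  are missing, the Gaussian noise cos \<phi> X supplies the regularity at a cost 1 / cos \<phi>; but
  differentiating sin \<phi> F + cos \<phi> X puts a factor cos \<phi> in front of F, and the two
  cancel, so the estimate is uniform along the path. Three sums around a fixed cell control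
  everything: those of K, of K^2 and of K * \<psi> K, of orders t^(-1/2), 1/t and (t^2
  \<epsilon>^d)^(1 - q/2) / t. The outer sum over cells contributes a further factor t |W|. The
  upper bound on p says that 2 p min \<alpha> > -d, so the moment of order 2 p is finite; its
  exponent 1 - p is at most -1 + 1/p. If t \<epsilon>^d tends to infinity, only the rank one part of
  the covariance survives, the range of C is a line, and the increments can leave it; hence the
  restriction for \<open>d2\<close>.\<close>

lemma gaussian_kernel_fourier:
  fixes z :: "'a::euclidean_space"
  defines "G \<equiv> distr (\<Pi>\<^sub>M b\<in>(Basis::'a set). std_normal_distribution) borel (\<lambda>f. \<Sum>b\<in>Basis. f b *\<^sub>R b)"
  shows "(\<integral>u. iexp (c * (u \<bullet> z)) \<partial>G) = complex_of_real (exp (- (c\<^sup>2 * (z \<bullet> z)) / 2))"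
    and "prob_space G"
proof -
  interpret P: prob_space std_normal_distribution
    by (rule prob_space_normal_density) simp
  interpret PP: product_prob_space "\<lambda>_. std_normal_distribution" "Basis :: 'a set"
    by unfold_locales
  interpret PF: finite_product_sigma_finite "\<lambda>_. std_normal_distribution" "Basis :: 'a set"
    by unfold_locales simp
  have meas[measurable]: "(\<lambda>f. \<Sum>b\<in>Basis. f b *\<^sub>R b) \<in> (\<Pi>\<^sub>M b\<in>(Basis::'a set). std_normal_distribution) \<rightarrow>\<^sub>M (borel :: 'a measure)"
    by measurable
  have int: "integrable std_normal_distribution (\<lambda>x. iexp (c * (b \<bullet> z) * x))" for b
    by (rule P.integrable_iexp) auto
  have "(\<integral>u. iexp (c * (u \<bullet> z)) \<partial>G)
      = (\<integral>f. iexp (c * ((\<Sum>b\<in>Basis. f b *\<^sub>R b) \<bullet> z)) \<partial>(\<Pi>\<^sub>M b\<in>(Basis::'a set). std_normal_distribution))"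
    unfolding G_def by (intro integral_distr) auto
  also have "\<dots> = (\<integral>f. (\<Prod>b\<in>Basis. iexp (c * (b \<bullet> z) * f b)) \<partial>(\<Pi>\<^sub>M b\<in>(Basis::'a set). std_normal_distribution))"
    by (intro Bochner_Integration.integral_cong refl)
       (simp add: exp_sum[symmetric] inner_sum_left sum_distrib_left mult_ac)
  also have "\<dots> = (\<Prod>b\<in>Basis. \<integral>x. iexp (c * (b \<bullet> z) * x) \<partial>std_normal_distribution)"
    by (intro PP.product_integral_prod finite_Basis int)
  also have "\<dots> = (\<Prod>b\<in>Basis. complex_of_real (exp (- (c * (b \<bullet> z))\<^sup>2 / 2)))"
    using char_std_normal_distribution by (intro prod.cong refl) (simp add: char_def fun_eq_iff flip: of_real_mult)
  also have "\<dots> = complex_of_real (exp (\<Sum>b\<in>Basis. - (c * (b \<bullet> z))\<^sup>2 / 2))"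
    by (simp add: exp_sum)
  also have "(\<Sum>b\<in>Basis. - (c * (b \<bullet> z))\<^sup>2 / 2) = - (c\<^sup>2 * (z \<bullet> z)) / 2"
    by (subst (2) euclidean_inner)
       (simp add: power_mult_distrib power2_eq_square sum_distrib_left sum_negf sum_divide_distrib inner_commute mult_ac)
  finally show "(\<integral>u. iexp (c * (u \<bullet> z)) \<partial>G) = complex_of_real (exp (- (c\<^sup>2 * (z \<bullet> z)) / 2))" .
  show "prob_space G" unfolding G_def
    by (rule PP.prob_space_distr) measurable
qed

lemma integrable_gaussian_kernel:
  "integrable lborel (\<lambda>y::'a::euclidean_space. exp (- (y \<bullet> y) / 2))"
proof (rule integrableI_nonneg)
  have fin: "(\<integral>\<^sup>+ x. ennreal (exp (- x\<^sup>2 / 2)) \<partial>lborel) < \<infinity>"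
  proof -
    have "integrable lborel (\<lambda>x::real. std_normal_density x * sqrt (2 * pi))" by simp
    then have "integrable lborel (\<lambda>x::real. exp (- x\<^sup>2 / 2))"
      by (simp add: std_normal_density_def)
    then show ?thesis by (simp add: integrable_iff_bounded)
  qed
  have "(\<integral>\<^sup>+ x. ennreal (exp (- (x \<bullet> x) / 2)) \<partial>(lborel :: 'a measure))
     = (\<integral>\<^sup>+ x. (\<Prod>b\<in>Basis. ennreal (exp (- (x \<bullet> b)\<^sup>2 / 2))) \<partial>(lborel :: 'a measure))"
  proof (intro nn_integral_cong)
    fix x :: 'a
    have "- (x \<bullet> x) / 2 = (\<Sum>b\<in>Basis. - (x \<bullet> b)\<^sup>2 / 2)"
      by (subst euclidean_inner) (simp add: power2_eq_square sum_negf sum_divide_distrib)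
    then show "ennreal (exp (- (x \<bullet> x) / 2)) = (\<Prod>b\<in>Basis. ennreal (exp (- (x \<bullet> b)\<^sup>2 / 2)))"
      by (simp add: exp_sum prod_ennreal)
  qed
  also have "\<dots> = (\<Prod>b\<in>(Basis::'a set). \<integral>\<^sup>+ x. ennreal (exp (- x\<^sup>2 / 2)) \<partial>lborel)"
    by (subst nn_integral_lborel_prod) auto
  also have "\<dots> < \<infinity>" using fin by (simp add: power_less_top_ennreal top.not_eq_extremum)
  finally show "(\<integral>\<^sup>+ x. ennreal (exp (- (x \<bullet> x) / 2)) \<partial>(lborel :: 'a measure)) < \<infinity>" .
qed auto

text \<open>The indicator of a closed set is the pointwise limit of the continuous functions
  \<open>max 0 (1 - n * infdist x A)\<close>, and the closed sets are an intersection-stable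
  generator of the Borel sets.\<close>

lemma measure_eqI_closed:
  fixes \<mu> \<nu> :: "'a::metric_space measure"
  assumes "prob_space \<mu>" "prob_space \<nu>" and sets: "sets \<mu> = sets borel" "sets \<nu> = sets borel"
    and eq: "\<And>f::'a \<Rightarrow> real. continuous_on UNIV f \<Longrightarrow> (\<And>x. \<bar>f x\<bar> \<le> 1) \<Longrightarrow> (\<integral>x. f x \<partial>\<mu>) = (\<integral>x. f x \<partial>\<nu>)"
  shows "\<mu> = \<nu>"
proof -
  interpret m: prob_space \<mu> by fact
  interpret n: prob_space \<nu> by fact
  have closed: "measure \<mu> A = measure \<nu> A" if A: "closed A" "A \<noteq> {}" for A
  proof -
    define f where "f n x = max 0 (1 - real n * infdist x A)" for n x
    have cont: "continuous_on UNIV (f n)" for n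
      unfolding f_def by (intro continuous_intros)
    have bd: "\<bar>f n x\<bar> \<le> 1" for n x
      unfolding f_def by (auto simp: max_def infdist_nonneg)
    have lim: "(\<lambda>n. f n x) \<longlonglongrightarrow> indicat_real A x" for x
    proof (cases "x \<in> A")
      case True then show ?thesis by (simp add: f_def)
    next
      case False
      then have pos: "infdist x A > 0"
        using A in_closed_iff_infdist_zero[of A x] infdist_nonneg[of x A] by auto
      obtain k :: nat where k: "1 / infdist x A < k" using reals_Archimedean2 by blast
      have "eventually (\<lambda>n. f n x = 0) sequentially"
        using eventually_ge_at_top[of k]
      proof eventually_elim
        case (elim n)
        then have "1 / infdist x A < real n" using k by linarith
        then show ?case using pos by (auto simp: f_def field_simps max_def)
      qed
      then show ?thesis using False by (simp add: tendsto_eventually)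
    qed
    have mf: "f n \<in> borel_measurable borel" for n
      by (rule borel_measurable_continuous_onI[OF cont])
    have Am: "A \<in> sets borel" using A by auto
    have "(\<lambda>n. \<integral>x. f n x \<partial>\<mu>) \<longlonglongrightarrow> (\<integral>x. indicat_real A x \<partial>\<mu>)"
      by (rule integral_dominated_convergence[where w="\<lambda>_. 1"])
         (use lim bd mf Am in \<open>auto simp: measurable_cong_sets[OF sets(1) refl]\<close>)
    moreover have "(\<lambda>n. \<integral>x. f n x \<partial>\<nu>) \<longlonglongrightarrow> (\<integral>x. indicat_real A x \<partial>\<nu>)"
      by (rule integral_dominated_convergence[where w="\<lambda>_. 1"])
         (use lim bd mf Am in \<open>auto simp: measurable_cong_sets[OF sets(2) refl]\<close>)
    ultimately have "(\<integral>x. indicat_real A x \<partial>\<mu>) = (\<integral>x. indicat_real A x \<partial>\<nu>)"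
      using eq[OF cont bd] LIMSEQ_unique by auto
    then show ?thesis using Am sets sets_eq_imp_space_eq[OF sets(1)] sets_eq_imp_space_eq[OF sets(2)] by simp
  qed
  show ?thesis
  proof (rule measure_eqI_generator_eq[where E="Collect closed" and A="\<lambda>_. UNIV" and \<Omega>=UNIV])
    show "Int_stable (Collect closed :: 'a set set)" by (auto simp: Int_stable_def)
    show "emeasure \<mu> X = emeasure \<nu> X" if "X \<in> Collect closed" for X
      using closed[of X] that by (cases "X = {}") (auto simp: m.emeasure_eq_measure n.emeasure_eq_measure)
    show "sets \<mu> = sigma_sets UNIV (Collect closed)" "sets \<nu> = sigma_sets UNIV (Collect closed)"
      using sets by (simp_all add: borel_eq_closed sets_measure_of_conv)
  qed (auto simp: m.emeasure_eq_measure)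
qed

text \<open>\<open>K\<close> is the Fourier transform of the standard Gaussian law \<open>G\<close>,
  so by Fubini the smoothed density \<open>H m c y\<close> depends on \<open>m\<close> only through
  its characteristic function. Shrinking the kernel recovers the integrals of bounded continuous
  functions up to the factor \<open>integral\<^sup>L lborel K\<close>, which is cancelled because it
  is positive.\<close>

theorem char_uniqueness_euclidean:
  fixes \<mu> \<nu> :: "'a::euclidean_space measure"
  assumes pm: "prob_space \<mu>" and pn: "prob_space \<nu>" and sets: "sets \<mu> = sets borel" "sets \<nu> = sets borel"
    and char: "\<And>u. (\<integral>x. iexp (u \<bullet> x) \<partial>\<mu>) = (\<integral>x. iexp (u \<bullet> x) \<partial>\<nu>)"
  shows "\<mu> = \<nu>"
proof (rule measure_eqI_closed[OF pm pn sets])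
  fix f :: "'a \<Rightarrow> real"
  assume fc: "continuous_on UNIV f" and fb: "\<And>x. \<bar>f x\<bar> \<le> 1"
  have fm[measurable]: "f \<in> borel_measurable borel" by (rule borel_measurable_continuous_onI[OF fc])
  define G where "G = distr (\<Pi>\<^sub>M b\<in>(Basis::'a set). std_normal_distribution) borel (\<lambda>f. \<Sum>b\<in>Basis. f b *\<^sub>R b)"
  interpret G: prob_space G unfolding G_def by (rule gaussian_kernel_fourier)
  have sG[measurable_cong]: "sets G = sets borel" by (simp add: G_def)
  note [measurable_cong] = sets
  define K where "K z = exp (- (z \<bullet> z) / 2)" for z :: 'a
  have Km[measurable]: "K \<in> borel_measurable borel" unfolding K_def by measurable
  have K0: "K z \<ge> 0" for z by (simp add: K_def)
  have K1: "K z \<le> 1" for z by (simp add: K_def)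
  have Ki: "integrable lborel K" unfolding K_def by (rule integrable_gaussian_kernel)
  have Kf: "complex_of_real (K (c *\<^sub>R z)) = (\<integral>u. iexp (c * (u \<bullet> z)) \<partial>G)" for c z
    unfolding G_def gaussian_kernel_fourier by (simp add: K_def power2_eq_square mult_ac)
  define H where "H m c y = (\<integral>x. K (c *\<^sub>R (y - x)) \<partial>m)" for m :: "'a measure" and c y
  have Heq: "complex_of_real (H m c y) = (\<integral>u. iexp (c * (u \<bullet> y)) * (\<integral>x. iexp ((- c *\<^sub>R u) \<bullet> x) \<partial>m) \<partial>G)"
    if "prob_space m" and [measurable_cong]: "sets m = sets borel" for m c y
  proof -
    interpret m: prob_space m by fact
    interpret mG: pair_prob_space m G ..
    have "complex_of_real (H m c y) = (\<integral>x. complex_of_real (K (c *\<^sub>R (y - x))) \<partial>m)"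
      unfolding H_def by simp
    also have "\<dots> = (\<integral>x. (\<integral>u. iexp (c * (u \<bullet> (y - x))) \<partial>G) \<partial>m)" by (simp only: Kf)
    also have "\<dots> = (\<integral>u. (\<integral>x. iexp (c * (u \<bullet> (y - x))) \<partial>m) \<partial>G)"
      by (rule mG.Fubini_integral[symmetric], rule mG.integrable_const_bound[where B=1]) auto
    also have "\<dots> = (\<integral>u. iexp (c * (u \<bullet> y)) * (\<integral>x. iexp ((- c *\<^sub>R u) \<bullet> x) \<partial>m) \<partial>G)"
    proof (intro Bochner_Integration.integral_cong refl)
      fix u
      have "iexp (c * (u \<bullet> (y - x))) = iexp (c * (u \<bullet> y)) * iexp ((- c *\<^sub>R u) \<bullet> x)" for x
        by (simp add: exp_add[symmetric] inner_diff_right algebra_simps)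
      then show "(\<integral>x. iexp (c * (u \<bullet> (y - x))) \<partial>m) = iexp (c * (u \<bullet> y)) * (\<integral>x. iexp ((- c *\<^sub>R u) \<bullet> x) \<partial>m)"
        by simp
    qed
    finally show ?thesis .
  qed
  have HH: "H \<mu> c y = H \<nu> c y" for c y
  proof -
    have "complex_of_real (H \<mu> c y) = complex_of_real (H \<nu> c y)"
      unfolding Heq[OF pm sets(1)] Heq[OF pn sets(2)] char ..
    then show ?thesis by simp
  qed
  \<comment> \<open>\<open>f\<close> averaged over a Gaussian perturbation of size 1/c. A
    substitution turns this into an integral against \<open>K (c *\<^sub>R (y - x))\<close>, with
    Jacobian \<open>c ^ DIM('a)\<close>, and Fubini then produces \<open>H m c\<close>.\<close>
  define J where "J c x = (\<integral>y. f (x + y /\<^sub>R c) * K y \<partial>lborel)" for c x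
  have J: "(\<integral>x. J c x \<partial>m) = c ^ DIM('a) * (\<integral>y. f y * H m c y \<partial>lborel)"
    if "prob_space m" and [measurable_cong]: "sets m = sets borel" and c: "c > 0" for m c
  proof -
    interpret m: prob_space m by fact
    interpret ml: pair_sigma_finite m lborel ..
    have e: "c *\<^sub>R (x + (1/c) *\<^sub>R y - x) = y" for x y :: 'a using c by simp
    have Kci: "integrable lborel (\<lambda>y. K (c *\<^sub>R (y - x)))" for x
    proof -
      have "integrable (density (distr lborel borel (\<lambda>y. x + (1/c) *\<^sub>R y)) (\<lambda>_. ennreal (\<bar>1/c\<bar> ^ DIM('a)))) (\<lambda>y. K (c *\<^sub>R (y - x)))"
        using Ki c by (subst integrable_density) (simp_all add: integrable_distr_eq e)
      then show ?thesis using c by (subst lborel_affine[of "1/c" x]) simp_all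
    qed
    have cv: "J c x = c ^ DIM('a) * (\<integral>y. f y * K (c *\<^sub>R (y - x)) \<partial>lborel)" for x
    proof -
      have "(\<integral>y. f y * K (c *\<^sub>R (y - x)) \<partial>lborel) =
        (\<integral>y. f y * K (c *\<^sub>R (y - x)) \<partial>density (distr lborel borel (\<lambda>y. x + (1/c) *\<^sub>R y)) (\<lambda>_. ennreal (\<bar>1/c\<bar> ^ DIM('a))))"
        using c by (subst lborel_affine[of "1/c" x]) simp_all
      also have "\<dots> = (1/c) ^ DIM('a) * J c x"
        using c by (subst integral_density)
           (simp_all add: integral_distr J_def e inverse_eq_divide)
      finally show ?thesis using c by (simp add: field_simps)
    qed
    have nnK: "(\<integral>\<^sup>+ y. ennreal (K (c *\<^sub>R (y - x))) \<partial>lborel) = (\<integral>\<^sup>+ y. ennreal (K (c *\<^sub>R y)) \<partial>lborel)" for x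
      by (subst lborel_distr_plus[of x, symmetric], subst nn_integral_distr) auto
    have int: "integrable (m \<Otimes>\<^sub>M lborel) (\<lambda>(x, y). f y * K (c *\<^sub>R (y - x)))"
    proof (rule Bochner_Integration.integrable_bound[where f="\<lambda>(x,y). K (c *\<^sub>R (y - x))"])
      show "integrable (m \<Otimes>\<^sub>M lborel) (\<lambda>(x, y). K (c *\<^sub>R (y - x)))"
      proof (rule integrableI_nonneg)
        have "(\<integral>\<^sup>+ z. ennreal (case z of (x, y) \<Rightarrow> K (c *\<^sub>R (y - x))) \<partial>(m \<Otimes>\<^sub>M lborel))
          = (\<integral>\<^sup>+ x. (\<integral>\<^sup>+ y. ennreal (K (c *\<^sub>R (y - x))) \<partial>lborel) \<partial>m)"
          by (subst lborel.nn_integral_fst[symmetric]) auto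
        also have "\<dots> = (\<integral>\<^sup>+ y. ennreal (K (c *\<^sub>R y)) \<partial>lborel)"
          by (simp add: nnK m.emeasure_space_1)
        also have "\<dots> < \<infinity>" using Kci[of 0] by (simp add: integrable_iff_bounded K0)
        finally show "(\<integral>\<^sup>+ z. ennreal (case z of (x, y) \<Rightarrow> K (c *\<^sub>R (y - x))) \<partial>(m \<Otimes>\<^sub>M lborel)) < \<infinity>" .
      qed (auto simp: K0)
      show "AE z in m \<Otimes>\<^sub>M lborel. norm (case z of (x, y) \<Rightarrow> f y * K (c *\<^sub>R (y - x))) \<le> norm (case z of (x, y) \<Rightarrow> K (c *\<^sub>R (y - x)))"
        using fb K0 by (auto simp: abs_mult mult_left_le_one_le)
    qed auto
    have "(\<integral>x. J c x \<partial>m) = c ^ DIM('a) * (\<integral>x. (\<integral>y. f y * K (c *\<^sub>R (y - x)) \<partial>lborel) \<partial>m)"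
      by (simp add: cv)
    also have "(\<integral>x. (\<integral>y. f y * K (c *\<^sub>R (y - x)) \<partial>lborel) \<partial>m) = (\<integral>y. (\<integral>x. f y * K (c *\<^sub>R (y - x)) \<partial>m) \<partial>lborel)"
      by (rule ml.Fubini_integral[symmetric, OF int])
    finally show ?thesis by (simp add: H_def)
  qed
  have lim: "(\<lambda>n. \<integral>x. J (real (Suc n)) x \<partial>m) \<longlonglongrightarrow> (\<integral>x. f x * integral\<^sup>L lborel K \<partial>m)"
    if "prob_space m" and [measurable_cong]: "sets m = sets borel" for m
  proof (rule integral_dominated_convergence[where w="\<lambda>_. integral\<^sup>L lborel K"])
    interpret m: prob_space m by fact
    show "(\<lambda>x. J (real (Suc n)) x) \<in> borel_measurable m" for n unfolding J_def by measurable
    show "(\<lambda>x. f x * integral\<^sup>L lborel K) \<in> borel_measurable m" by measurable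
    show "integrable m (\<lambda>_. integral\<^sup>L lborel K)" by simp
    show "AE x in m. norm (J (real (Suc n)) x) \<le> integral\<^sup>L lborel K" for n
      unfolding J_def real_norm_def
      by (intro AE_I2 integral_abs_bound[THEN order_trans] integral_mono' Ki)
         (use fb K0 in \<open>auto simp: abs_mult mult_left_le_one_le\<close>)
    show "AE x in m. (\<lambda>n. J (real (Suc n)) x) \<longlonglongrightarrow> f x * integral\<^sup>L lborel K"
    proof (intro AE_I2)
      fix x
      have "(\<lambda>n. \<integral>y. f (x + y /\<^sub>R real (Suc n)) * K y \<partial>lborel) \<longlonglongrightarrow> (\<integral>y. f x * K y \<partial>lborel)"
      proof (rule integral_dominated_convergence[where w=K])
        show "AE y in lborel. (\<lambda>n. f (x + y /\<^sub>R real (Suc n)) * K y) \<longlonglongrightarrow> f x * K y"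
        proof (intro AE_I2 tendsto_mult tendsto_const)
          fix y :: 'a
          have "(\<lambda>n. inverse (real (Suc n))) \<longlonglongrightarrow> 0" by (rule LIMSEQ_inverse_real_of_nat)
          then have "(\<lambda>n. x + y /\<^sub>R real (Suc n)) \<longlonglongrightarrow> x + 0 *\<^sub>R y"
            by (intro tendsto_add tendsto_const tendsto_scaleR)
          then show "(\<lambda>n. f (x + y /\<^sub>R real (Suc n))) \<longlonglongrightarrow> f x"
            using fc by (auto simp: continuous_on_eq_continuous_at intro: isCont_tendsto_compose)
        qed
        show "AE y in lborel. norm (f (x + y /\<^sub>R real (Suc n)) * K y) \<le> K y" for n
          using fb K0 by (auto simp: abs_mult mult_left_le_one_le)
      qed (use Ki in auto)
      then show "(\<lambda>n. J (real (Suc n)) x) \<longlonglongrightarrow> f x * integral\<^sup>L lborel K"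
        by (simp add: J_def)
    qed
  qed
  have eqJ: "(\<integral>x. J (real (Suc n)) x \<partial>\<mu>) = (\<integral>x. J (real (Suc n)) x \<partial>\<nu>)" for n
    by (simp add: J[OF pm sets(1)] J[OF pn sets(2)] HH)
  have "(\<integral>x. f x * integral\<^sup>L lborel K \<partial>\<mu>) = (\<integral>x. f x * integral\<^sup>L lborel K \<partial>\<nu>)"
    by (rule LIMSEQ_unique[OF lim[OF pm sets(1), unfolded eqJ] lim[OF pn sets(2)]])
  moreover have "integral\<^sup>L lborel K > 0"
  proof -
    have "integral\<^sup>L lborel K \<noteq> 0"
    proof
      assume "integral\<^sup>L lborel K = 0"
      then have "AE x in lborel. K x = 0"
        by (subst (asm) integral_nonneg_eq_0_iff_AE[OF Ki]) (auto simp: K0)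
      then have "AE x in (lborel::'a measure). False" by (simp add: K_def)
      then show False using AE_iff_measurable[of UNIV lborel "\<lambda>_::'a. False"] by simp
    qed
    then show ?thesis using Bochner_Integration.integral_nonneg[of lborel K] K0 by (simp add: less_eq_real_def)
  qed
  ultimately show "(\<integral>x. f x \<partial>\<mu>) = (\<integral>x. f x \<partial>\<nu>)" by simp
qed

section \<open>Gaussian integration by parts\<close>

text \<open>Integrate the derivative of density times \<open>f\<close> over the line. A bounded
  derivative gives linear growth of \<open>f\<close>, which makes the boundary terms vanish and all
  integrals finite.\<close>

lemma std_normal_ibp:
  fixes f f' :: "real \<Rightarrow> real"
  assumes df: "\<And>x. (f has_real_derivative f' x) (at x)"
    and cf': "continuous_on UNIV f'" and bd: "\<And>x. \<bar>f' x\<bar> \<le> D"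
  shows "(\<integral>x. x * f x \<partial>std_normal_distribution) = (\<integral>x. f' x \<partial>std_normal_distribution)"
    and "integrable std_normal_distribution (\<lambda>x. x * f x)"
proof -
  have D: "D \<ge> 0" using bd[of 0] by linarith
  have cf: "continuous_on UNIV f" using df DERIV_isCont continuous_at_imp_continuous_on by blast
  have [measurable]: "f \<in> borel_measurable borel" "f' \<in> borel_measurable borel"
    using cf cf' by (auto intro: borel_measurable_continuous_onI)
  have growth: "\<bar>f x\<bar> \<le> \<bar>f 0\<bar> + D * \<bar>x\<bar>" for x
  proof -
    have "norm (f x - f 0) \<le> D * norm (x - 0)"
      by (rule field_differentiable_bound[of UNIV f f']) (use df bd in auto)
    then show ?thesis by simp
  qed
  have i1: "integrable lborel (\<lambda>x. std_normal_density x * f' x)"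
    by (rule Bochner_Integration.integrable_bound[where f="\<lambda>x. D * std_normal_density x"])
       (use bd in \<open>auto simp: abs_mult mult.commute intro!: mult_right_mono order_trans[OF bd]\<close>)
  have i2: "integrable lborel (\<lambda>x. std_normal_density x * (x * f x))"
  proof (rule Bochner_Integration.integrable_bound[where f="\<lambda>x. \<bar>f 0\<bar> * (std_normal_density x * \<bar>x\<bar> ^ 1) + D * (std_normal_density x * \<bar>x\<bar> ^ 2)"])
    show "integrable lborel (\<lambda>x. \<bar>f 0\<bar> * (std_normal_density x * \<bar>x\<bar> ^ 1) + D * (std_normal_density x * \<bar>x\<bar> ^ 2))"
      by (intro Bochner_Integration.integrable_add integrable_mult_right integrable_std_normal_moment_abs)
    show "AE x in lborel. norm (std_normal_density x * (x * f x)) \<le> norm (\<bar>f 0\<bar> * (std_normal_density x * \<bar>x\<bar> ^ 1) + D * (std_normal_density x * \<bar>x\<bar> ^ 2))"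
    proof (intro AE_I2)
      fix x :: real
      have "norm (std_normal_density x * (x * f x)) = std_normal_density x * \<bar>x\<bar> * \<bar>f x\<bar>"
        by (simp add: abs_mult)
      also have "\<dots> \<le> std_normal_density x * \<bar>x\<bar> * (\<bar>f 0\<bar> + D * \<bar>x\<bar>)"
        by (intro mult_left_mono growth) auto
      also have "\<dots> = \<bar>f 0\<bar> * (std_normal_density x * \<bar>x\<bar> ^ 1) + D * (std_normal_density x * \<bar>x\<bar> ^ 2)"
        by (simp add: algebra_simps power2_eq_square)
      finally show "norm (std_normal_density x * (x * f x)) \<le> norm (\<bar>f 0\<bar> * (std_normal_density x * \<bar>x\<bar> ^ 1) + D * (std_normal_density x * \<bar>x\<bar> ^ 2))"
        by simp
    qed
  qed auto
  define F where "F x = std_normal_density x * f x" for x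
  have dF: "(F has_real_derivative (std_normal_density x * f' x - std_normal_density x * (x * f x))) (at x)" for x
  proof -
    have eq: "std_normal_density = (\<lambda>x. (1 / sqrt (2 * pi)) * exp (- x\<^sup>2 / 2))"
      by (simp add: fun_eq_iff std_normal_density_def)
    have "(std_normal_density has_real_derivative (1 / sqrt (2 * pi)) * (exp (- x\<^sup>2 / 2) * (- x))) (at x)"
      unfolding eq by (intro DERIV_cmult) (auto intro!: derivative_eq_intros)
    then have "(std_normal_density has_real_derivative - (x * std_normal_density x)) (at x)"
      by (simp add: std_normal_density_def mult.commute)
    from DERIV_mult[OF this df] show ?thesis unfolding F_def by (simp add: algebra_simps)
  qed
  have t1: "((\<lambda>x. std_normal_density x * (\<bar>f 0\<bar> + D * \<bar>x\<bar>)) \<longlongrightarrow> 0) F" if F: "F = at_top \<or> F = at_bot" for F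
  proof -
    have "((\<lambda>x::real. exp (- x\<^sup>2 / 2) * \<bar>x\<bar>) \<longlongrightarrow> 0) F" "((\<lambda>x::real. exp (- x\<^sup>2 / 2)) \<longlongrightarrow> 0) F"
      using F by (auto; real_asymp)+
    then have "((\<lambda>x::real. (1 / sqrt (2 * pi)) * (exp (- x\<^sup>2 / 2) * \<bar>f 0\<bar> + D * (exp (- x\<^sup>2 / 2) * \<bar>x\<bar>))) \<longlongrightarrow> (1 / sqrt (2 * pi)) * (0 * \<bar>f 0\<bar> + D * 0)) F"
      by (intro tendsto_intros)
    then show ?thesis by (simp add: std_normal_density_def algebra_simps add_divide_distrib)
  qed
  have lim: "(F \<longlongrightarrow> 0) at_top" "(F \<longlongrightarrow> 0) at_bot"
    by (rule Lim_null_comparison[OF always_eventually t1];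
        use growth in \<open>auto simp: F_def abs_mult intro!: mult_left_mono\<close>)+
  have "(LBINT x=-\<infinity>..\<infinity>. std_normal_density x * f' x - std_normal_density x * (x * f x)) = 0 - 0"
  proof (rule interval_integral_FTC_integrable[where F=F])
    show "isCont (\<lambda>x. std_normal_density x * f' x - std_normal_density x * (x * f x)) x" for x
    proof -
      have "continuous_on UNIV (\<lambda>x. std_normal_density x * f' x - std_normal_density x * (x * f x))"
        unfolding std_normal_density_def by (intro continuous_intros cf cf') auto
      then show ?thesis by (simp add: continuous_on_eq_continuous_at)
    qed
    show "set_integrable lborel (einterval (- \<infinity>) \<infinity>) (\<lambda>x. std_normal_density x * f' x - std_normal_density x * (x * f x))"
      unfolding set_integrable_def using i1 i2 by (simp add: einterval_def)
    show "((F \<circ> real_of_ereal) \<longlongrightarrow> 0) (at_right (- \<infinity>))" "((F \<circ> real_of_ereal) \<longlongrightarrow> 0) (at_left \<infinity>)"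
      using lim by (simp_all add: ereal_tendsto_simps)
  qed (use dF in \<open>auto simp: has_real_derivative_iff_has_vector_derivative[symmetric]\<close>)
  then have "(\<integral>x. std_normal_density x * f' x - std_normal_density x * (x * f x) \<partial>lborel) = 0"
    by (simp add: interval_lebesgue_integral_def einterval_def set_lebesgue_integral_def)
  then have "(\<integral>x. std_normal_density x * (x * f x) \<partial>lborel) = (\<integral>x. std_normal_density x * f' x \<partial>lborel)"
    using i1 i2 by simp
  then show "(\<integral>x. x * f x \<partial>std_normal_distribution) = (\<integral>x. f' x \<partial>std_normal_distribution)"
    by (simp add: integral_density)
  show "integrable std_normal_distribution (\<lambda>x. x * f x)"
    using i2 by (simp add: integrable_density)
qed

text \<open>Puts the point mass and the density into one formula, so that the case distinction in
  \<open>normal_law\<close> is made only here.\<close>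

lemma normal_law_std: "normal_law \<mu> \<sigma> = distr std_normal_distribution borel (\<lambda>g. \<mu> + \<sigma> * g)" if "\<sigma> \<ge> 0"
proof (cases "\<sigma> = 0")
  case True
  interpret P: prob_space std_normal_distribution by (rule prob_space_normal_density) simp
  show ?thesis using True by (simp add: normal_law_def)
next
  case False
  interpret P: prob_space std_normal_distribution by (rule prob_space_normal_density) simp
  have "distributed std_normal_distribution lborel (\<lambda>x. x) std_normal_density"
    by (auto simp: distributed_def distr_id2)
  from P.normal_density_affine[OF this, of \<sigma> \<mu>] show ?thesis
    using False that by (simp add: normal_law_def distributed_def) (metis distr_cong sets_lborel)
qed

section \<open>Centred Gaussian vectors with a possibly singular covariance matrix\<close>

locale centred_gaussian_vector = prob_space N for N :: "'v measure" +
  fixes X :: "'v \<Rightarrow> real ^ 'm::finite" and C :: "real ^ 'm ^ 'm"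
  assumes gauss: "centred_gaussian N X C"
begin

lemma X_measurable[measurable]: "X \<in> borel_measurable N"
  using gauss by (simp add: centred_gaussian_def gaussian_vector_def)

text \<open>Only the one-dimensional projections are known. They give square integrability first,
  hence integrable products of coordinates; bilinearity then expresses all second moments through
  \<open>C\<close>. As the coordinates have mean zero, this fixes the unknown mean and deviation of
  each projection.\<close>

lemma linear_law:
  "distr N borel (\<lambda>\<omega>. u \<bullet> X \<omega>) = distr std_normal_distribution borel (\<lambda>g. sqrt (u \<bullet> (C *v u)) * g)"
  "u \<bullet> (C *v u) \<ge> 0"
  "expectation (\<lambda>\<omega>. (u \<bullet> X \<omega>) * (w \<bullet> X \<omega>)) = u \<bullet> (C *v w)"
  "integrable N (\<lambda>\<omega>. (u \<bullet> X \<omega>)\<^sup>2)"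
  "integrable N (\<lambda>\<omega>. u \<bullet> X \<omega>)"
proof -
  interpret P: prob_space std_normal_distribution by (rule prob_space_normal_density) simp
  have m1: "integrable std_normal_distribution (\<lambda>x. x)" "(\<integral>x. x \<partial>std_normal_distribution) = 0"
    using integrable_std_normal_distribution_moment[of 1] integral_std_normal_distribution_moment_odd[of 1] by auto
  have m2: "integrable std_normal_distribution (\<lambda>x. x\<^sup>2)" "(\<integral>x. x\<^sup>2 \<partial>std_normal_distribution) = 1"
    using integrable_std_normal_distribution_moment[of 2] std_normal_distribution_even_moments(1)[of 1] by (auto simp: fact_numeral)
  have ex: "\<exists>\<mu> \<sigma>. \<sigma> \<ge> 0 \<and> distr N borel (\<lambda>\<omega>. u \<bullet> X \<omega>) = distr std_normal_distribution borel (\<lambda>g. \<mu> + \<sigma> * g)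
      \<and> integrable N (\<lambda>\<omega>. u \<bullet> X \<omega>) \<and> expectation (\<lambda>\<omega>. u \<bullet> X \<omega>) = \<mu>
      \<and> integrable N (\<lambda>\<omega>. (u \<bullet> X \<omega>)\<^sup>2) \<and> expectation (\<lambda>\<omega>. (u \<bullet> X \<omega>)\<^sup>2) = \<mu>\<^sup>2 + \<sigma>\<^sup>2" for u
  proof -
    obtain \<mu> \<sigma> where s: "\<sigma> \<ge> 0" and eq: "distr N borel (\<lambda>\<omega>. u \<bullet> X \<omega>) = normal_law \<mu> \<sigma>"
      using gauss unfolding centred_gaussian_def gaussian_vector_def by blast
    note eq = eq[unfolded normal_law_std[OF s]]
    have sq: "(\<mu> + \<sigma> * g)\<^sup>2 = \<mu>\<^sup>2 + 2 * \<mu> * \<sigma> * g + \<sigma>\<^sup>2 * g\<^sup>2" for g :: real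
      by (simp add: power2_eq_square algebra_simps)
    have c1: "integrable std_normal_distribution (\<lambda>_. c)" "(\<integral>x. c \<partial>std_normal_distribution) = c" for c :: real
      by (simp, subst lebesgue_integral_const, simp only: P.prob_space, simp)
    have j1: "integrable std_normal_distribution (\<lambda>g. \<mu> + \<sigma> * g)"
      by (intro Bochner_Integration.integrable_add integrable_mult_right c1 m1)
    have j2: "integrable std_normal_distribution (\<lambda>g. (\<mu> + \<sigma> * g)\<^sup>2)"
      unfolding sq by (intro Bochner_Integration.integrable_add integrable_mult_right c1 m1 m2)
    have v1: "(\<integral>g. \<mu> + \<sigma> * g \<partial>std_normal_distribution) = \<mu>"
      by (subst Bochner_Integration.integral_add) (simp_all only: integral_mult_right_zero c1 m1 integrable_mult_right mult_zero_right add_0_right)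
    have v2: "(\<integral>g. (\<mu> + \<sigma> * g)\<^sup>2 \<partial>std_normal_distribution) = \<mu>\<^sup>2 + \<sigma>\<^sup>2"
      unfolding sq by (subst Bochner_Integration.integral_add | simp only: Bochner_Integration.integrable_add integral_mult_right_zero c1 m1 m2 integrable_mult_right mult_zero_right add_0_right mult_1_right)+
    have meas: "(\<lambda>\<omega>. u \<bullet> X \<omega>) \<in> measurable N borel" "(\<lambda>g. \<mu> + \<sigma> * g) \<in> measurable std_normal_distribution borel"
      "(\<lambda>x::real. x) \<in> borel_measurable borel" "(\<lambda>x::real. x\<^sup>2) \<in> borel_measurable borel"
      by measurable
    have i1: "integrable N (\<lambda>\<omega>. u \<bullet> X \<omega>)"
      using integrable_distr_eq[OF meas(1,3)] integrable_distr_eq[OF meas(2,3)] j1 unfolding eq by blast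
    have i2: "integrable N (\<lambda>\<omega>. (u \<bullet> X \<omega>)\<^sup>2)"
      using integrable_distr_eq[OF meas(1,4)] integrable_distr_eq[OF meas(2,4)] j2 unfolding eq by blast
    have e1: "expectation (\<lambda>\<omega>. u \<bullet> X \<omega>) = \<mu>"
      using integral_distr[OF meas(1,3)] integral_distr[OF meas(2,3)] v1 unfolding eq by simp
    have "expectation (\<lambda>\<omega>. (u \<bullet> X \<omega>)\<^sup>2) = \<mu>\<^sup>2 + \<sigma>\<^sup>2"
      using integral_distr[OF meas(1,4)] integral_distr[OF meas(2,4)] v2 unfolding eq by simp
    then show ?thesis using s eq i1 i2 e1 by blast
  qed
  have comp: "X \<omega> $ i = axis i 1 \<bullet> X \<omega>" for \<omega> i by (simp add: inner_axis' )
  have i1: "integrable N (\<lambda>\<omega>. X \<omega> $ i)" for i using ex[of "axis i 1"] unfolding comp by blast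
  have i2: "integrable N (\<lambda>\<omega>. (X \<omega> $ i)\<^sup>2)" for i using ex[of "axis i 1"] unfolding comp by blast
  have i12: "integrable N (\<lambda>\<omega>. X \<omega> $ i * X \<omega> $ j)" for i j
  proof (rule Bochner_Integration.integrable_bound[where f="\<lambda>\<omega>. (X \<omega> $ i)\<^sup>2 + (X \<omega> $ j)\<^sup>2"])
    have "\<bar>a * b\<bar> \<le> a\<^sup>2 + b\<^sup>2" for a b :: real
      using sum_squares_bound[of "\<bar>a\<bar>" "\<bar>b\<bar>"] mult_nonneg_nonneg[of "\<bar>a\<bar>" "\<bar>b\<bar>"]
      unfolding abs_mult power2_abs by linarith
    then show "AE \<omega> in N. norm (X \<omega> $ i * X \<omega> $ j) \<le> norm ((X \<omega> $ i)\<^sup>2 + (X \<omega> $ j)\<^sup>2)"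
      by simp
    show "(\<lambda>\<omega>. X \<omega> $ i * X \<omega> $ j) \<in> borel_measurable N" unfolding comp by measurable
  qed (use i2 in auto)
  show cov: "expectation (\<lambda>\<omega>. (u \<bullet> X \<omega>) * (w \<bullet> X \<omega>)) = u \<bullet> (C *v w)" for u w
  proof -
    have "(u \<bullet> X \<omega>) * (w \<bullet> X \<omega>) = (\<Sum>i\<in>UNIV. \<Sum>j\<in>UNIV. u $ i * w $ j * (X \<omega> $ i * X \<omega> $ j))" for \<omega>
      by (simp add: inner_vec_def sum_product algebra_simps)
    then have "expectation (\<lambda>\<omega>. (u \<bullet> X \<omega>) * (w \<bullet> X \<omega>)) = (\<Sum>i\<in>UNIV. \<Sum>j\<in>UNIV. u $ i * w $ j * C $ i $ j)"
      using gauss i12 by (simp add: centred_gaussian_def)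
    also have "\<dots> = u \<bullet> (C *v w)"
      by (simp add: inner_vec_def matrix_vector_mult_def sum_distrib_left algebra_simps)
    finally show ?thesis .
  qed
  obtain \<mu> \<sigma> where s: "\<sigma> \<ge> 0" and eq: "distr N borel (\<lambda>\<omega>. u \<bullet> X \<omega>) = distr std_normal_distribution borel (\<lambda>g. \<mu> + \<sigma> * g)"
      and ii: "integrable N (\<lambda>\<omega>. u \<bullet> X \<omega>)" "integrable N (\<lambda>\<omega>. (u \<bullet> X \<omega>)\<^sup>2)"
      and e: "expectation (\<lambda>\<omega>. u \<bullet> X \<omega>) = \<mu>" "expectation (\<lambda>\<omega>. (u \<bullet> X \<omega>)\<^sup>2) = \<mu>\<^sup>2 + \<sigma>\<^sup>2"
    using ex[of u] by blast
  show "integrable N (\<lambda>\<omega>. u \<bullet> X \<omega>)" "integrable N (\<lambda>\<omega>. (u \<bullet> X \<omega>)\<^sup>2)" by fact+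
  have "expectation (\<lambda>\<omega>. u \<bullet> X \<omega>) = 0"
    using gauss i1 by (simp add: inner_vec_def centred_gaussian_def)
  then have mu: "\<mu> = 0" using e by simp
  have q: "u \<bullet> (C *v u) = \<sigma>\<^sup>2"
    using cov[of u u] e mu by (simp add: power2_eq_square)
  show "u \<bullet> (C *v u) \<ge> 0" by (simp add: q)
  show "distr N borel (\<lambda>\<omega>. u \<bullet> X \<omega>) = distr std_normal_distribution borel (\<lambda>g. sqrt (u \<bullet> (C *v u)) * g)"
    using eq mu q s by simp
qed

lemma cov_symmetric: "u \<bullet> (C *v w) = w \<bullet> (C *v u)"
  using linear_law(3)[of u w] linear_law(3)[of w u] by (simp add: mult.commute)

lemma integrable_norm_X_sq: "integrable N (\<lambda>\<omega>. (norm (X \<omega>))\<^sup>2)"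
proof -
  have ax: "axis i 1 \<bullet> X \<omega> = X \<omega> $ i" for i \<omega> by (simp add: inner_axis')
  have "(norm (X \<omega>))\<^sup>2 = (\<Sum>i\<in>UNIV. (axis i 1 \<bullet> X \<omega>)\<^sup>2)" for \<omega>
    unfolding ax power2_norm_eq_inner by (simp add: inner_vec_def power2_eq_square)
  then show ?thesis using linear_law(4) by simp
qed

lemma integrable_norm_X: "integrable N (\<lambda>\<omega>. norm (X \<omega>))"
proof -
  have self_le_power_bound: "a \<le> 1 + a\<^sup>2" for a :: real
    using sum_squares_bound[of a 1] zero_le_power2[of a] by (simp; linarith)
  show ?thesis
  by (rule Bochner_Integration.integrable_bound[where f="\<lambda>\<omega>. 1 + (norm (X \<omega>))\<^sup>2"])
     (use integrable_norm_X_sq self_le_power_bound in auto)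
qed

lemma characteristic_function:
  "(CLINT \<omega>|N. iexp (u \<bullet> X \<omega>)) = complex_of_real (exp (- (u \<bullet> (C *v u)) / 2))"
proof -
  let ?q = "u \<bullet> (C *v u)"
  have "(CLINT \<omega>|N. iexp (u \<bullet> X \<omega>)) = (CLINT x|distr N borel (\<lambda>\<omega>. u \<bullet> X \<omega>). iexp x)"
    by (subst integral_distr) auto
  also have "\<dots> = (CLINT g|std_normal_distribution. iexp (sqrt ?q * g))"
    unfolding linear_law(1) by (subst integral_distr) auto
  also have "\<dots> = char std_normal_distribution (sqrt ?q)" by (simp add: char_def)
  also have "\<dots> = complex_of_real (exp (- ?q / 2))"
    using linear_law(2)[of u] by (simp add: char_std_normal_distribution)
  finally show ?thesis .
qed

text \<open>Gaussian conditioning: for v = C w the residual is uncorrelated with w \<bullet> X,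
  whose variance is w \<bullet> v. So the component w \<bullet> X can be replaced by an independent
  normal variable with that variance, which is checked on characteristic functions.\<close>

lemma law_decomposition:
  assumes v: "v = C *v w" and pos: "w \<bullet> v > 0"
  shows "distr N borel X = distr (N \<Otimes>\<^sub>M std_normal_distribution) borel
     (\<lambda>(\<omega>, g). X \<omega> - ((w \<bullet> X \<omega>) / (w \<bullet> v)) *\<^sub>R v + (g / sqrt (w \<bullet> v)) *\<^sub>R v)"
proof (rule char_uniqueness_euclidean)
  interpret P: prob_space std_normal_distribution by (rule prob_space_normal_density) simp
  interpret NP: pair_prob_space N std_normal_distribution ..
  define Y where "Y = (\<lambda>(\<omega>, g). X \<omega> - ((w \<bullet> X \<omega>) / (w \<bullet> v)) *\<^sub>R v + (g / sqrt (w \<bullet> v)) *\<^sub>R v)"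
  have [measurable]: "Y \<in> borel_measurable (N \<Otimes>\<^sub>M std_normal_distribution)"
    unfolding Y_def by measurable
  show "prob_space (distr N borel X)" by (rule prob_space_distr) simp
  show "prob_space (distr (N \<Otimes>\<^sub>M std_normal_distribution) borel Y)" by (rule NP.prob_space_distr) simp
  fix u :: "real ^ 'm"
  define s2 where "s2 = w \<bullet> v"
  have s2: "s2 > 0" using pos by (simp add: s2_def)
  define u' where "u' = u - ((u \<bullet> v) / s2) *\<^sub>R w"
  have uY: "u \<bullet> Y (\<omega>, g) = u' \<bullet> X \<omega> + ((u \<bullet> v) / sqrt s2) * g" for \<omega> g
    by (simp add: Y_def u'_def s2_def inner_diff_right inner_add_right inner_diff_left mult.commute)
  \<comment> \<open>Passing from u to u' removes the variance (u \<bullet> v)^2 / (w \<bullet> v),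
    and the independent variable \<open>g\<close> puts exactly this amount back.\<close>
  have "u' \<bullet> (C *v u') = u \<bullet> (C *v u) - (u \<bullet> v)\<^sup>2 / s2"
    using cov_symmetric[of w u] s2
    by (simp add: u'_def matrix_vector_mult_diff_distrib matrix_vector_mult_scaleR inner_diff_left inner_diff_right
        v[symmetric] s2_def[symmetric] power2_eq_square field_simps)
  then have q': "- (u' \<bullet> (C *v u')) / 2 + - ((u \<bullet> v) / sqrt s2)\<^sup>2 / 2 = - (u \<bullet> (C *v u)) / 2"
    using s2 by (simp add: power_divide field_simps)
  have "(CLINT x|distr (N \<Otimes>\<^sub>M std_normal_distribution) borel Y. iexp (u \<bullet> x))
     = (CLINT z|(N \<Otimes>\<^sub>M std_normal_distribution). iexp (u \<bullet> Y z))"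
    by (subst integral_distr) auto
  also have "\<dots> = (CLINT \<omega>|N. (CLINT g|std_normal_distribution. iexp (u \<bullet> Y (\<omega>, g))))"
    by (rule NP.integral_fst'[symmetric], rule NP.integrable_const_bound[where B=1]) auto
  also have "\<dots> = (CLINT \<omega>|N. (CLINT g|std_normal_distribution. iexp (u' \<bullet> X \<omega>) * iexp (((u \<bullet> v) / sqrt s2) * g)))"
    by (simp only: uY of_real_add distrib_left exp_add)
  also have "\<dots> = (CLINT \<omega>|N. iexp (u' \<bullet> X \<omega>)) * char std_normal_distribution ((u \<bullet> v) / sqrt s2)"
    by (simp add: char_def)
  also have "\<dots> = complex_of_real (exp (- (u' \<bullet> (C *v u')) / 2 + - ((u \<bullet> v) / sqrt s2)\<^sup>2 / 2))"
    unfolding characteristic_function exp_add by (simp add: char_std_normal_distribution)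
  also have "\<dots> = (CLINT \<omega>|N. iexp (u \<bullet> X \<omega>))" unfolding q' characteristic_function ..
  also have "\<dots> = (CLINT x|distr N borel X. iexp (u \<bullet> x))" by (subst integral_distr) auto
  finally show "(CLINT x|distr N borel X. iexp (u \<bullet> x)) = (CLINT x|distr (N \<Otimes>\<^sub>M std_normal_distribution) borel Y. iexp (u \<bullet> x))" ..
qed auto

text \<open>A projection of variance zero vanishes almost surely, and |v|^2 is the covariance of v
  \<bullet> X with it.\<close>

lemma degenerate_direction:
  assumes v: "v = C *v w" and z: "w \<bullet> v = 0"
  shows "v = 0" "AE \<omega> in N. w \<bullet> X \<omega> = 0"
proof -
  have "expectation (\<lambda>\<omega>. (w \<bullet> X \<omega>)\<^sup>2) = 0"
    using linear_law(3)[of w w] z v by (simp add: power2_eq_square)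
  then show ae: "AE \<omega> in N. w \<bullet> X \<omega> = 0"
    by (subst (asm) integral_nonneg_eq_0_iff_AE[OF linear_law(4)]) auto
  have "v \<bullet> v = expectation (\<lambda>\<omega>. (v \<bullet> X \<omega>) * (w \<bullet> X \<omega>))"
    by (simp add: linear_law(3) v)
  also have "\<dots> = expectation (\<lambda>\<omega>. 0)"
    by (rule integral_cong_AE) (use ae in auto)
  finally show "v = 0" by simp
qed

text \<open>By \<open>law_decomposition\<close> the vector has the law of Z + (g / s) v with Z
  independent of \<open>g\<close> and w \<bullet> Z = 0. So the claim is the one-dimensional formula
  in \<open>g\<close>, integrated over \<open>Z\<close>; regularity of \<open>f\<close> is asked for
  only along lines in direction v.\<close>

theorem gaussian_integration_by_parts:
  fixes f Df :: "real ^ 'm \<Rightarrow> real"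
  assumes v: "v = C *v w"
    and fm[measurable]: "f \<in> borel_measurable borel" and growth: "\<And>x. \<bar>f x\<bar> \<le> A + B * norm x"
    and Dm[measurable]: "Df \<in> borel_measurable borel" and bd: "\<And>x. \<bar>Df x\<bar> \<le> D"
    and deriv: "\<And>x. ((\<lambda>r. f (x + r *\<^sub>R v)) has_real_derivative Df x) (at 0)"
    and cont: "\<And>x. continuous_on UNIV (\<lambda>r. Df (x + r *\<^sub>R v))"
  shows "expectation (\<lambda>\<omega>. (w \<bullet> X \<omega>) * f (X \<omega>)) = expectation (\<lambda>\<omega>. Df (X \<omega>))"
proof (cases "w \<bullet> v = 0")
  case True
  note dg = degenerate_direction[OF v True]
  have "Df x = 0" for x
    using deriv[of x] dg(1) DERIV_unique[OF _ DERIV_const] by fastforce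
  moreover have "expectation (\<lambda>\<omega>. (w \<bullet> X \<omega>) * f (X \<omega>)) = expectation (\<lambda>\<omega>. 0)"
    by (rule integral_cong_AE) (use dg(2) in auto)
  ultimately show ?thesis by simp
next
  case False
  define s where "s = sqrt (w \<bullet> v)"
  have pos: "w \<bullet> v > 0" using False linear_law(2)[of w] v by simp
  then have s: "s > 0" "w \<bullet> v = s\<^sup>2" by (auto simp: s_def)
  interpret P: prob_space std_normal_distribution by (rule prob_space_normal_density) simp
  interpret NP: pair_prob_space N std_normal_distribution ..
  define Z where "Z \<omega> = X \<omega> - ((w \<bullet> X \<omega>) / (w \<bullet> v)) *\<^sub>R v" for \<omega>
  have [measurable]: "Z \<in> borel_measurable N" unfolding Z_def by measurable
  note law = law_decomposition[OF v pos, folded Z_def s_def]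
  have wZ: "w \<bullet> Z \<omega> = 0" for \<omega> using pos by (simp add: Z_def inner_diff_right)
  have derivr: "((\<lambda>r. f (x + r *\<^sub>R v)) has_real_derivative Df (x + r *\<^sub>R v)) (at r)" for x r
  proof -
    have "((\<lambda>h. f ((x + r *\<^sub>R v) + h *\<^sub>R v)) has_real_derivative Df (x + r *\<^sub>R v)) (at 0)" by (rule deriv)
    then show ?thesis
      using DERIV_shift[of "\<lambda>r. f (x + r *\<^sub>R v)" "Df (x + r *\<^sub>R v)" 0 r]
      by (simp add: scaleR_add_left add_ac)
  qed
  have inner: "(\<integral>g. g * f (z + (g / s) *\<^sub>R v) \<partial>std_normal_distribution)
      = (\<integral>g. Df (z + (g / s) *\<^sub>R v) / s \<partial>std_normal_distribution)" for z
  proof (rule std_normal_ibp(1))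
    fix g :: real
    show "((\<lambda>g. f (z + (g / s) *\<^sub>R v)) has_real_derivative Df (z + (g / s) *\<^sub>R v) / s) (at g)"
      by (rule DERIV_chain'[OF _ derivr, of "\<lambda>g. g / s" "1 / s", simplified]) (use s in \<open>auto intro!: derivative_eq_intros\<close>)
    show "\<bar>Df (z + (g / s) *\<^sub>R v) / s\<bar> \<le> D / s" using bd s by (simp add: divide_right_mono)
  next
    have "continuous_on UNIV (\<lambda>g. (\<lambda>r. Df (z + r *\<^sub>R v)) (g / s))"
      using s by (intro continuous_on_compose2[OF cont] continuous_intros) auto
    then show "continuous_on UNIV (\<lambda>g. Df (z + (g / s) *\<^sub>R v) / s)"
      using s by (intro continuous_intros) auto
  qed
  have dist_int: "integrable N (\<lambda>\<omega>. h (X \<omega>)) \<longleftrightarrow> integrable (N \<Otimes>\<^sub>M std_normal_distribution) (\<lambda>(\<omega>, g). h (Z \<omega> + (g / s) *\<^sub>R v))"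
    and dist_eq: "expectation (\<lambda>\<omega>. h (X \<omega>)) = (\<integral>(\<omega>, g). h (Z \<omega> + (g / s) *\<^sub>R v) \<partial>(N \<Otimes>\<^sub>M std_normal_distribution))"
    if [measurable]: "h \<in> borel_measurable borel" for h :: "real ^ 'm \<Rightarrow> real"
  proof -
    have "integrable N (\<lambda>\<omega>. h (X \<omega>)) \<longleftrightarrow> integrable (distr N borel X) h"
      by (subst integrable_distr_eq) auto
    also have "\<dots> \<longleftrightarrow> integrable (N \<Otimes>\<^sub>M std_normal_distribution) (\<lambda>(\<omega>, g). h (Z \<omega> + (g / s) *\<^sub>R v))"
      unfolding law by (subst integrable_distr_eq) (auto simp: case_prod_beta')
    finally show "integrable N (\<lambda>\<omega>. h (X \<omega>)) \<longleftrightarrow> integrable (N \<Otimes>\<^sub>M std_normal_distribution) (\<lambda>(\<omega>, g). h (Z \<omega> + (g / s) *\<^sub>R v))" .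
    have "expectation (\<lambda>\<omega>. h (X \<omega>)) = integral\<^sup>L (distr N borel X) h"
      by (subst integral_distr) auto
    also have "\<dots> = (\<integral>(\<omega>, g). h (Z \<omega> + (g / s) *\<^sub>R v) \<partial>(N \<Otimes>\<^sub>M std_normal_distribution))"
      unfolding law by (subst integral_distr) (auto simp: case_prod_beta')
    finally show "expectation (\<lambda>\<omega>. h (X \<omega>)) = (\<integral>(\<omega>, g). h (Z \<omega> + (g / s) *\<^sub>R v) \<partial>(N \<Otimes>\<^sub>M std_normal_distribution))" .
  qed
  have intw: "integrable N (\<lambda>\<omega>. (w \<bullet> X \<omega>) * f (X \<omega>))"
  proof (rule Bochner_Integration.integrable_bound[where f="\<lambda>\<omega>. norm w * A * norm (X \<omega>) + norm w * B * (norm (X \<omega>))\<^sup>2"])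
    show "integrable N (\<lambda>\<omega>. norm w * A * norm (X \<omega>) + norm w * B * (norm (X \<omega>))\<^sup>2)"
      using integrable_norm_X integrable_norm_X_sq by simp
    show "AE \<omega> in N. norm ((w \<bullet> X \<omega>) * f (X \<omega>)) \<le> norm (norm w * A * norm (X \<omega>) + norm w * B * (norm (X \<omega>))\<^sup>2)"
    proof (intro AE_I2)
      fix \<omega>
      have "norm ((w \<bullet> X \<omega>) * f (X \<omega>)) \<le> (norm w * norm (X \<omega>)) * (A + B * norm (X \<omega>))"
        unfolding norm_mult by (intro mult_mono) (auto simp: growth Cauchy_Schwarz_ineq2)
      also have "\<dots> = norm w * A * norm (X \<omega>) + norm w * B * (norm (X \<omega>))\<^sup>2"
        by (simp add: algebra_simps power2_eq_square)
      finally show "norm ((w \<bullet> X \<omega>) * f (X \<omega>)) \<le> norm (norm w * A * norm (X \<omega>) + norm w * B * (norm (X \<omega>))\<^sup>2)"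
        by simp
    qed
  qed auto
  have wv: "w \<bullet> (Z \<omega> + (g / s) *\<^sub>R v) = s * g" for \<omega> g
    using s wZ by (simp add: inner_add_right power2_eq_square)
  have "expectation (\<lambda>\<omega>. (w \<bullet> X \<omega>) * f (X \<omega>)) =
    (\<integral>(\<omega>, g). (w \<bullet> (Z \<omega> + (g / s) *\<^sub>R v)) * f (Z \<omega> + (g / s) *\<^sub>R v) \<partial>(N \<Otimes>\<^sub>M std_normal_distribution))"
    by (rule dist_eq) simp
  also have "\<dots> = (\<integral>\<omega>. (\<integral>g. (w \<bullet> (Z \<omega> + (g / s) *\<^sub>R v)) * f (Z \<omega> + (g / s) *\<^sub>R v) \<partial>std_normal_distribution) \<partial>N)"
    using NP.integral_fst'[OF iffD1[OF dist_int intw]] by (simp add: case_prod_beta')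
  also have "\<dots> = (\<integral>\<omega>. (\<integral>g. Df (Z \<omega> + (g / s) *\<^sub>R v) \<partial>std_normal_distribution) \<partial>N)"
    unfolding wv using s inner by (simp add: mult.assoc)
  also have "\<dots> = (\<integral>(\<omega>, g). Df (Z \<omega> + (g / s) *\<^sub>R v) \<partial>(N \<Otimes>\<^sub>M std_normal_distribution))"
    using NP.integral_fst'[of "\<lambda>(\<omega>, g). Df (Z \<omega> + (g / s) *\<^sub>R v)"] NP.integrable_const_bound[of "\<lambda>(\<omega>, g). Df (Z \<omega> + (g / s) *\<^sub>R v)" D] bd
    by (simp add: case_prod_beta')
  also have "\<dots> = expectation (\<lambda>\<omega>. Df (X \<omega>))" by (rule dist_eq[symmetric]) simp
  finally show ?thesis .
qed

text \<open>A Cameron-Martin estimate for functions that are merely continuous and bounded. The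
  average \<open>P\<close> of \<open>f\<close> over the segment from x to x + v has derivative f (x
  + v) - f x along v. Integration by parts turns the difference of expectations into the expectation
  of (w \<bullet> X) P(X), and E |w \<bullet> X| is at most sqrt (w \<bullet> v).\<close>

lemma expectation_shift_bound:
  fixes f :: "real ^ 'm \<Rightarrow> real"
  assumes v: "v = C *v w" and fc: "continuous_on UNIV f" and bd: "\<And>x. \<bar>f x\<bar> \<le> B"
  shows "\<bar>expectation (\<lambda>\<omega>. f (X \<omega> + v)) - expectation (\<lambda>\<omega>. f (X \<omega>))\<bar> \<le> B * sqrt (w \<bullet> v)"
proof -
  have B: "B \<ge> 0" using bd[of 0] by linarith
  have fm[measurable]: "f \<in> borel_measurable borel" by (rule borel_measurable_continuous_onI[OF fc])
  define P where "P x = (\<integral>u. f (x + u *\<^sub>R v) * indicator {0..1::real} u \<partial>lborel)" for x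
  have Pm[measurable]: "P \<in> borel_measurable borel" unfolding P_def by measurable
  have Pb: "\<bar>P x\<bar> \<le> B" for x
  proof -
    have "\<bar>P x\<bar> \<le> (\<integral>u. \<bar>f (x + u *\<^sub>R v) * indicator {0..1::real} u\<bar> \<partial>lborel)"
      unfolding P_def by (rule integral_abs_bound)
    also have "\<dots> \<le> (\<integral>u. B * indicator {0..1::real} u \<partial>lborel)"
      by (rule integral_mono') (use bd B in \<open>auto simp: abs_mult intro: mult_right_mono\<close>)
    finally show ?thesis by simp
  qed
  have line: "isCont (\<lambda>u. f (x + u *\<^sub>R v)) r" for x and r :: real
  proof -
    have "continuous_on UNIV (\<lambda>u::real. f (x + u *\<^sub>R v))"
      by (intro continuous_on_compose2[OF fc] continuous_intros) auto
    then show ?thesis by (simp add: continuous_on_eq_continuous_at)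
  qed
  have ibp: "expectation (\<lambda>\<omega>. (w \<bullet> X \<omega>) * P (X \<omega>)) = expectation (\<lambda>\<omega>. f (X \<omega> + v) - f (X \<omega>))"
  proof (rule gaussian_integration_by_parts[OF v, where A=B and B=0 and D="2 * B"])
    fix x
    have "\<exists>F. \<forall>u. - \<infinity> < ereal u \<longrightarrow> ereal u < \<infinity> \<longrightarrow> (F has_vector_derivative f (x + u *\<^sub>R v)) (at u)"
      by (rule einterval_antiderivative) (use line in auto)
    then obtain F where F: "(F has_real_derivative f (x + u *\<^sub>R v)) (at u)" for u
      by (auto simp: has_real_derivative_iff_has_vector_derivative)
    have "P (x + r *\<^sub>R v) = F (r + 1) - F r" for r
    proof -
      have d: "((\<lambda>u. F (u + r)) has_real_derivative f ((x + r *\<^sub>R v) + u *\<^sub>R v)) (at u)" for u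
        using F[of "u + r"] DERIV_shift[of F _ u r] by (simp add: scaleR_add_left add_ac)
      have "P (x + r *\<^sub>R v) = F (1 + r) - F (0 + r)"
        unfolding P_def by (rule integral_FTC_Icc_real) (use d line in auto)
      then show ?thesis by (simp add: add.commute)
    qed
    moreover have "((\<lambda>r. F (r + 1) - F r) has_real_derivative f (x + (0 + 1) *\<^sub>R v) - f (x + 0 *\<^sub>R v)) (at 0)"
      by (intro DERIV_diff F) (use DERIV_shift[of F _ 0 1] F[of 1] F[of 0] in auto)
    ultimately show "((\<lambda>r. P (x + r *\<^sub>R v)) has_real_derivative f (x + v) - f x) (at 0)"
      by (simp add: fun_eq_iff)
    show "continuous_on UNIV (\<lambda>r. f (x + r *\<^sub>R v + v) - f (x + r *\<^sub>R v))"
      by (intro continuous_intros continuous_on_compose2[OF fc]) auto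
    show "\<bar>f (x + v) - f x\<bar> \<le> 2 * B" using bd[of x] bd[of "x + v"] by linarith
    show "\<bar>P x\<bar> \<le> B + 0 * norm x" using Pb by simp
  qed auto
  have i: "integrable N (\<lambda>\<omega>. f (X \<omega> + v))" "integrable N (\<lambda>\<omega>. f (X \<omega>))"
    using bd by (auto intro!: integrable_const_bound[where B=B])
  have "\<bar>expectation (\<lambda>\<omega>. f (X \<omega> + v)) - expectation (\<lambda>\<omega>. f (X \<omega>))\<bar> = \<bar>expectation (\<lambda>\<omega>. (w \<bullet> X \<omega>) * P (X \<omega>))\<bar>"
    using i ibp by simp
  also have "\<dots> \<le> expectation (\<lambda>\<omega>. \<bar>(w \<bullet> X \<omega>) * P (X \<omega>)\<bar>)" by (rule integral_abs_bound)
  also have "\<dots> \<le> expectation (\<lambda>\<omega>. B * \<bar>w \<bullet> X \<omega>\<bar>)"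
    using linear_law(5)[of w] Pb B
    by (intro integral_mono') (auto simp: abs_mult mult.commute[of "\<bar>P _\<bar>"] mult.commute[of B] intro!: mult_left_mono)
  also have "\<dots> = B * expectation (\<lambda>\<omega>. \<bar>w \<bullet> X \<omega>\<bar>)" by simp
  also have "\<dots> \<le> B * sqrt (w \<bullet> v)"
  proof (intro mult_left_mono B real_le_rsqrt)
    \<comment> \<open>The square of the mean is at most the mean of the square, because the variance
      is nonnegative.\<close>
    have "(expectation (\<lambda>\<omega>. \<bar>w \<bullet> X \<omega>\<bar>))\<^sup>2 \<le> expectation (\<lambda>\<omega>. \<bar>w \<bullet> X \<omega>\<bar>\<^sup>2)"
    proof -
      have "0 \<le> expectation (\<lambda>\<omega>. (\<bar>w \<bullet> X \<omega>\<bar> - expectation (\<lambda>\<omega>. \<bar>w \<bullet> X \<omega>\<bar>))\<^sup>2)" by simp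
      also have "\<dots> = expectation (\<lambda>\<omega>. \<bar>w \<bullet> X \<omega>\<bar>\<^sup>2) - (expectation (\<lambda>\<omega>. \<bar>w \<bullet> X \<omega>\<bar>))\<^sup>2"
        using linear_law(4,5)[of w] by (intro variance_eq) auto
      finally show ?thesis by simp
    qed
    then show "(expectation (\<lambda>\<omega>. \<bar>w \<bullet> X \<omega>\<bar>))\<^sup>2 \<le> w \<bullet> v"
      using linear_law(3)[of w w] by (simp add: v power2_eq_square)
  qed
  finally show ?thesis .
qed

end

section \<open>Quadratic functionals of independent Poisson counts\<close>

locale indep_poisson = prob_space M for M :: "'w measure" +
  fixes I :: "'i set" and cnt :: "'i \<Rightarrow> 'w \<Rightarrow> nat" and lam :: "'i \<Rightarrow> real"
  assumes finite_I: "finite I"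
    and lam_nonneg: "i \<in> I \<Longrightarrow> 0 \<le> lam i"
    and indep: "indep_vars (\<lambda>_. count_space UNIV) cnt I"
    and poisson: "i \<in> I \<Longrightarrow> prob {\<omega> \<in> space M. cnt i \<omega> = k} = lam i ^ k / fact k * exp (- lam i)"
begin

text \<open>Extensional functions on the finite set \<open>I\<close>, hence countably many: laws
  become sums over configurations, and every function of a configuration is measurable.\<close>

definition configs :: "('i \<Rightarrow> nat) set" where "configs = (\<Pi>\<^sub>E i\<in>I. UNIV)"
definition config :: "'w \<Rightarrow> 'i \<Rightarrow> nat" where "config \<omega> = (\<lambda>i\<in>I. cnt i \<omega>)"
definition up :: "'i \<Rightarrow> ('i \<Rightarrow> nat) \<Rightarrow> ('i \<Rightarrow> nat)" where "up a n = n(a := Suc (n a))"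
definition mean :: "(('i \<Rightarrow> nat) \<Rightarrow> real) \<Rightarrow> real" where "mean f = expectation (\<lambda>\<omega>. f (config \<omega>))"

lemma countable_configs: "countable configs"
  unfolding configs_def by (intro countable_PiE finite_I) auto

lemma config_in: "config \<omega> \<in> configs" by (auto simp: configs_def config_def)
lemma up_in: "a \<in> I \<Longrightarrow> n \<in> configs \<Longrightarrow> up a n \<in> configs"
  by (auto simp: configs_def up_def PiE_def extensional_def)

lemma cnt_measurable: "i \<in> I \<Longrightarrow> cnt i \<in> measurable M (count_space UNIV)"
  using indep by (auto simp: indep_vars_def)

lemma config_vimage: "k \<in> configs \<Longrightarrow> config -` {k} \<inter> space M = {\<omega>\<in>space M. \<forall>i\<in>I. cnt i \<omega> = k i}"
  by (auto simp: configs_def config_def PiE_def extensional_def fun_eq_iff restrict_def)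

lemma config_measurable: "config \<in> measurable M (count_space configs)"
proof -
  have "{\<omega>\<in>space M. \<forall>i\<in>I. cnt i \<omega> = k i} \<in> sets M" for k
  proof (rule sets.sets_Collect_finite_All[OF _ finite_I])
    fix i assume "i \<in> I"
    then have "cnt i -` {k i} \<inter> space M \<in> sets M" by (intro measurable_sets[OF cnt_measurable]) auto
    moreover have "cnt i -` {k i} \<inter> space M = {\<omega> \<in> space M. cnt i \<omega> = k i}" by auto
    ultimately show "{\<omega> \<in> space M. cnt i \<omega> = k i} \<in> sets M" by simp
  qed
  then show ?thesis
    by (subst measurable_count_space_eq_countable[OF countable_configs]) (auto simp: config_in config_vimage)
qed

lemma config_fun_measurable[measurable]: "(\<lambda>\<omega>. f (config \<omega>)) \<in> measurable M borel"
  by (rule measurable_compose[OF config_measurable]) simp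

definition config_prob :: "('i \<Rightarrow> nat) \<Rightarrow> real" where
  "config_prob k = (\<Prod>i\<in>I. lam i ^ k i / fact (k i) * exp (- lam i))"

lemma nn_integral_config:
  assumes "I \<noteq> {}"
  shows "(\<integral>\<^sup>+\<omega>. f (config \<omega>) \<partial>M) = (\<integral>\<^sup>+k. ennreal (config_prob k) * f k \<partial>count_space configs)"
proof -
  have "distr M (count_space configs) config = density (count_space configs) (\<lambda>k. ennreal (config_prob k))"
  proof (rule measure_eqI_countable)
    fix k assume k: "k \<in> configs"
    have "emeasure (distr M (count_space configs) config) {k} = emeasure M (config -` {k} \<inter> space M)"
      using k by (intro emeasure_distr config_measurable) auto
    also have "config -` {k} \<inter> space M = (\<Inter>i\<in>I. cnt i -` {k i} \<inter> space M)"
      using assms config_vimage[OF k] by auto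
    also have "emeasure M \<dots> = ennreal (\<Prod>i\<in>I. prob (cnt i -` {k i} \<inter> space M))"
      unfolding emeasure_eq_measure
      by (subst indep_varsD_finite[OF indep assms finite_I]) auto
    also have "(\<Prod>i\<in>I. prob (cnt i -` {k i} \<inter> space M)) = config_prob k"
      unfolding config_prob_def
    proof (intro prod.cong refl)
      fix i assume i: "i \<in> I"
      have "cnt i -` {k i} \<inter> space M = {\<omega> \<in> space M. cnt i \<omega> = k i}" by auto
      then show "prob (cnt i -` {k i} \<inter> space M) = lam i ^ k i / fact (k i) * exp (- lam i)"
        using poisson[OF i] by simp
    qed
    finally show "emeasure (distr M (count_space configs) config) {k} = emeasure (density (count_space configs) (\<lambda>k. ennreal (config_prob k))) {k}"
      using k by (simp add: emeasure_density nn_integral_count_space_indicator[symmetric] nn_integral_count_space_finite)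
  qed (use countable_configs in auto)
  then have "(\<integral>\<^sup>+k. f k \<partial>distr M (count_space configs) config) = (\<integral>\<^sup>+k. ennreal (config_prob k) * f k \<partial>count_space configs)"
    by (simp add: nn_integral_density)
  then show ?thesis by (simp add: nn_integral_distr[OF config_measurable])
qed

text \<open>The recursion of the Poisson weights lam^k / k!, which is all that the Mecke formula
  needs.\<close>

lemma config_prob_up:
  assumes "a \<in> I"
  shows "config_prob (up a k) * real (Suc (k a)) = lam a * config_prob k"
proof -
  have "(\<Prod>i\<in>I - {a}. lam i ^ up a k i / fact (up a k i) * exp (- lam i)) = (\<Prod>i\<in>I - {a}. lam i ^ k i / fact (k i) * exp (- lam i))"
    by (intro prod.cong) (auto simp: up_def)
  moreover have "lam a ^ up a k a / fact (up a k a) * exp (- lam a) * real (Suc (k a)) = lam a * (lam a ^ k a / fact (k a) * exp (- lam a))"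
    by (simp add: up_def field_simps del: of_nat_Suc)
  moreover have "config_prob (up a k) * real (Suc (k a)) =
      (lam a ^ up a k a / fact (up a k a) * exp (- lam a) * real (Suc (k a))) * (\<Prod>i\<in>I - {a}. lam i ^ up a k i / fact (up a k i) * exp (- lam i))"
    unfolding config_prob_def prod.remove[OF finite_I assms] by (simp only: mult_ac)
  moreover have "lam a * config_prob k =
      (lam a * (lam a ^ k a / fact (k a) * exp (- lam a))) * (\<Prod>i\<in>I - {a}. lam i ^ k i / fact (k i) * exp (- lam i))"
    unfolding config_prob_def prod.remove[OF finite_I assms] by (simp only: mult_ac)
  ultimately show ?thesis by (simp only:)
qed

text \<open>Adding a point in cell \<open>a\<close> is a bijection from all configurations onto
  those with a point in \<open>a\<close>; the others contribute nothing because of the factor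
  \<open>cnt a\<close>.\<close>

lemma nn_mecke:
  assumes a: "a \<in> I"
  shows "(\<integral>\<^sup>+\<omega>. of_nat (cnt a \<omega>) * f (config \<omega>) \<partial>M) = ennreal (lam a) * (\<integral>\<^sup>+\<omega>. f (up a (config \<omega>)) \<partial>M)"
proof -
  have ne: "I \<noteq> {}" using a by auto
  let ?V = "{k \<in> configs. k a > 0}"
  have bij: "bij_betw (up a) configs ?V"
  proof (rule bij_betwI[where g="\<lambda>k. k(a := k a - 1)"])
    show "(\<lambda>k. k(a := k a - 1)) \<in> ?V \<rightarrow> configs"
      using a by (auto simp: configs_def PiE_def extensional_def)
  qed (use up_in[OF a] in \<open>auto simp: up_def\<close>)
  have p0: "config_prob k \<ge> 0" for k
    unfolding config_prob_def using lam_nonneg by (intro prod_nonneg) auto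
  have "(\<integral>\<^sup>+\<omega>. of_nat (cnt a \<omega>) * f (config \<omega>) \<partial>M) = (\<integral>\<^sup>+\<omega>. of_nat (config \<omega> a) * f (config \<omega>) \<partial>M)"
    using a by (simp add: config_def)
  also have "\<dots> = (\<integral>\<^sup>+k. ennreal (config_prob k) * (of_nat (k a) * f k) \<partial>count_space configs)"
    by (rule nn_integral_config[OF ne])
  also have "\<dots> = (\<integral>\<^sup>+k. ennreal (config_prob k) * (of_nat (k a) * f k) \<partial>count_space ?V)"
    by (rule nn_integral_count_space_eq) auto
  also have "\<dots> = (\<integral>\<^sup>+k. ennreal (config_prob (up a k)) * (of_nat (up a k a) * f (up a k)) \<partial>count_space configs)"
    by (rule nn_integral_bij_count_space[OF bij, symmetric])
  also have "\<dots> = (\<integral>\<^sup>+k. ennreal (lam a) * (ennreal (config_prob k) * f (up a k)) \<partial>count_space configs)"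
  proof (intro nn_integral_cong)
    fix k
    have "ennreal (config_prob (up a k)) * of_nat (up a k a) = ennreal (config_prob (up a k) * real (Suc (k a)))"
      using p0 by (simp add: up_def ennreal_mult ennreal_of_nat_eq_real_of_nat del: of_nat_Suc)
    also have "\<dots> = ennreal (lam a) * ennreal (config_prob k)"
      unfolding config_prob_up[OF a] using p0 lam_nonneg[OF a] by (simp add: ennreal_mult)
    finally show "ennreal (config_prob (up a k)) * (of_nat (up a k a) * f (up a k)) = ennreal (lam a) * (ennreal (config_prob k) * f (up a k))"
      by (simp add: mult.assoc[symmetric])
  qed
  also have "\<dots> = ennreal (lam a) * (\<integral>\<^sup>+k. ennreal (config_prob k) * f (up a k) \<partial>count_space configs)"
    by (rule nn_integral_cmult) simp
  also have "\<dots> = ennreal (lam a) * (\<integral>\<^sup>+\<omega>. f (up a (config \<omega>)) \<partial>M)"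
    by (subst nn_integral_config[OF ne, of "\<lambda>k. f (up a k)"]) simp
  finally show ?thesis .
qed

lemma real_mecke:
  fixes f :: "('i \<Rightarrow> nat) \<Rightarrow> real"
  assumes a: "a \<in> I" and int: "integrable M (\<lambda>\<omega>. f (up a (config \<omega>)))"
  shows "integrable M (\<lambda>\<omega>. real (config \<omega> a) * f (config \<omega>))"
    and "expectation (\<lambda>\<omega>. real (config \<omega> a) * f (config \<omega>)) = lam a * expectation (\<lambda>\<omega>. f (up a (config \<omega>)))"
proof -
  have cnt: "cnt a \<omega> = config \<omega> a" for \<omega> using a by (simp add: config_def)
  have pos: "(\<integral>\<^sup>+\<omega>. ennreal (real (config \<omega> a) * g (config \<omega>)) \<partial>M) = ennreal (lam a) * (\<integral>\<^sup>+\<omega>. ennreal (g (up a (config \<omega>))) \<partial>M)" for g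
    using nn_mecke[OF a, of "\<lambda>k. ennreal (g k)"]
    by (simp add: cnt ennreal_mult' ennreal_of_nat_eq_real_of_nat)
  show "integrable M (\<lambda>\<omega>. real (config \<omega> a) * f (config \<omega>))"
    using int pos[of "\<lambda>k. \<bar>f k\<bar>"] by (simp add: integrable_iff_bounded abs_mult ennreal_mult_less_top)
  then show "expectation (\<lambda>\<omega>. real (config \<omega> a) * f (config \<omega>)) = lam a * expectation (\<lambda>\<omega>. f (up a (config \<omega>)))"
    using int pos[of f] pos[of "\<lambda>k. - f k"] lam_nonneg[OF a]
    by (simp add: real_lebesgue_integral_def enn2real_mult right_diff_distrib)
qed

section \<open>Moments and functions of polynomial growth\<close>

definition total :: "('i \<Rightarrow> nat) \<Rightarrow> real" where "total n = (\<Sum>i\<in>I. real (n i))"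

lemma total_nonneg: "total n \<ge> 0" by (simp add: total_def sum_nonneg)
lemma total_up: "a \<in> I \<Longrightarrow> total (up a n) = 1 + total n"
proof -
  assume a: "a \<in> I"
  have "(\<Sum>i\<in>I - {a}. real (up a n i)) = (\<Sum>i\<in>I - {a}. real (n i))"
    by (intro sum.cong) (auto simp: up_def)
  then show ?thesis unfolding total_def sum.remove[OF finite_I a] by (simp add: up_def)
qed

text \<open>Induction on the exponent with \<open>c\<close> arbitrary: expanding one factor of the
  power and applying the Mecke formula replaces \<open>c\<close> by \<open>c + 1\<close> in the
  remaining factors.\<close>

lemma integrable_total_power: "integrable M (\<lambda>\<omega>. (c + total (config \<omega>)) ^ m)"
proof (induction m arbitrary: c)
  case (Suc m)
  have "integrable M (\<lambda>\<omega>. real (config \<omega> a) * (c + total (config \<omega>)) ^ m)" if "a \<in> I" for a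
    using that Suc.IH[of "c + 1"] by (intro real_mecke(1)[of a "\<lambda>n. (c + total n) ^ m"]) (auto simp: total_up add_ac)
  then have "integrable M (\<lambda>\<omega>. c * (c + total (config \<omega>)) ^ m + (\<Sum>a\<in>I. real (config \<omega> a) * (c + total (config \<omega>)) ^ m))"
    using Suc.IH[of c] by auto
  then show ?case by (simp add: total_def sum_distrib_right distrib_right)
qed simp

text \<open>A class of integrable functions closed under the algebraic operations and under
  \<open>up\<close>; it settles the integrability conditions of the whole discrete calculus.\<close>

definition poly_growth :: "(('i \<Rightarrow> nat) \<Rightarrow> real) \<Rightarrow> bool" where
  "poly_growth f \<longleftrightarrow> (\<exists>A m. \<forall>n\<in>configs. \<bar>f n\<bar> \<le> A * (1 + total n) ^ m)"

lemma poly_growthI: "(\<And>n. n \<in> configs \<Longrightarrow> \<bar>f n\<bar> \<le> A * (1 + total n) ^ m) \<Longrightarrow> poly_growth f"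
  unfolding poly_growth_def by blast

lemma poly_growthE:
  assumes "poly_growth f"
  obtains A m where "A \<ge> 0" "\<And>n. n \<in> configs \<Longrightarrow> \<bar>f n\<bar> \<le> A * (1 + total n) ^ m"
proof -
  obtain A m where *: "\<forall>n\<in>configs. \<bar>f n\<bar> \<le> A * (1 + total n) ^ m" using assms by (auto simp: poly_growth_def)
  have "\<bar>f n\<bar> \<le> \<bar>A\<bar> * (1 + total n) ^ m" if "n \<in> configs" for n
    using *[rule_format, OF that] mult_right_mono[of A "\<bar>A\<bar>" "(1 + total n) ^ m"] total_nonneg[of n]
    by (smt (verit) zero_le_power)
  then show ?thesis using that[of "\<bar>A\<bar>" m] by auto
qed

lemma poly_growth_integrable: "poly_growth f \<Longrightarrow> integrable M (\<lambda>\<omega>. f (config \<omega>))"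
proof (elim poly_growthE)
  fix A m assume A: "A \<ge> 0" and *: "\<And>n. n \<in> configs \<Longrightarrow> \<bar>f n\<bar> \<le> A * (1 + total n) ^ m"
  show ?thesis
    by (rule Bochner_Integration.integrable_bound[where f="\<lambda>\<omega>. A * (1 + total (config \<omega>)) ^ m"])
       (use integrable_total_power * config_in A total_nonneg in \<open>auto simp: abs_mult intro!: AE_I2\<close>)
qed

lemma poly_growth_const: "poly_growth (\<lambda>_. c)"
  by (rule poly_growthI[where A="\<bar>c\<bar>" and m=0]) auto

lemma poly_growth_coord: "a \<in> I \<Longrightarrow> poly_growth (\<lambda>n. real (n a))"
  by (rule poly_growthI[where A=1 and m=1]) (auto simp: total_def intro!: add_increasing member_le_sum finite_I)

lemma poly_growth_mult:
  assumes "poly_growth f" "poly_growth g" shows "poly_growth (\<lambda>n. f n * g n)"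
proof -
  obtain A m where A: "A \<ge> 0" "\<And>n. n \<in> configs \<Longrightarrow> \<bar>f n\<bar> \<le> A * (1 + total n) ^ m" using assms(1) by (rule poly_growthE, blast)
  obtain B l where B: "B \<ge> 0" "\<And>n. n \<in> configs \<Longrightarrow> \<bar>g n\<bar> \<le> B * (1 + total n) ^ l" using assms(2) by (rule poly_growthE, blast)
  show ?thesis
  proof (rule poly_growthI[where A="A * B" and m="m + l"])
    fix n assume n: "n \<in> configs"
    have "\<bar>f n * g n\<bar> \<le> (A * (1 + total n) ^ m) * (B * (1 + total n) ^ l)"
      unfolding abs_mult using A B n total_nonneg[of n] by (intro mult_mono) auto
    then show "\<bar>f n * g n\<bar> \<le> A * B * (1 + total n) ^ (m + l)" by (simp add: power_add algebra_simps)
  qed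
qed

lemma poly_growth_add:
  assumes "poly_growth f" "poly_growth g" shows "poly_growth (\<lambda>n. f n + g n)"
proof -
  obtain A m where A: "A \<ge> 0" "\<And>n. n \<in> configs \<Longrightarrow> \<bar>f n\<bar> \<le> A * (1 + total n) ^ m" using assms(1) by (rule poly_growthE, blast)
  obtain B l where B: "B \<ge> 0" "\<And>n. n \<in> configs \<Longrightarrow> \<bar>g n\<bar> \<le> B * (1 + total n) ^ l" using assms(2) by (rule poly_growthE, blast)
  show ?thesis
  proof (rule poly_growthI[where A="A + B" and m="m + l"])
    fix n assume n: "n \<in> configs"
    have "(1 + total n) ^ m \<le> (1 + total n) ^ (m + l)" "(1 + total n) ^ l \<le> (1 + total n) ^ (m + l)"
      using total_nonneg[of n] by (auto intro!: power_increasing)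
    then have "A * (1 + total n) ^ m \<le> A * (1 + total n) ^ (m + l)" "B * (1 + total n) ^ l \<le> B * (1 + total n) ^ (m + l)"
      using A B by (auto intro: mult_left_mono)
    then show "\<bar>f n + g n\<bar> \<le> (A + B) * (1 + total n) ^ (m + l)"
      using A(2)[OF n] B(2)[OF n] by (simp add: distrib_right)
  qed
qed

lemma poly_growth_cong: "poly_growth f \<Longrightarrow> (\<And>n. n \<in> configs \<Longrightarrow> \<bar>g n\<bar> \<le> \<bar>f n\<bar>) \<Longrightarrow> poly_growth g"
  unfolding poly_growth_def by (meson order_trans)

lemma poly_growth_minus: "poly_growth f \<Longrightarrow> poly_growth (\<lambda>n. - f n)"
  by (erule poly_growth_cong) simp

lemma poly_growth_diff: "poly_growth f \<Longrightarrow> poly_growth g \<Longrightarrow> poly_growth (\<lambda>n. f n - g n)"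
  using poly_growth_add[of f "\<lambda>n. - g n"] poly_growth_minus[of g] by simp

lemma poly_growth_divide: "poly_growth f \<Longrightarrow> poly_growth (\<lambda>n. f n / c)"
  using poly_growth_mult[of f "\<lambda>_. inverse c"] poly_growth_const by (simp add: divide_inverse)

lemma poly_growth_power: "poly_growth f \<Longrightarrow> poly_growth (\<lambda>n. f n ^ k)"
  by (induction k) (auto intro: poly_growth_mult poly_growth_const)

lemma poly_growth_sum: "(\<And>j. j \<in> J \<Longrightarrow> poly_growth (f j)) \<Longrightarrow> poly_growth (\<lambda>n. \<Sum>j\<in>J. f j n)"
  by (induction J rule: infinite_finite_induct) (auto intro: poly_growth_add poly_growth_const)

lemma poly_growth_up:
  assumes a: "a \<in> I" and "poly_growth f" shows "poly_growth (\<lambda>n. f (up a n))"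
proof -
  obtain A m where A: "A \<ge> 0" "\<And>n. n \<in> configs \<Longrightarrow> \<bar>f n\<bar> \<le> A * (1 + total n) ^ m" using assms(2) by (rule poly_growthE, blast)
  show ?thesis
  proof (rule poly_growthI[where A="A * 2 ^ m" and m=m])
    fix n assume n: "n \<in> configs"
    have "\<bar>f (up a n)\<bar> \<le> A * (2 + total n) ^ m" using A(2)[OF up_in[OF a n]] by (simp add: total_up[OF a])
    also have "\<dots> \<le> A * (2 * (1 + total n)) ^ m"
      using A(1) total_nonneg[of n] by (intro mult_left_mono power_mono) auto
    finally show "\<bar>f (up a n)\<bar> \<le> A * 2 ^ m * (1 + total n) ^ m" by (simp only: power_mult_distrib mult.assoc)
  qed
qed

lemma poly_growth_abs: "poly_growth f \<Longrightarrow> poly_growth (\<lambda>n. \<bar>f n\<bar>)"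
  by (erule poly_growth_cong) simp

lemmas poly_growth_intros = poly_growth_const poly_growth_coord poly_growth_mult poly_growth_add
  poly_growth_minus poly_growth_diff poly_growth_divide poly_growth_power poly_growth_sum poly_growth_up poly_growth_abs

lemma mean_add: "poly_growth f \<Longrightarrow> poly_growth g \<Longrightarrow> mean (\<lambda>n. f n + g n) = mean f + mean g"
  unfolding mean_def by (intro Bochner_Integration.integral_add poly_growth_integrable)
lemma mean_diff: "poly_growth f \<Longrightarrow> poly_growth g \<Longrightarrow> mean (\<lambda>n. f n - g n) = mean f - mean g"
  unfolding mean_def by (intro Bochner_Integration.integral_diff poly_growth_integrable)
lemma mean_cmult: "mean (\<lambda>n. c * f n) = c * mean f"
  unfolding mean_def by simp
lemma mean_const: "mean (\<lambda>n. c) = c"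
  unfolding mean_def by (simp add: prob_space)
lemma mean_sum: "(\<And>j. j \<in> J \<Longrightarrow> poly_growth (f j)) \<Longrightarrow> mean (\<lambda>n. \<Sum>j\<in>J. f j n) = (\<Sum>j\<in>J. mean (f j))"
  unfolding mean_def by (intro Bochner_Integration.integral_sum poly_growth_integrable)
lemma mean_mono: "poly_growth f \<Longrightarrow> poly_growth g \<Longrightarrow> (\<And>n. n \<in> configs \<Longrightarrow> f n \<le> g n) \<Longrightarrow> mean f \<le> mean g"
  unfolding mean_def by (intro integral_mono poly_growth_integrable) (auto simp: config_in)
lemma mean_nonneg: "(\<And>n. n \<in> configs \<Longrightarrow> 0 \<le> f n) \<Longrightarrow> 0 \<le> mean f"
  unfolding mean_def by (intro Bochner_Integration.integral_nonneg) (auto simp: config_in)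
lemma mean_cong: "(\<And>n. n \<in> configs \<Longrightarrow> f n = g n) \<Longrightarrow> mean f = mean g"
  unfolding mean_def by (intro Bochner_Integration.integral_cong) (auto simp: config_in)

lemma mecke: "a \<in> I \<Longrightarrow> poly_growth f \<Longrightarrow> mean (\<lambda>n. real (n a) * f n) = lam a * mean (\<lambda>n. f (up a n))"
  unfolding mean_def by (intro real_mecke(2) poly_growth_integrable poly_growth_up)

text \<open>The Mecke formula minus lam b times the mean of \<open>G\<close>: multiplication by a
  centred count acts as the difference operator of adding a point.\<close>

lemma linear_ibp:
  assumes G: "poly_growth G"
  shows "mean (\<lambda>n. (\<Sum>b\<in>I. c b * (real (n b) - lam b)) * G n) = (\<Sum>b\<in>I. c b * lam b * mean (\<lambda>n. G (up b n) - G n))"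
proof -
  have "mean (\<lambda>n. (\<Sum>b\<in>I. c b * (real (n b) - lam b)) * G n) = mean (\<lambda>n. \<Sum>b\<in>I. c b * (real (n b) * G n - lam b * G n))"
    unfolding sum_distrib_right by (simp only: left_diff_distrib mult.assoc)
  also have "\<dots> = (\<Sum>b\<in>I. mean (\<lambda>n. c b * (real (n b) * G n - lam b * G n)))"
    by (intro mean_sum poly_growth_intros G)
  also have "\<dots> = (\<Sum>b\<in>I. c b * lam b * mean (\<lambda>n. G (up b n) - G n))"
    by (intro sum.cong refl)
       (simp add: mean_cmult mean_diff mecke G poly_growth_intros right_diff_distrib)
  finally show ?thesis .
qed

text \<open>With a zero diagonal, points in a common cell do not interact. So no terms n (n - 1)
  occur, and a new point in \<open>a\<close> leaves \<open>S k a\<close> unchanged.\<close>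

definition kernel :: "('i \<Rightarrow> 'i \<Rightarrow> real) \<Rightarrow> bool" where
  "kernel k \<longleftrightarrow> (\<forall>a\<in>I. \<forall>b\<in>I. k a b = k b a \<and> 0 \<le> k a b) \<and> (\<forall>a\<in>I. k a a = 0)"

lemma k_sym: "kernel k \<Longrightarrow> a \<in> I \<Longrightarrow> b \<in> I \<Longrightarrow> k a b = k b a"
  and k_diag: "kernel k \<Longrightarrow> a \<in> I \<Longrightarrow> k a a = 0"
  and k_nonneg: "kernel k \<Longrightarrow> a \<in> I \<Longrightarrow> b \<in> I \<Longrightarrow> 0 \<le> k a b"
  by (auto simp: kernel_def)

definition S :: "('i \<Rightarrow> 'i \<Rightarrow> real) \<Rightarrow> 'i \<Rightarrow> ('i \<Rightarrow> nat) \<Rightarrow> real" where "S k a n = (\<Sum>b\<in>I. k a b * real (n b))"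
definition m :: "('i \<Rightarrow> 'i \<Rightarrow> real) \<Rightarrow> 'i \<Rightarrow> real" where "m k a = (\<Sum>b\<in>I. k a b * lam b)"
definition F :: "('i \<Rightarrow> 'i \<Rightarrow> real) \<Rightarrow> ('i \<Rightarrow> nat) \<Rightarrow> real" where "F k n = 1 / 2 * (\<Sum>a\<in>I. real (n a) * S k a n)"

lemma S_nonneg: "kernel k \<Longrightarrow> a \<in> I \<Longrightarrow> 0 \<le> S k a n"
  unfolding S_def by (intro sum_nonneg mult_nonneg_nonneg k_nonneg[of k]) auto
lemma m_nonneg: "kernel k \<Longrightarrow> a \<in> I \<Longrightarrow> 0 \<le> m k a"
  unfolding m_def by (intro sum_nonneg mult_nonneg_nonneg k_nonneg[of k] lam_nonneg) auto

lemma poly_growth_S: "poly_growth (S k a)"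
  unfolding S_def by (intro poly_growth_intros)
lemma poly_growth_F: "poly_growth (F k)"
  unfolding F_def by (intro poly_growth_intros poly_growth_S)

lemma S_up: "a \<in> I \<Longrightarrow> S k b (up a n) = S k b n + k b a"
proof -
  assume a: "a \<in> I"
  have "(\<Sum>i\<in>I - {a}. k b i * real (up a n i)) = (\<Sum>i\<in>I - {a}. k b i * real (n i))"
    by (intro sum.cong) (auto simp: up_def)
  then show ?thesis unfolding S_def sum.remove[OF finite_I a] by (simp add: up_def algebra_simps)
qed

lemma S_up_self: "kernel k \<Longrightarrow> a \<in> I \<Longrightarrow> S k a (up a n) = S k a n"
  by (simp add: S_up k_diag)

lemma F_up:
  assumes K: "kernel k" and a: "a \<in> I"
  shows "F k (up a n) = F k n + S k a n"
proof -
  have "(\<Sum>c\<in>I. real (up a n c) * S k c (up a n)) = (\<Sum>c\<in>I. real (n c) * S k c (up a n)) + S k a (up a n)"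
  proof -
    have "(\<Sum>i\<in>I - {a}. real (up a n i) * S k i (up a n)) = (\<Sum>i\<in>I - {a}. real (n i) * S k i (up a n))"
      by (intro sum.cong) (auto simp: up_def)
    then show ?thesis unfolding sum.remove[OF finite_I a] by (simp add: up_def algebra_simps)
  qed
  also have "(\<Sum>c\<in>I. real (n c) * S k c (up a n)) = (\<Sum>c\<in>I. real (n c) * S k c n) + (\<Sum>c\<in>I. real (n c) * k c a)"
    by (simp add: S_up[OF a] distrib_left sum.distrib)
  also have "(\<Sum>c\<in>I. real (n c) * k c a) = S k a n"
    unfolding S_def using k_sym[OF K] a by (intro sum.cong) auto
  finally show ?thesis by (simp add: F_def S_up_self[OF K a])
qed

text \<open>The Mecke formula turns the left side into half the sum of lam a * mean (S k a * G (up
  a)). The expression with (S + m) / 2 and differences of \<open>G\<close> contains two further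
  mixed sums, which cancel by the symmetry of \<open>k\<close>, and a multiple of
  \<open>mean G\<close>.\<close>

lemma F_product_mean:
  assumes K: "kernel k" and G: "poly_growth G"
  shows "mean (\<lambda>n. F k n * G n) = (\<Sum>a\<in>I. lam a * mean (\<lambda>n. (G (up a n) - G n) * (1 / 2 * (S k a n + m k a))))
      + 1 / 2 * (\<Sum>a\<in>I. lam a * m k a) * mean G"
proof -
  note pg = poly_growth_intros poly_growth_S G
  have "mean (\<lambda>n. F k n * G n) = mean (\<lambda>n. \<Sum>a\<in>I. 1 / 2 * (real (n a) * (S k a n * G n)))"
    unfolding F_def sum_distrib_left sum_distrib_right by (simp only: mult.assoc)
  also have "\<dots> = (\<Sum>a\<in>I. 1 / 2 * (lam a * mean (\<lambda>n. S k a n * G (up a n))))"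
    by (subst mean_sum, (intro pg; assumption)+, intro sum.cong refl, unfold mean_cmult) (simp add: mecke pg S_up_self[OF K])
  finally have 1: "mean (\<lambda>n. F k n * G n) = (\<Sum>a\<in>I. 1 / 2 * (lam a * mean (\<lambda>n. S k a n * G (up a n))))" .
  have mS: "mean (\<lambda>n. S k a n * G n) = (\<Sum>b\<in>I. k a b * (lam b * mean (\<lambda>n. G (up b n))))" for a
  proof -
    have "mean (\<lambda>n. S k a n * G n) = mean (\<lambda>n. \<Sum>b\<in>I. k a b * (real (n b) * G n))"
      unfolding S_def sum_distrib_left sum_distrib_right by (simp only: mult.assoc)
    also have "\<dots> = (\<Sum>b\<in>I. k a b * (lam b * mean (\<lambda>n. G (up b n))))"
      by (subst mean_sum, (intro pg; assumption)+, intro sum.cong refl, unfold mean_cmult) (simp add: mecke pg)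
    finally show ?thesis .
  qed
  \<comment> \<open>The cancellation: the Mecke formula for the counts inside \<open>S\<close>
    exchanges the roles of the two cells.\<close>
  have 2: "(\<Sum>a\<in>I. lam a * mean (\<lambda>n. S k a n * G n)) = (\<Sum>a\<in>I. lam a * (m k a * mean (\<lambda>n. G (up a n))))"
  proof -
    have "(\<Sum>a\<in>I. lam a * mean (\<lambda>n. S k a n * G n)) = (\<Sum>a\<in>I. \<Sum>b\<in>I. lam a * (k a b * (lam b * mean (\<lambda>n. G (up b n)))))"
      by (simp add: mS sum_distrib_left)
    also have "\<dots> = (\<Sum>b\<in>I. \<Sum>a\<in>I. lam a * (k a b * (lam b * mean (\<lambda>n. G (up b n)))))"
      by (rule sum.swap)
    also have "\<dots> = (\<Sum>b\<in>I. \<Sum>a\<in>I. lam b * (k b a * lam a * mean (\<lambda>n. G (up b n))))"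
      by (intro sum.cong refl) (subst k_sym[OF K], auto)
    also have "\<dots> = (\<Sum>a\<in>I. lam a * (m k a * mean (\<lambda>n. G (up a n))))"
      by (simp add: m_def sum_distrib_left sum_distrib_right)
    finally show ?thesis .
  qed
  have "(\<Sum>a\<in>I. lam a * mean (\<lambda>n. (G (up a n) - G n) * (1 / 2 * (S k a n + m k a))))
     = (\<Sum>a\<in>I. 1 / 2 * (lam a * mean (\<lambda>n. S k a n * G (up a n))) - 1 / 2 * (lam a * mean (\<lambda>n. S k a n * G n))
          + 1 / 2 * (lam a * (m k a * mean (\<lambda>n. G (up a n)))) - 1 / 2 * (lam a * m k a) * mean G)"
  proof (intro sum.cong refl)
    fix a assume a: "a \<in> I"
    have "mean (\<lambda>n. (G (up a n) - G n) * (1 / 2 * (S k a n + m k a)))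
      = mean (\<lambda>n. 1 / 2 * ((S k a n * G (up a n) - S k a n * G n) + (m k a * G (up a n) - m k a * G n)))"
      by (rule mean_cong) (simp add: field_simps)
    also have "\<dots> = 1 / 2 * ((mean (\<lambda>n. S k a n * G (up a n)) - mean (\<lambda>n. S k a n * G n)) + (m k a * mean (\<lambda>n. G (up a n)) - m k a * mean G))"
      unfolding mean_cmult by (simp add: mean_add mean_diff mean_cmult pg a)
    moreover have "l * (1 / 2 * ((x - y) + (c * z - c * w))) = 1 / 2 * (l * x) - 1 / 2 * (l * y) + 1 / 2 * (l * (c * z)) - 1 / 2 * (l * c) * w"
      for l x y c z w :: real by (simp add: field_simps)
    ultimately show "lam a * mean (\<lambda>n. (G (up a n) - G n) * (1 / 2 * (S k a n + m k a))) =
       1 / 2 * (lam a * mean (\<lambda>n. S k a n * G (up a n))) - 1 / 2 * (lam a * mean (\<lambda>n. S k a n * G n))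
          + 1 / 2 * (lam a * (m k a * mean (\<lambda>n. G (up a n)))) - 1 / 2 * (lam a * m k a) * mean G"
      by (simp only:)
  qed
  also have "\<dots> = mean (\<lambda>n. F k n * G n) - 1 / 2 * (\<Sum>a\<in>I. lam a * m k a) * mean G"
    unfolding sum.distrib sum_subtractf sum_distrib_left[symmetric] sum_distrib_right[symmetric] 1 2
    by (simp add: sum_distrib_left)
  finally show ?thesis by simp
qed

lemma mean_F: "kernel k \<Longrightarrow> mean (F k) = 1 / 2 * (\<Sum>a\<in>I. lam a * m k a)"
  using F_product_mean[of k "\<lambda>_. 1"] by (simp add: poly_growth_const mean_const)

theorem F_ibp:
  assumes K: "kernel k" and G: "poly_growth G"
  shows "mean (\<lambda>n. (F k n - mean (F k)) * G n) = (\<Sum>a\<in>I. lam a * mean (\<lambda>n. (G (up a n) - G n) * (1 / 2 * (S k a n + m k a))))"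
proof -
  have "mean (\<lambda>n. (F k n - mean (F k)) * G n) = mean (\<lambda>n. F k n * G n) - mean (F k) * mean G"
    unfolding left_diff_distrib by (subst mean_diff) (auto intro!: poly_growth_intros poly_growth_F G simp: mean_cmult)
  then show ?thesis by (simp add: F_product_mean[OF K G] mean_F[OF K])
qed


definition Sc :: "('i \<Rightarrow> 'i \<Rightarrow> real) \<Rightarrow> 'i \<Rightarrow> ('i \<Rightarrow> nat) \<Rightarrow> real" where
  "Sc k a n = (\<Sum>b\<in>I. k a b * (real (n b) - lam b))"

lemma poly_growth_Sc: "poly_growth (Sc k a)"
  unfolding Sc_def by (intro poly_growth_intros)

lemma S_Sc: "S k a n = Sc k a n + m k a"
  unfolding S_def Sc_def m_def sum.distrib[symmetric] by (simp add: algebra_simps)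

lemma Sc_up: "a \<in> I \<Longrightarrow> Sc k b (up a n) = Sc k b n + k b a"
  using S_up[of a k b n] by (simp add: S_Sc)

lemma mean_Sc: "mean (Sc k a) = 0"
  unfolding Sc_def using linear_ibp[of "\<lambda>_. 1" "k a"] by (simp add: poly_growth_const mean_const)

lemma mean_Sc_Sc: "mean (\<lambda>n. Sc k a n * Sc l c n) = (\<Sum>b\<in>I. lam b * k a b * l c b)"
proof -
  have "mean (\<lambda>n. Sc k a n * Sc l c n) = (\<Sum>b\<in>I. k a b * lam b * mean (\<lambda>n. Sc l c (up b n) - Sc l c n))"
    unfolding Sc_def[of k] by (rule linear_ibp[OF poly_growth_Sc])
  also have "\<dots> = (\<Sum>b\<in>I. lam b * k a b * l c b)"
    by (intro sum.cong refl) (simp add: Sc_up mean_const)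
  finally show ?thesis .
qed

text \<open>For \<open>G = F l\<close> the increment in \<open>F_ibp\<close> is \<open>S l\<close>,
  so the mean of \<open>T k l\<close> is the covariance of \<open>F k\<close> and
  \<open>F l\<close>. The comparison with a Gaussian vector needs that \<open>T\<close> itself stays
  close to a constant.\<close>

definition T :: "('i \<Rightarrow> 'i \<Rightarrow> real) \<Rightarrow> ('i \<Rightarrow> 'i \<Rightarrow> real) \<Rightarrow> ('i \<Rightarrow> nat) \<Rightarrow> real" where
  "T k l n = (\<Sum>a\<in>I. lam a * (S l a n * (1 / 2 * (S k a n + m k a))))"

lemma poly_growth_T: "poly_growth (T k l)"
  unfolding T_def by (intro poly_growth_intros poly_growth_S)

text \<open>The first part stems from pairs of edges with both ends in common, the second from pairs
  with one common end. After normalisation they turn into \<open>sigma1\<close> and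
  \<open>sigma2\<close>.\<close>

lemma mean_T: "mean (T k l) = (\<Sum>a\<in>I. lam a * (1 / 2 * (\<Sum>b\<in>I. lam b * k a b * l a b) + m k a * m l a))"
proof -
  have "mean (T k l) = (\<Sum>a\<in>I. lam a * mean (\<lambda>n. S l a n * (1 / 2 * (S k a n + m k a))))"
    unfolding T_def by (simp only: mean_sum mean_cmult poly_growth_intros poly_growth_S)
  also have "\<dots> = (\<Sum>a\<in>I. lam a * (1 / 2 * (\<Sum>b\<in>I. lam b * k a b * l a b) + m k a * m l a))"
  proof (intro sum.cong refl arg_cong2[of _ _ _ _ "(*)"])
    fix a
    have "mean (\<lambda>n. S l a n * (1 / 2 * (S k a n + m k a)))
        = mean (\<lambda>n. 1 / 2 * (Sc k a n * Sc l a n) + (m k a * Sc l a n + (1 / 2 * m l a * Sc k a n + m k a * m l a)))"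
      by (rule mean_cong) (simp add: S_Sc field_simps)
    also have "\<dots> = 1 / 2 * (\<Sum>b\<in>I. lam b * k a b * l a b) + m k a * m l a"
      by (simp only: mean_add mean_cmult mean_const mean_Sc mean_Sc_Sc poly_growth_intros poly_growth_Sc)
    finally show "mean (\<lambda>n. S l a n * (1 / 2 * (S k a n + m k a))) = 1 / 2 * (\<Sum>b\<in>I. lam b * k a b * l a b) + m k a * m l a" .
  qed
  finally show ?thesis .
qed

section \<open>Variance of the covariance functional\<close>

definition Q :: "('i \<Rightarrow> 'i \<Rightarrow> real) \<Rightarrow> ('i \<Rightarrow> 'i \<Rightarrow> real) \<Rightarrow> ('i \<Rightarrow> nat) \<Rightarrow> real" where
  "Q k l n = (\<Sum>a\<in>I. lam a * (Sc k a n * Sc l a n))"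

lemma poly_growth_Q: "poly_growth (Q k l)"
  unfolding Q_def by (intro poly_growth_intros poly_growth_Sc)

context
  fixes K :: "'i \<Rightarrow> 'i \<Rightarrow> real" and \<Lambda> M1 M2 :: real
  assumes K: "kernel K" and \<Lambda>: "\<Lambda> = (\<Sum>a\<in>I. lam a)"
    and M1: "\<And>a. a \<in> I \<Longrightarrow> (\<Sum>b\<in>I. lam b * K a b) \<le> M1"
    and M2: "\<And>a. a \<in> I \<Longrightarrow> (\<Sum>b\<in>I. lam b * (K a b)\<^sup>2) \<le> M2"
begin

lemma K_nonneg: "a \<in> I \<Longrightarrow> b \<in> I \<Longrightarrow> 0 \<le> K a b" and K_sym: "a \<in> I \<Longrightarrow> b \<in> I \<Longrightarrow> K a b = K b a"
  using K by (auto simp: kernel_def)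

lemma M1': "a \<in> I \<Longrightarrow> (\<Sum>b\<in>I. lam b * K b a) \<le> M1" and M2': "a \<in> I \<Longrightarrow> (\<Sum>b\<in>I. lam b * (K b a)\<^sup>2) \<le> M2"
  using M1[of a] M2[of a] K_sym[of a] by auto

lemma weighted_sum_le: "(\<And>a. a \<in> I \<Longrightarrow> f a \<le> c) \<Longrightarrow> (\<Sum>a\<in>I. lam a * f a) \<le> \<Lambda> * c"
  unfolding \<Lambda> sum_distrib_right by (intro sum_mono mult_left_mono lam_nonneg)

lemma M1_nonneg: "I \<noteq> {} \<Longrightarrow> M1 \<ge> 0" and M2_nonneg: "I \<noteq> {} \<Longrightarrow> M2 \<ge> 0"
proof -
  assume "I \<noteq> {}"
  then obtain a where a: "a \<in> I" by blast
  have "0 \<le> (\<Sum>b\<in>I. lam b * K a b)" "0 \<le> (\<Sum>b\<in>I. lam b * (K a b)\<^sup>2)"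
    using a by (auto intro!: sum_nonneg mult_nonneg_nonneg lam_nonneg K_nonneg)
  then show "M1 \<ge> 0" "M2 \<ge> 0" using M1[OF a] M2[OF a] by linarith+
qed

lemma \<Lambda>_nonneg: "\<Lambda> \<ge> 0" unfolding \<Lambda> by (intro sum_nonneg lam_nonneg)

definition R :: "'i \<Rightarrow> 'i \<Rightarrow> real" where "R a c = (\<Sum>b\<in>I. lam b * K a b * K c b)"

text \<open>The sum runs over closed cycles of length four, the fourth cell being hidden in
  \<open>R\<close>. Bounding \<open>K a b * K c b\<close> by the mean of the squares opens the
  cycle: one square summed over its free cell gives M2, \<open>R\<close> summed over the other end
  gives M1^2, and the last cell gives \<Lambda>.\<close>

lemma cycle_bound:
  assumes "I \<noteq> {}"
  shows "(\<Sum>a\<in>I. \<Sum>b\<in>I. \<Sum>c\<in>I. lam a * lam b * lam c * K a b * K c b * R a c) \<le> \<Lambda> * (M2 * M1\<^sup>2)"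
proof -
  note M1n = M1_nonneg[OF assms] and M2n = M2_nonneg[OF assms]
  have Rn: "R a c \<ge> 0" if "a \<in> I" "c \<in> I" for a c
    unfolding R_def using that by (intro sum_nonneg mult_nonneg_nonneg lam_nonneg K_nonneg)
  have Rsym: "R a c = R c a" for a c unfolding R_def by (simp add: mult_ac)
  have Rsum: "(\<Sum>c\<in>I. lam c * R a c) \<le> M1\<^sup>2" if a: "a \<in> I" for a
  proof -
    have "(\<Sum>c\<in>I. lam c * R a c) = (\<Sum>b\<in>I. lam b * K a b * (\<Sum>c\<in>I. lam c * K c b))"
      unfolding R_def sum_distrib_left by (subst sum.swap) (simp add: mult_ac)
    also have "\<dots> \<le> (\<Sum>b\<in>I. lam b * K a b * M1)"
      using a by (intro sum_mono mult_left_mono M1' mult_nonneg_nonneg lam_nonneg K_nonneg)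
    also have "\<dots> \<le> M1 * M1" unfolding sum_distrib_right[symmetric] using M1[OF a] M1n by (intro mult_right_mono)
    finally show ?thesis by (simp add: power2_eq_square)
  qed
  let ?A = "\<Sum>a\<in>I. \<Sum>b\<in>I. \<Sum>c\<in>I. lam a * lam b * lam c * (K a b)\<^sup>2 * R a c"
  let ?B = "\<Sum>a\<in>I. \<Sum>b\<in>I. \<Sum>c\<in>I. lam a * lam b * lam c * (K c b)\<^sup>2 * R a c"
  have A: "?A \<le> \<Lambda> * (M2 * M1\<^sup>2)"
  proof -
    have "?A = (\<Sum>a\<in>I. lam a * ((\<Sum>b\<in>I. lam b * (K a b)\<^sup>2) * (\<Sum>c\<in>I. lam c * R a c)))"
      unfolding sum_product by (simp only: sum_distrib_left mult_ac)
    also have "\<dots> \<le> \<Lambda> * (M2 * M1\<^sup>2)"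
      by (intro weighted_sum_le mult_mono M2 Rsum M2n sum_nonneg mult_nonneg_nonneg lam_nonneg Rn)
    finally show ?thesis .
  qed
  \<comment> \<open>Relabelling: \<open>R\<close> is symmetric, so a and c may be exchanged.\<close>
  have "?B = (\<Sum>c\<in>I. \<Sum>b\<in>I. \<Sum>a\<in>I. lam a * lam b * lam c * (K c b)\<^sup>2 * R a c)"
    by (subst sum.swap, subst (2) sum.swap, subst sum.swap) simp
  also have "\<dots> = ?A" by (simp add: Rsym mult_ac)
  finally have B: "?B = ?A" .
  have "(\<Sum>a\<in>I. \<Sum>b\<in>I. \<Sum>c\<in>I. lam a * lam b * lam c * K a b * K c b * R a c)
      \<le> (\<Sum>a\<in>I. \<Sum>b\<in>I. \<Sum>c\<in>I. lam a * lam b * lam c * ((K a b)\<^sup>2 / 2 + (K c b)\<^sup>2 / 2) * R a c)"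
  proof (intro sum_mono)
    fix a b c assume *: "a \<in> I" "b \<in> I" "c \<in> I"
    have "K a b * K c b \<le> (K a b)\<^sup>2 / 2 + (K c b)\<^sup>2 / 2"
      using sum_squares_bound[of "K a b" "K c b"] by simp
    then have "(lam a * lam b * lam c) * (K a b * K c b) * R a c \<le> (lam a * lam b * lam c) * ((K a b)\<^sup>2 / 2 + (K c b)\<^sup>2 / 2) * R a c"
      using * by (intro mult_right_mono mult_left_mono Rn mult_nonneg_nonneg lam_nonneg)
    then show "lam a * lam b * lam c * K a b * K c b * R a c \<le> lam a * lam b * lam c * ((K a b)\<^sup>2 / 2 + (K c b)\<^sup>2 / 2) * R a c"
      by (simp add: mult_ac)
  qed
  also have "\<dots> = 1 / 2 * ?A + 1 / 2 * ?B"
    unfolding sum_distrib_left sum.distrib[symmetric] by (intro sum.cong refl) (simp add: field_simps)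
  finally show ?thesis using A B by simp
qed

text \<open>Fourth moments are avoided by integrating by parts in the factor \<open>Sc l a\<close>
  of one \<open>Q\<close>. The increment \<open>D b\<close> of the other \<open>Q\<close> is affine
  in the centred sums, so only second moments remain: paired with \<open>Sc k a\<close> it yields
  the cycles, and multiplied by \<open>k a b\<close> it yields the term \<Lambda> * M2^2.\<close>

lemma variance_Q:
  assumes k: "kernel k" and l: "kernel l"
    and kK: "\<And>a b. a \<in> I \<Longrightarrow> b \<in> I \<Longrightarrow> k a b \<le> K a b" and lK: "\<And>a b. a \<in> I \<Longrightarrow> b \<in> I \<Longrightarrow> l a b \<le> K a b"
    and ne: "I \<noteq> {}"
  shows "mean (\<lambda>n. (Q k l n - mean (Q k l))\<^sup>2) \<le> 2 * (\<Lambda> * (M2 * M1\<^sup>2)) + \<Lambda> * M2\<^sup>2"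
proof -
  note M2n = M2_nonneg[OF ne]
  note kn = k_nonneg[OF k] and ln = k_nonneg[OF l]
  note pg = poly_growth_intros poly_growth_Sc poly_growth_Q
  define q where "q = mean (Q k l)"
  define D where "D b n = Q k l (up b n) - Q k l n" for b n
  have pgD: "b \<in> I \<Longrightarrow> poly_growth (D b)" for b unfolding D_def by (intro pg)
  have D: "D b n = (\<Sum>c\<in>I. lam c * (k c b * Sc l c n + l c b * Sc k c n + k c b * l c b))" if "b \<in> I" for b n
    using that unfolding D_def Q_def sum_subtractf[symmetric]
    by (intro sum.cong refl) (simp add: Sc_up algebra_simps)
  have mD: "mean (D b) = (\<Sum>c\<in>I. lam c * (k c b * l c b))" if "b \<in> I" for b
  proof -
    have "mean (D b) = mean (\<lambda>n. \<Sum>c\<in>I. lam c * (k c b * Sc l c n + l c b * Sc k c n + k c b * l c b))"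
      using D[OF that] by (intro mean_cong)
    also have "\<dots> = (\<Sum>c\<in>I. lam c * (k c b * mean (Sc l c) + l c b * mean (Sc k c) + k c b * l c b))"
      by (simp only: mean_sum mean_add mean_cmult mean_const pg)
    finally show ?thesis by (simp add: mean_Sc)
  qed
  have mUD: "mean (\<lambda>n. Sc k a n * D b n) = (\<Sum>c\<in>I. lam c * (k c b * (\<Sum>e\<in>I. lam e * k a e * l c e) + l c b * (\<Sum>e\<in>I. lam e * k a e * k c e)))"
    if "a \<in> I" "b \<in> I" for a b
  proof -
    have "mean (\<lambda>n. Sc k a n * D b n) = mean (\<lambda>n. \<Sum>c\<in>I. lam c * (k c b * (Sc k a n * Sc l c n) + l c b * (Sc k a n * Sc k c n) + k c b * l c b * Sc k a n))"
      unfolding D[OF that(2)] by (intro mean_cong) (simp add: sum_distrib_left algebra_simps)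
    also have "\<dots> = (\<Sum>c\<in>I. lam c * (k c b * mean (\<lambda>n. Sc k a n * Sc l c n) + l c b * mean (\<lambda>n. Sc k a n * Sc k c n) + k c b * l c b * mean (Sc k a)))"
      by (simp only: mean_sum mean_add mean_cmult mean_const pg)
    finally show ?thesis by (simp add: mean_Sc mean_Sc_Sc)
  qed
  have mq: "mean (\<lambda>n. Q k l n - q) = 0"
    using mean_diff[OF poly_growth_Q poly_growth_const[of q]] by (simp add: mean_const q_def)
  \<comment> \<open>One factor is expanded and the other stays centred, so that terms with an
    isolated Q - q have mean zero, here and again after the integration by parts.\<close>
  have "mean (\<lambda>n. (Q k l n - q)\<^sup>2) = mean (\<lambda>n. Q k l n * (Q k l n - q) - q * (Q k l n - q))"
    by (simp add: power2_eq_square algebra_simps)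
  also have "\<dots> = mean (\<lambda>n. Q k l n * (Q k l n - q)) - q * mean (\<lambda>n. Q k l n - q)"
    by (simp only: mean_diff mean_cmult pg)
  also have "\<dots> = mean (\<lambda>n. \<Sum>a\<in>I. lam a * (Sc l a n * (Sc k a n * (Q k l n - q))))"
    unfolding mq by (simp add: Q_def sum_distrib_right mult_ac)
  also have "\<dots> = (\<Sum>a\<in>I. lam a * mean (\<lambda>n. Sc l a n * (Sc k a n * (Q k l n - q))))"
    by (simp only: mean_sum mean_cmult pg)
  also have "\<dots> = (\<Sum>a\<in>I. lam a * (\<Sum>b\<in>I. l a b * lam b * (mean (\<lambda>n. Sc k a n * D b n) + k a b * mean (D b))))"
  proof (intro sum.cong refl arg_cong2[of _ _ _ _ "(*)"])
    fix a assume a: "a \<in> I"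
    have "mean (\<lambda>n. Sc l a n * (Sc k a n * (Q k l n - q))) =
      (\<Sum>b\<in>I. l a b * lam b * mean (\<lambda>n. Sc k a (up b n) * (Q k l (up b n) - q) - Sc k a n * (Q k l n - q)))"
      unfolding Sc_def[of l] by (rule linear_ibp) (intro pg)
    also have "\<dots> = (\<Sum>b\<in>I. l a b * lam b * (mean (\<lambda>n. Sc k a n * D b n) + k a b * mean (D b)))"
    proof (intro sum.cong refl arg_cong2[of _ _ _ _ "(*)"])
      fix b assume b: "b \<in> I"
      have "mean (\<lambda>n. Sc k a (up b n) * (Q k l (up b n) - q) - Sc k a n * (Q k l n - q))
         = mean (\<lambda>n. Sc k a n * D b n + (k a b * D b n + k a b * (Q k l n - q)))"
        by (rule mean_cong) (simp add: Sc_up[OF b] D_def algebra_simps)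
      also have "\<dots> = mean (\<lambda>n. Sc k a n * D b n) + (k a b * mean (D b) + k a b * mean (\<lambda>n. Q k l n - q))"
        by (simp only: mean_add mean_cmult pg pgD b)
      finally show "mean (\<lambda>n. Sc k a (up b n) * (Q k l (up b n) - q) - Sc k a n * (Q k l n - q)) = mean (\<lambda>n. Sc k a n * D b n) + k a b * mean (D b)"
        by (simp add: mq)
    qed
    finally show "mean (\<lambda>n. Sc l a n * (Sc k a n * (Q k l n - q))) = (\<Sum>b\<in>I. l a b * lam b * (mean (\<lambda>n. Sc k a n * D b n) + k a b * mean (D b)))" .
  qed
  also have "\<dots> \<le> (\<Sum>a\<in>I. lam a * (\<Sum>b\<in>I. K a b * lam b * (2 * (\<Sum>c\<in>I. lam c * (K c b * R a c)) + K a b * M2)))"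
  proof (intro sum_mono mult_left_mono)
    fix a b assume a: "a \<in> I" and b: "b \<in> I"
    have R1: "(\<Sum>e\<in>I. lam e * k a e * l c e) \<le> R a c" "(\<Sum>e\<in>I. lam e * k a e * k c e) \<le> R a c"
         "0 \<le> (\<Sum>e\<in>I. lam e * k a e * l c e)" "0 \<le> (\<Sum>e\<in>I. lam e * k a e * k c e)" if "c \<in> I" for c
      unfolding R_def using a that
      by (auto intro!: sum_mono sum_nonneg mult_mono mult_nonneg_nonneg lam_nonneg kK lK kn ln K_nonneg)
    have "mean (\<lambda>n. Sc k a n * D b n) \<le> (\<Sum>c\<in>I. lam c * (K c b * R a c + K c b * R a c))"
      unfolding mUD[OF a b]
      using b by (intro sum_mono mult_left_mono add_mono mult_mono kK lK R1 K_nonneg lam_nonneg)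
    also have "\<dots> = 2 * (\<Sum>c\<in>I. lam c * (K c b * R a c))"
      by (simp add: sum_distrib_left algebra_simps)
    finally have 1: "mean (\<lambda>n. Sc k a n * D b n) \<le> 2 * (\<Sum>c\<in>I. lam c * (K c b * R a c))" .
    have p1: "0 \<le> mean (\<lambda>n. Sc k a n * D b n)"
      unfolding mUD[OF a b] using b by (intro sum_nonneg mult_nonneg_nonneg add_nonneg_nonneg lam_nonneg kn ln R1)
    have "mean (D b) \<le> (\<Sum>c\<in>I. lam c * (K c b)\<^sup>2)"
      unfolding mD[OF b] power2_eq_square using b by (intro sum_mono mult_left_mono mult_mono kK lK K_nonneg kn ln lam_nonneg)
    then have 2: "mean (D b) \<le> M2" using M2'[OF b] by simp
    have p2: "0 \<le> mean (D b)" unfolding mD[OF b] using b by (intro sum_nonneg mult_nonneg_nonneg lam_nonneg kn ln)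
    show "l a b * lam b * (mean (\<lambda>n. Sc k a n * D b n) + k a b * mean (D b))
        \<le> K a b * lam b * (2 * (\<Sum>c\<in>I. lam c * (K c b * R a c)) + K a b * M2)"
      using a b by (intro mult_mono add_mono 1 2 lK kK lam_nonneg K_nonneg mult_nonneg_nonneg add_nonneg_nonneg p1 p2 kn order_refl)
  qed (use lam_nonneg in auto)
  also have "\<dots> = 2 * (\<Sum>a\<in>I. \<Sum>b\<in>I. \<Sum>c\<in>I. lam a * lam b * lam c * K a b * K c b * R a c) + (\<Sum>a\<in>I. lam a * (\<Sum>b\<in>I. lam b * (K a b)\<^sup>2)) * M2"
    unfolding sum_distrib_left sum_distrib_right sum.distrib[symmetric] distrib_left
    by (intro sum.cong refl) (simp add: sum_distrib_left sum_distrib_right sum.distrib algebra_simps power2_eq_square)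
  also have "\<dots> \<le> 2 * (\<Lambda> * (M2 * M1\<^sup>2)) + (\<Lambda> * M2) * M2"
    using cycle_bound[OF ne] M2n by (intro add_mono mult_right_mono weighted_sum_le M2) auto
  finally show ?thesis by (simp add: q_def power2_eq_square mult.assoc)
qed

end

end

text \<open>The size of the Taylor remainder of a gradient whose derivatives are bounded and
  Lipschitz: quadratic for small increments, only linear for large ones.\<close>

definition \<psi> :: "real \<Rightarrow> real" where "\<psi> s = s * min 1 s"

lemma psi_nonneg: "0 \<le> s \<Longrightarrow> 0 \<le> \<psi> s" by (simp add: \<psi>_def)
lemma psi_le: "0 \<le> s \<Longrightarrow> \<psi> s \<le> s" by (simp add: \<psi>_def mult_left_le)
lemma psi_le_sq: "0 \<le> s \<Longrightarrow> \<psi> s \<le> s\<^sup>2" by (simp add: \<psi>_def power2_eq_square mult_left_mono)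
lemma psi_mono: "0 \<le> s \<Longrightarrow> s \<le> r \<Longrightarrow> \<psi> s \<le> \<psi> r" unfolding \<psi>_def by (intro mult_mono) auto
lemma psi_double: "0 \<le> s \<Longrightarrow> \<psi> (2 * s) \<le> 4 * \<psi> s"
proof -
  assume s: "0 \<le> s"
  have "(2 * s) * min 1 (2 * s) \<le> (2 * s) * (2 * min 1 s)"
    using s by (intro mult_left_mono) (auto simp: min_def)
  then show ?thesis by (simp add: \<psi>_def mult_ac)
qed
lemma psi_add: "0 \<le> s \<Longrightarrow> 0 \<le> r \<Longrightarrow> \<psi> (s + r) \<le> 4 * \<psi> s + 4 * \<psi> r"
proof -
  assume s: "0 \<le> s" and r: "0 \<le> r"
  show ?thesis
  proof (cases "s \<le> r")
    case True
    then have "\<psi> (s + r) \<le> \<psi> (2 * r)" using s r by (intro psi_mono) auto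
    then show ?thesis using psi_double[OF r] psi_nonneg[OF s] by linarith
  next
    case False
    then have "\<psi> (s + r) \<le> \<psi> (2 * s)" using s r by (intro psi_mono) auto
    then show ?thesis using psi_double[OF s] psi_nonneg[OF r] by linarith
  qed
qed

section \<open>Bounds for the two error terms\<close>

context indep_poisson
begin

lemma mean_abs_le_sqrt:
  assumes "poly_growth f" shows "mean (\<lambda>n. \<bar>f n\<bar>) \<le> sqrt (mean (\<lambda>n. (f n)\<^sup>2))"
proof (rule real_le_rsqrt)
  define c where "c = mean (\<lambda>n. \<bar>f n\<bar>)"
  note pg = poly_growth_intros assms
  have "0 \<le> mean (\<lambda>n. (\<bar>f n\<bar> - c)\<^sup>2)" by (rule mean_nonneg) simp
  also have "\<dots> = mean (\<lambda>n. (f n)\<^sup>2 - 2 * c * \<bar>f n\<bar> + c\<^sup>2)"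
    by (rule mean_cong) (simp add: power2_eq_square algebra_simps)
  also have "\<dots> = mean (\<lambda>n. (f n)\<^sup>2) - 2 * c * mean (\<lambda>n. \<bar>f n\<bar>) + c\<^sup>2"
    by (simp only: mean_add mean_diff mean_cmult mean_const pg)
  finally show "(mean (\<lambda>n. \<bar>f n\<bar>))\<^sup>2 \<le> mean (\<lambda>n. (f n)\<^sup>2)"
    by (simp add: c_def[symmetric] power2_eq_square)
qed

lemma S_product_mean:
  assumes G: "poly_growth G"
  shows "mean (\<lambda>n. S k a n * G n) = (\<Sum>b\<in>I. lam b * (k a b * mean (\<lambda>n. G (up b n))))"
proof -
  have "mean (\<lambda>n. S k a n * G n) = mean (\<lambda>n. \<Sum>b\<in>I. k a b * (real (n b) * G n))"
    unfolding S_def sum_distrib_right by (simp only: mult.assoc)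
  also have "\<dots> = (\<Sum>b\<in>I. k a b * mean (\<lambda>n. real (n b) * G n))"
    by (simp only: mean_sum mean_cmult poly_growth_intros G)
  also have "\<dots> = (\<Sum>b\<in>I. lam b * (k a b * mean (\<lambda>n. G (up b n))))"
    by (intro sum.cong refl) (simp add: mecke G)
  finally show ?thesis .
qed

context
  fixes K :: "'i \<Rightarrow> 'i \<Rightarrow> real" and \<Lambda> M1 M2 :: real
  assumes K: "kernel K" and \<Lambda>: "\<Lambda> = (\<Sum>a\<in>I. lam a)"
    and M1: "\<And>a. a \<in> I \<Longrightarrow> (\<Sum>b\<in>I. lam b * K a b) \<le> M1"
    and M2: "\<And>a. a \<in> I \<Longrightarrow> (\<Sum>b\<in>I. lam b * (K a b)\<^sup>2) \<le> M2"
    and ne: "I \<noteq> {}"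
begin

text \<open>In centred sums, \<open>T\<close> is half of \<open>Q\<close>, plus a linear functional
  \<open>L\<close>, plus a constant. The coefficients of \<open>L\<close> are at most 3/2 * M1^2, so
  its variance is at most 9/4 * \<Lambda> * M1^4; \<open>variance_Q\<close> does the rest.\<close>

lemma variance_T:
  assumes k: "kernel k" and l: "kernel l"
    and kK: "\<And>a b. a \<in> I \<Longrightarrow> b \<in> I \<Longrightarrow> k a b \<le> K a b" and lK: "\<And>a b. a \<in> I \<Longrightarrow> b \<in> I \<Longrightarrow> l a b \<le> K a b"
  shows "mean (\<lambda>n. (T k l n - mean (T k l))\<^sup>2) \<le> \<Lambda> * M2 * M1\<^sup>2 + \<Lambda> * M2\<^sup>2 + 5 * \<Lambda> * M1 ^ 4"
proof -
  note M1n = M1_nonneg[OF K \<Lambda> M1 M2 ne] and M2n = M2_nonneg[OF K \<Lambda> M1 M2 ne] and \<Lambda>n = \<Lambda>_nonneg[OF K \<Lambda> M1 M2]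
  note ws = weighted_sum_le[OF K \<Lambda> M1 M2]
  note pg = poly_growth_intros poly_growth_Sc poly_growth_Q poly_growth_T
  have mK: "m k a \<le> M1" "0 \<le> m k a" if "a \<in> I" "kernel k" "\<And>a b. a \<in> I \<Longrightarrow> b \<in> I \<Longrightarrow> k a b \<le> K a b" for k a
  proof -
    have "m k a \<le> (\<Sum>b\<in>I. lam b * K a b)"
      unfolding m_def using that by (intro sum_mono) (simp add: mult.commute lam_nonneg mult_left_mono)
    then show "m k a \<le> M1" using M1[OF that(1)] by simp
  qed (rule m_nonneg[OF that(2,1)])
  define c where "c b = (\<Sum>a\<in>I. lam a * (m k a * l a b + 1 / 2 * m l a * k a b))" for b
  have c: "0 \<le> c b" "c b \<le> 3 / 2 * M1\<^sup>2" if b: "b \<in> I" for b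
  proof -
    show "0 \<le> c b" unfolding c_def using b mK k l kK lK
      by (intro sum_nonneg mult_nonneg_nonneg add_nonneg_nonneg lam_nonneg k_nonneg[OF k] k_nonneg[OF l]) auto
    have "c b \<le> (\<Sum>a\<in>I. lam a * (M1 * K b a + 1 / 2 * M1 * K b a))"
      unfolding c_def using b mK k l kK lK M1n
      by (intro sum_mono mult_left_mono add_mono mult_mono lam_nonneg k_nonneg[OF k] k_nonneg[OF l])
         (auto simp: k_sym[OF K, of b])
    also have "\<dots> = 3 / 2 * M1 * (\<Sum>a\<in>I. lam a * K b a)"
      unfolding sum_distrib_left by (intro sum.cong refl) (simp add: field_simps)
    also have "\<dots> \<le> 3 / 2 * M1 * M1" using M1n M1[OF b] by (intro mult_left_mono) auto
    finally show "c b \<le> 3 / 2 * M1\<^sup>2" by (simp add: power2_eq_square)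
  qed
  \<comment> \<open>A kernel that ignores its first argument makes \<open>Sc\<close> an arbitrary
    linear functional, so that \<open>mean_Sc\<close> and \<open>mean_Sc_Sc\<close> give its mean
    and variance; the index is a dummy.\<close>
  define L where "L n = Sc (\<lambda>_. c) undefined n" for n
  have L: "L n = (\<Sum>a\<in>I. lam a * (m k a * Sc l a n + 1 / 2 * m l a * Sc k a n))" for n
  proof -
    have "L n = (\<Sum>b\<in>I. \<Sum>a\<in>I. lam a * (m k a * l a b + 1 / 2 * m l a * k a b) * (real (n b) - lam b))"
      by (simp add: L_def Sc_def c_def sum_distrib_right)
    also have "\<dots> = (\<Sum>a\<in>I. \<Sum>b\<in>I. lam a * (m k a * l a b + 1 / 2 * m l a * k a b) * (real (n b) - lam b))"
      by (rule sum.swap)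
    also have "\<dots> = (\<Sum>a\<in>I. lam a * (m k a * Sc l a n + 1 / 2 * m l a * Sc k a n))"
      unfolding Sc_def by (intro sum.cong refl) (simp only: sum_distrib_left sum.distrib[symmetric] distrib_left distrib_right mult_ac)
    finally show ?thesis .
  qed
  have pL: "poly_growth L" unfolding L_def by (intro pg)
  have T: "T k l n = 1 / 2 * Q k l n + L n + (\<Sum>a\<in>I. lam a * (m k a * m l a))" for n
    unfolding T_def L Q_def sum_distrib_left sum.distrib[symmetric]
    by (intro sum.cong refl) (simp add: S_Sc field_simps)
  have mL: "mean L = 0" unfolding L_def by (simp add: mean_Sc[of "\<lambda>_. c" undefined])
  have mT: "mean (T k l) = 1 / 2 * mean (Q k l) + (\<Sum>a\<in>I. lam a * (m k a * m l a))"
  proof -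
    have "mean (T k l) = mean (\<lambda>n. 1 / 2 * Q k l n + L n + (\<Sum>a\<in>I. lam a * (m k a * m l a)))"
      by (rule mean_cong) (rule T)
    also have "\<dots> = 1 / 2 * mean (Q k l) + mean L + (\<Sum>a\<in>I. lam a * (m k a * m l a))"
      by (simp only: mean_add mean_cmult mean_const pg pL)
    finally show ?thesis by (simp add: mL)
  qed
  have "mean (\<lambda>n. (T k l n - mean (T k l))\<^sup>2) \<le> mean (\<lambda>n. 1 / 2 * (Q k l n - mean (Q k l))\<^sup>2 + 2 * (L n)\<^sup>2)"
  proof (rule mean_mono)
    fix n
    have "T k l n - mean (T k l) = 1 / 2 * (Q k l n - mean (Q k l)) + L n" by (simp add: T mT right_diff_distrib)
    moreover have "(1 / 2 * x + y)\<^sup>2 \<le> 1 / 2 * x\<^sup>2 + 2 * y\<^sup>2" for x y :: real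
      using zero_le_power2[of "1 / 2 * x - y"] by (simp add: power2_eq_square field_simps)
    ultimately show "(T k l n - mean (T k l))\<^sup>2 \<le> 1 / 2 * (Q k l n - mean (Q k l))\<^sup>2 + 2 * (L n)\<^sup>2" by simp
  qed (intro pg pL)+
  also have "\<dots> = 1 / 2 * mean (\<lambda>n. (Q k l n - mean (Q k l))\<^sup>2) + 2 * mean (\<lambda>n. (L n)\<^sup>2)"
    by (simp only: mean_add mean_cmult pg pL)
  also have "\<dots> \<le> 1 / 2 * (2 * (\<Lambda> * (M2 * M1\<^sup>2)) + \<Lambda> * M2\<^sup>2) + 2 * (\<Lambda> * (9 / 4 * M1 ^ 4))"
  proof (intro add_mono mult_left_mono variance_Q[OF K \<Lambda> M1 M2 k l kK lK ne])
    have "mean (\<lambda>n. (L n)\<^sup>2) = (\<Sum>b\<in>I. lam b * (c b * c b))"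
      using mean_Sc_Sc[of "\<lambda>_. c" undefined "\<lambda>_. c" undefined] by (simp add: L_def power2_eq_square mult.assoc)
    also have "\<dots> \<le> \<Lambda> * (3 / 2 * M1\<^sup>2 * (3 / 2 * M1\<^sup>2))"
      using c by (intro ws mult_mono) auto
    finally show "mean (\<lambda>n. (L n)\<^sup>2) \<le> \<Lambda> * (9 / 4 * M1 ^ 4)" by (simp add: power2_eq_square power4_eq_xxxx)
  qed auto
  also have "\<dots> \<le> \<Lambda> * M2 * M1\<^sup>2 + \<Lambda> * M2\<^sup>2 + 5 * \<Lambda> * M1 ^ 4"
    using mult_nonneg_nonneg[OF \<Lambda>n, of "M2\<^sup>2"] mult_nonneg_nonneg[OF \<Lambda>n, of "M1 ^ 4"] by (simp add: algebra_simps)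
  finally show ?thesis .
qed

text \<open>The Mecke formula for the factor \<open>S\<close> adds one kernel value
  \<open>K a b\<close> to the argument of \<psi>, and \<open>psi_add\<close> separates it from the
  rest. Thus large kernel values enter only through K * \<psi> K; elsewhere \<psi> s <= s^2
  suffices. The 5 is 4 from \<open>psi_add\<close> plus 1 from the summand
  \<open>m K a\<close>.\<close>

lemma remainder_bound:
  assumes M3: "\<And>a. a \<in> I \<Longrightarrow> (\<Sum>b\<in>I. lam b * (K a b * \<psi> (K a b))) \<le> M3"
  shows "(\<Sum>a\<in>I. lam a * mean (\<lambda>n. \<psi> (S K a n) * (S K a n + m K a))) \<le> \<Lambda> * (5 * M1 * (M2 + M1\<^sup>2) + 4 * M3)"
proof (rule weighted_sum_le[OF K \<Lambda> M1 M2])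
  fix a assume a: "a \<in> I"
  note M1n = M1_nonneg[OF K \<Lambda> M1 M2 ne] and M2n = M2_nonneg[OF K \<Lambda> M1 M2 ne]
  note Sn = S_nonneg[OF K a]
  have m: "m K a \<le> M1" "0 \<le> m K a"
    using M1[OF a] m_nonneg[OF K a] by (auto simp: m_def mult.commute)
  have pg1: "poly_growth (\<lambda>n. \<psi> (S K a n))"
    by (rule poly_growth_cong[OF poly_growth_S[of K a]]) (simp add: Sn psi_nonneg psi_le)
  note pg = poly_growth_intros poly_growth_S pg1 poly_growth_Sc
  have E2: "mean (\<lambda>n. \<psi> (S K a n)) \<le> M2 + M1\<^sup>2"
  proof -
    have "mean (\<lambda>n. \<psi> (S K a n)) \<le> mean (\<lambda>n. Sc K a n * Sc K a n + (2 * m K a * Sc K a n + (m K a)\<^sup>2))"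
    proof (rule mean_mono)
      fix n have "\<psi> (S K a n) \<le> (S K a n)\<^sup>2" by (rule psi_le_sq[OF Sn])
      then show "\<psi> (S K a n) \<le> Sc K a n * Sc K a n + (2 * m K a * Sc K a n + (m K a)\<^sup>2)"
        by (simp add: S_Sc power2_eq_square algebra_simps)
    qed (intro pg)+
    also have "\<dots> = (\<Sum>b\<in>I. lam b * K a b * K a b) + (2 * m K a * 0 + (m K a)\<^sup>2)"
      by (simp only: mean_add mean_cmult mean_const mean_Sc mean_Sc_Sc pg)
    also have "\<dots> \<le> M2 + M1\<^sup>2"
      using M2[OF a] m by (intro add_mono) (auto simp: power2_eq_square mult.assoc intro!: mult_mono)
    finally show ?thesis .
  qed
  have "mean (\<lambda>n. S K a n * \<psi> (S K a n)) = (\<Sum>b\<in>I. lam b * (K a b * mean (\<lambda>n. \<psi> (S K a (up b n)))))"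
    by (rule S_product_mean[OF pg1])
  also have "\<dots> \<le> (\<Sum>b\<in>I. lam b * (K a b * (4 * (M2 + M1\<^sup>2) + 4 * \<psi> (K a b))))"
  proof (intro sum_mono mult_left_mono lam_nonneg k_nonneg[OF K a])
    fix b assume b: "b \<in> I"
    have "mean (\<lambda>n. \<psi> (S K a (up b n))) \<le> mean (\<lambda>n. 4 * \<psi> (S K a n) + 4 * \<psi> (K a b))"
      using b by (intro mean_mono poly_growth_up[OF b pg1] pg) (auto simp: S_up intro!: psi_add Sn k_nonneg[OF K a])
    also have "\<dots> = 4 * mean (\<lambda>n. \<psi> (S K a n)) + 4 * \<psi> (K a b)"
      by (simp only: mean_add mean_cmult mean_const pg)
    finally show "mean (\<lambda>n. \<psi> (S K a (up b n))) \<le> 4 * (M2 + M1\<^sup>2) + 4 * \<psi> (K a b)" using E2 by simp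
  qed
  also have "\<dots> = (\<Sum>b\<in>I. lam b * K a b) * (4 * (M2 + M1\<^sup>2)) + 4 * (\<Sum>b\<in>I. lam b * (K a b * \<psi> (K a b)))"
    unfolding sum_distrib_left sum_distrib_right sum.distrib[symmetric] by (intro sum.cong refl) (simp add: algebra_simps)
  also have "\<dots> \<le> M1 * (4 * (M2 + M1\<^sup>2)) + 4 * M3"
    using M1[OF a] M3[OF a] M2n by (intro add_mono mult_right_mono) auto
  finally have 1: "mean (\<lambda>n. S K a n * \<psi> (S K a n)) \<le> M1 * (4 * (M2 + M1\<^sup>2)) + 4 * M3" .
  have "mean (\<lambda>n. \<psi> (S K a n) * (S K a n + m K a)) = mean (\<lambda>n. S K a n * \<psi> (S K a n) + m K a * \<psi> (S K a n))"
    by (rule mean_cong) (simp add: algebra_simps)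
  also have "\<dots> = mean (\<lambda>n. S K a n * \<psi> (S K a n)) + m K a * mean (\<lambda>n. \<psi> (S K a n))"
    by (simp only: mean_add mean_cmult pg)
  also have "\<dots> \<le> (M1 * (4 * (M2 + M1\<^sup>2)) + 4 * M3) + M1 * (M2 + M1\<^sup>2)"
    using m E2 M1n M2n by (intro add_mono 1 mult_mono mean_nonneg psi_nonneg Sn) auto
  finally show "mean (\<lambda>n. \<psi> (S K a n) * (S K a n + m K a)) \<le> 5 * M1 * (M2 + M1\<^sup>2) + 4 * M3"
    by (simp add: algebra_simps)
qed

end

end

section \<open>Interpolation between Poisson functionals and Gaussian vectors\<close>

text \<open>Differentiation under the expectation is replaced by the fundamental theorem of calculus
  for each \<omega> followed by Fubini, for which an integrable bound on the derivative over [a, b]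
  is enough.\<close>

lemma expectation_mvt:
  fixes f f' :: "real \<Rightarrow> 'a \<Rightarrow> real"
  assumes P: "prob_space P" and ab: "a \<le> b"
    and deriv: "\<And>u \<omega>. ((\<lambda>u. f u \<omega>) has_real_derivative f' u \<omega>) (at u)"
    and cont: "\<And>\<omega>. continuous_on UNIV (\<lambda>u. f' u \<omega>)"
    and meas[measurable]: "(\<lambda>(u, \<omega>). f' u \<omega>) \<in> borel_measurable (borel \<Otimes>\<^sub>M P)"
    and bd: "\<And>u \<omega>. a \<le> u \<Longrightarrow> u \<le> b \<Longrightarrow> \<bar>f' u \<omega>\<bar> \<le> B \<omega>" and B: "integrable P B"
    and fa: "integrable P (f a)" and fb: "integrable P (f b)"
    and K: "\<And>u. a \<le> u \<Longrightarrow> u \<le> b \<Longrightarrow> \<bar>\<integral>\<omega>. f' u \<omega> \<partial>P\<bar> \<le> K"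
  shows "\<bar>(\<integral>\<omega>. f b \<omega> \<partial>P) - (\<integral>\<omega>. f a \<omega> \<partial>P)\<bar> \<le> K * (b - a)"
proof -
  interpret P: prob_space P by fact
  interpret LP: pair_sigma_finite lborel P ..
  have [measurable]: "(\<lambda>(u, \<omega>). f' u \<omega>) \<in> borel_measurable (lborel \<Otimes>\<^sub>M P)"
    using meas by (simp cong: measurable_cong_sets sets_pair_measure_cong)
  have Bm[measurable]: "B \<in> borel_measurable P" using B by auto
  have ftc: "f b \<omega> - f a \<omega> = (\<integral>u. f' u \<omega> * indicator {a..b} u \<partial>lborel)" for \<omega>
    using integral_FTC_Icc_real[OF ab, of "\<lambda>u. f u \<omega>" "\<lambda>u. f' u \<omega>"] deriv cont
    by (simp add: continuous_on_eq_continuous_at)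
  have intI: "integrable lborel (indicat_real {a..b})"
    by (intro integrable_real_indicator) (auto simp: emeasure_lborel_Icc_eq)
  have intB: "integrable (lborel \<Otimes>\<^sub>M P) (\<lambda>(u, \<omega>). indicator {a..b} u * B \<omega>)"
  proof (rule LP.Fubini_integrable)
    show "integrable lborel (\<lambda>u. \<integral>\<omega>. norm (case (u, \<omega>) of (u, \<omega>) \<Rightarrow> indicator {a..b} u * B \<omega>) \<partial>P)"
      using intI by (simp add: abs_mult)
  qed (use B in auto)
  have int: "integrable (lborel \<Otimes>\<^sub>M P) (\<lambda>(u, \<omega>). f' u \<omega> * indicator {a..b} u)"
    by (rule Bochner_Integration.integrable_bound[OF intB])
       (auto simp: abs_mult indicator_def split: prod.splits intro!: AE_I2 order_trans[OF bd])
  have "(\<integral>\<omega>. f b \<omega> \<partial>P) - (\<integral>\<omega>. f a \<omega> \<partial>P) = (\<integral>\<omega>. f b \<omega> - f a \<omega> \<partial>P)" using fa fb by simp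
  also have "\<dots> = (\<integral>\<omega>. (\<integral>u. f' u \<omega> * indicator {a..b} u \<partial>lborel) \<partial>P)" by (simp only: ftc)
  also have "\<dots> = (\<integral>u. (\<integral>\<omega>. f' u \<omega> * indicator {a..b} u \<partial>P) \<partial>lborel)"
    by (rule LP.Fubini_integral[OF int])
  finally have eq: "(\<integral>\<omega>. f b \<omega> \<partial>P) - (\<integral>\<omega>. f a \<omega> \<partial>P) = (\<integral>u. (\<integral>\<omega>. f' u \<omega> \<partial>P) * indicator {a..b} u \<partial>lborel)"
    by simp
  have "\<bar>\<integral>u. (\<integral>\<omega>. f' u \<omega> \<partial>P) * indicator {a..b} u \<partial>lborel\<bar> \<le> (\<integral>u. \<bar>(\<integral>\<omega>. f' u \<omega> \<partial>P) * indicator {a..b} u\<bar> \<partial>lborel)"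
    by (rule integral_abs_bound)
  also have "\<dots> \<le> (\<integral>u. K * indicator {a..b} u \<partial>lborel)"
  proof (rule integral_mono')
    fix u show "\<bar>(\<integral>\<omega>. f' u \<omega> \<partial>P) * indicator {a..b} u\<bar> \<le> K * indicator {a..b} u"
      using K[of u] by (auto simp: abs_mult indicator_def)
    show "0 \<le> K * indicator {a..b} u" using K[of u] by (auto simp: indicator_def)
  qed (use intI in simp)
  also have "\<dots> = K * (b - a)" using ab by simp
  finally show ?thesis using eq by simp
qed

text \<open>\<open>h1\<close> and \<open>h2\<close> are the first and second order partial derivatives of \<open>h\<close>. The smoothing
  hypothesis replaces a bound on the third derivatives: for \<open>d2\<close> it comes from the
  Gaussian noise alone, which is why \<open>V\<close> then has to consist of nondegenerate directions.\<close>

locale smooth_test = centred_gaussian_vector N X C for N :: "'v measure" and X :: "'v \<Rightarrow> real ^ 'm::finite" and C +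
  fixes h :: "real ^ 'm \<Rightarrow> real" and h1 :: "'m \<Rightarrow> real ^ 'm \<Rightarrow> real" and h2 :: "'m \<Rightarrow> 'm \<Rightarrow> real ^ 'm \<Rightarrow> real"
    and V :: "(real ^ 'm) set" and L :: real
  assumes D1: "\<And>x. (h has_derivative (\<lambda>v. \<Sum>i\<in>UNIV. v $ i * h1 i x)) (at x)"
    and D2: "\<And>i x. (h1 i has_derivative (\<lambda>v. \<Sum>j\<in>UNIV. v $ j * h2 i j x)) (at x)"
    and h2_cont: "\<And>i j. continuous_on UNIV (h2 i j)"
    and h2_bound: "\<And>i j x. \<bar>h2 i j x\<bar> \<le> 1"
    and V_scale: "\<And>v u. v \<in> V \<Longrightarrow> 0 \<le> u \<Longrightarrow> u *\<^sub>R v \<in> V"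
    and L_nonneg: "0 \<le> L"
    and smooth: "\<And>v y c i j. v \<in> V \<Longrightarrow> 0 < c \<Longrightarrow> c \<le> 1 \<Longrightarrow>
       \<bar>expectation (\<lambda>\<omega>. h2 i j (y + v + c *\<^sub>R X \<omega>)) - expectation (\<lambda>\<omega>. h2 i j (y + c *\<^sub>R X \<omega>))\<bar> \<le> L * norm v / c"
begin

lemma h_cont: "continuous_on UNIV h" and h1_cont: "continuous_on UNIV (h1 i)"
  using has_derivative_continuous[OF D1] has_derivative_continuous[OF D2] by (auto simp: continuous_on_eq_continuous_at)

lemma h_measurable[measurable]: "h \<in> borel_measurable borel" "h1 i \<in> borel_measurable borel" "h2 i j \<in> borel_measurable borel"
  using h_cont h1_cont h2_cont by (auto intro: borel_measurable_continuous_onI)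

lemma h1_line: "((\<lambda>u. h1 i (y + u *\<^sub>R v)) has_real_derivative (\<Sum>j\<in>UNIV. v $ j * h2 i j (y + u *\<^sub>R v))) (at u)"
proof -
  have "((\<lambda>u. h1 i (y + u *\<^sub>R v)) has_derivative (\<lambda>t. \<Sum>j\<in>UNIV. (t *\<^sub>R v) $ j * h2 i j (y + u *\<^sub>R v))) (at u)"
    by (rule has_derivative_compose[OF _ D2]) (auto intro!: derivative_eq_intros)
  then show ?thesis unfolding has_field_derivative_def
    by (rule has_derivative_eq_rhs) (auto simp: fun_eq_iff sum_distrib_left mult_ac)
qed

definition d :: real where "d = real CARD('m)"

lemma sum_abs_le: "(\<Sum>j\<in>UNIV. \<bar>v $ j\<bar>) \<le> d * norm v" for v :: "real ^ 'm"
  using sum_bounded_above[of UNIV "\<lambda>j. \<bar>v $ j\<bar>" "norm v"] component_le_norm_cart[of v] by (simp add: d_def)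

lemma h1_growth: "\<exists>A B. A \<ge> 0 \<and> B \<ge> 0 \<and> (\<forall>i x. \<bar>h1 i x\<bar> \<le> A + B * norm x)"
proof (intro exI conjI allI)
  fix i x
  have "norm (h1 i x - h1 i 0) \<le> d * norm (x - 0)"
  proof (rule differentiable_bound[of UNIV])
    fix y
    have "\<bar>\<Sum>j\<in>UNIV. v $ j * h2 i j y\<bar> \<le> (\<Sum>j\<in>UNIV. \<bar>v $ j\<bar>)" for v
      by (intro sum_abs[THEN order_trans] sum_mono) (simp add: abs_mult h2_bound mult_left_le)
    then show "onorm (\<lambda>v. \<Sum>j\<in>UNIV. v $ j * h2 i j y) \<le> d"
      by (intro onorm_le) (auto intro: order_trans[OF _ sum_abs_le])
  qed (use D2 in auto)
  then have "\<bar>h1 i x\<bar> \<le> \<bar>h1 i 0\<bar> + d * norm x" by simp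
  also have "\<bar>h1 i 0\<bar> \<le> (\<Sum>i\<in>UNIV. \<bar>h1 i 0\<bar>)" by (rule member_le_sum) auto
  finally show "\<bar>h1 i x\<bar> \<le> (\<Sum>i\<in>UNIV. \<bar>h1 i 0\<bar>) + d * norm x" by simp
qed (auto simp: d_def sum_nonneg)

lemma h_growth: "\<exists>A. A \<ge> 0 \<and> (\<forall>x. \<bar>h x\<bar> \<le> A * (1 + (norm x)\<^sup>2))"
proof -
  obtain A B where AB: "A \<ge> 0" "B \<ge> 0" "\<And>i x. \<bar>h1 i x\<bar> \<le> A + B * norm x" using h1_growth by blast
  have "\<bar>h x\<bar> \<le> (\<bar>h 0\<bar> + d * A + d * B) * (1 + (norm x)\<^sup>2)" for x
  proof -
    have "norm (h x - h 0) \<le> (d * (A + B * norm x)) * norm (x - 0)"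
    proof (rule differentiable_bound[of "cball 0 (norm x)"])
      fix y :: "real ^ 'm" assume y: "y \<in> cball 0 (norm x)"
      have b: "\<bar>h1 i y\<bar> \<le> A + B * norm x" for i
        using AB(3)[of i y] mult_left_mono[OF _ AB(2), of "norm y" "norm x"] y by auto
      have "\<bar>\<Sum>i\<in>UNIV. v $ i * h1 i y\<bar> \<le> (\<Sum>i\<in>UNIV. \<bar>v $ i\<bar> * (A + B * norm x))" for v
        by (intro sum_abs[THEN order_trans] sum_mono) (simp add: abs_mult b mult_left_mono)
      also have "\<dots> v \<le> (d * (A + B * norm x)) * norm v" for v
        using mult_right_mono[OF sum_abs_le[of v], of "A + B * norm x"] AB
        by (simp add: sum_distrib_right[symmetric] mult_ac)
      finally show "onorm (\<lambda>v. \<Sum>i\<in>UNIV. v $ i * h1 i y) \<le> d * (A + B * norm x)"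
        by (intro onorm_le) auto
    qed (auto intro: has_derivative_at_withinI[OF D1])
    then have "\<bar>h x\<bar> \<le> \<bar>h 0\<bar> + d * A * norm x + d * B * (norm x)\<^sup>2"
      by (simp add: algebra_simps power2_eq_square)
    also have "\<dots> \<le> \<bar>h 0\<bar> * (1 + (norm x)\<^sup>2) + d * A * (1 + (norm x)\<^sup>2) + d * B * (1 + (norm x)\<^sup>2)"
    proof (intro add_mono mult_left_mono)
      show "norm x \<le> 1 + (norm x)\<^sup>2" using sum_squares_bound[of "norm x" 1] by (simp; smt (verit) norm_ge_zero)
      show "\<bar>h 0\<bar> \<le> \<bar>h 0\<bar> * (1 + (norm x)\<^sup>2)" by (simp add: algebra_simps)
    qed (use AB in \<open>auto simp: d_def\<close>)
    finally show ?thesis by (simp add: algebra_simps)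
  qed
  then show ?thesis using AB by (intro exI[of _ "\<bar>h 0\<bar> + d * A + d * B"]) (auto simp: d_def)
qed

definition g1 :: "real \<Rightarrow> 'm \<Rightarrow> real ^ 'm \<Rightarrow> real" where "g1 c i y = expectation (\<lambda>\<omega>. h1 i (y + c *\<^sub>R X \<omega>))"
definition g2 :: "real \<Rightarrow> 'm \<Rightarrow> 'm \<Rightarrow> real ^ 'm \<Rightarrow> real" where "g2 c i j y = expectation (\<lambda>\<omega>. h2 i j (y + c *\<^sub>R X \<omega>))"

lemma g2_bound: "\<bar>g2 c i j y\<bar> \<le> 1"
proof -
  have "\<bar>g2 c i j y\<bar> \<le> expectation (\<lambda>\<omega>. \<bar>h2 i j (y + c *\<^sub>R X \<omega>)\<bar>)" unfolding g2_def by (rule integral_abs_bound)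
  also have "\<dots> \<le> expectation (\<lambda>_. 1)" by (rule integral_mono') (use h2_bound in auto)
  finally show ?thesis by (simp add: prob_space)
qed

lemma integrable_h2: "integrable N (\<lambda>\<omega>. h2 i j (y + c *\<^sub>R X \<omega>))"
  using h2_bound by (intro integrable_const_bound[where B=1]) auto

lemma integrable_h1: "integrable N (\<lambda>\<omega>. h1 i (y + c *\<^sub>R X \<omega>))"
proof -
  obtain A B where AB: "A \<ge> 0" "B \<ge> 0" "\<And>i x. \<bar>h1 i x\<bar> \<le> A + B * norm x" using h1_growth by blast
  show ?thesis
  proof (rule Bochner_Integration.integrable_bound[where f="\<lambda>\<omega>. A + B * (norm y + \<bar>c\<bar> * norm (X \<omega>))"])
    show "AE \<omega> in N. norm (h1 i (y + c *\<^sub>R X \<omega>)) \<le> norm (A + B * (norm y + \<bar>c\<bar> * norm (X \<omega>)))"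
    proof (intro AE_I2)
      fix \<omega>
      have "B * norm (y + c *\<^sub>R X \<omega>) \<le> B * (norm y + \<bar>c\<bar> * norm (X \<omega>))"
        using norm_triangle_ineq[of y "c *\<^sub>R X \<omega>"] AB by (intro mult_left_mono) auto
      then show "norm (h1 i (y + c *\<^sub>R X \<omega>)) \<le> norm (A + B * (norm y + \<bar>c\<bar> * norm (X \<omega>)))"
        using AB(3)[of i "y + c *\<^sub>R X \<omega>"] by auto
    qed
  qed (use integrable_norm_X in auto)
qed

text \<open>The difference of two second derivatives, averaged over the noise, is at most 2, and at
  most L * |v| / c by smoothing. The factor c in front absorbs the 1/c, so the bound is uniform down
  to c = 0.\<close>

lemma taylor_bound:
  assumes v: "v \<in> V" and c: "0 \<le> c" "c \<le> 1" and s: "0 \<le> s" "s \<le> 1"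
  shows "\<bar>c * (g1 c i (y + s *\<^sub>R v) - g1 c i y) - c * s * (\<Sum>j\<in>UNIV. v $ j * g2 c i j y)\<bar>
    \<le> (2 + L) * ((\<Sum>j\<in>UNIV. \<bar>v $ j\<bar>) * min 1 (norm v))"
proof (cases "c = 0")
  case True
  then show ?thesis using L_nonneg by (auto intro!: mult_nonneg_nonneg sum_nonneg)
next
  case False
  then have cp: "c > 0" using c by simp
  define D where "D = (\<Sum>j\<in>UNIV. \<bar>v $ j\<bar>)"
  have D0: "D \<ge> 0" by (simp add: D_def sum_nonneg)
  \<comment> \<open>With the linear term subtracted, the derivative in u is a difference of second
    derivatives at two points, to which both bounds apply.\<close>
  define f where "f u \<omega> = h1 i ((y + c *\<^sub>R X \<omega>) + u *\<^sub>R v) - u * (\<Sum>j\<in>UNIV. v $ j * h2 i j (y + c *\<^sub>R X \<omega>))" for u \<omega>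
  define f' where "f' u \<omega> = (\<Sum>j\<in>UNIV. v $ j * h2 i j ((y + c *\<^sub>R X \<omega>) + u *\<^sub>R v)) - (\<Sum>j\<in>UNIV. v $ j * h2 i j (y + c *\<^sub>R X \<omega>))" for u \<omega>
  have sw: "(y + c *\<^sub>R X \<omega>) + u *\<^sub>R v = (y + u *\<^sub>R v) + c *\<^sub>R X \<omega>" for u \<omega> by (simp add: add_ac)
  have intf: "integrable N (f u)" for u
    unfolding f_def sw by (intro Bochner_Integration.integrable_diff integrable_mult_right integrable_h1 Bochner_Integration.integrable_sum integrable_h2)
  have Ef: "expectation (f u) = g1 c i (y + u *\<^sub>R v) - u * (\<Sum>j\<in>UNIV. v $ j * g2 c i j y)" for u
    unfolding f_def sw using integrable_h1 integrable_h2 by (simp add: g1_def g2_def)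
  have "\<bar>expectation (f s) - expectation (f 0)\<bar> \<le> (D * min 2 (L * norm v / c)) * (s - 0)"
  proof (rule expectation_mvt[where f'=f' and B="\<lambda>_. 2 * D"])
    show "prob_space N" by unfold_locales
    show "((\<lambda>u. f u \<omega>) has_real_derivative f' u \<omega>) (at u)" for u \<omega>
      unfolding f_def f'_def by (intro DERIV_diff h1_line) (auto intro!: derivative_eq_intros)
    have "continuous_on UNIV (\<lambda>u. h2 i j (y + c *\<^sub>R X \<omega> + u *\<^sub>R v))" for j \<omega>
      by (intro continuous_on_compose2[OF h2_cont] continuous_intros) auto
    then show "continuous_on UNIV (\<lambda>u. f' u \<omega>)" for \<omega>
      unfolding f'_def by (intro continuous_intros)
    show "(\<lambda>(u, \<omega>). f' u \<omega>) \<in> borel_measurable (borel \<Otimes>\<^sub>M N)" unfolding f'_def by measurable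
    show "\<bar>f' u \<omega>\<bar> \<le> 2 * D" for u \<omega>
    proof -
      have "\<bar>\<Sum>j\<in>UNIV. v $ j * h2 i j z\<bar> \<le> D" for z
        unfolding D_def by (intro sum_abs[THEN order_trans] sum_mono) (simp add: abs_mult h2_bound mult_left_le)
      from this[of "(y + c *\<^sub>R X \<omega>) + u *\<^sub>R v"] this[of "y + c *\<^sub>R X \<omega>"] show ?thesis unfolding f'_def by linarith
    qed
    fix u assume u: "0 \<le> u" "u \<le> s"
    have "expectation (f' u) = (\<Sum>j\<in>UNIV. v $ j * (g2 c i j (y + u *\<^sub>R v) - g2 c i j y))"
      unfolding f'_def sw using integrable_h2 by (simp add: g2_def sum_subtractf right_diff_distrib)
    also have "\<bar>\<dots>\<bar> \<le> (\<Sum>j\<in>UNIV. \<bar>v $ j\<bar> * min 2 (L * norm v / c))"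
    proof (intro sum_abs[THEN order_trans] sum_mono)
      fix j
      have "\<bar>g2 c i j (y + u *\<^sub>R v) - g2 c i j y\<bar> \<le> L * norm (u *\<^sub>R v) / c"
        unfolding g2_def by (rule smooth[OF V_scale[OF v u(1)] cp c(2)])
      also have "\<dots> \<le> L * norm v / c"
        using u s L_nonneg cp by (intro divide_right_mono mult_left_mono) (auto simp: mult_left_le_one_le)
      finally have "\<bar>g2 c i j (y + u *\<^sub>R v) - g2 c i j y\<bar> \<le> min 2 (L * norm v / c)"
        using g2_bound[of c i j "y + u *\<^sub>R v"] g2_bound[of c i j y] by linarith
      then show "\<bar>v $ j * (g2 c i j (y + u *\<^sub>R v) - g2 c i j y)\<bar> \<le> \<bar>v $ j\<bar> * min 2 (L * norm v / c)"
        by (simp add: abs_mult mult_left_mono)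
    qed
    finally show "\<bar>expectation (f' u)\<bar> \<le> D * min 2 (L * norm v / c)"
      by (simp add: D_def sum_distrib_right)
  qed (use s intf in auto)
  then have 1: "\<bar>g1 c i (y + s *\<^sub>R v) - s * (\<Sum>j\<in>UNIV. v $ j * g2 c i j y) - g1 c i y\<bar> \<le> D * min 2 (L * norm v / c) * s"
    by (simp add: Ef)
  have "\<bar>c * (g1 c i (y + s *\<^sub>R v) - g1 c i y) - c * s * (\<Sum>j\<in>UNIV. v $ j * g2 c i j y)\<bar>
      = c * \<bar>g1 c i (y + s *\<^sub>R v) - s * (\<Sum>j\<in>UNIV. v $ j * g2 c i j y) - g1 c i y\<bar>"
  proof -
    have "c * (A - B) - c * s * Z = c * (A - s * Z - B)" for A B Z :: real by (simp add: algebra_simps)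
    then show ?thesis using cp by (simp add: abs_mult)
  qed
  also have "\<dots> \<le> c * (D * min 2 (L * norm v / c) * s)" using 1 cp by (intro mult_left_mono) auto
  also have "\<dots> \<le> c * (D * min 2 (L * norm v / c) * 1)"
    using s cp D0 L_nonneg by (intro mult_left_mono mult_nonneg_nonneg) auto
  also have "\<dots> = D * (c * min 2 (L * norm v / c))" by simp
  also have "\<dots> \<le> D * ((2 + L) * min 1 (norm v))"
  proof (intro mult_left_mono D0)
    have "c * min 2 (L * norm v / c) = min (c * 2) (L * norm v)"
      using cp by (simp add: min_mult_distrib_left)
    also have "\<dots> \<le> (2 + L) * min 1 (norm v)"
      using c L_nonneg by (auto simp: min_def algebra_simps intro: order_trans)
    finally show "c * min 2 (L * norm v / c) \<le> (2 + L) * min 1 (norm v)" .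
  qed
  finally show ?thesis by (simp add: D_def mult_ac)
qed

text \<open>Integration by parts in the direction of column i of \<open>C\<close>, which by symmetry
  is row i; the factor c is the inner derivative.\<close>

lemma gaussian_term:
  "expectation (\<lambda>\<omega>. X \<omega> $ i * h1 i (y + c *\<^sub>R X \<omega>)) = c * (\<Sum>j\<in>UNIV. C $ i $ j * g2 c i j y)"
proof -
  obtain A B where AB: "A \<ge> 0" "B \<ge> 0" "\<And>i x. \<bar>h1 i x\<bar> \<le> A + B * norm x" using h1_growth by blast
  define v where "v = C *v axis i 1"
  have vj: "v $ j = C $ i $ j" for j
  proof -
    have "v $ j = axis j 1 \<bullet> (C *v axis i 1)" by (simp add: v_def inner_axis')
    also have "\<dots> = axis i 1 \<bullet> (C *v axis j 1)" by (rule cov_symmetric)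
    also have "\<dots> = C $ i $ j" by (simp add: inner_axis' matrix_vector_mult_basis column_def)
    finally show ?thesis .
  qed
  define Df where "Df x = c * (\<Sum>j\<in>UNIV. v $ j * h2 i j (y + c *\<^sub>R x))" for x
  have "expectation (\<lambda>\<omega>. (axis i 1 \<bullet> X \<omega>) * h1 i (y + c *\<^sub>R X \<omega>)) = expectation (\<lambda>\<omega>. Df (X \<omega>))"
  proof (rule gaussian_integration_by_parts[OF v_def, where A="A + B * norm y" and B="B * \<bar>c\<bar>" and D="\<bar>c\<bar> * (\<Sum>j\<in>UNIV. \<bar>v $ j\<bar>)"])
    show "(\<lambda>x. h1 i (y + c *\<^sub>R x)) \<in> borel_measurable borel" "Df \<in> borel_measurable borel"
      unfolding Df_def by measurable
    fix x
    have "B * norm (y + c *\<^sub>R x) \<le> B * (norm y + \<bar>c\<bar> * norm x)"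
      using norm_triangle_ineq[of y "c *\<^sub>R x"] AB by (intro mult_left_mono) auto
    then show "\<bar>h1 i (y + c *\<^sub>R x)\<bar> \<le> A + B * norm y + B * \<bar>c\<bar> * norm x"
      using AB(3)[of i "y + c *\<^sub>R x"] by (simp add: algebra_simps)
    show "\<bar>Df x\<bar> \<le> \<bar>c\<bar> * (\<Sum>j\<in>UNIV. \<bar>v $ j\<bar>)"
      unfolding Df_def abs_mult
      by (intro mult_left_mono sum_abs[THEN order_trans] sum_mono) (auto simp: abs_mult h2_bound mult_left_le)
    have "((\<lambda>r. h1 i ((y + c *\<^sub>R x) + r *\<^sub>R (c *\<^sub>R v))) has_real_derivative (\<Sum>j\<in>UNIV. (c *\<^sub>R v) $ j * h2 i j ((y + c *\<^sub>R x) + 0 *\<^sub>R (c *\<^sub>R v)))) (at 0)"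
      by (rule h1_line)
    then show "((\<lambda>r. h1 i (y + c *\<^sub>R (x + r *\<^sub>R v))) has_real_derivative Df x) (at 0)"
      by (simp add: Df_def sum_distrib_left mult_ac scaleR_add_right add_ac)
    have "continuous_on UNIV (\<lambda>r. h2 i j (y + c *\<^sub>R (x + r *\<^sub>R v)))" for j
      by (intro continuous_on_compose2[OF h2_cont] continuous_intros) auto
    then show "continuous_on UNIV (\<lambda>r. Df (x + r *\<^sub>R v))" unfolding Df_def by (intro continuous_intros)
  qed
  also have "\<dots> = c * (\<Sum>j\<in>UNIV. v $ j * g2 c i j y)"
    unfolding Df_def g2_def using integrable_h2 by simp
  finally show ?thesis by (simp add: inner_axis' vj)
qed


lemma X_nth_measurable[measurable]: "(\<lambda>\<omega>. X \<omega> $ i) \<in> borel_measurable N"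
proof -
  have "X \<omega> $ i = axis i 1 \<bullet> X \<omega>" for \<omega> by (simp add: inner_axis')
  then show ?thesis by simp
qed

lemma integrable_X_h1: "integrable N (\<lambda>\<omega>. X \<omega> $ i * h1 i (y + c *\<^sub>R X \<omega>))"
proof -
  obtain A B where AB: "A \<ge> 0" "B \<ge> 0" "\<And>i x. \<bar>h1 i x\<bar> \<le> A + B * norm x" using h1_growth by blast
  show ?thesis
  proof (rule Bochner_Integration.integrable_bound[where f="\<lambda>\<omega>. (A + B * norm y) * norm (X \<omega>) + B * \<bar>c\<bar> * (norm (X \<omega>))\<^sup>2"])
    show "AE \<omega> in N. norm (X \<omega> $ i * h1 i (y + c *\<^sub>R X \<omega>)) \<le> norm ((A + B * norm y) * norm (X \<omega>) + B * \<bar>c\<bar> * (norm (X \<omega>))\<^sup>2)"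
    proof (intro AE_I2)
      fix \<omega>
      have "B * norm (y + c *\<^sub>R X \<omega>) \<le> B * (norm y + \<bar>c\<bar> * norm (X \<omega>))"
        using norm_triangle_ineq[of y "c *\<^sub>R X \<omega>"] AB by (intro mult_left_mono) auto
      then have "norm (X \<omega> $ i * h1 i (y + c *\<^sub>R X \<omega>)) \<le> norm (X \<omega>) * (A + B * (norm y + \<bar>c\<bar> * norm (X \<omega>)))"
        using AB(3)[of i "y + c *\<^sub>R X \<omega>"] component_le_norm_cart[of "X \<omega>" i] unfolding norm_mult by (intro mult_mono) auto
      also have "\<dots> = (A + B * norm y) * norm (X \<omega>) + B * \<bar>c\<bar> * (norm (X \<omega>))\<^sup>2"
        by (simp add: algebra_simps power2_eq_square)
      finally show "norm (X \<omega> $ i * h1 i (y + c *\<^sub>R X \<omega>)) \<le> norm ((A + B * norm y) * norm (X \<omega>) + B * \<bar>c\<bar> * (norm (X \<omega>))\<^sup>2)"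
        by simp
    qed
    show "(\<lambda>\<omega>. X \<omega> $ i * h1 i (y + c *\<^sub>R X \<omega>)) \<in> borel_measurable N" by measurable
  qed (use integrable_norm_X integrable_norm_X_sq in auto)
qed

lemma g1_growth: "\<exists>A B. A \<ge> 0 \<and> B \<ge> 0 \<and> (\<forall>y. \<bar>g1 c i y\<bar> \<le> A + B * norm y)"
proof -
  obtain A B where AB: "A \<ge> 0" "B \<ge> 0" "\<And>i x. \<bar>h1 i x\<bar> \<le> A + B * norm x" using h1_growth by blast
  define A' where "A' = A + B * \<bar>c\<bar> * expectation (\<lambda>\<omega>. norm (X \<omega>))"
  have "\<bar>g1 c i y\<bar> \<le> A' + B * norm y" for y
  proof -
    have "\<bar>g1 c i y\<bar> \<le> expectation (\<lambda>\<omega>. \<bar>h1 i (y + c *\<^sub>R X \<omega>)\<bar>)" unfolding g1_def by (rule integral_abs_bound)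
    also have "\<dots> \<le> expectation (\<lambda>\<omega>. (A + B * norm y) + B * \<bar>c\<bar> * norm (X \<omega>))"
    proof (rule integral_mono')
      fix \<omega>
      have "B * norm (y + c *\<^sub>R X \<omega>) \<le> B * (norm y + \<bar>c\<bar> * norm (X \<omega>))"
        using norm_triangle_ineq[of y "c *\<^sub>R X \<omega>"] AB by (intro mult_left_mono) auto
      then show "\<bar>h1 i (y + c *\<^sub>R X \<omega>)\<bar> \<le> (A + B * norm y) + B * \<bar>c\<bar> * norm (X \<omega>)"
        using AB(3)[of i "y + c *\<^sub>R X \<omega>"] by (simp add: algebra_simps)
      show "0 \<le> (A + B * norm y) + B * \<bar>c\<bar> * norm (X \<omega>)" using AB by auto
    qed (use integrable_norm_X in simp)
    also have "\<dots> = A' + B * norm y"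
      using integrable_norm_X by (simp add: A'_def prob_space)
    finally show ?thesis .
  qed
  moreover have "A' \<ge> 0" unfolding A'_def using AB by simp
  ultimately show ?thesis using AB by blast
qed

end

lemma (in pair_prob_space) integrable_fst_comp:
  fixes u :: "'a \<Rightarrow> real"
  assumes [measurable]: "integrable M1 u" shows "integrable (M1 \<Otimes>\<^sub>M M2) (\<lambda>z. u (fst z))"
  by (rule Fubini_integrable) (use assms in \<open>auto simp: M2.prob_space\<close>)

lemma (in pair_prob_space) integrable_snd_comp:
  fixes u :: "'b \<Rightarrow> real"
  assumes [measurable]: "integrable M2 u" shows "integrable (M1 \<Otimes>\<^sub>M M2) (\<lambda>z. u (snd z))"
  by (rule Fubini_integrable) (use assms in \<open>auto simp: M2.prob_space\<close>)

section \<open>Interpolation between the Poisson and the Gaussian side\<close>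

locale comparison = T: smooth_test N X C h h1 h2 V L + P: indep_poisson M I cnt lam
  for N :: "'v measure" and X :: "'v \<Rightarrow> real ^ 'm::finite" and C h h1 h2 V L
    and M :: "'w measure" and I :: "'i set" and cnt lam +
  fixes k :: "'m \<Rightarrow> 'i \<Rightarrow> 'i \<Rightarrow> real"
  assumes kernels: "\<And>i. P.kernel (k i)"
    and S_in_V: "\<And>a n. a \<in> I \<Longrightarrow> (\<chi> i. P.S (k i) a n) \<in> V"
begin

definition Fc :: "('i \<Rightarrow> nat) \<Rightarrow> real ^ 'm" where "Fc n = (\<chi> i. P.F (k i) n - P.mean (P.F (k i)))"
definition Sv :: "'i \<Rightarrow> ('i \<Rightarrow> nat) \<Rightarrow> real ^ 'm" where "Sv a n = (\<chi> i. P.S (k i) a n)"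
text \<open>As the kernels are nonnegative, their sum is the l1 norm of the vector of kernels. It
  dominates each \<open>k i\<close> and the norm of every increment, so one scalar kernel carries
  all moment conditions.\<close>

definition K :: "'i \<Rightarrow> 'i \<Rightarrow> real" where "K a b = (\<Sum>i\<in>UNIV. k i a b)"

lemma Fc_up: "a \<in> I \<Longrightarrow> Fc (P.up a n) = Fc n + Sv a n"
  by (simp add: Fc_def Sv_def vec_eq_iff P.F_up[OF kernels])

lemma S_K: "P.S K a n = (\<Sum>i\<in>UNIV. P.S (k i) a n)"
  unfolding P.S_def K_def sum_distrib_right by (rule sum.swap)

lemma m_K: "P.m K a = (\<Sum>i\<in>UNIV. P.m (k i) a)"
  unfolding P.m_def K_def sum_distrib_right by (rule sum.swap)

lemma kernel_K: "P.kernel K"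
  unfolding P.kernel_def K_def using kernels
  by (auto simp: P.k_sym[OF kernels] P.k_diag[OF kernels] intro!: sum_nonneg P.k_nonneg[OF kernels] sum.cong)

lemma poly_growth_Fc: "P.poly_growth (\<lambda>n. Fc n $ i)"
  unfolding Fc_def by (simp add: P.poly_growth_intros P.poly_growth_F)

lemma poly_growth_norm_Fc: "P.poly_growth (\<lambda>n. norm (Fc n))"
  by (rule P.poly_growth_cong[where f="\<lambda>n. \<Sum>i\<in>UNIV. \<bar>Fc n $ i\<bar>"])
     (auto intro!: P.poly_growth_intros poly_growth_Fc order_trans[OF norm_le_l1_cart])

lemma poly_growth_g1: "P.poly_growth (\<lambda>n. T.g1 c i (s *\<^sub>R Fc n))"
proof -
  obtain A B where AB: "A \<ge> 0" "B \<ge> 0" "\<And>y. \<bar>T.g1 c i y\<bar> \<le> A + B * norm y" using T.g1_growth by blast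
  show ?thesis
    by (rule P.poly_growth_cong[where f="\<lambda>n. A + B * (\<bar>s\<bar> * norm (Fc n))"])
       (auto intro!: P.poly_growth_intros poly_growth_norm_Fc simp: AB order_trans[OF AB(3)])
qed

lemma poly_growth_g2: "P.poly_growth (\<lambda>n. T.g2 c i j (s *\<^sub>R Fc n))"
  by (rule P.poly_growth_cong[OF P.poly_growth_const[of 1]]) (simp add: T.g2_bound)

definition err :: real where
  "err = (2 + L) / 2 * (\<Sum>a\<in>I. lam a * P.mean (\<lambda>n. \<psi> (P.S K a n) * (P.S K a n + P.m K a)))
     + (\<Sum>i\<in>UNIV. \<Sum>j\<in>UNIV. P.mean (\<lambda>n. \<bar>P.T (k i) (k j) n - C $ i $ j\<bar>))"

text \<open>Integrating the Poisson part by parts creates increments of \<open>g1\<close>. Their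
  linear parts add up to c * s * g2 * T and meet c * s * g2 * C from the Gaussian part, where all
  three factors before T - C are at most 1 in absolute value. What remains of the increments is
  \<open>rm\<close>, which \<open>taylor_bound\<close> controls.\<close>

lemma derivative_bound:
  assumes c: "0 \<le> c" "c \<le> 1" and s: "0 \<le> s" "s \<le> 1"
  shows "\<bar>\<Sum>i\<in>UNIV. P.mean (\<lambda>n. c * (Fc n $ i * T.g1 c i (s *\<^sub>R Fc n)) - s * (c * (\<Sum>j\<in>UNIV. C $ i $ j * T.g2 c i j (s *\<^sub>R Fc n))))\<bar> \<le> err"
proof -
  note pg = P.poly_growth_intros P.poly_growth_S P.poly_growth_T poly_growth_g1 poly_growth_g2 poly_growth_Fc
  define rm where "rm i a n = c * (T.g1 c i (s *\<^sub>R Fc (P.up a n)) - T.g1 c i (s *\<^sub>R Fc n))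
      - c * s * (\<Sum>j\<in>UNIV. P.S (k j) a n * T.g2 c i j (s *\<^sub>R Fc n))" for i a n
  have pgr: "a \<in> I \<Longrightarrow> P.poly_growth (rm i a)" for i a
    unfolding rm_def by (intro pg P.poly_growth_up[where f="\<lambda>n. T.g1 c i (s *\<^sub>R Fc n)"])
  define w where "w i a n = 1 / 2 * (P.S (k i) a n + P.m (k i) a)" for i a n
  have pgw: "P.poly_growth (w i a)" for i a unfolding w_def by (intro pg)
  have w0: "0 \<le> w i a n" if "a \<in> I" for i a n
    unfolding w_def using P.S_nonneg[OF kernels that] P.m_nonneg[OF kernels that] by (auto intro!: add_nonneg_nonneg)
  have pgS: "P.poly_growth (\<lambda>n. \<psi> (P.S K a n))" if "a \<in> I" for a
    by (rule P.poly_growth_cong[OF P.poly_growth_S[of K a]]) (simp add: P.S_nonneg[OF kernel_K that] psi_nonneg psi_le)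
  have termeq: "P.mean (\<lambda>n. c * (Fc n $ i * T.g1 c i (s *\<^sub>R Fc n)) - s * (c * (\<Sum>j\<in>UNIV. C $ i $ j * T.g2 c i j (s *\<^sub>R Fc n))))
     = (\<Sum>a\<in>I. lam a * P.mean (\<lambda>n. rm i a n * w i a n))
       + (\<Sum>j\<in>UNIV. P.mean (\<lambda>n. c * s * (T.g2 c i j (s *\<^sub>R Fc n) * (P.T (k i) (k j) n - C $ i $ j))))" for i
  proof -
    have "P.mean (\<lambda>n. Fc n $ i * T.g1 c i (s *\<^sub>R Fc n))
      = (\<Sum>a\<in>I. lam a * P.mean (\<lambda>n. (T.g1 c i (s *\<^sub>R Fc (P.up a n)) - T.g1 c i (s *\<^sub>R Fc n)) * w i a n))"
      unfolding Fc_def[of n for n] w_def using P.F_ibp[OF kernels[of i] poly_growth_g1[of c i s]] by (simp add: Fc_def)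
    then have "P.mean (\<lambda>n. c * (Fc n $ i * T.g1 c i (s *\<^sub>R Fc n)))
      = (\<Sum>a\<in>I. lam a * P.mean (\<lambda>n. c * ((T.g1 c i (s *\<^sub>R Fc (P.up a n)) - T.g1 c i (s *\<^sub>R Fc n)) * w i a n)))"
      unfolding P.mean_cmult by (simp add: sum_distrib_left mult_ac)
    also have "\<dots> = (\<Sum>a\<in>I. lam a * (P.mean (\<lambda>n. rm i a n * w i a n) + (\<Sum>j\<in>UNIV. c * s * P.mean (\<lambda>n. T.g2 c i j (s *\<^sub>R Fc n) * (P.S (k j) a n * w i a n)))))"
    proof (intro sum.cong refl arg_cong2[of _ _ _ _ "(*)"])
      fix a assume a: "a \<in> I"
      have "P.mean (\<lambda>n. c * ((T.g1 c i (s *\<^sub>R Fc (P.up a n)) - T.g1 c i (s *\<^sub>R Fc n)) * w i a n))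
        = P.mean (\<lambda>n. rm i a n * w i a n + (\<Sum>j\<in>UNIV. c * s * (T.g2 c i j (s *\<^sub>R Fc n) * (P.S (k j) a n * w i a n))))"
      proof (rule P.mean_cong)
        fix n
        have "(\<Sum>j\<in>UNIV. c * s * (T.g2 c i j (s *\<^sub>R Fc n) * (P.S (k j) a n * w i a n))) = c * s * (\<Sum>j\<in>UNIV. P.S (k j) a n * T.g2 c i j (s *\<^sub>R Fc n)) * w i a n"
          by (simp add: sum_distrib_left sum_distrib_right mult_ac)
        then show "c * ((T.g1 c i (s *\<^sub>R Fc (P.up a n)) - T.g1 c i (s *\<^sub>R Fc n)) * w i a n)
          = rm i a n * w i a n + (\<Sum>j\<in>UNIV. c * s * (T.g2 c i j (s *\<^sub>R Fc n) * (P.S (k j) a n * w i a n)))"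
          by (simp add: rm_def algebra_simps)
      qed
      also have "\<dots> = P.mean (\<lambda>n. rm i a n * w i a n) + (\<Sum>j\<in>UNIV. c * s * P.mean (\<lambda>n. T.g2 c i j (s *\<^sub>R Fc n) * (P.S (k j) a n * w i a n)))"
        by (simp only: P.mean_add P.mean_sum P.mean_cmult pg pgr[OF a] pgw)
      finally show "P.mean (\<lambda>n. c * ((T.g1 c i (s *\<^sub>R Fc (P.up a n)) - T.g1 c i (s *\<^sub>R Fc n)) * w i a n))
        = P.mean (\<lambda>n. rm i a n * w i a n) + (\<Sum>j\<in>UNIV. c * s * P.mean (\<lambda>n. T.g2 c i j (s *\<^sub>R Fc n) * (P.S (k j) a n * w i a n)))" .
    qed
    also have "\<dots> = (\<Sum>a\<in>I. lam a * P.mean (\<lambda>n. rm i a n * w i a n))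
        + (\<Sum>j\<in>UNIV. c * s * (\<Sum>a\<in>I. lam a * P.mean (\<lambda>n. T.g2 c i j (s *\<^sub>R Fc n) * (P.S (k j) a n * w i a n))))"
      unfolding distrib_left sum.distrib sum_distrib_left by (subst (2) sum.swap) (simp add: mult_ac)
    also have "(\<Sum>j\<in>UNIV. c * s * (\<Sum>a\<in>I. lam a * P.mean (\<lambda>n. T.g2 c i j (s *\<^sub>R Fc n) * (P.S (k j) a n * w i a n))))
       = (\<Sum>j\<in>UNIV. P.mean (\<lambda>n. c * s * (T.g2 c i j (s *\<^sub>R Fc n) * P.T (k i) (k j) n)))"
    proof (intro sum.cong refl)
      fix j
      have "(\<Sum>a\<in>I. lam a * P.mean (\<lambda>n. T.g2 c i j (s *\<^sub>R Fc n) * (P.S (k j) a n * w i a n)))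
        = P.mean (\<lambda>n. \<Sum>a\<in>I. lam a * (T.g2 c i j (s *\<^sub>R Fc n) * (P.S (k j) a n * w i a n)))"
        by (simp only: P.mean_sum P.mean_cmult pg pgw)
      also have "\<dots> = P.mean (\<lambda>n. T.g2 c i j (s *\<^sub>R Fc n) * P.T (k i) (k j) n)"
        unfolding P.T_def w_def sum_distrib_left by (simp add: mult_ac)
      finally show "c * s * (\<Sum>a\<in>I. lam a * P.mean (\<lambda>n. T.g2 c i j (s *\<^sub>R Fc n) * (P.S (k j) a n * w i a n)))
        = P.mean (\<lambda>n. c * s * (T.g2 c i j (s *\<^sub>R Fc n) * P.T (k i) (k j) n))"
        by (simp only: P.mean_cmult)
    qed
    finally have 1: "P.mean (\<lambda>n. c * (Fc n $ i * T.g1 c i (s *\<^sub>R Fc n))) = (\<Sum>a\<in>I. lam a * P.mean (\<lambda>n. rm i a n * w i a n))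
       + (\<Sum>j\<in>UNIV. P.mean (\<lambda>n. c * s * (T.g2 c i j (s *\<^sub>R Fc n) * P.T (k i) (k j) n)))" .
    have 2: "P.mean (\<lambda>n. s * (c * (\<Sum>j\<in>UNIV. C $ i $ j * T.g2 c i j (s *\<^sub>R Fc n))))
      = (\<Sum>j\<in>UNIV. P.mean (\<lambda>n. c * s * (T.g2 c i j (s *\<^sub>R Fc n) * C $ i $ j)))"
    proof -
      have "P.mean (\<lambda>n. s * (c * (\<Sum>j\<in>UNIV. C $ i $ j * T.g2 c i j (s *\<^sub>R Fc n))))
        = P.mean (\<lambda>n. \<Sum>j\<in>UNIV. c * s * (T.g2 c i j (s *\<^sub>R Fc n) * C $ i $ j))"
        by (simp add: sum_distrib_left mult_ac)
      then show ?thesis by (simp only: P.mean_sum pg)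
    qed
    have "P.mean (\<lambda>n. c * (Fc n $ i * T.g1 c i (s *\<^sub>R Fc n)) - s * (c * (\<Sum>j\<in>UNIV. C $ i $ j * T.g2 c i j (s *\<^sub>R Fc n))))
      = P.mean (\<lambda>n. c * (Fc n $ i * T.g1 c i (s *\<^sub>R Fc n))) - P.mean (\<lambda>n. s * (c * (\<Sum>j\<in>UNIV. C $ i $ j * T.g2 c i j (s *\<^sub>R Fc n))))"
      by (rule P.mean_diff; intro pg)
    also have "\<dots> = (\<Sum>a\<in>I. lam a * P.mean (\<lambda>n. rm i a n * w i a n))
       + (\<Sum>j\<in>UNIV. P.mean (\<lambda>n. c * s * (T.g2 c i j (s *\<^sub>R Fc n) * P.T (k i) (k j) n)) - P.mean (\<lambda>n. c * s * (T.g2 c i j (s *\<^sub>R Fc n) * C $ i $ j)))"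
      unfolding 1 2 by (simp add: sum_subtractf)
    also have "(\<Sum>j\<in>UNIV. P.mean (\<lambda>n. c * s * (T.g2 c i j (s *\<^sub>R Fc n) * P.T (k i) (k j) n)) - P.mean (\<lambda>n. c * s * (T.g2 c i j (s *\<^sub>R Fc n) * C $ i $ j)))
      = (\<Sum>j\<in>UNIV. P.mean (\<lambda>n. c * s * (T.g2 c i j (s *\<^sub>R Fc n) * (P.T (k i) (k j) n - C $ i $ j))))"
      unfolding right_diff_distrib by (intro sum.cong refl P.mean_diff[symmetric] pg)
    finally show ?thesis .
  qed
  have b1: "\<bar>P.mean (\<lambda>n. rm i a n * w i a n)\<bar> \<le> P.mean (\<lambda>n. (2 + L) * (\<psi> (P.S K a n) * w i a n))" if a: "a \<in> I" for i a
  proof -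
    have "\<bar>P.mean (\<lambda>n. rm i a n * w i a n)\<bar> \<le> P.mean (\<lambda>n. \<bar>rm i a n * w i a n\<bar>)"
      unfolding P.mean_def by (rule integral_abs_bound)
    also have "\<dots> \<le> P.mean (\<lambda>n. (2 + L) * (\<psi> (P.S K a n) * w i a n))"
    proof (rule P.mean_mono)
      fix n
      have Sn: "P.S (k j) a n \<ge> 0" for j by (rule P.S_nonneg[OF kernels a])
      have sm: "(\<Sum>j\<in>UNIV. \<bar>Sv a n $ j\<bar>) = P.S K a n" using Sn by (simp add: S_K Sv_def)
      have "\<bar>rm i a n\<bar> \<le> (2 + L) * ((\<Sum>j\<in>UNIV. \<bar>Sv a n $ j\<bar>) * min 1 (norm (Sv a n)))"
        using T.taylor_bound[OF S_in_V[OF a] c s, where y="s *\<^sub>R Fc n" and i=i]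
        unfolding rm_def Fc_up[OF a] by (simp add: Sv_def scaleR_add_right)
      also have "\<dots> \<le> (2 + L) * \<psi> (P.S K a n)"
        unfolding \<psi>_def sm using T.L_nonneg norm_le_l1_cart[of "Sv a n"] P.S_nonneg[OF kernel_K a]
        by (intro mult_left_mono) (auto simp: sm min_le_iff_disj intro!: min.mono)
      finally show "\<bar>rm i a n * w i a n\<bar> \<le> (2 + L) * (\<psi> (P.S K a n) * w i a n)"
        using w0[OF a, of i n] by (simp add: abs_mult mult_right_mono mult.assoc[symmetric])
    qed (intro pg pgr pgw pgS a)+
    finally show ?thesis .
  qed
  have b2: "\<bar>P.mean (\<lambda>n. c * s * (T.g2 c i j (s *\<^sub>R Fc n) * (P.T (k i) (k j) n - C $ i $ j)))\<bar> \<le> P.mean (\<lambda>n. \<bar>P.T (k i) (k j) n - C $ i $ j\<bar>)" for i j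
  proof -
    have "\<bar>P.mean (\<lambda>n. c * s * (T.g2 c i j (s *\<^sub>R Fc n) * (P.T (k i) (k j) n - C $ i $ j)))\<bar>
      \<le> P.mean (\<lambda>n. \<bar>c * s * (T.g2 c i j (s *\<^sub>R Fc n) * (P.T (k i) (k j) n - C $ i $ j))\<bar>)"
      unfolding P.mean_def by (rule integral_abs_bound)
    also have "\<dots> \<le> P.mean (\<lambda>n. \<bar>P.T (k i) (k j) n - C $ i $ j\<bar>)"
    proof (rule P.mean_mono)
      fix n
      have "\<bar>c * s * T.g2 c i j (s *\<^sub>R Fc n)\<bar> \<le> 1"
        unfolding abs_mult using c s T.g2_bound[of c i j "s *\<^sub>R Fc n"] by (intro mult_le_one) auto
      then show "\<bar>c * s * (T.g2 c i j (s *\<^sub>R Fc n) * (P.T (k i) (k j) n - C $ i $ j))\<bar> \<le> \<bar>P.T (k i) (k j) n - C $ i $ j\<bar>"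
        using mult_right_mono[of "\<bar>c * s * T.g2 c i j (s *\<^sub>R Fc n)\<bar>" 1 "\<bar>P.T (k i) (k j) n - C $ i $ j\<bar>"] by (simp add: abs_mult mult.assoc)
    qed (intro pg)+
    finally show ?thesis .
  qed
  have "\<bar>\<Sum>i\<in>UNIV. P.mean (\<lambda>n. c * (Fc n $ i * T.g1 c i (s *\<^sub>R Fc n)) - s * (c * (\<Sum>j\<in>UNIV. C $ i $ j * T.g2 c i j (s *\<^sub>R Fc n))))\<bar>
    \<le> (\<Sum>i\<in>UNIV. (\<Sum>a\<in>I. lam a * P.mean (\<lambda>n. (2 + L) * (\<psi> (P.S K a n) * w i a n))) + (\<Sum>j\<in>UNIV. P.mean (\<lambda>n. \<bar>P.T (k i) (k j) n - C $ i $ j\<bar>)))"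
    unfolding termeq
  proof (intro sum_abs[THEN order_trans] sum_mono abs_triangle_ineq[THEN order_trans] add_mono)
    fix i a assume a: "a \<in> I"
    show "\<bar>lam a * P.mean (\<lambda>n. rm i a n * w i a n)\<bar> \<le> lam a * P.mean (\<lambda>n. (2 + L) * (\<psi> (P.S K a n) * w i a n))"
      using b1[OF a, of i] P.lam_nonneg[OF a] by (simp add: abs_mult mult_left_mono)
  qed (rule b2)
  also have "\<dots> = err"
  proof -
    have "(\<Sum>i\<in>UNIV. \<Sum>a\<in>I. lam a * P.mean (\<lambda>n. (2 + L) * (\<psi> (P.S K a n) * w i a n)))
      = (\<Sum>a\<in>I. lam a * (\<Sum>i\<in>UNIV. P.mean (\<lambda>n. (2 + L) * (\<psi> (P.S K a n) * w i a n))))"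
      by (subst sum.swap) (simp add: sum_distrib_left)
    also have "\<dots> = (\<Sum>a\<in>I. lam a * ((2 + L) / 2 * P.mean (\<lambda>n. \<psi> (P.S K a n) * (P.S K a n + P.m K a))))"
    proof (intro sum.cong refl arg_cong2[of _ _ _ _ "(*)"])
      fix a assume a: "a \<in> I"
      have "(\<Sum>i\<in>UNIV. P.mean (\<lambda>n. (2 + L) * (\<psi> (P.S K a n) * w i a n))) = P.mean (\<lambda>n. \<Sum>i\<in>UNIV. (2 + L) * (\<psi> (P.S K a n) * w i a n))"
        by (subst P.mean_sum; intro refl pg pgw pgS a)
      also have "\<dots> = P.mean (\<lambda>n. (2 + L) / 2 * (\<psi> (P.S K a n) * (P.S K a n + P.m K a)))"
      proof (rule P.mean_cong)
        fix n
        have "(\<Sum>i\<in>UNIV. w i a n) = 1 / 2 * (P.S K a n + P.m K a)"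
          unfolding w_def S_K m_K sum.distrib[symmetric] sum_distrib_left ..
        then show "(\<Sum>i\<in>UNIV. (2 + L) * (\<psi> (P.S K a n) * w i a n)) = (2 + L) / 2 * (\<psi> (P.S K a n) * (P.S K a n + P.m K a))"
          by (simp add: sum_distrib_left[symmetric])
      qed
      finally show "(\<Sum>i\<in>UNIV. P.mean (\<lambda>n. (2 + L) * (\<psi> (P.S K a n) * w i a n))) = (2 + L) / 2 * P.mean (\<lambda>n. \<psi> (P.S K a n) * (P.S K a n + P.m K a))"
        unfolding P.mean_cmult .
    qed
    finally show ?thesis unfolding err_def sum.distrib by (simp add: sum_distrib_left mult_ac)
  qed
  finally show ?thesis .
qed

text \<open>The path leads from X at \<phi> = 0 to F at \<phi> = pi/2. Its derivative is cos \<phi>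
  F - sin \<phi> X, so the Poisson term has the factor cos \<phi> that \<open>taylor_bound\<close>
  asks for, and after both integrations by parts the second order terms share the factor sin \<phi>
  cos \<phi>.\<close>

theorem interpolation:
  "\<bar>P.mean (\<lambda>n. h (Fc n)) - T.expectation (\<lambda>x. h (X x))\<bar> \<le> err * (pi / 2)"
proof -
  interpret MN: pair_prob_space M N ..
  obtain A B where AB: "A \<ge> 0" "B \<ge> 0" "\<And>i x. \<bar>h1 i x\<bar> \<le> A + B * norm x" using T.h1_growth by blast
  obtain A' where A': "A' \<ge> 0" "\<And>x. \<bar>h x\<bar> \<le> A' * (1 + (norm x)\<^sup>2)" using T.h_growth by blast
  define Y where "Y \<phi> z = sin \<phi> *\<^sub>R Fc (P.config (fst z)) + cos \<phi> *\<^sub>R X (snd z)" for \<phi> z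
  define f where "f \<phi> z = h (Y \<phi> z)" for \<phi> z
  define f' where "f' \<phi> z = (\<Sum>i\<in>UNIV. (cos \<phi> * Fc (P.config (fst z)) $ i - sin \<phi> * X (snd z) $ i) * h1 i (Y \<phi> z))" for \<phi> z
  define nF where "nF \<omega> = norm (Fc (P.config \<omega>))" for \<omega>
  define nX where "nX x = norm (X x)" for x
  have Fm[measurable]: "(\<lambda>\<omega>. Fc (P.config \<omega>)) \<in> borel_measurable M" by (rule P.config_fun_measurable)
  have Fim[measurable]: "(\<lambda>\<omega>. Fc (P.config \<omega>) $ i) \<in> borel_measurable M" for i by (rule P.config_fun_measurable)
  have Ym[measurable]: "(\<lambda>(\<phi>, z). Y \<phi> z) \<in> borel_measurable (borel \<Otimes>\<^sub>M (M \<Otimes>\<^sub>M N))"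
    unfolding Y_def by measurable
  have Ym'[measurable]: "Y \<phi> \<in> borel_measurable (M \<Otimes>\<^sub>M N)" for \<phi> unfolding Y_def by measurable
  have f'm[measurable]: "(\<lambda>(\<phi>, z). f' \<phi> z) \<in> borel_measurable (borel \<Otimes>\<^sub>M (M \<Otimes>\<^sub>M N))"
    unfolding f'_def split_beta' by (measurable)
  have f'm'[measurable]: "f' \<phi> \<in> borel_measurable (M \<Otimes>\<^sub>M N)" for \<phi> unfolding f'_def by measurable
  have fm'[measurable]: "f \<phi> \<in> borel_measurable (M \<Otimes>\<^sub>M N)" for \<phi> unfolding f_def by measurable
  have nY: "norm (Y \<phi> z) \<le> nF (fst z) + nX (snd z)" for \<phi> z
  proof -
    have "norm (Y \<phi> z) \<le> norm (sin \<phi> *\<^sub>R Fc (P.config (fst z))) + norm (cos \<phi> *\<^sub>R X (snd z))"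
      unfolding Y_def by (rule norm_triangle_ineq)
    also have "\<dots> \<le> nF (fst z) + nX (snd z)"
      by (intro add_mono) (auto simp: nF_def nX_def mult_left_le_one_le)
    finally show ?thesis .
  qed
  have iF: "integrable M nF" "integrable M (\<lambda>\<omega>. (nF \<omega>)\<^sup>2)"
    unfolding nF_def by (auto intro!: P.poly_growth_integrable[where f="\<lambda>n. norm (Fc n)"] P.poly_growth_integrable[where f="\<lambda>n. (norm (Fc n))\<^sup>2"] P.poly_growth_intros poly_growth_norm_Fc)
  have iX: "integrable N nX" "integrable N (\<lambda>x. (nX x)\<^sup>2)"
    unfolding nX_def by (auto intro: T.integrable_norm_X T.integrable_norm_X_sq)
  define Bd where "Bd z = T.d * A * (nF (fst z) + nX (snd z)) + 2 * T.d * B * ((nF (fst z))\<^sup>2 + (nX (snd z))\<^sup>2)" for z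
  have iBd: "integrable (M \<Otimes>\<^sub>M N) Bd"
    unfolding Bd_def
    by (intro Bochner_Integration.integrable_add integrable_mult_right MN.integrable_fst_comp[OF iF(1)] MN.integrable_snd_comp[OF iX(1)]
        MN.integrable_fst_comp[OF iF(2)] MN.integrable_snd_comp[OF iX(2)])
  have f'b: "\<bar>f' \<phi> z\<bar> \<le> Bd z" for \<phi> z
  proof -
    let ?a = "nF (fst z)" and ?b = "nX (snd z)"
    have ab: "?a \<ge> 0" "?b \<ge> 0" by (auto simp: nF_def nX_def)
    have "\<bar>f' \<phi> z\<bar> \<le> (\<Sum>i\<in>(UNIV::'m set). (?a + ?b) * (A + B * (?a + ?b)))"
      unfolding f'_def
    proof (intro sum_abs[THEN order_trans] sum_mono)
      fix i :: 'm
      have 1: "\<bar>cos \<phi> * Fc (P.config (fst z)) $ i - sin \<phi> * X (snd z) $ i\<bar> \<le> ?a + ?b"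
      proof -
        have "\<bar>cos \<phi> * Fc (P.config (fst z)) $ i\<bar> \<le> ?a" "\<bar>sin \<phi> * X (snd z) $ i\<bar> \<le> ?b"
          unfolding abs_mult nF_def nX_def
          by (auto intro!: order_trans[OF mult_left_le_one_le] component_le_norm_cart)
        then show ?thesis by linarith
      qed
      have "\<bar>h1 i (Y \<phi> z)\<bar> \<le> A + B * (?a + ?b)"
        using AB(3)[of i "Y \<phi> z"] mult_left_mono[OF nY[of \<phi> z] AB(2)] by linarith
      then show "\<bar>(cos \<phi> * Fc (P.config (fst z)) $ i - sin \<phi> * X (snd z) $ i) * h1 i (Y \<phi> z)\<bar> \<le> (?a + ?b) * (A + B * (?a + ?b))"
        unfolding abs_mult using ab by (intro mult_mono 1) auto
    qed
    also have "\<dots> = T.d * A * (?a + ?b) + T.d * B * (?a + ?b)\<^sup>2"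
      by (simp add: T.d_def power2_eq_square algebra_simps)
    also have "\<dots> \<le> Bd z"
    proof -
      have "(?a + ?b)\<^sup>2 \<le> 2 * (?a\<^sup>2 + ?b\<^sup>2)" using sum_squares_bound[of ?a ?b] by (simp add: power2_sum)
      then have "T.d * B * (?a + ?b)\<^sup>2 \<le> T.d * B * (2 * (?a\<^sup>2 + ?b\<^sup>2))"
        using AB by (intro mult_left_mono) (auto simp: T.d_def)
      then show ?thesis by (simp add: Bd_def algebra_simps)
    qed
    finally show ?thesis .
  qed
  have if': "integrable (M \<Otimes>\<^sub>M N) (f' \<phi>)" for \<phi>
    by (rule Bochner_Integration.integrable_bound[OF iBd]) (use f'b in \<open>auto intro!: AE_I2 order_trans[OF f'b]\<close>)
  have if0: "integrable (M \<Otimes>\<^sub>M N) (f \<phi>)" for \<phi>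
  proof (rule Bochner_Integration.integrable_bound)
    show "integrable (M \<Otimes>\<^sub>M N) (\<lambda>z. A' * (1 + 2 * ((nF (fst z))\<^sup>2 + (nX (snd z))\<^sup>2)))"
      by (intro Bochner_Integration.integrable_add integrable_mult_right MN.integrable_fst_comp[OF iF(2)] MN.integrable_snd_comp[OF iX(2)]) simp
    show "AE z in M \<Otimes>\<^sub>M N. norm (f \<phi> z) \<le> norm (A' * (1 + 2 * ((nF (fst z))\<^sup>2 + (nX (snd z))\<^sup>2)))"
    proof (intro AE_I2)
      fix z
      let ?a = "nF (fst z)" and ?b = "nX (snd z)"
      have "(norm (Y \<phi> z))\<^sup>2 \<le> (?a + ?b)\<^sup>2" by (intro power_mono nY) auto
      also have "\<dots> \<le> 2 * (?a\<^sup>2 + ?b\<^sup>2)" using sum_squares_bound[of ?a ?b] by (simp add: power2_sum)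
      finally have "A' * (1 + (norm (Y \<phi> z))\<^sup>2) \<le> A' * (1 + 2 * (?a\<^sup>2 + ?b\<^sup>2))"
        using A' by (intro mult_left_mono) auto
      then show "norm (f \<phi> z) \<le> norm (A' * (1 + 2 * (?a\<^sup>2 + ?b\<^sup>2)))"
        using A'(2)[of "Y \<phi> z"] unfolding f_def by (auto intro: order_trans)
    qed
  qed auto
  have "\<bar>(\<integral>z. f (pi / 2) z \<partial>(M \<Otimes>\<^sub>M N)) - (\<integral>z. f 0 z \<partial>(M \<Otimes>\<^sub>M N))\<bar> \<le> err * (pi / 2 - 0)"
  proof (rule expectation_mvt[where f'=f' and B=Bd])
    show "prob_space (M \<Otimes>\<^sub>M N)" by unfold_locales
    show "((\<lambda>\<phi>. f \<phi> z) has_real_derivative f' \<phi> z) (at \<phi>)" for \<phi> z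
    proof -
      have "((\<lambda>\<phi>. Y \<phi> z) has_derivative (\<lambda>t. t *\<^sub>R (cos \<phi> *\<^sub>R Fc (P.config (fst z)) - sin \<phi> *\<^sub>R X (snd z)))) (at \<phi>)"
        unfolding Y_def by (auto intro!: derivative_eq_intros simp: algebra_simps)
      from has_derivative_compose[OF this T.D1]
      show ?thesis unfolding has_field_derivative_def f_def
        by (rule has_derivative_eq_rhs) (auto simp: fun_eq_iff f'_def sum_distrib_left mult_ac)
    qed
    show "continuous_on UNIV (\<lambda>\<phi>. f' \<phi> z)" for z
    proof -
      have "continuous_on UNIV (\<lambda>\<phi>. h1 i (Y \<phi> z))" for i
        unfolding Y_def by (intro continuous_on_compose2[OF T.h1_cont] continuous_intros) auto
      then show ?thesis unfolding f'_def by (intro continuous_intros)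
    qed
    fix \<phi> :: real assume p: "0 \<le> \<phi>" "\<phi> \<le> pi / 2"
    let ?s = "sin \<phi>" and ?c = "cos \<phi>"
    have cs: "0 \<le> ?c" "?c \<le> 1" "0 \<le> ?s" "?s \<le> 1" using p by (auto intro: cos_ge_zero sin_ge_zero)
    \<comment> \<open>\<open>X\<close> is integrated out first, for a fixed configuration; this
      leaves a function of the configuration alone, to which the Poisson calculus applies.\<close>
    have inner: "(\<integral>x. f' \<phi> (\<omega>, x) \<partial>N) = (\<Sum>i\<in>UNIV. (\<lambda>n. ?c * (Fc n $ i * T.g1 ?c i (?s *\<^sub>R Fc n)) - ?s * (?c * (\<Sum>j\<in>UNIV. C $ i $ j * T.g2 ?c i j (?s *\<^sub>R Fc n)))) (P.config \<omega>))" for \<omega>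
    proof -
      define v where "v = Fc (P.config \<omega>)"
      define y where "y = ?s *\<^sub>R v"
      have "(\<integral>x. f' \<phi> (\<omega>, x) \<partial>N) = (\<integral>x. (\<Sum>i\<in>UNIV. ?c * v $ i * h1 i (y + ?c *\<^sub>R X x) - ?s * (X x $ i * h1 i (y + ?c *\<^sub>R X x))) \<partial>N)"
        unfolding f'_def Y_def fst_conv snd_conv v_def[symmetric] y_def[symmetric] by (simp add: algebra_simps)
      also have "\<dots> = (\<Sum>i\<in>UNIV. (\<integral>x. ?c * v $ i * h1 i (y + ?c *\<^sub>R X x) - ?s * (X x $ i * h1 i (y + ?c *\<^sub>R X x)) \<partial>N))"
        by (intro Bochner_Integration.integral_sum Bochner_Integration.integrable_diff integrable_mult_right T.integrable_h1 T.integrable_X_h1)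
      also have "\<dots> = (\<Sum>i\<in>UNIV. ?c * v $ i * T.g1 ?c i y - ?s * (?c * (\<Sum>j\<in>UNIV. C $ i $ j * T.g2 ?c i j y)))"
      proof (intro sum.cong refl)
        fix i
        have "(\<integral>x. ?c * v $ i * h1 i (y + ?c *\<^sub>R X x) - ?s * (X x $ i * h1 i (y + ?c *\<^sub>R X x)) \<partial>N)
          = (\<integral>x. ?c * v $ i * h1 i (y + ?c *\<^sub>R X x) \<partial>N) - (\<integral>x. ?s * (X x $ i * h1 i (y + ?c *\<^sub>R X x)) \<partial>N)"
          by (intro Bochner_Integration.integral_diff integrable_mult_right T.integrable_h1 T.integrable_X_h1)
        then show "(\<integral>x. ?c * v $ i * h1 i (y + ?c *\<^sub>R X x) - ?s * (X x $ i * h1 i (y + ?c *\<^sub>R X x)) \<partial>N)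
          = ?c * v $ i * T.g1 ?c i y - ?s * (?c * (\<Sum>j\<in>UNIV. C $ i $ j * T.g2 ?c i j y))"
          by (simp add: T.gaussian_term T.g1_def)
      qed
      finally show ?thesis by (simp add: y_def v_def mult.assoc)
    qed
    have e1: "(\<integral>z. f' \<phi> z \<partial>(M \<Otimes>\<^sub>M N)) = (\<integral>\<omega>. (\<integral>x. f' \<phi> (\<omega>, x) \<partial>N) \<partial>M)"
      by (rule MN.integral_fst'[OF if', symmetric])
    have e2: "(\<integral>\<omega>. (\<integral>x. f' \<phi> (\<omega>, x) \<partial>N) \<partial>M) = (\<Sum>i\<in>UNIV. P.mean (\<lambda>n. ?c * (Fc n $ i * T.g1 ?c i (?s *\<^sub>R Fc n)) - ?s * (?c * (\<Sum>j\<in>UNIV. C $ i $ j * T.g2 ?c i j (?s *\<^sub>R Fc n)))))"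
      unfolding inner P.mean_def
      by (intro Bochner_Integration.integral_sum P.poly_growth_integrable P.poly_growth_intros poly_growth_Fc poly_growth_g1 poly_growth_g2)
    show "\<bar>\<integral>z. f' \<phi> z \<partial>(M \<Otimes>\<^sub>M N)\<bar> \<le> err"
      unfolding e1 e2 by (rule derivative_bound[OF cs])
  qed (rule f'm f'b iBd if0 | simp)+
  moreover have "(\<integral>z. f (pi / 2) z \<partial>(M \<Otimes>\<^sub>M N)) = P.mean (\<lambda>n. h (Fc n))"
    unfolding MN.integral_fst'[OF if0, symmetric] by (simp add: f_def Y_def P.mean_def T.prob_space)
  moreover have "(\<integral>z. f 0 z \<partial>(M \<Otimes>\<^sub>M N)) = T.expectation (\<lambda>x. h (X x))"
    unfolding MN.integral_fst'[OF if0, symmetric] by (simp add: f_def Y_def P.prob_space)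
  ultimately show ?thesis by simp
qed

end

lemma (in comparison) err_bound:
  fixes \<Lambda> M1 M2 M3 :: real
  assumes ne: "I \<noteq> {}" and \<Lambda>: "\<Lambda> = (\<Sum>a\<in>I. lam a)"
    and M1: "\<And>a. a \<in> I \<Longrightarrow> (\<Sum>b\<in>I. lam b * K a b) \<le> M1"
    and M2: "\<And>a. a \<in> I \<Longrightarrow> (\<Sum>b\<in>I. lam b * (K a b)\<^sup>2) \<le> M2"
    and M3: "\<And>a. a \<in> I \<Longrightarrow> (\<Sum>b\<in>I. lam b * (K a b * \<psi> (K a b))) \<le> M3"
  shows "err \<le> (2 + L) / 2 * (\<Lambda> * (5 * M1 * (M2 + M1\<^sup>2) + 4 * M3))
    + (\<Sum>i\<in>UNIV. \<Sum>j\<in>UNIV. sqrt (\<Lambda> * M2 * M1\<^sup>2 + \<Lambda> * M2\<^sup>2 + 5 * \<Lambda> * M1 ^ 4) + \<bar>P.mean (P.T (k i) (k j)) - C $ i $ j\<bar>)"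
  unfolding err_def
proof (intro add_mono mult_left_mono sum_mono)
  show "(\<Sum>a\<in>I. lam a * P.mean (\<lambda>n. \<psi> (P.S K a n) * (P.S K a n + P.m K a))) \<le> \<Lambda> * (5 * M1 * (M2 + M1\<^sup>2) + 4 * M3)"
    by (rule P.remainder_bound[OF kernel_K \<Lambda> M1 M2 ne M3])
  show "0 \<le> (2 + L) / 2" using T.L_nonneg by simp
  fix i j
  have kK: "k i a b \<le> K a b" if "a \<in> I" "b \<in> I" for i a b
    unfolding K_def by (rule member_le_sum) (auto intro: P.k_nonneg[OF kernels that])
  have "P.mean (\<lambda>n. \<bar>P.T (k i) (k j) n - C $ i $ j\<bar>)
      \<le> P.mean (\<lambda>n. \<bar>P.T (k i) (k j) n - P.mean (P.T (k i) (k j))\<bar> + \<bar>P.mean (P.T (k i) (k j)) - C $ i $ j\<bar>)"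
    by (intro P.mean_mono P.poly_growth_intros P.poly_growth_T) auto
  also have "\<dots> = P.mean (\<lambda>n. \<bar>P.T (k i) (k j) n - P.mean (P.T (k i) (k j))\<bar>) + \<bar>P.mean (P.T (k i) (k j)) - C $ i $ j\<bar>"
    by (simp only: P.mean_add P.mean_const P.poly_growth_intros P.poly_growth_T)
  also have "P.mean (\<lambda>n. \<bar>P.T (k i) (k j) n - P.mean (P.T (k i) (k j))\<bar>) \<le> sqrt (P.mean (\<lambda>n. (P.T (k i) (k j) n - P.mean (P.T (k i) (k j)))\<^sup>2))"
    by (intro P.mean_abs_le_sqrt P.poly_growth_intros P.poly_growth_T)
  also have "\<dots> \<le> sqrt (\<Lambda> * M2 * M1\<^sup>2 + \<Lambda> * M2\<^sup>2 + 5 * \<Lambda> * M1 ^ 4)"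
    by (intro real_sqrt_le_mono P.variance_T[OF kernel_K \<Lambda> M1 M2 ne kernels kernels kK kK])
  finally show "P.mean (\<lambda>n. \<bar>P.T (k i) (k j) n - C $ i $ j\<bar>)
    \<le> sqrt (\<Lambda> * M2 * M1\<^sup>2 + \<Lambda> * M2\<^sup>2 + 5 * \<Lambda> * M1 ^ 4) + \<bar>P.mean (P.T (k i) (k j)) - C $ i $ j\<bar>"
    by simp
qed

section \<open>Test functions of the two distances\<close>

lemma has_derivative_partial:
  fixes f :: "real ^ 'm::finite \<Rightarrow> real"
  assumes "f differentiable_on UNIV"
  shows "(f has_derivative (\<lambda>v. \<Sum>i\<in>UNIV. v $ i * partial i f x)) (at x)"
proof -
  have d: "(f has_derivative frechet_derivative f (at x)) (at x)"
    using assms by (simp add: differentiable_on_def frechet_derivative_works[symmetric])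
  interpret l: bounded_linear "frechet_derivative f (at x)" by (rule has_derivative_bounded_linear[OF d])
  have "frechet_derivative f (at x) v = (\<Sum>i\<in>UNIV. v $ i * partial i f x)" for v
  proof -
    have "frechet_derivative f (at x) v = frechet_derivative f (at x) (\<Sum>i\<in>UNIV. v $ i *\<^sub>R axis i 1)"
      by (simp add: basis_expansion[of v, unfolded scalar_mult_eq_scaleR])
    then show ?thesis by (simp add: l.sum l.scaleR partial_def)
  qed
  then show ?thesis by (intro has_derivative_eq_rhs[OF d]) (simp add: fun_eq_iff)
qed

lemma C_k_2_simps:
  assumes "C_k (Suc (Suc k)) h"
  shows "h differentiable_on UNIV" "partial i h differentiable_on UNIV" "C_k k (partial j (partial i h))"
  using assms by auto

lemma deriv_sup_norm_bound:
  assumes "deriv_sup_norm k f \<le> 1" "length is = k" shows "\<bar>foldr partial is f x\<bar> \<le> 1"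
proof -
  have "ereal \<bar>foldr partial is f x\<bar> \<le> (SUP x. ereal \<bar>foldr partial is f x\<bar>)" by (rule SUP_upper) simp
  also have "\<dots> \<le> deriv_sup_norm k f"
    unfolding deriv_sup_norm_def using assms(2) by (intro SUP_upper) simp
  also have "\<dots> \<le> 1" by (rule assms(1))
  finally show ?thesis by (simp add: one_ereal_def)
qed

context centred_gaussian_vector
begin

text \<open>Third partial derivatives bounded by 1 make the second ones Lipschitz, with constant
  CARD('m) from comparing the l1 and the Euclidean norm. Every direction is admissible, and dividing
  by c <= 1 only weakens the estimate.\<close>

lemma smooth_test_H3:
  assumes h: "h \<in> H3"
  shows "smooth_test N X C h (\<lambda>i. partial i h) (\<lambda>i j. partial j (partial i h)) UNIV (real CARD('m))"
proof -
  have "C_k (Suc (Suc (Suc 0))) h" using h by (simp add: H3_def numeral_3_eq_3)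
  note Ck = C_k_2_simps[OF this]
  have c2: "partial j (partial i h) differentiable_on UNIV" for i j using Ck(3)[of j i] by simp
  have b2: "\<bar>partial j (partial i h) x\<bar> \<le> 1" for i j x
    using h deriv_sup_norm_bound[of 2 h "[j, i]" x] by (simp add: H3_def)
  have b3: "\<bar>partial l (partial j (partial i h)) x\<bar> \<le> 1" for i j l x
    using h deriv_sup_norm_bound[of 3 h "[l, j, i]" x] by (simp add: H3_def)
  have sum_le: "(\<Sum>j\<in>UNIV. \<bar>v $ j\<bar>) \<le> real CARD('m) * norm v" for v :: "real ^ 'm"
    using sum_bounded_above[of UNIV "\<lambda>j. \<bar>v $ j\<bar>" "norm v"] component_le_norm_cart[of v] by simp
  have lip: "\<bar>partial j (partial i h) x - partial j (partial i h) y\<bar> \<le> real CARD('m) * norm (x - y)" for i j x y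
  proof -
    have "norm (partial j (partial i h) x - partial j (partial i h) y) \<le> real CARD('m) * norm (x - y)"
    proof (rule differentiable_bound[of UNIV])
      fix z
      have "\<bar>\<Sum>l\<in>UNIV. v $ l * partial l (partial j (partial i h)) z\<bar> \<le> (\<Sum>l\<in>UNIV. \<bar>v $ l\<bar>)" for v :: "real ^ 'm"
        by (intro sum_abs[THEN order_trans] sum_mono) (simp add: abs_mult b3 mult_left_le)
      then show "onorm (\<lambda>v. \<Sum>l\<in>UNIV. v $ l * partial l (partial j (partial i h)) z) \<le> real CARD('m)"
        by (intro onorm_le) (auto intro: order_trans[OF _ sum_le])
    qed (use has_derivative_partial[OF c2] in auto)
    then show ?thesis by simp
  qed
  show ?thesis
  proof
    show "(h has_derivative (\<lambda>v. \<Sum>i\<in>UNIV. v $ i * partial i h x)) (at x)" for x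
      by (rule has_derivative_partial[OF Ck(1)])
    show "(partial i h has_derivative (\<lambda>v. \<Sum>j\<in>UNIV. v $ j * partial j (partial i h) x)) (at x)" for i x
      by (rule has_derivative_partial[OF Ck(2)])
    show cont: "continuous_on UNIV (partial j (partial i h))" for i j
      by (rule differentiable_imp_continuous_on[OF c2])
    show "\<bar>partial j (partial i h) x\<bar> \<le> 1" for i j x by (rule b2)
    fix v :: "real ^ 'm" and y c i j assume c: "0 < c" "c \<le> (1::real)"
    have [measurable]: "partial j (partial i h) \<in> borel_measurable borel"
      by (rule borel_measurable_continuous_onI[OF cont])
    have int: "integrable N (\<lambda>\<omega>. partial j (partial i h) (z + c *\<^sub>R X \<omega>))" for z
      using b2 by (intro integrable_const_bound[where B=1]) auto
    have "\<bar>expectation (\<lambda>\<omega>. partial j (partial i h) (y + v + c *\<^sub>R X \<omega>)) - expectation (\<lambda>\<omega>. partial j (partial i h) (y + c *\<^sub>R X \<omega>))\<bar>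
      = \<bar>expectation (\<lambda>\<omega>. partial j (partial i h) (y + v + c *\<^sub>R X \<omega>) - partial j (partial i h) (y + c *\<^sub>R X \<omega>))\<bar>"
      using int by simp
    also have "\<dots> \<le> expectation (\<lambda>\<omega>. \<bar>partial j (partial i h) (y + v + c *\<^sub>R X \<omega>) - partial j (partial i h) (y + c *\<^sub>R X \<omega>)\<bar>)"
      by (rule integral_abs_bound)
    also have "\<dots> \<le> expectation (\<lambda>\<omega>. real CARD('m) * norm v)"
    proof (rule integral_mono')
      fix \<omega> show "\<bar>partial j (partial i h) (y + v + c *\<^sub>R X \<omega>) - partial j (partial i h) (y + c *\<^sub>R X \<omega>)\<bar> \<le> real CARD('m) * norm v"
        using lip[of j i "y + v + c *\<^sub>R X \<omega>" "y + c *\<^sub>R X \<omega>"] by simp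
    qed auto
    also have "\<dots> = real CARD('m) * norm v" by (simp add: prob_space)
    also have "\<dots> \<le> real CARD('m) * norm v / c"
      using c by (simp add: pos_le_divide_eq mult_left_le)
    finally show "\<bar>expectation (\<lambda>\<omega>. partial j (partial i h) (y + v + c *\<^sub>R X \<omega>)) - expectation (\<lambda>\<omega>. partial j (partial i h) (y + c *\<^sub>R X \<omega>))\<bar> \<le> real CARD('m) * norm v / c" .
  qed auto
qed

text \<open>The smoothing is \<open>expectation_shift_bound\<close> for x -> h2 (y + c x), shifted
  by v / c; this is where the loss 1/c comes from. Directions must lie in the range of
  \<open>C\<close>, with control on a preimage.\<close>

lemma smooth_test_H2:
  assumes h: "h \<in> H2" and scale: "\<And>v u. v \<in> V \<Longrightarrow> 0 \<le> u \<Longrightarrow> u *\<^sub>R v \<in> V" and L: "0 \<le> L"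
    and V: "\<And>v. v \<in> V \<Longrightarrow> \<exists>w. v = C *v w \<and> sqrt (w \<bullet> v) \<le> L * norm v"
  shows "smooth_test N X C h (\<lambda>i. partial i h) (\<lambda>i j. partial j (partial i h)) V L"
proof -
  have "C_k (Suc (Suc 0)) h" using h by (simp add: H2_def numeral_2_eq_2)
  note Ck = C_k_2_simps[OF this]
  have c2: "continuous_on UNIV (partial j (partial i h))" for i j using Ck(3)[of j i] by simp
  have b2: "\<bar>partial j (partial i h) x\<bar> \<le> 1" for i j x
  proof -
    have "ereal (onorm (\<lambda>v. hessian h x *v v)) \<le> (SUP x. ereal (onorm (\<lambda>v. hessian h x *v v)))" by (rule SUP_upper) simp
    also have "\<dots> \<le> 1" using h by (simp add: H2_def)
    finally have on: "onorm (\<lambda>v. hessian h x *v v) \<le> 1" by (simp add: one_ereal_def)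
    have "partial j (partial i h) x = (hessian h x *v axis i 1) $ j"
      by (simp add: matrix_vector_mult_basis column_def hessian_def)
    also have "\<bar>\<dots>\<bar> \<le> norm (hessian h x *v axis i 1)" by (rule component_le_norm_cart)
    also have "\<dots> \<le> onorm (\<lambda>v. hessian h x *v v) * norm (axis i 1 :: real ^ 'm)"
      by (intro onorm matrix_vector_mul_bounded_linear)
    also have "\<dots> \<le> 1" using on by simp
    finally show ?thesis .
  qed
  show ?thesis
  proof
    show "(h has_derivative (\<lambda>v. \<Sum>i\<in>UNIV. v $ i * partial i h x)) (at x)" for x
      by (rule has_derivative_partial[OF Ck(1)])
    show "(partial i h has_derivative (\<lambda>v. \<Sum>j\<in>UNIV. v $ j * partial j (partial i h) x)) (at x)" for i x
      by (rule has_derivative_partial[OF Ck(2)])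
    fix v :: "real ^ 'm" and y c i j assume v: "v \<in> V" and c: "0 < c" "c \<le> (1::real)"
    obtain w where w: "v = C *v w" "sqrt (w \<bullet> v) \<le> L * norm v" using V[OF v] by blast
    have w': "v /\<^sub>R c = C *v (w /\<^sub>R c)" using w by (simp add: matrix_vector_mult_scaleR)
    have "\<bar>expectation (\<lambda>\<omega>. (\<lambda>x. partial j (partial i h) (y + c *\<^sub>R x)) (X \<omega> + v /\<^sub>R c)) - expectation (\<lambda>\<omega>. (\<lambda>x. partial j (partial i h) (y + c *\<^sub>R x)) (X \<omega>))\<bar>
       \<le> 1 * sqrt ((w /\<^sub>R c) \<bullet> (v /\<^sub>R c))"
      by (rule expectation_shift_bound[OF w']) (auto intro!: b2 continuous_on_compose2[OF c2] continuous_intros)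
    also have "(w /\<^sub>R c) \<bullet> (v /\<^sub>R c) = (w \<bullet> v) / c\<^sup>2" by (simp add: power2_eq_square divide_inverse)
    also have "1 * sqrt ((w \<bullet> v) / c\<^sup>2) = sqrt (w \<bullet> v) / c" using c by (simp add: real_sqrt_divide)
    also have "\<dots> \<le> L * norm v / c" using w c by (intro divide_right_mono) auto
    finally show "\<bar>expectation (\<lambda>\<omega>. partial j (partial i h) (y + v + c *\<^sub>R X \<omega>)) - expectation (\<lambda>\<omega>. partial j (partial i h) (y + c *\<^sub>R X \<omega>))\<bar> \<le> L * norm v / c"
      using c by (simp add: scaleR_add_right add_ac)
  qed (use c2 b2 scale L in auto)
qed

text \<open>A symmetric matrix is injective on its range, hence bounded below there by some e > 0. A
  preimage w of v that lies in the range itself then satisfies |w| <= |v| / e, so w \<bullet> v <=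
  |v|^2 / e.\<close>

lemma range_covariance:
  obtains L where "L \<ge> 0" "\<And>v. v \<in> range ((*v) C) \<Longrightarrow> \<exists>w. v = C *v w \<and> sqrt (w \<bullet> v) \<le> L * norm v"
proof -
  let ?V = "range ((*v) C)"
  have sub: "subspace ?V"
    by (intro linear_subspace_image matrix_vector_mul_linear subspace_UNIV)
  have null: "C *v z = 0" if "\<And>u. z \<bullet> (C *v u) = 0" for z
  proof -
    have "(C *v z) \<bullet> (C *v z) = z \<bullet> (C *v (C *v z))" by (rule cov_symmetric)
    then show ?thesis using that by simp
  qed
  have inj: "x = 0" if xV: "x \<in> ?V" and x0: "C *v x = 0" for x
  proof -
    obtain y where "x = C *v y" using xV by auto
    then have "x \<bullet> x = y \<bullet> (C *v x)" using cov_symmetric[of x y] by simp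
    then show ?thesis using x0 by simp
  qed
  have "\<exists>e>0. \<forall>x\<in>?V. norm (C *v x) \<ge> e * norm x"
    by (rule injective_imp_isometric[OF closed_subspace[OF sub] sub matrix_vector_mul_bounded_linear]) (use inj in blast)
  then obtain e where e: "e > 0" "\<And>x. x \<in> ?V \<Longrightarrow> norm (C *v x) \<ge> e * norm x"
    by blast
  show ?thesis
  proof (rule that[of "1 / sqrt e"])
    fix v assume "v \<in> ?V"
    then obtain x where x: "v = C *v x" by auto
    obtain y z where yz: "y \<in> span ?V" "\<And>w. w \<in> span ?V \<Longrightarrow> orthogonal z w" "x = y + z"
      using orthogonal_subspace_decomp_exists[of ?V x] by blast
    have sp: "span ?V = ?V" by (rule span_eq_iff[THEN iffD2, OF sub])
    have yV: "y \<in> ?V" by (rule yz(1)[unfolded sp])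
    have "C *v z = 0"
    proof (rule null)
      fix u show "z \<bullet> (C *v u) = 0" using yz(2)[OF span_base, of "C *v u"] by (simp add: orthogonal_def)
    qed
    then have vy: "v = C *v y" using x yz(3) by (simp add: matrix_vector_right_distrib)
    have "y \<bullet> v \<le> norm y * norm v" by (rule norm_cauchy_schwarz)
    also have "\<dots> \<le> (norm v / e) * norm v"
      using e(2)[OF yV] e(1) vy by (intro mult_right_mono) (auto simp: field_simps)
    also have "\<dots> = (norm v / sqrt e)\<^sup>2" using e by (simp add: power_divide power2_eq_square)
    finally have "sqrt (y \<bullet> v) \<le> norm v / sqrt e" using e by (intro real_le_lsqrt) auto
    then show "\<exists>w. v = C *v w \<and> sqrt (w \<bullet> v) \<le> 1 / sqrt e * norm v" using vy by auto
  qed (use e in auto)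
qed

text \<open>The component of v orthogonal to the range is annihilated by the symmetric matrix
  \<open>C\<close>, so by assumption it is orthogonal to v and hence zero.\<close>

lemma orthogonal_to_null_in_range:
  assumes "\<And>z. C *v z = 0 \<Longrightarrow> z \<bullet> v = 0"
  shows "v \<in> range ((*v) C)"
proof -
  let ?V = "range ((*v) C)"
  have sub: "subspace ?V"
    by (intro linear_subspace_image matrix_vector_mul_linear subspace_UNIV)
  obtain y z where yz: "y \<in> span ?V" "\<And>w. w \<in> span ?V \<Longrightarrow> orthogonal z w" "v = y + z"
    using orthogonal_subspace_decomp_exists[of ?V v] by blast
  have "(C *v z) \<bullet> (C *v z) = z \<bullet> (C *v (C *v z))" by (rule cov_symmetric)
  also have "\<dots> = 0" using yz(2)[OF span_base, of "C *v (C *v z)"] by (simp add: orthogonal_def)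
  finally have "z \<bullet> v = 0" using assms by simp
  moreover have "z \<bullet> y = 0" using yz(1,2) by (auto simp: orthogonal_def)
  ultimately have "z = 0" using yz(3) by (simp add: inner_add_right)
  then have "v = y" using yz(3) by simp
  moreover have "span ?V = ?V" by (rule span_eq_iff[THEN iffD2, OF sub])
  ultimately show ?thesis using yz(1) by (simp only:)
qed

end

section \<open>Grid approximation of point configurations\<close>

definition cell :: "nat \<Rightarrow> real ^ 'd::finite \<Rightarrow> int ^ 'd" where "cell n x = (\<chi> i. \<lfloor>2 ^ n * x $ i\<rfloor>)"
definition corner :: "nat \<Rightarrow> int ^ 'd::finite \<Rightarrow> real ^ 'd" where "corner n z = (\<chi> i. of_int (z $ i) / 2 ^ n)"
abbreviation grid_pt :: "nat \<Rightarrow> real ^ 'd::finite \<Rightarrow> real ^ 'd" where "grid_pt n x \<equiv> corner n (cell n x)"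

lemma grid_pt_close: "norm (grid_pt n x - x) \<le> real CARD('d) / 2 ^ n" for x :: "real ^ 'd::finite"
proof -
  have "norm (grid_pt n x - x) \<le> (\<Sum>i\<in>UNIV. \<bar>(grid_pt n x - x) $ i\<bar>)" by (rule norm_le_l1_cart)
  also have "\<dots> \<le> (\<Sum>i\<in>(UNIV::'d set). 1 / 2 ^ n)"
  proof (intro sum_mono)
    fix i
    have "(grid_pt n x - x) $ i = (of_int \<lfloor>2 ^ n * x $ i\<rfloor> - 2 ^ n * x $ i) / 2 ^ n"
      by (simp add: corner_def cell_def field_simps)
    moreover have "\<bar>of_int \<lfloor>2 ^ n * x $ i\<rfloor> - 2 ^ n * x $ i\<bar> \<le> 1" by linarith
    ultimately show "\<bar>(grid_pt n x - x) $ i\<bar> \<le> 1 / 2 ^ n"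
      by (simp add: divide_right_mono)
  qed
  finally show ?thesis by simp
qed

lemma grid_dist: "\<bar>norm (grid_pt n x - grid_pt n y) - norm (x - y)\<bar> \<le> 2 * real CARD('d) / 2 ^ n" for x :: "real ^ 'd::finite"
proof -
  have "\<bar>norm (grid_pt n x - grid_pt n y) - norm (x - y)\<bar> \<le> norm ((grid_pt n x - grid_pt n y) - (x - y))"
    by (rule norm_triangle_ineq3)
  also have "\<dots> = norm ((grid_pt n x - x) - (grid_pt n y - y))" by (simp add: algebra_simps)
  also have "\<dots> \<le> norm (grid_pt n x - x) + norm (grid_pt n y - y)" by (rule norm_triangle_ineq4)
  also have "\<dots> \<le> 2 * real CARD('d) / 2 ^ n" using grid_pt_close[of n x] grid_pt_close[of n y] by simp
  finally show ?thesis .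
qed

definition edge_kernel :: "real \<Rightarrow> real \<Rightarrow> real \<Rightarrow> real" where
  "edge_kernel \<alpha> r u = (if 0 < u \<and> u < r then u powr \<alpha> else 0)"

text \<open>The margins at \<open>0\<close> and \<open>r\<close> are wider than the error of \<open>grid_dist\<close>; this gives both
  the domination by the kernel itself and the convergence at pairs with distance exactly \<open>r\<close>.\<close>

definition grid_kernel :: "nat \<Rightarrow> real \<Rightarrow> real \<Rightarrow> int ^ 'd::finite \<Rightarrow> int ^ 'd \<Rightarrow> real" where
  "grid_kernel n \<alpha> r z z' = (let u = norm (corner n z - corner n z'); g = 4 * real CARD('d) / 2 ^ n in
     if g \<le> u \<and> u < r - g then u powr \<alpha> else 0)"

lemma edge_kernel_nonneg: "0 \<le> edge_kernel \<alpha> r u" by (simp add: edge_kernel_def)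
lemma grid_kernel_nonneg: "0 \<le> grid_kernel n \<alpha> r z z'" by (simp add: grid_kernel_def Let_def)
lemma grid_kernel_sym: "grid_kernel n \<alpha> r z z' = grid_kernel n \<alpha> r z' z"
  by (simp add: grid_kernel_def norm_minus_commute)
lemma grid_kernel_diag: "grid_kernel n \<alpha> r z z = 0"
  by (simp add: grid_kernel_def Let_def)

lemma gap_tendsto: "(\<lambda>n. c / 2 ^ n) \<longlonglongrightarrow> (0::real)"
  using tendsto_mult_right_zero[OF LIMSEQ_power_zero[of "1/2::real"], of c] by (simp add: power_divide)

text \<open>The logarithms differ by at most ln 2 in either direction, so the sign of \<alpha> does
  not matter.\<close>

lemma powr_ratio_le:
  fixes u w \<alpha> :: real assumes "0 < u" "u \<le> 2 * w" "w \<le> 2 * u"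
  shows "u powr \<alpha> \<le> 2 powr \<bar>\<alpha>\<bar> * w powr \<alpha>"
proof -
  have w: "w > 0" using assms by linarith
  have "ln (u / w) \<le> ln 2" "ln (w / u) \<le> ln 2" using assms w by (auto simp: divide_le_eq)
  then have "\<bar>ln u - ln w\<bar> \<le> ln 2" using assms w by (simp add: ln_div)
  then have "\<alpha> * (ln u - ln w) \<le> \<bar>\<alpha>\<bar> * ln 2"
    using mult_left_mono[of "\<bar>ln u - ln w\<bar>" "ln 2" "\<bar>\<alpha>\<bar>"] abs_ge_self[of "\<alpha> * (ln u - ln w)"]
    unfolding abs_mult by linarith
  then have "\<alpha> * ln u \<le> \<bar>\<alpha>\<bar> * ln 2 + \<alpha> * ln w" by (simp add: algebra_simps)
  then have "exp (\<alpha> * ln u) \<le> exp (\<bar>\<alpha>\<bar> * ln 2 + \<alpha> * ln w)" by simp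
  then show ?thesis using assms w by (simp add: powr_def exp_add)
qed

lemma grid_kernel_le:
  fixes x y :: "real ^ 'd::finite"
  shows "grid_kernel n \<alpha> r (cell n x) (cell n y) \<le> 2 powr \<bar>\<alpha>\<bar> * edge_kernel \<alpha> r (norm (x - y))"
proof (cases "4 * real CARD('d) / 2 ^ n \<le> norm (grid_pt n x - grid_pt n y) \<and> norm (grid_pt n x - grid_pt n y) < r - 4 * real CARD('d) / 2 ^ n")
  case False
  then have "grid_kernel n \<alpha> r (cell n x) (cell n y) = 0" unfolding grid_kernel_def Let_def by (rule if_not_P)
  then show ?thesis using edge_kernel_nonneg[of \<alpha> r "norm (x - y)"] by simp
next
  case True
  define u where "u = norm (grid_pt n x - grid_pt n y)"
  define w where "w = norm (x - y)"
  define g where "g = real CARD('d) / 2 ^ n"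
  have g: "g > 0" by (simp add: g_def)
  have uw: "\<bar>u - w\<bar> \<le> 2 * g" using grid_dist[of n x y] by (simp add: u_def w_def g_def)
  have u: "4 * g \<le> u" "u < r - 4 * g" using True by (auto simp: u_def g_def)
  \<comment> \<open>From u >= 4 g and an error of at most 2 g, the distances u and w differ at most
    by a factor 2; the upper margin keeps w below r.\<close>
  have "u powr \<alpha> \<le> 2 powr \<bar>\<alpha>\<bar> * w powr \<alpha>" by (rule powr_ratio_le) (use uw u g in linarith)+
  moreover have "0 < w" "w < r" using uw u g by linarith+
  ultimately show ?thesis using True by (simp add: grid_kernel_def Let_def edge_kernel_def u_def w_def)
qed

lemma grid_kernel_tendsto:
  fixes x y :: "real ^ 'd::finite"
  shows "(\<lambda>n. grid_kernel n \<alpha> r (cell n x) (cell n y)) \<longlonglongrightarrow> edge_kernel \<alpha> r (norm (x - y))"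
proof -
  define w where "w = norm (x - y)"
  define u where "u n = norm (grid_pt n x - grid_pt n y)" for n
  define g where "g n = real CARD('d) / 2 ^ n" for n
  have g0: "g \<longlonglongrightarrow> 0" unfolding g_def by (rule gap_tendsto)
  have gpos: "g n > 0" for n by (simp add: g_def)
  have uw: "\<bar>u n - w\<bar> \<le> 2 * g n" for n using grid_dist[of n x y] by (simp add: u_def w_def g_def)
  have ulim: "u \<longlonglongrightarrow> w"
  proof (rule LIM_zero_cancel, rule Lim_null_comparison)
    show "eventually (\<lambda>n. norm (u n - w) \<le> 2 * g n) sequentially" using uw by simp
    show "(\<lambda>n. 2 * g n) \<longlonglongrightarrow> 0" using tendsto_mult_right_zero[OF g0] .
  qed
  have gk: "grid_kernel n \<alpha> r (cell n x) (cell n y) = (if 4 * g n \<le> u n \<and> u n < r - 4 * g n then u n powr \<alpha> else 0)" for n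
    by (simp add: grid_kernel_def Let_def u_def g_def)
  show ?thesis
  proof (cases "0 < w \<and> w < r")
    case True
    \<comment> \<open>6 g is the margin 4 g plus the discretisation error 2 g.\<close>
    have "eventually (\<lambda>n. 6 * g n < min w (r - w)) sequentially"
      using order_tendstoD(2)[OF tendsto_mult_right_zero[OF g0, of 6], of "min w (r - w)"] True by simp
    then have "eventually (\<lambda>n. u n powr \<alpha> = grid_kernel n \<alpha> r (cell n x) (cell n y)) sequentially"
    proof eventually_elim
      case (elim n)
      then show ?case unfolding gk using uw[of n] by (auto simp: min_def split: if_splits)
    qed
    moreover have "(\<lambda>n. u n powr \<alpha>) \<longlonglongrightarrow> w powr \<alpha>" using ulim True by (intro tendsto_intros) auto
    ultimately show ?thesis using True by (simp add: edge_kernel_def w_def tendsto_cong)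
  next
    case False
    have "grid_kernel n \<alpha> r (cell n x) (cell n y) = 0" for n
      unfolding gk using False uw[of n] gpos[of n] norm_ge_zero[of "x - y"] by (auto simp: w_def[symmetric])
    moreover have "edge_kernel \<alpha> r w = 0" using False by (auto simp: edge_kernel_def)
    ultimately show ?thesis by (simp add: w_def)
  qed
qed

lemma finite_cells:
  fixes W :: "(real ^ 'd::finite) set" assumes "bounded W" shows "finite (cell n ` W)"
proof -
  obtain B where B: "\<And>x. x \<in> W \<Longrightarrow> norm x \<le> B" using assms by (auto simp: bounded_iff)
  define S where "S = {\<lfloor>- (2 ^ n * B)\<rfloor>..\<lfloor>2 ^ n * B\<rfloor>}"
  have "cell n ` W \<subseteq> vec_lambda ` (PiE UNIV (\<lambda>_. S))"
  proof
    fix z assume "z \<in> cell n ` W"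
    then obtain x where x: "x \<in> W" "z = cell n x" by auto
    have "z $ i \<in> S" for i
    proof -
      have "\<bar>x $ i\<bar> \<le> B" using component_le_norm_cart[of x i] B[OF x(1)] by linarith
      then have "2 ^ n * x $ i \<le> 2 ^ n * B" "2 ^ n * (- B) \<le> 2 ^ n * x $ i"
        by (intro mult_left_mono; simp add: abs_le_iff)+
      then have "2 ^ n * x $ i \<le> 2 ^ n * B" "- (2 ^ n * B) \<le> 2 ^ n * x $ i" by simp_all
      then show ?thesis unfolding S_def x cell_def by (auto intro: floor_mono)
    qed
    then show "z \<in> vec_lambda ` (PiE UNIV (\<lambda>_. S))"
      by (intro image_eqI[of _ _ "vec_nth z"]) auto
  qed
  then show ?thesis by (rule finite_subset) (auto intro!: finite_imageI finite_PiE simp: S_def)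
qed

lemma cell_sets: "cell n -` {z} \<in> sets borel" for z :: "int ^ 'd::finite"
proof -
  have "cell n -` {z} = (\<Inter>i\<in>UNIV. {x. of_int (z $ i) \<le> 2 ^ n * x $ i \<and> 2 ^ n * x $ i < of_int (z $ i) + 1})"
    by (auto simp: cell_def vec_eq_iff floor_eq_iff)
  also have "\<dots> \<in> sets borel"
  proof (intro sets.finite_INT)
    fix i :: 'd
    have [measurable]: "(\<lambda>x :: real ^ 'd. x $ i) \<in> borel_measurable borel"
      by (intro borel_measurable_continuous_onI continuous_intros)
    show "{x :: real ^ 'd. of_int (z $ i) \<le> 2 ^ n * x $ i \<and> 2 ^ n * x $ i < of_int (z $ i) + 1} \<in> sets borel"
      by measurable
  qed auto
  finally show ?thesis .
qed

lemma eventually_cell_inj: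
  fixes P :: "(real ^ 'd::finite) set" assumes P: "finite P"
  shows "eventually (\<lambda>n. inj_on (cell n) P) sequentially"
proof -
  have "eventually (\<lambda>n. x \<noteq> y \<longrightarrow> cell n x \<noteq> cell n y) sequentially" for x y :: "real ^ 'd"
  proof (cases "x = y")
    case False
    have "eventually (\<lambda>n. 2 * real CARD('d) / 2 ^ n < norm (x - y)) sequentially"
      using order_tendstoD(2)[OF gap_tendsto] False by simp
    then show ?thesis
    proof eventually_elim
      case (elim n)
      then show ?case using grid_dist[of n x y] by auto
    qed
  qed simp
  then have "eventually (\<lambda>n. \<forall>x\<in>P. \<forall>y\<in>P. x \<noteq> y \<longrightarrow> cell n x \<noteq> cell n y) sequentially"
    by (intro eventually_ball_finite[OF P] ballI)
  then show ?thesis by eventually_elim (auto simp: inj_on_def)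
qed

section \<open>Integer-valued measures and their atoms\<close>

locale point_measure = sigma_finite_measure \<mu> for \<mu> :: "(real ^ 'd::finite) measure" +
  assumes sets_mu: "sets \<mu> = sets borel"
    and integer: "\<And>A. A \<in> sets borel \<Longrightarrow> emeasure \<mu> A \<in> insert \<infinity> (range of_nat)"
begin

lemma space_mu: "space \<mu> = UNIV" using sets_eq_imp_space_eq[OF sets_mu] by simp

lemma lt_one: "A \<in> sets borel \<Longrightarrow> emeasure \<mu> A < 1 \<Longrightarrow> emeasure \<mu> A = 0"
proof -
  assume A: "A \<in> sets borel" and l: "emeasure \<mu> A < 1"
  from integer[OF A] l obtain k where k: "emeasure \<mu> A = of_nat k" by auto
  have "k = 0"
  proof (rule ccontr)
    assume "k \<noteq> 0"
    then have "(of_nat 1 :: ennreal) \<le> of_nat k" by (intro of_nat_mono) simp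
    then show False using l k by simp
  qed
  then show ?thesis using k by simp
qed

text \<open>If \<open>A\<close> had no atom, every point would have a ball whose part in
  \<open>A\<close> has mass below 1, and an integer below 1 is 0. Finitely many such balls cover the
  compact closure of \<open>A\<close>.\<close>

lemma atom_exists:
  assumes A: "A \<in> sets borel" "bounded A" and fin: "emeasure \<mu> A < \<infinity>" and pos: "emeasure \<mu> A \<noteq> 0"
  shows "\<exists>x\<in>A. emeasure \<mu> {x} \<noteq> 0"
proof (rule ccontr)
  assume "\<not> ?thesis"
  then have zero: "emeasure \<mu> {x} = 0" if "x \<in> A" for x using that by auto
  have ball0: "\<exists>r>0. emeasure \<mu> (A \<inter> ball x r) = 0" for x
  proof -
    define B where "B n = A \<inter> ball x (1 / real (Suc n))" for n
    have Bs: "B n \<in> sets borel" for n using A by (auto simp: B_def)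
    have Int: "(\<Inter>n. B n) = A \<inter> {x}"
    proof -
      have "y = x" if "\<And>n. dist x y < 1 / real (Suc n)" for y
      proof (rule ccontr)
        assume "y \<noteq> x"
        then have "0 < dist x y" by simp
        then obtain n where "inverse (real (Suc n)) < dist x y" using reals_Archimedean by blast
        then show False using that[of n] by (simp add: inverse_eq_divide)
      qed
      then show ?thesis by (auto simp: B_def)
    qed
    have "emeasure \<mu> (A \<inter> {x}) = 0" using zero[of x] by (cases "x \<in> A") auto
    moreover have "(INF n. emeasure \<mu> (B n)) = emeasure \<mu> (\<Inter>n. B n)"
    proof (rule INF_emeasure_decseq)
      show "decseq B" unfolding decseq_def B_def
        by (intro allI impI Int_mono subset_ball order_refl) (simp add: frac_le)
      show "emeasure \<mu> (B n) \<noteq> \<infinity>" for n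
        using emeasure_mono[of "B n" A \<mu>] A fin sets_mu by (auto simp: B_def top.not_eq_extremum[symmetric] top_unique)
    qed (use Bs sets_mu in auto)
    ultimately have "(INF n. emeasure \<mu> (B n)) < 1" unfolding Int by simp
    then obtain n where "emeasure \<mu> (B n) < 1" by (auto simp: INF_less_iff)
    then have "emeasure \<mu> (B n) = 0" by (rule lt_one[OF Bs])
    then show ?thesis by (intro exI[of _ "1 / real (Suc n)"]) (auto simp: B_def)
  qed
  then obtain r where r: "\<And>x. r x > 0" "\<And>x. emeasure \<mu> (A \<inter> ball x (r x)) = 0" by metis
  have comp: "compact (closure A)" using A(2) by (simp add: compact_closure)
  have cov: "closure A \<subseteq> (\<Union>x\<in>closure A. ball x (r x))" using r(1) by fastforce
  obtain D where D: "D \<subseteq> closure A" "finite D" "closure A \<subseteq> (\<Union>x\<in>D. ball x (r x))"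
    by (rule compactE_image[OF comp _ cov]) auto
  have "A \<subseteq> (\<Union>x\<in>D. A \<inter> ball x (r x))" using D(3) closure_subset[of A] by blast
  moreover have null: "(\<Union>x\<in>D. A \<inter> ball x (r x)) \<in> null_sets \<mu>"
  proof (rule null_sets_UN'[OF countable_finite[OF D(2)]])
    fix x show "A \<inter> ball x (r x) \<in> null_sets \<mu>"
      by (rule null_setsI[OF r(2)]) (use A(1) in \<open>auto simp: sets_mu\<close>)
  qed
  ultimately have "A \<in> null_sets \<mu>" using A(1) sets_mu by (intro null_sets_subset[OF null]) auto
  then show False using pos by (simp add: null_sets_def)
qed

context
  fixes W :: "(real ^ 'd) set"
  assumes W: "W \<in> sets borel" "bounded W"
begin

definition atoms :: "(real ^ 'd) set" where "atoms = points \<mu> \<inter> W"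

lemma atoms_alt: "atoms = {x \<in> W. emeasure \<mu> {x} \<noteq> 0}"
  by (auto simp: atoms_def points_def space_mu)

lemma atom_ge_1: "x \<in> atoms \<Longrightarrow> 1 \<le> emeasure \<mu> {x}"
  using lt_one[of "{x}"] by (auto simp: atoms_alt intro: leI)

lemma no_atoms_null:
  assumes "B \<in> sets borel" "B \<subseteq> W" "emeasure \<mu> B < \<infinity>" "B \<inter> atoms = {}" shows "emeasure \<mu> B = 0"
proof (rule ccontr)
  assume "emeasure \<mu> B \<noteq> 0"
  then obtain x where "x \<in> B" "emeasure \<mu> {x} \<noteq> 0"
    using atom_exists[OF assms(1) bounded_subset[OF W(2) assms(2)] assms(3)] by blast
  then show False using assms by (auto simp: atoms_alt)
qed

lemma finite_atoms:
  assumes fin: "emeasure \<mu> W < \<infinity>" shows "finite atoms"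
proof (rule ccontr)
  assume inf: "infinite atoms"
  obtain k where k: "emeasure \<mu> W = of_nat k" using integer[OF W(1)] fin by auto
  obtain Q where Q: "Q \<subseteq> atoms" "finite Q" "card Q = Suc k" using infinite_arbitrarily_large[OF inf] by blast
  have "of_nat (Suc k) \<le> (\<Sum>x\<in>Q. emeasure \<mu> {x})"
    using sum_mono[of Q "\<lambda>_. 1::ennreal" "\<lambda>x. emeasure \<mu> {x}"] Q atom_ge_1 by auto
  also have "\<dots> = emeasure \<mu> Q" using Q(2) sets_mu by (intro emeasure_eq_sum_singleton[symmetric]) auto
  also have "\<dots> \<le> emeasure \<mu> W" using Q W sets_mu by (intro emeasure_mono) (auto simp: atoms_alt)
  finally have "(of_nat (Suc k) :: ennreal) \<le> of_nat k" unfolding k .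
  then show False by (simp only: of_nat_le_iff)
qed

lemma emeasure_atoms:
  assumes B: "B \<in> sets borel" "B \<subseteq> W" and fin: "emeasure \<mu> W < \<infinity>"
  shows "emeasure \<mu> B = (\<Sum>x\<in>B \<inter> atoms. emeasure \<mu> {x})"
proof -
  have fa: "finite (B \<inter> atoms)" using finite_atoms[OF fin] by simp
  have s: "B \<inter> atoms \<in> sets borel" "B - atoms \<in> sets borel"
    using finite_atoms[OF fin] B by (auto intro: finite_imp_closed borel_closed)
  have "emeasure \<mu> B \<le> emeasure \<mu> W" using B W sets_mu by (intro emeasure_mono) auto
  then have "emeasure \<mu> (B - atoms) < \<infinity>"
    using fin emeasure_mono[of "B - atoms" B \<mu>] B sets_mu by (auto intro: le_less_trans)
  then have "emeasure \<mu> (B - atoms) = 0" using s B by (intro no_atoms_null) auto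
  moreover have "emeasure \<mu> B = emeasure \<mu> (B \<inter> atoms) + emeasure \<mu> (B - atoms)"
    using s sets_mu by (subst plus_emeasure) (auto intro: arg_cong[of _ _ "emeasure \<mu>"])
  moreover have "emeasure \<mu> (B \<inter> atoms) = (\<Sum>x\<in>B \<inter> atoms. emeasure \<mu> {x})"
    using fa sets_mu by (intro emeasure_eq_sum_singleton) auto
  ultimately show ?thesis by simp
qed

text \<open>By \<sigma>-finiteness each atom has finite mass and the part of W off the atoms is
  null, so finitely many atoms would give finite mass.\<close>

lemma infinite_atoms:
  assumes inf: "emeasure \<mu> W = \<infinity>" shows "infinite atoms"
proof
  assume fin: "finite atoms"
  obtain A :: "nat \<Rightarrow> (real ^ 'd) set" where A: "range A \<subseteq> sets \<mu>" "(\<Union>i. A i) = space \<mu>" "\<And>i. emeasure \<mu> (A i) \<noteq> \<infinity>"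
    by (rule sigma_finite, blast)
  have As: "A i \<in> sets borel" for i using A(1) sets_mu by auto
  have fs: "atoms \<in> sets borel" using fin by (auto intro: finite_imp_closed borel_closed)
  have n: "emeasure \<mu> ((W \<inter> A i) - atoms) = 0" for i
  proof (rule no_atoms_null)
    have "emeasure \<mu> ((W \<inter> A i) - atoms) \<le> emeasure \<mu> (A i)"
      using A(1) As W sets_mu by (intro emeasure_mono) auto
    then show "emeasure \<mu> ((W \<inter> A i) - atoms) < \<infinity>" using A(3)[of i] by (auto simp: less_top[symmetric] top_unique)
  qed (use As W fs in auto)
  have "W - atoms = (\<Union>i. (W \<inter> A i) - atoms)" using A(2) space_mu by auto
  moreover have "emeasure \<mu> (\<Union>i. (W \<inter> A i) - atoms) = 0"
    using n As W fs sets_mu by (intro emeasure_UN_eq_0) auto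
  ultimately have 0: "emeasure \<mu> (W - atoms) = 0" by simp
  have "emeasure \<mu> {x} < \<infinity>" for x
  proof -
    obtain i where "x \<in> A i" using A(2) space_mu by auto
    then have "emeasure \<mu> {x} \<le> emeasure \<mu> (A i)" using A(1) by (intro emeasure_mono) auto
    then show ?thesis using A(3)[of i] by (auto simp: less_top[symmetric] top_unique)
  qed
  then have "(\<Sum>x\<in>atoms. emeasure \<mu> {x}) < \<infinity>" using fin by simp
  moreover have "emeasure \<mu> atoms = (\<Sum>x\<in>atoms. emeasure \<mu> {x})" using fin sets_mu by (intro emeasure_eq_sum_singleton) auto
  moreover have "emeasure \<mu> W = emeasure \<mu> atoms + emeasure \<mu> (W - atoms)"
    using fs W sets_mu by (subst plus_emeasure) (auto simp: atoms_alt intro: arg_cong[of _ _ "emeasure \<mu>"])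
  ultimately show False using inf 0 by simp
qed

lemma edge_sum_finite:
  assumes fin: "finite atoms"
  shows "edge_sum W r \<alpha> \<mu> = 1 / 2 * (\<Sum>x\<in>atoms. \<Sum>y\<in>atoms. edge_kernel \<alpha> r (norm (x - y)))"
proof -
  have "(\<Sum>(x, y) \<in> {(x, y) \<in> atoms \<times> atoms. 0 < norm (x - y) \<and> norm (x - y) < r}. norm (x - y) powr \<alpha>)
     = (\<Sum>(x, y) \<in> atoms \<times> atoms. edge_kernel \<alpha> r (norm (x - y)))"
    by (rule sum.mono_neutral_cong_left) (use fin in \<open>auto simp: edge_kernel_def split: if_splits\<close>)
  also have "\<dots> = (\<Sum>x\<in>atoms. \<Sum>y\<in>atoms. edge_kernel \<alpha> r (norm (x - y)))"
    by (rule sum.cartesian_product[symmetric])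
  finally show ?thesis by (simp add: edge_sum_def atoms_def[symmetric])
qed

text \<open>By the pigeonhole principle one cell of a grid so fine that distances within a cell are
  below r contains infinitely many atoms. The index set of the sum is then infinite and
  \<open>sum\<close> takes its default value 0.\<close>

lemma edge_sum_infinite:
  assumes inf: "infinite atoms" and r: "r > 0"
  shows "edge_sum W r \<alpha> \<mu> = 0"
proof -
  have "eventually (\<lambda>n. 2 * real CARD('d) / 2 ^ n < r) sequentially"
    using order_tendstoD(2)[OF gap_tendsto r] .
  then obtain n where n: "2 * real CARD('d) / 2 ^ n < r" by (auto simp: eventually_sequentially)
  have "cell n ` atoms \<subseteq> cell n ` W" by (auto simp: atoms_def)
  then have "finite (cell n ` atoms)" using finite_cells[OF W(2)] by (rule finite_subset)
  from pigeonhole_infinite[OF inf this] obtain a where a: "a \<in> atoms" "infinite {y \<in> atoms. cell n y = cell n a}" by auto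
  let ?Y = "{y \<in> atoms. cell n y = cell n a} - {a}"
  have "Pair a ` ?Y \<subseteq> {(x, y) \<in> atoms \<times> atoms. 0 < norm (x - y) \<and> norm (x - y) < r}"
  proof (rule image_subsetI)
    fix y assume "y \<in> ?Y"
    then show "(a, y) \<in> {(x, y) \<in> atoms \<times> atoms. 0 < norm (x - y) \<and> norm (x - y) < r}"
      using grid_dist[of n a y] n a(1) by auto
  qed
  moreover have "infinite (Pair a ` ?Y)"
  proof -
    have "infinite ?Y" using a(2) by simp
    moreover have "inj_on (Pair a) ?Y" by (auto simp: inj_on_def)
    ultimately show ?thesis using finite_imageD by blast
  qed
  ultimately have "infinite {(x, y) \<in> atoms \<times> atoms. 0 < norm (x - y) \<and> norm (x - y) < r}"
    using finite_subset by blast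
  then show ?thesis by (simp add: edge_sum_def atoms_def[symmetric])
qed

lemma occupied_cell:
  assumes fin: "emeasure \<mu> W < \<infinity>"
  shows "emeasure \<mu> (W \<inter> cell n -` {z}) \<noteq> 0 \<longleftrightarrow> z \<in> cell n ` atoms"
proof -
  have "emeasure \<mu> (W \<inter> cell n -` {z}) = (\<Sum>x\<in>(W \<inter> cell n -` {z}) \<inter> atoms. emeasure \<mu> {x})"
    using cell_sets[of n z] W by (intro emeasure_atoms fin) auto
  also have "\<dots> = 0 \<longleftrightarrow> (W \<inter> cell n -` {z}) \<inter> atoms = {}"
    using finite_atoms[OF fin] by (subst sum_eq_0_iff) (auto simp: atoms_alt)
  finally show ?thesis by (auto simp: atoms_alt)
qed

text \<open>Occupied cells ignore multiplicities, just as \<open>edge_sum\<close> does, so this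
  covers every outcome of finite mass once the cells separate the atoms.\<close>

lemma sum_occupied:
  fixes g :: "int ^ 'd \<Rightarrow> real"
  assumes fin: "emeasure \<mu> W < \<infinity>" and inj: "inj_on (cell n) atoms"
  shows "(\<Sum>z\<in>cell n ` W. (if emeasure \<mu> (W \<inter> cell n -` {z}) \<noteq> 0 then 1 else 0) * g z) = (\<Sum>x\<in>atoms. g (cell n x))"
proof -
  have "(\<Sum>z\<in>cell n ` W. (if emeasure \<mu> (W \<inter> cell n -` {z}) \<noteq> 0 then 1 else 0) * g z) = (\<Sum>z\<in>cell n ` atoms. g z)"
    unfolding occupied_cell[OF fin]
    by (rule sum.mono_neutral_cong_right) (use finite_cells[OF W(2)] in \<open>auto simp: atoms_alt\<close>)
  also have "\<dots> = (\<Sum>x\<in>atoms. g (cell n x))" using inj by (simp add: sum.reindex)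
  finally show ?thesis .
qed

text \<open>Counts see multiplicities, so all atoms must have mass one; in return the identity holds
  at every grid level.\<close>

lemma sum_counts:
  fixes g :: "int ^ 'd \<Rightarrow> real"
  assumes fin: "emeasure \<mu> W < \<infinity>" and simple: "\<And>x. x \<in> W \<Longrightarrow> emeasure \<mu> {x} \<le> 1"
  shows "(\<Sum>z\<in>cell n ` W. real (nat \<lfloor>enn2real (emeasure \<mu> (W \<inter> cell n -` {z}))\<rfloor>) * g z) = (\<Sum>x\<in>atoms. g (cell n x))"
proof -
  have one: "emeasure \<mu> {x} = 1" if "x \<in> atoms" for x
    using simple[of x] atom_ge_1[OF that] that by (intro antisym) (auto simp: atoms_alt)
  have c: "real (nat \<lfloor>enn2real (emeasure \<mu> (W \<inter> cell n -` {z}))\<rfloor>) = real (card {x\<in>atoms. cell n x = z})" for z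
  proof -
    have "emeasure \<mu> (W \<inter> cell n -` {z}) = (\<Sum>x\<in>(W \<inter> cell n -` {z}) \<inter> atoms. emeasure \<mu> {x})"
      using cell_sets[of n z] W by (intro emeasure_atoms fin) auto
    also have "\<dots> = of_nat (card ((W \<inter> cell n -` {z}) \<inter> atoms))" using one by simp
    also have "(W \<inter> cell n -` {z}) \<inter> atoms = {x\<in>atoms. cell n x = z}" by (auto simp: atoms_alt)
    finally show ?thesis by simp
  qed
  have "(\<Sum>z\<in>cell n ` W. real (card {x\<in>atoms. cell n x = z}) * g z) = (\<Sum>z\<in>cell n ` W. \<Sum>x\<in>{x\<in>atoms. cell n x = z}. g (cell n x))"
    by (intro sum.cong refl) simp
  also have "\<dots> = (\<Sum>x\<in>atoms. g (cell n x))"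
    by (rule sum.group) (use finite_atoms[OF fin] finite_cells[OF W(2)] in \<open>auto simp: atoms_alt\<close>)
  finally show ?thesis unfolding c .
qed

end

end

text \<open>Bridges the numbering in the independence axiom of \<open>poisson_measure\<close> and
  the cells, which are indexed by integer vectors.\<close>

lemma (in prob_space) indep_vars_reindex_bij:
  assumes e: "bij_betw e K I" and ind: "indep_vars (\<lambda>_. S) (\<lambda>i. X (e i)) K"
  shows "indep_vars (\<lambda>_. S) X I"
proof -
  let ?G = "\<lambda>i. sigma_sets (space M) {X i -` A \<inter> space M |A. A \<in> sets S}"
  have I: "I = e ` K" and inj: "inj_on e K" using e by (auto simp: bij_betw_def)
  have rv: "\<forall>i\<in>K. random_variable S (X (e i))" and isets: "indep_sets (\<lambda>i. ?G (e i)) K"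
    using ind by (auto simp: indep_vars_def)
  show ?thesis unfolding indep_vars_def
  proof (intro conjI)
    show "\<forall>i\<in>I. random_variable S (X i)" using rv I by auto
    show "indep_sets ?G I" unfolding indep_sets_def
    proof (intro conjI allI impI ballI)
      show "?G i \<subseteq> events" if "i \<in> I" for i
        using isets that unfolding indep_sets_def I by auto
      fix J A assume J: "J \<subseteq> I" "J \<noteq> {}" "finite J" and A: "A \<in> Pi J ?G"
      define J' where "J' = {i \<in> K. e i \<in> J}"
      have J': "e ` J' = J" "inj_on e J'" "J' \<subseteq> K"
        using J(1) I inj by (auto simp: J'_def inj_on_def)
      have "finite J'" "J' \<noteq> {}" using J J' finite_image_iff by fastforce+
      moreover have "(\<lambda>i. A (e i)) \<in> Pi J' (\<lambda>i. ?G (e i))" using A J' by auto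
      ultimately have "prob (\<Inter>i\<in>J'. A (e i)) = (\<Prod>i\<in>J'. prob (A (e i)))"
        using isets J'(3) unfolding indep_sets_def by blast
      moreover have "(\<Inter>i\<in>J'. A (e i)) = (\<Inter>j\<in>J. A j)" unfolding J'(1)[symmetric] by simp
      moreover have "(\<Prod>i\<in>J'. prob (A (e i))) = (\<Prod>j\<in>J. prob (A j))"
        unfolding J'(1)[symmetric] by (simp add: prod.reindex[OF J'(2)])
      ultimately show "prob (\<Inter>j\<in>J. A j) = (\<Prod>j\<in>J. prob (A j))" by simp
    qed
  qed
qed

text \<open>The Poisson probabilities of the finite values already add up to one.\<close>

lemma (in poisson_measure) AE_finite_count:
  assumes A: "A \<in> sets \<Lambda>" "emeasure \<Lambda> A < \<infinity>"
  shows "AE \<omega> in M. emeasure (\<eta> \<omega>) A \<noteq> \<infinity>"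
proof -
  note [measurable] = measurable_eta[OF A(1)]
  define E where "E k = {\<omega> \<in> space M. emeasure (\<eta> \<omega>) A = of_nat k}" for k :: nat
  have E: "E k \<in> events" for k unfolding E_def by measurable
  have "(\<lambda>k. prob (E k)) sums prob (\<Union>k. E k)"
    by (rule finite_measure_UNION) (use E in \<open>auto simp: disjoint_family_on_def E_def\<close>)
  moreover have "(\<lambda>k. prob (E k)) sums 1"
  proof -
    have "(\<lambda>k. (measure \<Lambda> A ^ k /\<^sub>R fact k) * exp (- measure \<Lambda> A)) sums (exp (measure \<Lambda> A) * exp (- measure \<Lambda> A))"
      by (intro sums_mult2 exp_converges)
    then show ?thesis by (simp add: E_def poisson_finite[OF A] exp_minus divide_inverse mult.commute)
  qed
  ultimately have "prob (\<Union>k. E k) = 1" by (rule sums_unique2)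
  then have "AE \<omega> in M. \<omega> \<in> (\<Union>k. E k)" using E by (subst (asm) prob_eq_1) auto
  then show ?thesis by eventually_elim (auto simp: E_def)
qed

section \<open>A Poisson process seen through the grid\<close>

locale poisson_window = poisson_measure M \<eta> "scale_measure (ennreal t) lborel"
  for M :: "'w measure" and \<eta> :: "'w \<Rightarrow> (real ^ 'd::finite) measure" and t :: real +
  fixes W :: "(real ^ 'd) set"
  assumes t_pos: "0 < t" and W_compact: "compact W"
begin

definition I :: "nat \<Rightarrow> (int ^ 'd) set" where "I n = cell n ` W"
definition Wc :: "nat \<Rightarrow> int ^ 'd \<Rightarrow> (real ^ 'd) set" where "Wc n z = W \<inter> cell n -` {z}"
text \<open>An infinite mass is read as the count 0; by \<open>AE_finite_window\<close> this happens
  on a null set only.\<close>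

definition cnt :: "nat \<Rightarrow> int ^ 'd \<Rightarrow> 'w \<Rightarrow> nat" where "cnt n z \<omega> = nat \<lfloor>enn2real (emeasure (\<eta> \<omega>) (Wc n z))\<rfloor>"
definition lam :: "nat \<Rightarrow> int ^ 'd \<Rightarrow> real" where "lam n z = t * measure lborel (Wc n z)"
definition grid_sum :: "nat \<Rightarrow> real \<Rightarrow> real \<Rightarrow> 'w \<Rightarrow> real" where
  "grid_sum n \<alpha> r \<omega> = 1 / 2 * (\<Sum>z\<in>I n. real (cnt n z \<omega>) * (\<Sum>z'\<in>I n. grid_kernel n \<alpha> r z z' * real (cnt n z' \<omega>)))"

lemma W_borel: "W \<in> sets borel" and W_bounded: "bounded W"
  using W_compact by (auto intro: borel_compact compact_imp_bounded)

lemma finite_I: "finite (I n)" unfolding I_def by (rule finite_cells[OF W_bounded])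

lemma Wc_borel[measurable]: "Wc n z \<in> sets borel" unfolding Wc_def using cell_sets W_borel by blast

lemma emeasure_W: "emeasure lborel W < \<infinity>" using emeasure_compact_finite[OF W_compact] .

lemma emeasure_Wc: "emeasure lborel (Wc n z) < \<infinity>"
proof -
  have "emeasure lborel (Wc n z) \<le> emeasure lborel W"
    using W_borel by (intro emeasure_mono) (auto simp: Wc_def)
  then show ?thesis using emeasure_W by (rule le_less_trans)
qed

lemma Wc_Union: "(\<Union>z\<in>I n. Wc n z) = W" by (auto simp: Wc_def I_def)

lemma lam_nonneg: "0 \<le> lam n z" using t_pos by (simp add: lam_def)

lemma measure_scaled: "measure (scale_measure (ennreal t) lborel) A = t * measure lborel A"
  using t_pos by (simp add: measure_scale_measure)

lemma emeasure_eta_measurable: "A \<in> sets borel \<Longrightarrow> (\<lambda>\<omega>. emeasure (\<eta> \<omega>) A) \<in> borel_measurable M"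
  by (rule measurable_eta) simp

lemma AE_finite_window: "A \<in> sets borel \<Longrightarrow> emeasure lborel A < \<infinity> \<Longrightarrow> AE \<omega> in M. emeasure (\<eta> \<omega>) A \<noteq> \<infinity>"
  by (rule AE_finite_count) (auto simp: ennreal_mult_less_top)

lemma prob_count:
  assumes A: "A \<in> sets borel" "emeasure lborel A < \<infinity>"
  shows "prob {\<omega> \<in> space M. emeasure (\<eta> \<omega>) A = of_nat k} = (t * measure lborel A) ^ k / fact k * exp (- (t * measure lborel A))"
  using poisson_finite[of A k] A by (simp add: measure_scaled ennreal_mult_less_top)

lemma indep_poisson_grid: "indep_poisson M (I n) (cnt n) (lam n)"
proof unfold_locales
  show "finite (I n)" by (rule finite_I)
  show "0 \<le> lam n z" for z by (rule lam_nonneg)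
  obtain e where e: "bij_betw e {..<card (I n)} (I n)"
    using ex_bij_betw_nat_finite[OF finite_I[of n]] by (auto simp: atLeast0LessThan)
  have "indep_vars (\<lambda>_. borel) (\<lambda>i \<omega>. emeasure (\<eta> \<omega>) (Wc n (e i))) {..<card (I n)}"
  proof (rule independent)
    show "disjoint_family_on (\<lambda>i. Wc n (e i)) {..<card (I n)}"
      using e by (auto simp: disjoint_family_on_def Wc_def bij_betw_def dest: inj_onD)
  qed simp
  then have "indep_vars (\<lambda>_. borel) (\<lambda>z \<omega>. emeasure (\<eta> \<omega>) (Wc n z)) (I n)"
    using indep_vars_reindex_bij[OF e, of borel "\<lambda>z \<omega>. emeasure (\<eta> \<omega>) (Wc n z)"] by simp
  then have "indep_vars (\<lambda>_. count_space UNIV) (\<lambda>z \<omega>. nat \<lfloor>enn2real (emeasure (\<eta> \<omega>) (Wc n z))\<rfloor>) (I n)"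
    by (rule indep_vars_compose2[where Y="\<lambda>_ x. nat \<lfloor>enn2real x\<rfloor>"]) measurable
  then show "indep_vars (\<lambda>_. count_space UNIV) (cnt n) (I n)" unfolding cnt_def[abs_def] .
  fix z k assume "z \<in> I n"
  note [measurable] = emeasure_eta_measurable[OF Wc_borel]
  have "prob {\<omega> \<in> space M. cnt n z \<omega> = k} = prob {\<omega> \<in> space M. emeasure (\<eta> \<omega>) (Wc n z) = of_nat k}"
  proof (rule finite_measure_eq_AE)
    show "AE \<omega> in M. \<omega> \<in> {\<omega> \<in> space M. cnt n z \<omega> = k} \<longleftrightarrow> \<omega> \<in> {\<omega> \<in> space M. emeasure (\<eta> \<omega>) (Wc n z) = of_nat k}"
      using AE_finite_window[OF Wc_borel[of n z] emeasure_Wc[of n z]] AE_space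
    proof eventually_elim
      case (elim \<omega>)
      then obtain j where "emeasure (\<eta> \<omega>) (Wc n z) = of_nat j"
        using integer_valued[of \<omega> "Wc n z"] by auto
      then show ?case by (simp add: cnt_def)
    qed
    show "{\<omega> \<in> space M. cnt n z \<omega> = k} \<in> events" unfolding cnt_def by measurable
    show "{\<omega> \<in> space M. emeasure (\<eta> \<omega>) (Wc n z) = of_nat k} \<in> events" by measurable
  qed
  then show "prob {\<omega> \<in> space M. cnt n z \<omega> = k} = lam n z ^ k / fact k * exp (- lam n z)"
    by (simp add: prob_count[OF Wc_borel emeasure_Wc] lam_def)
qed

lemma lam_sum:
  fixes f :: "int ^ 'd \<Rightarrow> real"
  shows "(\<Sum>z\<in>I n. lam n z * f z) = t * (\<integral>y. indicator W y * f (cell n y) \<partial>lborel)"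
proof -
  have "indicator W y * f (cell n y) = (\<Sum>z\<in>I n. f z * indicator (Wc n z) y)" for y
  proof (cases "y \<in> W")
    case True
    then have "(\<Sum>z\<in>I n. f z * indicator (Wc n z) y) = (\<Sum>z\<in>{cell n y}. f z * indicator (Wc n z) y)"
      by (intro sum.mono_neutral_right finite_I) (auto simp: I_def Wc_def)
    then show ?thesis using True by (simp add: Wc_def)
  qed (simp add: Wc_def)
  moreover have "integrable lborel (indicat_real (Wc n z))" for z
    using emeasure_Wc by (intro integrable_real_indicator) auto
  ultimately have "(\<integral>y. indicator W y * f (cell n y) \<partial>lborel) = (\<Sum>z\<in>I n. f z * measure lborel (Wc n z))"
    by simp
  then show ?thesis by (simp add: lam_def sum_distrib_left mult_ac)
qed

lemma sum_lam: "(\<Sum>z\<in>I n. lam n z) = t * measure lborel W"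
  using lam_sum[of n "\<lambda>_. 1"] by simp

lemma point_measure_eta: "\<omega> \<in> space M \<Longrightarrow> point_measure (\<eta> \<omega>)"
  using sets_eta[of \<omega>] sigma_finite_eta[of \<omega>] integer_valued[of \<omega>]
  by (simp add: point_measure_def point_measure_axioms_def)

text \<open>A cell lies in a cube of volume 2^(-n d); the cruder 2^(-n) is enough for
  \<open>AE_simple\<close>.\<close>

lemma lam_le: "lam n z \<le> t / 2 ^ n"
proof -
  define a b where "a = corner n z" and "b = (\<chi> i. corner n z $ i + 1 / 2 ^ n)"
  have sub: "Wc n z \<subseteq> cbox a b"
  proof
    fix x assume "x \<in> Wc n z"
    then have fl: "\<lfloor>2 ^ n * x $ i\<rfloor> = z $ i" for i by (auto simp: Wc_def cell_def)
    have c: "of_int (z $ i) \<le> 2 ^ n * x $ i" "2 ^ n * x $ i \<le> of_int (z $ i) + 1" for i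
      using fl[of i] by linarith+
    have "a $ i \<le> x $ i \<and> x $ i \<le> b $ i" for i
      using c[of i] by (simp add: a_def b_def corner_def field_simps)
    then show "x \<in> cbox a b" by (simp add: mem_box_cart)
  qed
  have "measure lborel (Wc n z) \<le> measure lborel (cbox a b)"
    by (rule measure_mono_fmeasurable[OF sub]) auto
  also have "\<dots> = (1 / 2 ^ n) ^ CARD('d)"
    by (subst content_cbox_cart) (auto simp: a_def b_def interval_ne_empty_cart)
  also have "\<dots> \<le> (1 / 2 ^ n) ^ 1"
    by (intro power_decreasing) (auto simp: Suc_le_eq)
  finally have "t * measure lborel (Wc n z) \<le> t * (1 / 2 ^ n)" using t_pos by (intro mult_left_mono) auto
  then show ?thesis by (simp add: lam_def)
qed

text \<open>A cell holds two or more points with probability at most the square of its intensity,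
  and these squares add up to order 2^(-n). So almost surely there is a level at which every cell
  holds at most one point.\<close>

lemma AE_simple: "AE \<omega> in M. emeasure (\<eta> \<omega>) W < \<infinity> \<and> (\<forall>x\<in>W. emeasure (\<eta> \<omega>) {x} \<le> 1)"
proof -
  note [measurable] = emeasure_eta_measurable[OF Wc_borel]
  define E where "E n z = {\<omega> \<in> space M. emeasure (\<eta> \<omega>) (Wc n z) \<noteq> of_nat 0 \<and> emeasure (\<eta> \<omega>) (Wc n z) \<noteq> of_nat 1}" for n z
  have Em[measurable]: "E n z \<in> events" for n z unfolding E_def by measurable
  have pE: "prob (E n z) \<le> (lam n z)\<^sup>2" for n z
  proof -
    let ?A = "\<lambda>k. {\<omega> \<in> space M. emeasure (\<eta> \<omega>) (Wc n z) = of_nat k}"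
    have m: "?A k \<in> events" for k by measurable
    have "E n z = space M - (?A 0 \<union> ?A 1)" by (auto simp: E_def)
    then have "prob (E n z) = 1 - prob (?A 0 \<union> ?A 1)" using m[of 0] m[of 1] by (simp add: prob_compl)
    also have "prob (?A 0 \<union> ?A 1) = prob (?A 0) + prob (?A 1)"
      using m[of 0] m[of 1] by (intro finite_measure_Union) auto
    also have "\<dots> = exp (- lam n z) * (1 + lam n z)"
      unfolding prob_count[OF Wc_borel emeasure_Wc] lam_def by (simp add: algebra_simps)
    also have "1 - \<dots> \<le> (lam n z)\<^sup>2"
    proof -
      have "(1 - lam n z) * (1 + lam n z) \<le> exp (- lam n z) * (1 + lam n z)"
        using lam_nonneg[of n z] exp_ge_add_one_self[of "- lam n z"] by (intro mult_right_mono) auto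
      then show ?thesis by (simp add: algebra_simps power2_eq_square)
    qed
    finally show ?thesis .
  qed
  define B where "B n = (\<Union>z\<in>I n. E n z)" for n
  have Bm[measurable]: "B n \<in> events" for n unfolding B_def using finite_I by auto
  have pB: "prob (B n) \<le> (t * (t * measure lborel W)) / 2 ^ n" for n
  proof -
    have "prob (B n) \<le> (\<Sum>z\<in>I n. prob (E n z))"
      unfolding B_def by (rule finite_measure_subadditive_finite[OF finite_I]) auto
    also have "\<dots> \<le> (\<Sum>z\<in>I n. lam n z * (t / 2 ^ n))"
    proof (intro sum_mono order_trans[OF pE])
      fix z show "(lam n z)\<^sup>2 \<le> lam n z * (t / 2 ^ n)"
        unfolding power2_eq_square by (intro mult_left_mono lam_le lam_nonneg)
    qed
    also have "\<dots> = (t * (t * measure lborel W)) / 2 ^ n"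
      unfolding sum_distrib_right[symmetric] sum_lam by simp
    finally show ?thesis .
  qed
  have "prob (\<Inter>n. B n) \<le> 0"
  proof (rule LIMSEQ_le_const[OF gap_tendsto[of "t * (t * measure lborel W)"]], intro exI allI impI)
    fix n
    have "prob (\<Inter>n. B n) \<le> prob (B n)" by (intro finite_measure_mono) auto
    then show "prob (\<Inter>n. B n) \<le> (t * (t * measure lborel W)) / 2 ^ n" using pB[of n] by linarith
  qed
  then have "prob (\<Inter>n. B n) = 0" using measure_nonneg[of M] by (intro antisym)
  then have "AE \<omega> in M. \<omega> \<notin> (\<Inter>n. B n)" by (subst (asm) prob_eq_0) auto
  then show ?thesis using AE_space
  proof eventually_elim
    case (elim \<omega>)
    interpret point_measure "\<eta> \<omega>" by (rule point_measure_eta[OF elim(2)])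
    obtain n where n: "\<omega> \<notin> B n" using elim by auto
    then have le: "emeasure (\<eta> \<omega>) (Wc n z) \<le> 1" if "z \<in> I n" for z
      using that elim(2) by (auto simp: B_def E_def)
    have "emeasure (\<eta> \<omega>) W = emeasure (\<eta> \<omega>) (\<Union>z\<in>I n. Wc n z)" by (simp add: Wc_Union)
    also have "\<dots> \<le> (\<Sum>z\<in>I n. emeasure (\<eta> \<omega>) (Wc n z))"
      by (intro emeasure_subadditive_finite finite_I) (auto simp: sets_mu)
    also have "\<dots> \<le> (\<Sum>z\<in>I n. 1)" by (intro sum_mono le)
    also have "\<dots> < \<infinity>" by (simp add: of_nat_less_top)
    finally have 1: "emeasure (\<eta> \<omega>) W < \<infinity>" .
    have "emeasure (\<eta> \<omega>) {x} \<le> 1" if x: "x \<in> W" for x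
    proof -
      have "emeasure (\<eta> \<omega>) {x} \<le> emeasure (\<eta> \<omega>) (Wc n (cell n x))"
        using x by (intro emeasure_mono) (auto simp: Wc_def sets_mu cell_sets W_borel)
      also have "\<dots> \<le> 1" using x by (intro le) (auto simp: I_def)
      finally show ?thesis .
    qed
    with 1 show ?case by blast
  qed
qed

text \<open>The function must be measurable as it stands, also where points are multiple or the mass
  is infinite. Hence the limit of sums over occupied cells, with value 0 for infinite mass.\<close>

lemma edge_sum_measurable:
  assumes r: "r > 0"
  shows "(\<lambda>\<omega>. edge_sum W r \<alpha> (\<eta> \<omega>)) \<in> borel_measurable M"
proof -
  note [measurable] = emeasure_eta_measurable[OF Wc_borel] emeasure_eta_measurable[OF W_borel]
  define occ where "occ n z \<omega> = (if emeasure (\<eta> \<omega>) (Wc n z) \<noteq> 0 then 1 else 0 :: real)" for n z \<omega>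
  define u where "u n \<omega> = (if emeasure (\<eta> \<omega>) W < \<infinity> then 1 / 2 * (\<Sum>z\<in>I n. occ n z \<omega> * (\<Sum>z'\<in>I n. occ n z' \<omega> * grid_kernel n \<alpha> r z z')) else 0)" for n \<omega>
  show ?thesis
  proof (rule borel_measurable_LIMSEQ_real)
    have [measurable]: "occ n z \<in> borel_measurable M" for n z unfolding occ_def by measurable
    show "u n \<in> borel_measurable M" for n unfolding u_def by measurable
    fix \<omega> assume \<omega>: "\<omega> \<in> space M"
    interpret point_measure "\<eta> \<omega>" by (rule point_measure_eta[OF \<omega>])
    note pw = W_borel W_bounded
    show "(\<lambda>n. u n \<omega>) \<longlonglongrightarrow> edge_sum W r \<alpha> (\<eta> \<omega>)"
    proof (cases "emeasure (\<eta> \<omega>) W < \<infinity>")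
      case False
      then have "edge_sum W r \<alpha> (\<eta> \<omega>) = 0"
        by (intro edge_sum_infinite[OF pw] infinite_atoms[OF pw] r) (auto simp: top.not_eq_extremum[symmetric])
      then show ?thesis using False by (simp add: u_def)
    next
      case True
      define P where "P = atoms W"
      have fin: "finite P" unfolding P_def by (rule finite_atoms[OF pw True])
      have "eventually (\<lambda>n. 1 / 2 * (\<Sum>x\<in>P. \<Sum>y\<in>P. grid_kernel n \<alpha> r (cell n x) (cell n y)) = u n \<omega>) sequentially"
        using eventually_cell_inj[OF fin]
      proof eventually_elim
        case (elim n)
        have "u n \<omega> = 1 / 2 * (\<Sum>z\<in>I n. occ n z \<omega> * (\<Sum>y\<in>P. grid_kernel n \<alpha> r z (cell n y)))"
          using True sum_occupied[OF pw True elim[unfolded P_def]]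
          unfolding u_def occ_def I_def Wc_def P_def by simp
        also have "\<dots> = 1 / 2 * (\<Sum>x\<in>P. \<Sum>y\<in>P. grid_kernel n \<alpha> r (cell n x) (cell n y))"
          using sum_occupied[OF pw True elim[unfolded P_def]] unfolding occ_def I_def Wc_def P_def by simp
        finally show ?case ..
      qed
      moreover have "(\<lambda>n. 1 / 2 * (\<Sum>x\<in>P. \<Sum>y\<in>P. grid_kernel n \<alpha> r (cell n x) (cell n y))) \<longlonglongrightarrow> 1 / 2 * (\<Sum>x\<in>P. \<Sum>y\<in>P. edge_kernel \<alpha> r (norm (x - y)))"
        by (intro tendsto_intros grid_kernel_tendsto)
      moreover have "edge_sum W r \<alpha> (\<eta> \<omega>) = 1 / 2 * (\<Sum>x\<in>P. \<Sum>y\<in>P. edge_kernel \<alpha> r (norm (x - y)))"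
        unfolding P_def by (rule edge_sum_finite[OF pw finite_atoms[OF pw True]])
      ultimately show ?thesis by (simp only: Lim_transform_eventually)
    qed
  qed
qed

lemma AE_grid_sum:
  "AE \<omega> in M. (\<forall>n. 0 \<le> grid_sum n \<alpha> r \<omega> \<and> grid_sum n \<alpha> r \<omega> \<le> 2 powr \<bar>\<alpha>\<bar> * edge_sum W r \<alpha> (\<eta> \<omega>))
     \<and> (\<lambda>n. grid_sum n \<alpha> r \<omega>) \<longlonglongrightarrow> edge_sum W r \<alpha> (\<eta> \<omega>)"
  using AE_simple AE_space
proof eventually_elim
  case (elim \<omega>)
  interpret point_measure "\<eta> \<omega>" by (rule point_measure_eta[OF elim(2)])
  note pw = W_borel W_bounded
  have fW: "emeasure (\<eta> \<omega>) W < \<infinity>" and simple: "\<And>x. x \<in> W \<Longrightarrow> emeasure (\<eta> \<omega>) {x} \<le> 1" using elim by auto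
  define P where "P = atoms W"
  have fin: "finite P" unfolding P_def by (rule finite_atoms[OF pw fW])
  have es: "edge_sum W r \<alpha> (\<eta> \<omega>) = 1 / 2 * (\<Sum>x\<in>P. \<Sum>y\<in>P. edge_kernel \<alpha> r (norm (x - y)))"
    unfolding P_def by (rule edge_sum_finite[OF pw finite_atoms[OF pw fW]])
  have gs: "grid_sum n \<alpha> r \<omega> = 1 / 2 * (\<Sum>x\<in>P. \<Sum>y\<in>P. grid_kernel n \<alpha> r (cell n x) (cell n y))" for n
  proof -
    have "grid_sum n \<alpha> r \<omega> = 1 / 2 * (\<Sum>z\<in>I n. real (cnt n z \<omega>) * (\<Sum>z'\<in>I n. real (cnt n z' \<omega>) * grid_kernel n \<alpha> r z z'))"
      unfolding grid_sum_def by (simp add: mult.commute)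
    also have "\<dots> = 1 / 2 * (\<Sum>z\<in>I n. real (cnt n z \<omega>) * (\<Sum>y\<in>P. grid_kernel n \<alpha> r z (cell n y)))"
      using sum_counts[OF pw fW simple] unfolding cnt_def I_def Wc_def P_def by simp
    also have "\<dots> = 1 / 2 * (\<Sum>x\<in>P. \<Sum>y\<in>P. grid_kernel n \<alpha> r (cell n x) (cell n y))"
      using sum_counts[OF pw fW simple] unfolding cnt_def I_def Wc_def P_def by simp
    finally show ?thesis .
  qed
  have "0 \<le> grid_sum n \<alpha> r \<omega>" for n unfolding gs by (intro mult_nonneg_nonneg sum_nonneg grid_kernel_nonneg) auto
  moreover have "grid_sum n \<alpha> r \<omega> \<le> 2 powr \<bar>\<alpha>\<bar> * edge_sum W r \<alpha> (\<eta> \<omega>)" for n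
  proof -
    have "(\<Sum>x\<in>P. \<Sum>y\<in>P. grid_kernel n \<alpha> r (cell n x) (cell n y)) \<le> (\<Sum>x\<in>P. \<Sum>y\<in>P. 2 powr \<bar>\<alpha>\<bar> * edge_kernel \<alpha> r (norm (x - y)))"
      by (intro sum_mono grid_kernel_le)
    also have "\<dots> = 2 powr \<bar>\<alpha>\<bar> * (\<Sum>x\<in>P. \<Sum>y\<in>P. edge_kernel \<alpha> r (norm (x - y)))"
      by (simp only: sum_distrib_left)
    finally show ?thesis unfolding gs es by simp
  qed
  moreover have "(\<lambda>n. grid_sum n \<alpha> r \<omega>) \<longlonglongrightarrow> edge_sum W r \<alpha> (\<eta> \<omega>)"
    unfolding gs es by (intro tendsto_intros grid_kernel_tendsto)
  ultimately show ?case by blast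
qed

end

section \<open>Radial integrals and erosion of convex bodies\<close>

text \<open>The integral of |y|^\<beta> over the ball of radius r; the factor in front is the
  surface area of the unit sphere.\<close>

definition radial_mass :: "nat \<Rightarrow> real \<Rightarrow> real \<Rightarrow> real" where
  "radial_mass d \<beta> r = real d * unit_ball_vol (real d) * r powr (\<beta> + real d) / (\<beta> + real d)"

text \<open>Polar coordinates for radial functions: both measures assign to {x<..} the volume of a
  spherical shell, which is a difference of volumes of balls.\<close>

lemma radial_law:
  fixes r :: real assumes r: "r > 0"
  shows "distr (density lborel (indicator (ball (0::real ^ 'd::finite) r))) borel norm =
    density lborel (\<lambda>s. ennreal (real CARD('d) * unit_ball_vol (real CARD('d)) * s powr (real CARD('d) - 1)) * indicator {0..r} s)"
    (is "?M = ?N")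
proof (rule measure_eqI_lessThan)
  define D where "D = CARD('d)"
  define \<kappa> where "\<kappa> = unit_ball_vol (real D)"
  have D: "D \<ge> 1" by (simp add: D_def Suc_le_eq)
  have \<kappa>: "\<kappa> \<ge> 0" by (simp add: \<kappa>_def)
  have nv: "norm -` {x<..} \<in> sets (borel :: (real ^ 'd) measure)" for x :: real
    by (intro borel_open open_vimage) (auto intro: continuous_intros)
  have im: "(indicator (ball (0::real ^ 'd) r) :: _ \<Rightarrow> ennreal) \<in> borel_measurable borel"
    by (intro borel_measurable_indicator) auto
  have M: "emeasure ?M {x<..} = emeasure lborel (ball (0::real ^ 'd) r - cball 0 x)" for x
  proof -
    have "emeasure ?M {x<..} = (\<integral>\<^sup>+y. indicator (ball 0 r) y * indicator (norm -` {x<..}) y \<partial>(lborel :: (real ^ 'd) measure))"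
      using nv im by (subst emeasure_distr) (auto simp: emeasure_density)
    also have "\<dots> = (\<integral>\<^sup>+y. indicator (ball 0 r - cball 0 x) y \<partial>(lborel :: (real ^ 'd) measure))"
      by (intro nn_integral_cong) (auto simp: indicator_def)
    finally show ?thesis by simp
  qed
  have diff: "emeasure lborel (ball (0::real ^ 'd) r - cball 0 x) = ennreal (\<kappa> * (r ^ D - x ^ D))" if x: "0 \<le> x" "x \<le> r" for x
  proof -
    have "emeasure lborel (ball (0::real ^ 'd) r - cball 0 x) = emeasure lborel (ball (0::real ^ 'd) r) - emeasure lborel (ball (0::real ^ 'd) x)"
    proof -
      have "emeasure lborel (ball (0::real ^ 'd) r - cball 0 x) = emeasure lborel (ball (0::real ^ 'd) r - ball 0 x)"
      proof (rule emeasure_eq_AE)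
        have "sphere (0::real ^ 'd) x \<in> null_sets lborel"
          using negligible_sphere[of "0::real ^ 'd" x] by (simp add: negligible_iff_null_sets null_sets_completion_iff)
        then have "AE y in lborel. y \<notin> sphere (0::real ^ 'd) x" by (rule AE_not_in)
        then show "AE y in lborel. (y \<in> ball (0::real ^ 'd) r - cball 0 x) = (y \<in> ball 0 r - ball 0 x)"
          by eventually_elim (auto simp: dist_norm)
      qed auto
      also have "\<dots> = emeasure lborel (ball (0::real ^ 'd) r) - emeasure lborel (ball (0::real ^ 'd) x)"
        using x emeasure_lborel_ball_finite[of "0::real ^ 'd" x] by (intro emeasure_Diff) (auto simp: subset_ball)
      finally show ?thesis .
    qed
    also have "\<dots> = ennreal (\<kappa> * r ^ D) - ennreal (\<kappa> * x ^ D)"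
      using x r by (simp add: emeasure_ball D_def \<kappa>_def)
    also have "\<dots> = ennreal (\<kappa> * r ^ D - \<kappa> * x ^ D)"
      using x \<kappa> by (subst ennreal_minus) auto
    finally show ?thesis by (simp add: right_diff_distrib)
  qed
  have full: "emeasure lborel (ball (0::real ^ 'd) r - cball 0 x) = ennreal (\<kappa> * r ^ D)" if "x < 0" for x
    using that r by (simp add: emeasure_ball D_def \<kappa>_def)
  have N: "emeasure ?N {x<..} = ennreal (\<kappa> * (r ^ D - x ^ D))" if x: "0 \<le> x" "x \<le> r" for x
  proof -
    have "emeasure ?N {x<..} = (\<integral>\<^sup>+s. ennreal (real D * \<kappa> * s powr (real D - 1)) * indicator {0..r} s * indicator {x<..} s \<partial>lborel)"
      by (subst emeasure_density) (auto simp: D_def \<kappa>_def)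
    also have "\<dots> = (\<integral>\<^sup>+s. ennreal (real D * \<kappa> * s ^ (D - 1)) * indicator {x..r} s \<partial>lborel)"
    proof (rule nn_integral_cong_AE)
      \<comment> \<open>The point 0 is excluded because \<open>0 powr 0 = 0\<close> but
        \<open>0 ^ 0 = 1\<close>, which matters for d = 1; the point x because {x<..} is open and
        {x..r} is closed.\<close>
      have "AE s in lborel. s \<noteq> x \<and> s \<noteq> 0" using AE_lborel_singleton[of x] AE_lborel_singleton[of 0] by eventually_elim auto
      then show "AE s in lborel. ennreal (real D * \<kappa> * s powr (real D - 1)) * indicator {0..r} s * indicator {x<..} s
         = ennreal (real D * \<kappa> * s ^ (D - 1)) * indicator {x..r} s"
      proof eventually_elim
        case (elim s)
        have "s powr (real D - 1) = s ^ (D - 1)" if "s > 0"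
          using that D by (simp add: powr_realpow[symmetric] of_nat_diff)
        then show ?case using elim x by (auto simp: indicator_def)
      qed
    qed
    also have "\<dots> = ennreal (\<kappa> * r ^ D - \<kappa> * x ^ D)"
    proof (rule nn_integral_FTC_Icc)
      show "((\<lambda>s. \<kappa> * s ^ D) has_real_derivative real D * \<kappa> * s ^ (D - 1)) (at s)" for s
        by (auto intro!: derivative_eq_intros)
    qed (use x \<kappa> in auto)
    finally show ?thesis by (simp add: right_diff_distrib)
  qed
  have N0: "emeasure ?N {x<..} = emeasure ?N {0<..}" if "x < 0" for x
  proof -
    have "emeasure ?N {x<..} = (\<integral>\<^sup>+s. ennreal (real D * \<kappa> * s powr (real D - 1)) * indicator {0..r} s * indicator {x<..} s \<partial>lborel)"
      by (subst emeasure_density) (auto simp: D_def \<kappa>_def)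
    also have "\<dots> = (\<integral>\<^sup>+s. ennreal (real D * \<kappa> * s powr (real D - 1)) * indicator {0..r} s * indicator {0<..} s \<partial>lborel)"
      by (rule nn_integral_cong_AE, rule AE_mp[OF AE_lborel_singleton[of 0]]) (use that in \<open>auto simp: indicator_def\<close>)
    also have "\<dots> = emeasure ?N {0<..}" by (subst emeasure_density) (auto simp: D_def \<kappa>_def)
    finally show ?thesis .
  qed
  have big: "emeasure ?N {x<..} = 0" if "x > r" for x
    by (subst emeasure_density) (use that in \<open>auto simp: nn_integral_0_iff_AE indicator_def\<close>)
  show "emeasure ?M {x<..} = emeasure ?N {x<..}" for x
  proof -
    consider "x < 0" | "0 \<le> x" "x \<le> r" | "x > r" by linarith
    then show ?thesis
    proof cases
      case 1
      have "0 ^ D = (0::real)" using D by simp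
      then show ?thesis using 1 r by (simp only: M N0 full N[of 0]) simp
    next
      case 2 then show ?thesis by (simp only: M diff N)
    next
      case 3
      then have "ball (0::real ^ 'd) r - cball 0 x = {}" by auto
      then show ?thesis by (simp only: M big[OF 3]) simp
    qed
  qed
  show "emeasure ?M {x<..} < \<infinity>" for x
  proof -
    have "emeasure lborel (ball (0::real ^ 'd) r - cball 0 x) \<le> emeasure lborel (ball (0::real ^ 'd) r)" by (intro emeasure_mono) auto
    then show ?thesis unfolding M using emeasure_lborel_ball_finite by (rule le_less_trans)
  qed
qed auto

lemma edge_kernel_measurable[measurable]: "edge_kernel \<beta> r \<in> borel_measurable borel"
  unfolding edge_kernel_def by measurable

lemma nn_integral_edge_kernel:
  assumes r: "r > 0" and \<beta>: "\<beta> > - real CARD('d)"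
  shows "(\<integral>\<^sup>+y. ennreal (edge_kernel \<beta> r (norm y)) \<partial>(lborel :: (real ^ 'd::finite) measure)) = ennreal (radial_mass CARD('d) \<beta> r)"
proof -
  define D where "D = CARD('d)"
  define \<kappa> where "\<kappa> = unit_ball_vol (real D)"
  have \<kappa>: "\<kappa> \<ge> 0" by (simp add: \<kappa>_def)
  have "(\<integral>\<^sup>+y. ennreal (edge_kernel \<beta> r (norm y)) \<partial>(lborel :: (real ^ 'd) measure))
    = (\<integral>\<^sup>+y. indicator (ball 0 r) y * ennreal (edge_kernel \<beta> r (norm y)) \<partial>(lborel :: (real ^ 'd) measure))"
    by (intro nn_integral_cong) (auto simp: indicator_def edge_kernel_def)
  also have "\<dots> = (\<integral>\<^sup>+y. ennreal (edge_kernel \<beta> r (norm y)) \<partial>density lborel (indicator (ball (0::real ^ 'd) r)))"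
    by (subst nn_integral_density) (auto intro!: borel_measurable_indicator)
  also have "\<dots> = (\<integral>\<^sup>+s. ennreal (edge_kernel \<beta> r s) \<partial>distr (density lborel (indicator (ball (0::real ^ 'd) r))) borel norm)"
    by (subst nn_integral_distr) auto
  also have "\<dots> = (\<integral>\<^sup>+s. (ennreal (real D * \<kappa> * s powr (real D - 1)) * indicator {0..r} s) * ennreal (edge_kernel \<beta> r s) \<partial>lborel)"
    unfolding radial_law[OF r] by (subst nn_integral_density) (auto simp: D_def \<kappa>_def)
  also have "\<dots> = (\<integral>\<^sup>+s. ennreal (real D * \<kappa> * s powr (\<beta> + real D - 1)) * indicator {0..r} s \<partial>lborel)"
  proof (rule nn_integral_cong_AE)
    have "AE s in lborel. s \<noteq> r \<and> s \<noteq> 0" using AE_lborel_singleton[of r] AE_lborel_singleton[of 0] by eventually_elim auto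
    then show "AE s in lborel. ennreal (real D * \<kappa> * s powr (real D - 1)) * indicator {0..r} s * ennreal (edge_kernel \<beta> r s)
      = ennreal (real D * \<kappa> * s powr (\<beta> + real D - 1)) * indicator {0..r} s"
    proof eventually_elim
      case (elim s)
      have "s powr (real D - 1) * s powr \<beta> = s powr (\<beta> + real D - 1)"
        by (simp add: powr_add[symmetric] algebra_simps)
      then show ?case using elim \<kappa>
        by (auto simp: indicator_def edge_kernel_def ennreal_mult[symmetric] mult.assoc)
    qed
  qed
  also have "\<dots> = ennreal (real D * \<kappa> * (r powr (\<beta> + real D - 1 + 1) / (\<beta> + real D - 1 + 1)))"
  proof (rule nn_integral_has_integral_lebesgue')
    show "((\<lambda>s. real D * \<kappa> * s powr (\<beta> + real D - 1)) has_integral real D * \<kappa> * (r powr (\<beta> + real D - 1 + 1) / (\<beta> + real D - 1 + 1))) {0..r}"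
      by (intro has_integral_mult_right has_integral_powr_from_0) (use r \<beta> in \<open>auto simp: D_def\<close>)
  qed (use \<kappa> in auto)
  finally show ?thesis by (simp add: radial_mass_def D_def \<kappa>_def)
qed

lemma
  fixes x :: "real ^ 'd::finite"
  assumes r: "r > 0" and \<beta>: "\<beta> > - real CARD('d)"
  shows integrable_edge_kernel: "integrable lborel (\<lambda>y. edge_kernel \<beta> r (norm (x - y)))"
    and integral_edge_kernel: "(\<integral>y. edge_kernel \<beta> r (norm (x - y)) \<partial>lborel) = radial_mass CARD('d) \<beta> r"
    and radial_mass_nonneg: "0 \<le> radial_mass CARD('d) \<beta> r"
proof -
  show rm: "0 \<le> radial_mass CARD('d) \<beta> r" using \<beta> by (auto simp: radial_mass_def intro!: divide_nonneg_pos)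
  have "(\<integral>\<^sup>+y. ennreal (edge_kernel \<beta> r (norm (x - y))) \<partial>lborel) = (\<integral>\<^sup>+y. ennreal (edge_kernel \<beta> r (norm (x - (x + y)))) \<partial>lborel)"
    by (subst lborel_distr_plus[of x, symmetric], subst nn_integral_distr) auto
  also have "\<dots> = ennreal (radial_mass CARD('d) \<beta> r)"
    using nn_integral_edge_kernel[OF r \<beta>] by simp
  finally have nn: "(\<integral>\<^sup>+y. ennreal (edge_kernel \<beta> r (norm (x - y))) \<partial>lborel) = ennreal (radial_mass CARD('d) \<beta> r)" .
  then show "integrable lborel (\<lambda>y. edge_kernel \<beta> r (norm (x - y)))"
    by (intro integrableI_nonneg) (auto simp: edge_kernel_nonneg)
  show "(\<integral>y. edge_kernel \<beta> r (norm (x - y)) \<partial>lborel) = radial_mass CARD('d) \<beta> r"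
    by (subst integral_eq_nn_integral) (auto simp: nn rm edge_kernel_nonneg)
qed

lemma edge_kernel_mult: "edge_kernel a r u * edge_kernel b r u = edge_kernel (a + b) r u"
  by (simp add: edge_kernel_def powr_add)

text \<open>Shrink W by the factor 1 - s with s = r / \<rho> towards the centre \<open>a\<close> of
  an inscribed ball of radius \<rho>. By convexity W contains the ball of radius r around each
  shrunk point, and Bernoulli's inequality bounds the lost volume by d * s times the volume of W.
  For r >= \<rho> the empty set serves.\<close>

lemma convex_body_erosion:
  fixes W :: "(real ^ 'd::finite) set"
  assumes W: "convex_body W"
  shows "\<exists>c>0. \<forall>r>0. \<exists>V. V \<in> sets borel \<and> V \<subseteq> W \<and> (\<forall>x\<in>V. ball x r \<subseteq> W) \<and> measure lborel W - measure lborel V \<le> c * r"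
proof -
  have comp: "compact W" and conv: "convex W" and "interior W \<noteq> {}" using W by (auto simp: convex_body_def)
  then obtain a \<rho> where \<rho>: "\<rho> > 0" "ball a \<rho> \<subseteq> W" by (meson ex_in_conv mem_interior)
  have mW: "W \<in> fmeasurable lborel" by (rule fmeasurable_compact[OF comp])
  define D where "D = CARD('d)"
  define w where "w = measure lborel W"
  have w: "w \<ge> 0" by (simp add: w_def)
  show ?thesis
  proof (intro exI[of _ "(real D * w + 1) / \<rho>"] conjI allI impI)
    show "0 < (real D * w + 1) / \<rho>" using w \<rho> by (auto intro!: divide_pos_pos add_nonneg_pos)
    fix r :: real assume r: "r > 0"
    define s where "s = r / \<rho>"
    have s: "s > 0" using r \<rho> by (simp add: s_def)
    show "\<exists>V. V \<in> sets borel \<and> V \<subseteq> W \<and> (\<forall>x\<in>V. ball x r \<subseteq> W) \<and> measure lborel W - measure lborel V \<le> (real D * w + 1) / \<rho> * r"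
    proof (cases "s < 1")
      case False
      have "1 * w \<le> real D * w" using w by (intro mult_right_mono) (auto simp: D_def Suc_le_eq)
      then have "w \<le> (real D * w + 1) * 1" by simp
      also have "\<dots> \<le> (real D * w + 1) * s" using False w by (intro mult_left_mono) auto
      also have "\<dots> = (real D * w + 1) / \<rho> * r" by (simp add: s_def)
      finally show ?thesis by (intro exI[of _ "{}"]) (simp add: w_def)
    next
      case True
      define \<phi> where "\<phi> x = s *\<^sub>R a + (1 - s) *\<^sub>R x" for x
      define V where "V = \<phi> ` W"
      have "compact V" unfolding V_def \<phi>_def by (intro compact_continuous_image continuous_intros comp)
      then have Vb: "V \<in> sets borel" by (rule borel_compact)
      have ballV: "ball x r \<subseteq> W" if "x \<in> V" for x
      proof
        fix y assume y: "y \<in> ball x r"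
        obtain z where z: "z \<in> W" "x = \<phi> z" using \<open>x \<in> V\<close> by (auto simp: V_def)
        \<comment> \<open>Solves y = s b + (1 - s) z; the distance of b from a is below r / s =
          \<rho>, so b lies in the inscribed ball.\<close>
        define b where "b = a + (1 / s) *\<^sub>R (y - x)"
        have "dist a b = norm (y - x) / s" using s by (simp add: b_def dist_norm)
        also have "\<dots> < r / s" using y s by (intro divide_strict_right_mono) (auto simp: dist_norm norm_minus_commute)
        also have "\<dots> = \<rho>" using r \<rho> by (simp add: s_def)
        finally have "b \<in> W" using \<rho> by auto
        moreover have "y = s *\<^sub>R b + (1 - s) *\<^sub>R z" using s by (simp add: b_def z \<phi>_def algebra_simps)
        ultimately show "y \<in> W" using conv z(1) s True by (auto simp: convex_alt intro: convexD)
      qed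
      have "V \<subseteq> W" using ballV r by (meson centre_in_ball subset_iff)
      moreover have "measure lborel V = (1 - s) ^ D * w"
      proof -
        have inj: "\<phi> x \<in> V \<longleftrightarrow> x \<in> W" for x using True by (auto simp: V_def \<phi>_def)
        have "emeasure lborel V = emeasure (density (distr lborel borel (\<lambda>x. s *\<^sub>R a + (1 - s) *\<^sub>R x)) (\<lambda>_. ennreal (\<bar>1 - s\<bar> ^ DIM(real ^ 'd)))) V"
          using True by (subst lborel_affine[of "1 - s" "s *\<^sub>R a"]) auto
        also have "\<dots> = ennreal ((1 - s) ^ D) * emeasure (distr lborel borel \<phi>) V"
          using Vb True by (subst emeasure_density) (auto simp: nn_integral_cmult_indicator D_def \<phi>_def[abs_def])
        also have "emeasure (distr lborel borel \<phi>) V = emeasure lborel W"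
          using Vb inj by (subst emeasure_distr) (auto simp: \<phi>_def[abs_def] vimage_def)
        finally have "emeasure lborel V = ennreal ((1 - s) ^ D) * emeasure lborel W" .
        then show ?thesis using True by (simp add: measure_def enn2real_mult w_def)
      qed
      moreover have "1 - real D * s \<le> (1 - s) ^ D"
        using Bernoulli_inequality[of "- s" D] True s by simp
      then have "w - (1 - s) ^ D * w \<le> (real D * s) * w" using mult_right_mono[OF _ w, of "1 - real D * s" "(1 - s) ^ D"] by (simp add: algebra_simps)
      moreover have "(real D * s) * w \<le> (real D * w + 1) / \<rho> * r" using \<rho>(1) r by (simp add: s_def field_simps)
      ultimately show ?thesis using Vb ballV by (intro exI[of _ V]) (auto simp: w_def)
    qed
  qed
qed

section \<open>Edge sums in a window\<close>

lemma grid_pt_measurable[measurable]: "(\<lambda>x :: real ^ 'd::finite. grid_pt n x) \<in> borel_measurable borel"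
proof -
  have [measurable]: "(\<lambda>x :: real ^ 'd. x $ i) \<in> borel_measurable borel" for i
    by (intro borel_measurable_continuous_onI continuous_intros)
  have "grid_pt n x = (\<Sum>i\<in>UNIV. (of_int \<lfloor>2 ^ n * x $ i\<rfloor> / 2 ^ n) *\<^sub>R axis i 1)" for x :: "real ^ 'd"
    by (subst basis_expansion[symmetric]) (simp add: corner_def cell_def scalar_mult_eq_scaleR)
  then show ?thesis by simp
qed

lemma grid_kernel_measurable[measurable (raw)]:
  fixes f g :: "'a \<Rightarrow> real ^ 'd::finite"
  assumes [measurable]: "f \<in> borel_measurable M" "g \<in> borel_measurable M"
  shows "(\<lambda>x. grid_kernel n \<alpha> r (cell n (f x)) (cell n (g x))) \<in> borel_measurable M"
proof -
  have "(\<lambda>x. grid_pt n (f x)) \<in> borel_measurable M" "(\<lambda>x. grid_pt n (g x)) \<in> borel_measurable M"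
    by (rule measurable_compose[OF _ grid_pt_measurable]; simp)+
  then have [measurable]: "(\<lambda>x. norm (grid_pt n (f x) - grid_pt n (g x))) \<in> borel_measurable M" by simp
  show ?thesis unfolding grid_kernel_def Let_def by simp
qed

text \<open>The power of CARD('m) comes from \<open>powr_sum_le\<close>, the powers of 2 from
  \<open>grid_kernel_le\<close>, and the last factor is the radial mass for r = 1.\<close>

definition moment_const :: "nat \<Rightarrow> ('m::finite \<Rightarrow> real) \<Rightarrow> real \<Rightarrow> real" where
  "moment_const d \<alpha> p = real CARD('m) powr p *
     (\<Sum>i\<in>UNIV. 2 powr (p * \<bar>\<alpha> i\<bar>) * (real d * unit_ball_vol (real d) / (p * \<alpha> i + real d)))"

lemma powr_sum_le:
  fixes x :: "'m::finite \<Rightarrow> real"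
  assumes x: "\<And>i. 0 \<le> x i" and p: "p > 0"
  shows "(\<Sum>i\<in>UNIV. x i) powr p \<le> real CARD('m) powr p * (\<Sum>i\<in>UNIV. x i powr p)"
proof -
  have "Max (range x) \<in> range x" by (intro Max_in) auto
  then obtain j where "Max (range x) = x j" by (rule imageE)
  then have j: "x i \<le> x j" for i using Max_ge[of "range x" "x i"] by simp
  have "(\<Sum>i\<in>UNIV. x i) \<le> real CARD('m) * x j"
    using sum_bounded_above[of UNIV x "x j"] j by simp
  then have "(\<Sum>i\<in>UNIV. x i) powr p \<le> (real CARD('m) * x j) powr p"
    using x p by (intro powr_mono2) (auto intro: sum_nonneg)
  also have "\<dots> = real CARD('m) powr p * x j powr p" using x by (simp add: powr_mult)
  also have "\<dots> \<le> real CARD('m) powr p * (\<Sum>i\<in>UNIV. x i powr p)"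
    by (intro mult_left_mono member_le_sum) auto
  finally show ?thesis .
qed

text \<open>Below 1 the left side is s^3 and above 1 it is s^2; the range of q is exactly what the
  two cases allow.\<close>

lemma psi_le_powr:
  assumes "0 \<le> s" "2 \<le> q" "q \<le> 3" shows "s * \<psi> s \<le> s powr q"
proof (cases "s = 0")
  case False
  then have s: "s > 0" using assms by simp
  show ?thesis
  proof (cases "s \<le> 1")
    case True
    have "s * \<psi> s = s powr 3" using True s by (simp add: \<psi>_def min_def power3_eq_cube)
    also have "\<dots> \<le> s powr q" using s True assms by (intro powr_mono') auto
    finally show ?thesis .
  next
    case False
    have "s * \<psi> s = s powr 2" using False s by (simp add: \<psi>_def min_def power2_eq_square)
    also have "\<dots> \<le> s powr q" using False assms by (intro powr_mono) auto
    finally show ?thesis .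
  qed
qed (simp add: \<psi>_def)

lemma edge_kernel_powr: "p > 0 \<Longrightarrow> edge_kernel \<alpha> r u powr p = edge_kernel (p * \<alpha>) r u"
  by (simp add: edge_kernel_def powr_powr mult.commute)

section \<open>Moments and covariances of the normalised kernel\<close>

locale edge_window = poisson_window M \<eta> t W
  for M :: "'w measure" and \<eta> :: "'w \<Rightarrow> (real ^ 'd::finite) measure" and t W +
  fixes r :: real and \<alpha> :: "'m::finite \<Rightarrow> real"
  assumes r_pos: "r > 0" and \<alpha>_sum: "\<And>i j. \<alpha> i + \<alpha> j > - real CARD('d)" and W_ne: "W \<noteq> {}"
begin

text \<open>The normalisation for exponent 0. By \<open>coef_eq\<close> the one for
  \<open>\<alpha> i\<close> differs from it only by a power of r, so a single scale serves all
  components.\<close>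

definition scale :: real where "scale = max (t * r powr (real CARD('d) / 2)) (t powr (3 / 2) * r powr real CARD('d))"
definition coef :: "'m \<Rightarrow> real" where
  "coef i = inverse (max (t * r powr (\<alpha> i + real CARD('d) / 2)) (t powr (3 / 2) * r powr (\<alpha> i + real CARD('d))))"
definition nk :: "nat \<Rightarrow> 'm \<Rightarrow> int ^ 'd \<Rightarrow> int ^ 'd \<Rightarrow> real" where
  "nk n i a b = coef i * grid_kernel n (\<alpha> i) r a b"
definition w :: real where "w = measure lborel W"

lemma \<alpha>_half: "\<alpha> i > - real CARD('d) / 2" using \<alpha>_sum[of i i] by simp
lemma \<alpha>_gt: "\<alpha> i > - real CARD('d)" using \<alpha>_half[of i] of_nat_0_le_iff[of "CARD('d)", where 'a=real] by linarith

lemma scale_pos: "scale > 0" using t_pos r_pos by (simp add: scale_def less_max_iff_disj)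

lemma coef_eq: "coef i = r powr (- \<alpha> i) / scale"
proof -
  have "max (t * r powr (\<alpha> i + real CARD('d) / 2)) (t powr (3 / 2) * r powr (\<alpha> i + real CARD('d))) = r powr \<alpha> i * scale"
    unfolding scale_def by (simp add: max_mult_distrib_left powr_add mult_ac)
  then have "coef i = inverse (r powr \<alpha> i) * inverse scale" unfolding coef_def by simp
  then show ?thesis unfolding powr_minus by (simp only: divide_inverse)
qed

lemma coef_pos: "coef i > 0" using scale_pos r_pos by (simp add: coef_eq)

text \<open>Either entry of the maximum bounds \<open>scale\<close> from below. The entry t^(3/2)
  r^d gives the rate t^(-1/2); the entry t r^(d/2), whose square is t^2 r^d, gives the powers of t^2
  r^d. The bound 1/t is the case q = 2.\<close>

lemma scale_bounds:
  "t * r ^ CARD('d) / scale \<le> t powr (-1/2)" "t * r ^ CARD('d) / scale powr 2 \<le> 1 / t"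
  "0 \<le> q \<Longrightarrow> t * (t * r ^ CARD('d) / scale powr q) \<le> (t\<^sup>2 * r ^ CARD('d)) powr (1 - q / 2)"
proof -
  have rp: "r ^ CARD('d) = r powr real CARD('d)" using r_pos by (simp add: powr_realpow)
  have lam: "t * r powr real CARD('d) > 0" using t_pos r_pos by simp
  have "t * r ^ CARD('d) / scale \<le> t * r powr real CARD('d) / (t powr (3 / 2) * r powr real CARD('d))"
    unfolding rp using lam t_pos r_pos by (intro divide_left_mono) (auto simp: scale_def intro!: mult_pos_pos max.strict_coboundedI1)
  also have "\<dots> = t / t powr (3 / 2)" using r_pos t_pos by simp
  also have "\<dots> = t powr (-1/2)" using t_pos powr_diff[of t 1 "3/2"] by simp
  finally show "t * r ^ CARD('d) / scale \<le> t powr (-1/2)" .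
  have key: "(t * r powr (real CARD('d) / 2)) powr q \<le> scale powr q" if "0 \<le> q" for q
    using that t_pos r_pos by (intro powr_mono2) (auto simp: scale_def)
  have half: "(t * r powr (real CARD('d) / 2)) powr q = (t\<^sup>2 * r ^ CARD('d)) powr (q / 2)" for q
  proof -
    have "(t * r powr (real CARD('d) / 2)) = (t\<^sup>2 * r ^ CARD('d)) powr (1 / 2)"
    proof -
      have "(t\<^sup>2 * r ^ CARD('d)) powr (1 / 2) = (t powr 2) powr (1/2) * (r powr real CARD('d)) powr (1 / 2)"
        unfolding rp using t_pos r_pos by (simp add: powr_mult)
      also have "\<dots> = t * r powr (real CARD('d) / 2)" using t_pos by (simp add: powr_powr del: powr_numeral)
      finally show ?thesis ..
    qed
    then show ?thesis by (simp add: powr_powr)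
  qed
  have s: "t\<^sup>2 * r ^ CARD('d) > 0" using t_pos r_pos by simp
  have gen: "t * (t * r ^ CARD('d) / scale powr q) \<le> (t\<^sup>2 * r ^ CARD('d)) powr (1 - q / 2)" if q: "0 \<le> q" for q
  proof -
    have "t * (t * r ^ CARD('d) / scale powr q) = (t\<^sup>2 * r ^ CARD('d)) / scale powr q" by (simp add: power2_eq_square)
    also have "\<dots> \<le> (t\<^sup>2 * r ^ CARD('d)) / (t\<^sup>2 * r ^ CARD('d)) powr (q / 2)"
      using key[OF q] s scale_pos t_pos r_pos unfolding half by (intro divide_left_mono mult_pos_pos) (simp_all add: powr_gt_zero)
    also have "\<dots> = (t\<^sup>2 * r ^ CARD('d)) powr (1 - q / 2)"
      using s by (simp add: powr_diff)
    finally show ?thesis .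
  qed
  then show "0 \<le> q \<Longrightarrow> t * (t * r ^ CARD('d) / scale powr q) \<le> (t\<^sup>2 * r ^ CARD('d)) powr (1 - q / 2)" .
  have "t * (t * r ^ CARD('d) / scale powr 2) \<le> 1" using gen[of 2] t_pos r_pos by simp
  then show "t * r ^ CARD('d) / scale powr 2 \<le> 1 / t" using t_pos by (simp add: pos_le_divide_eq mult.commute)
qed

lemma grid_moment:
  assumes a: "a \<in> I n" and p: "p > 0" "p * \<beta> > - real CARD('d)"
  shows "(\<Sum>b\<in>I n. lam n b * grid_kernel n \<beta> r a b powr p) \<le> t * (2 powr (p * \<bar>\<beta>\<bar>) * radial_mass CARD('d) (p * \<beta>) r)"
proof -
  obtain x where x: "x \<in> W" "a = cell n x" using a by (auto simp: I_def)
  have "(\<Sum>b\<in>I n. lam n b * grid_kernel n \<beta> r a b powr p) = t * (\<integral>y. indicator W y * grid_kernel n \<beta> r (cell n x) (cell n y) powr p \<partial>lborel)"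
    unfolding x by (rule lam_sum)
  also have "\<dots> \<le> t * (\<integral>y. 2 powr (p * \<bar>\<beta>\<bar>) * edge_kernel (p * \<beta>) r (norm (x - y)) \<partial>lborel)"
  proof (intro mult_left_mono integral_mono')
    show "integrable lborel (\<lambda>y. 2 powr (p * \<bar>\<beta>\<bar>) * edge_kernel (p * \<beta>) r (norm (x - y)))"
      by (intro integrable_mult_right integrable_edge_kernel r_pos p)
    fix y
    have "grid_kernel n \<beta> r (cell n x) (cell n y) powr p \<le> (2 powr \<bar>\<beta>\<bar> * edge_kernel \<beta> r (norm (x - y))) powr p"
      using p by (intro powr_mono2 grid_kernel_le grid_kernel_nonneg) auto
    also have "\<dots> = 2 powr (p * \<bar>\<beta>\<bar>) * edge_kernel (p * \<beta>) r (norm (x - y))"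
      using p by (simp add: powr_mult edge_kernel_nonneg powr_powr edge_kernel_powr mult.commute)
    finally show "indicator W y * grid_kernel n \<beta> r (cell n x) (cell n y) powr p \<le> 2 powr (p * \<bar>\<beta>\<bar>) * edge_kernel (p * \<beta>) r (norm (x - y))"
      by (cases "y \<in> W") (auto simp: edge_kernel_nonneg)
    show "0 \<le> 2 powr (p * \<bar>\<beta>\<bar>) * edge_kernel (p * \<beta>) r (norm (x - y))" by (simp add: edge_kernel_nonneg)
  qed (use t_pos in auto)
  also have "\<dots> = t * (2 powr (p * \<bar>\<beta>\<bar>) * radial_mass CARD('d) (p * \<beta>) r)"
    using integral_edge_kernel[OF r_pos p(2), of x] by simp
  finally show ?thesis .
qed

definition Ksum :: "nat \<Rightarrow> int ^ 'd \<Rightarrow> int ^ 'd \<Rightarrow> real" where "Ksum n a b = (\<Sum>i\<in>UNIV. nk n i a b)"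

lemma nk_nonneg: "0 \<le> nk n i a b" using coef_pos[of i] grid_kernel_nonneg[of n "\<alpha> i" r a b] by (simp add: nk_def)
lemma Ksum_nonneg: "0 \<le> Ksum n a b" by (simp add: Ksum_def sum_nonneg nk_nonneg)

text \<open>The power of r in \<open>coef i\<close> cancels the \<alpha>-dependent power in the
  radial mass, so all components contribute the same order t r^d / scale^p.\<close>

lemma Ksum_moment:
  assumes a: "a \<in> I n" and p: "p > 0" "\<And>i. p * \<alpha> i > - real CARD('d)"
  shows "(\<Sum>b\<in>I n. lam n b * Ksum n a b powr p) \<le> moment_const CARD('d) \<alpha> p * (t * r ^ CARD('d) / scale powr p)"
proof -
  have rp: "r ^ CARD('d) = r powr real CARD('d)" using r_pos by (simp add: powr_realpow)
  have "(\<Sum>b\<in>I n. lam n b * Ksum n a b powr p) \<le> (\<Sum>b\<in>I n. lam n b * (real CARD('m) powr p * (\<Sum>i\<in>UNIV. nk n i a b powr p)))"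
    unfolding Ksum_def by (intro sum_mono mult_left_mono powr_sum_le lam_nonneg nk_nonneg p)
  also have "\<dots> = real CARD('m) powr p * (\<Sum>i\<in>UNIV. coef i powr p * (\<Sum>b\<in>I n. lam n b * grid_kernel n (\<alpha> i) r a b powr p))"
  proof -
    have "nk n i a b powr p = coef i powr p * grid_kernel n (\<alpha> i) r a b powr p" for i b
      unfolding nk_def using coef_pos[of i] grid_kernel_nonneg[of n "\<alpha> i" r a b] by (simp add: powr_mult)
    then show ?thesis
      by (simp add: sum_distrib_left mult_ac) (rule sum.swap)
  qed
  also have "\<dots> \<le> real CARD('m) powr p * (\<Sum>i\<in>UNIV. coef i powr p * (t * (2 powr (p * \<bar>\<alpha> i\<bar>) * radial_mass CARD('d) (p * \<alpha> i) r)))"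
    by (intro mult_left_mono sum_mono grid_moment[OF a p(1) p(2)]) auto
  also have "\<dots> = real CARD('m) powr p * (\<Sum>i\<in>UNIV. 2 powr (p * \<bar>\<alpha> i\<bar>) * (real CARD('d) * unit_ball_vol (real CARD('d)) / (p * \<alpha> i + real CARD('d))) * (t * r ^ CARD('d) / scale powr p))"
  proof (rule arg_cong[where f="\<lambda>z. real CARD('m) powr p * z"], rule sum.cong[OF refl])
    fix i
    have "coef i powr p = r powr (- (p * \<alpha> i)) / scale powr p"
      unfolding coef_eq using scale_pos r_pos by (simp add: powr_divide powr_powr mult.commute)
    moreover have "r powr (- (p * \<alpha> i)) * r powr (p * \<alpha> i + real CARD('d)) = r powr real CARD('d)"
      by (simp add: powr_add[symmetric])
    ultimately show "coef i powr p * (t * (2 powr (p * \<bar>\<alpha> i\<bar>) * radial_mass CARD('d) (p * \<alpha> i) r))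
      = 2 powr (p * \<bar>\<alpha> i\<bar>) * (real CARD('d) * unit_ball_vol (real CARD('d)) / (p * \<alpha> i + real CARD('d))) * (t * r ^ CARD('d) / scale powr p)"
      by (simp add: radial_mass_def rp mult_ac)
  qed
  also have "\<dots> = moment_const CARD('d) \<alpha> p * (t * r ^ CARD('d) / scale powr p)"
    by (simp only: moment_const_def sum_distrib_right mult.assoc)
  finally show ?thesis .
qed

lemma moment_const_nonneg: "(\<And>i. p * \<alpha> i > - real CARD('d)) \<Longrightarrow> 0 \<le> moment_const CARD('d) \<alpha> p"
proof -
  assume p: "\<And>i. p * \<alpha> i > - real CARD('d)"
  have "0 < p * \<alpha> i + real CARD('d)" for i using p[of i] by linarith
  then show ?thesis unfolding moment_const_def
    by (intro mult_nonneg_nonneg sum_nonneg divide_nonneg_pos) auto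
qed

lemma I_ne: "I n \<noteq> {}" using W_ne by (simp add: I_def)

lemma kernel_nk: "indep_poisson.kernel (I n) (nk n i)"
proof -
  interpret G: indep_poisson M "I n" "cnt n" "lam n" by (rule indep_poisson_grid)
  show ?thesis unfolding G.kernel_def
  proof (intro conjI ballI)
    fix a b
    show "nk n i a b = nk n i b a" unfolding nk_def by (subst grid_kernel_sym) (rule refl)
    show "0 \<le> nk n i a b" by (rule nk_nonneg)
    show "nk n i a a = 0" by (simp add: nk_def grid_kernel_diag)
  qed
qed

lemma F_grid_sum: "indep_poisson.F (I n) (nk n i) (indep_poisson.config (I n) (cnt n) \<omega>) = coef i * grid_sum n (\<alpha> i) r \<omega>"
proof -
  interpret G: indep_poisson M "I n" "cnt n" "lam n" by (rule indep_poisson_grid)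
  have "G.F (nk n i) (G.config \<omega>) = 1 / 2 * (\<Sum>a\<in>I n. real (cnt n a \<omega>) * (\<Sum>b\<in>I n. nk n i a b * real (cnt n b \<omega>)))"
    by (simp add: G.F_def G.S_def G.config_def)
  then show ?thesis by (simp add: grid_sum_def nk_def sum_distrib_left mult_ac)
qed

definition A :: "'m \<Rightarrow> 'm \<Rightarrow> real ^ 'd \<Rightarrow> real" where
  "A i j x = (\<integral>y. indicator W y * edge_kernel (\<alpha> i + \<alpha> j) r (norm (x - y)) \<partial>lborel)"
definition B :: "'m \<Rightarrow> real ^ 'd \<Rightarrow> real" where
  "B i x = (\<integral>y. indicator W y * edge_kernel (\<alpha> i) r (norm (x - y)) \<partial>lborel)"
text \<open>The limit of the grid covariances as the mesh shrinks; it still contains the boundary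
  effect of W through \<open>A\<close> and \<open>B\<close>.\<close>

definition covL :: "'m \<Rightarrow> 'm \<Rightarrow> real" where
  "covL i j = coef i * coef j * (t * (\<integral>x. indicator W x * (1 / 2 * (t * A i j x) + t * B i x * (t * B j x)) \<partial>lborel))"

definition An :: "nat \<Rightarrow> 'm \<Rightarrow> 'm \<Rightarrow> real ^ 'd \<Rightarrow> real" where
  "An n i j x = (\<integral>y. indicator W y * (grid_kernel n (\<alpha> i) r (cell n x) (cell n y) * grid_kernel n (\<alpha> j) r (cell n x) (cell n y)) \<partial>lborel)"
definition Bn :: "nat \<Rightarrow> 'm \<Rightarrow> real ^ 'd \<Rightarrow> real" where
  "Bn n i x = (\<integral>y. indicator W y * grid_kernel n (\<alpha> i) r (cell n x) (cell n y) \<partial>lborel)"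

lemma W_measurable[measurable]: "W \<in> sets borel" by (rule W_borel)

lemma An_Bn_limits:
  "(\<lambda>n. An n i j x) \<longlonglongrightarrow> A i j x" "(\<lambda>n. Bn n i x) \<longlonglongrightarrow> B i x"
  "\<bar>An n i j x\<bar> \<le> 2 powr \<bar>\<alpha> i\<bar> * 2 powr \<bar>\<alpha> j\<bar> * radial_mass CARD('d) (\<alpha> i + \<alpha> j) r" "\<bar>Bn n i x\<bar> \<le> 2 powr \<bar>\<alpha> i\<bar> * radial_mass CARD('d) (\<alpha> i) r"
proof -
  have b2: "\<bar>indicator W y * (grid_kernel n (\<alpha> i) r (cell n x) (cell n y) * grid_kernel n (\<alpha> j) r (cell n x) (cell n y))\<bar>
     \<le> 2 powr \<bar>\<alpha> i\<bar> * 2 powr \<bar>\<alpha> j\<bar> * edge_kernel (\<alpha> i + \<alpha> j) r (norm (x - y))" for n y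
  proof -
    have "grid_kernel n (\<alpha> i) r (cell n x) (cell n y) * grid_kernel n (\<alpha> j) r (cell n x) (cell n y)
      \<le> (2 powr \<bar>\<alpha> i\<bar> * edge_kernel (\<alpha> i) r (norm (x - y))) * (2 powr \<bar>\<alpha> j\<bar> * edge_kernel (\<alpha> j) r (norm (x - y)))"
      by (intro mult_mono grid_kernel_le mult_nonneg_nonneg grid_kernel_nonneg edge_kernel_nonneg) auto
    also have "\<dots> = 2 powr \<bar>\<alpha> i\<bar> * 2 powr \<bar>\<alpha> j\<bar> * edge_kernel (\<alpha> i + \<alpha> j) r (norm (x - y))"
      by (simp add: edge_kernel_mult[symmetric])
    finally show ?thesis
      using edge_kernel_nonneg[of "\<alpha> i + \<alpha> j" r "norm (x - y)"] grid_kernel_nonneg[of n "\<alpha> i" r "cell n x" "cell n y"] grid_kernel_nonneg[of n "\<alpha> j" r "cell n x" "cell n y"]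
      by (cases "y \<in> W") auto
  qed
  have b1: "\<bar>indicator W y * grid_kernel n (\<alpha> i) r (cell n x) (cell n y)\<bar> \<le> 2 powr \<bar>\<alpha> i\<bar> * edge_kernel (\<alpha> i) r (norm (x - y))" for n y
    using grid_kernel_le[of n "\<alpha> i" r x y] grid_kernel_nonneg[of n "\<alpha> i" r "cell n x" "cell n y"] edge_kernel_nonneg[of "\<alpha> i" r "norm (x - y)"]
    by (cases "y \<in> W") auto
  note i2 = integrable_mult_right[OF integrable_edge_kernel[OF r_pos \<alpha>_sum[of i j], of x], of "2 powr \<bar>\<alpha> i\<bar> * 2 powr \<bar>\<alpha> j\<bar>"]
  note i1 = integrable_mult_right[OF integrable_edge_kernel[OF r_pos \<alpha>_gt[of i], of x], of "2 powr \<bar>\<alpha> i\<bar>"]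
  show "(\<lambda>n. An n i j x) \<longlonglongrightarrow> A i j x" unfolding An_def A_def
  proof (rule integral_dominated_convergence[OF _ _ i2])
    show "AE y in lborel. (\<lambda>n. indicator W y * (grid_kernel n (\<alpha> i) r (cell n x) (cell n y) * grid_kernel n (\<alpha> j) r (cell n x) (cell n y)))
       \<longlonglongrightarrow> indicator W y * edge_kernel (\<alpha> i + \<alpha> j) r (norm (x - y))"
      unfolding edge_kernel_mult[symmetric] by (intro AE_I2 tendsto_intros grid_kernel_tendsto)
  qed (use b2 in auto)
  show "(\<lambda>n. Bn n i x) \<longlonglongrightarrow> B i x" unfolding Bn_def B_def
  proof (rule integral_dominated_convergence[OF _ _ i1])
    show "AE y in lborel. (\<lambda>n. indicator W y * grid_kernel n (\<alpha> i) r (cell n x) (cell n y)) \<longlonglongrightarrow> indicator W y * edge_kernel (\<alpha> i) r (norm (x - y))"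
      by (intro AE_I2 tendsto_intros grid_kernel_tendsto)
  qed (use b1 in auto)
  have "\<bar>An n i j x\<bar> \<le> (\<integral>y. 2 powr \<bar>\<alpha> i\<bar> * 2 powr \<bar>\<alpha> j\<bar> * edge_kernel (\<alpha> i + \<alpha> j) r (norm (x - y)) \<partial>lborel)"
    unfolding An_def by (intro order_trans[OF integral_abs_bound] integral_mono' i2 b2) (simp add: edge_kernel_nonneg)
  then show "\<bar>An n i j x\<bar> \<le> 2 powr \<bar>\<alpha> i\<bar> * 2 powr \<bar>\<alpha> j\<bar> * radial_mass CARD('d) (\<alpha> i + \<alpha> j) r"
    by (simp add: integral_edge_kernel[OF r_pos \<alpha>_sum])
  have "\<bar>Bn n i x\<bar> \<le> (\<integral>y. 2 powr \<bar>\<alpha> i\<bar> * edge_kernel (\<alpha> i) r (norm (x - y)) \<partial>lborel)"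
    unfolding Bn_def by (intro order_trans[OF integral_abs_bound] integral_mono' i1 b1) (simp add: edge_kernel_nonneg)
  then show "\<bar>Bn n i x\<bar> \<le> 2 powr \<bar>\<alpha> i\<bar> * radial_mass CARD('d) (\<alpha> i) r"
    by (simp add: integral_edge_kernel[OF r_pos \<alpha>_gt])
qed

lemma mean_T_grid:
  "indep_poisson.mean M (I n) (cnt n) (indep_poisson.T (I n) (lam n) (nk n i) (nk n j))
    = coef i * coef j * (t * (\<integral>x. indicator W x * (1 / 2 * (t * An n i j x) + t * Bn n i x * (t * Bn n j x)) \<partial>lborel))"
proof -
  interpret G: indep_poisson M "I n" "cnt n" "lam n" by (rule indep_poisson_grid)
  have mB: "G.m (nk n i) (cell n x) = coef i * (t * Bn n i x)" for i x
  proof -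
    have "G.m (nk n i) (cell n x) = coef i * (\<Sum>b\<in>I n. lam n b * grid_kernel n (\<alpha> i) r (cell n x) b)"
      by (simp add: G.m_def nk_def sum_distrib_left mult_ac)
    then show ?thesis by (simp add: lam_sum Bn_def)
  qed
  have mA: "(\<Sum>b\<in>I n. lam n b * nk n i (cell n x) b * nk n j (cell n x) b) = coef i * coef j * (t * An n i j x)" for x
  proof -
    have "(\<Sum>b\<in>I n. lam n b * nk n i (cell n x) b * nk n j (cell n x) b)
      = coef i * coef j * (\<Sum>b\<in>I n. lam n b * (grid_kernel n (\<alpha> i) r (cell n x) b * grid_kernel n (\<alpha> j) r (cell n x) b))"
      by (simp add: nk_def sum_distrib_left mult_ac)
    then show ?thesis by (simp add: lam_sum An_def)
  qed
  have "G.mean (G.T (nk n i) (nk n j)) = t * (\<integral>x. indicator W x *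
     (1 / 2 * (\<Sum>b\<in>I n. lam n b * nk n i (cell n x) b * nk n j (cell n x) b) + G.m (nk n i) (cell n x) * G.m (nk n j) (cell n x)) \<partial>lborel)"
    unfolding G.mean_T by (rule lam_sum)
  also have "\<dots> = t * (\<integral>x. coef i * coef j * (indicator W x * (1 / 2 * (t * An n i j x) + t * Bn n i x * (t * Bn n j x))) \<partial>lborel)"
    unfolding mA mB by (intro arg_cong[where f="\<lambda>z. t * z"] Bochner_Integration.integral_cong refl) (simp add: algebra_simps)
  finally show ?thesis by simp
qed

lemma An_Bn_measurable: "(\<lambda>x. An n i j x) \<in> borel_measurable borel" "(\<lambda>x. Bn n i x) \<in> borel_measurable borel"
  unfolding An_def Bn_def by measurable

lemma A_B_measurable: "(\<lambda>x. A i j x) \<in> borel_measurable borel" "(\<lambda>x. B i x) \<in> borel_measurable borel"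
  unfolding A_def B_def by measurable

lemma integrable_W: "integrable lborel (indicat_real W)"
  using emeasure_W by (intro integrable_real_indicator) auto

lemma mean_T_limit:
  "(\<lambda>n. indep_poisson.mean M (I n) (cnt n) (indep_poisson.T (I n) (lam n) (nk n i) (nk n j))) \<longlonglongrightarrow> covL i j"
  unfolding mean_T_grid covL_def
proof (intro tendsto_mult tendsto_const integral_dominated_convergence)
  note [measurable] = An_Bn_measurable A_B_measurable
  let ?a = "2 powr \<bar>\<alpha> i\<bar> * 2 powr \<bar>\<alpha> j\<bar> * radial_mass CARD('d) (\<alpha> i + \<alpha> j) r" and ?b = "\<lambda>i. 2 powr \<bar>\<alpha> i\<bar> * radial_mass CARD('d) (\<alpha> i) r"
  show "integrable lborel (\<lambda>x. (1 / 2 * (t * ?a) + t * ?b i * (t * ?b j)) * indicator W x)"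
    using integrable_W by simp
  show "AE x in lborel. norm (indicator W x * (1 / 2 * (t * An n i j x) + t * Bn n i x * (t * Bn n j x)))
     \<le> (1 / 2 * (t * ?a) + t * ?b i * (t * ?b j)) * indicator W x" for n
  proof (intro AE_I2)
    fix x
    have "\<bar>t * Bn n i x * (t * Bn n j x)\<bar> \<le> t * ?b i * (t * ?b j)"
      unfolding abs_mult using t_pos
      by (intro mult_mono mult_nonneg_nonneg An_Bn_limits(4) radial_mass_nonneg[OF r_pos \<alpha>_gt]) auto
    moreover have "\<bar>1 / 2 * (t * An n i j x)\<bar> \<le> 1 / 2 * (t * ?a)"
      unfolding abs_mult using t_pos An_Bn_limits(3)[of n i j x] by (intro mult_mono) auto
    ultimately have "\<bar>1 / 2 * (t * An n i j x) + t * Bn n i x * (t * Bn n j x)\<bar> \<le> 1 / 2 * (t * ?a) + t * ?b i * (t * ?b j)"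
      using abs_triangle_ineq[of "1 / 2 * (t * An n i j x)" "t * Bn n i x * (t * Bn n j x)"] by linarith
    then show "norm (indicator W x * (1 / 2 * (t * An n i j x) + t * Bn n i x * (t * Bn n j x)))
     \<le> (1 / 2 * (t * ?a) + t * ?b i * (t * ?b j)) * indicator W x"
      by (cases "x \<in> W") auto
  qed
  show "AE x in lborel. (\<lambda>n. indicator W x * (1 / 2 * (t * An n i j x) + t * Bn n i x * (t * Bn n j x)))
     \<longlonglongrightarrow> indicator W x * (1 / 2 * (t * A i j x) + t * B i x * (t * B j x))"
    by (intro AE_I2 tendsto_intros An_Bn_limits)
qed (use An_Bn_measurable A_B_measurable in measurable)

text \<open>The covariance per unit volume when boundary effects are ignored. With l = t r^d one has
  scale^2 = t l max 1 l, and the two terms of \<open>mean_T\<close> become sigma1 and l sigma2,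
  divided by max 1 l.\<close>

lemma normalized_mass: "coef i * coef j * (t * (1 / 2 * (t * radial_mass CARD('d) (\<alpha> i + \<alpha> j) r) + t * radial_mass CARD('d) (\<alpha> i) r * (t * radial_mass CARD('d) (\<alpha> j) r))) = cov_beta CARD('d) t r (\<alpha> i) (\<alpha> j)"
proof -
  define l where "l = t * r ^ CARD('d)"
  have l: "l > 0" using t_pos r_pos by (simp add: l_def)
  have rp: "r powr real CARD('d) = r ^ CARD('d)" using r_pos by (simp add: powr_realpow)
  have sc: "scale\<^sup>2 = t * l * max 1 l"
  proof -
    have "t * r powr (real CARD('d) / 2) = sqrt (t * l)"
    proof (rule real_sqrt_unique[symmetric])
      show "(t * r powr (real CARD('d) / 2))\<^sup>2 = t * l"
        using r_pos by (simp add: power_mult_distrib l_def rp[symmetric] power2_eq_square powr_add[symmetric])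
    qed (use t_pos in simp)
    moreover have "t powr (3 / 2) * r powr real CARD('d) = sqrt (t * l * l)"
    proof (rule real_sqrt_unique[symmetric])
      have "t powr (3 / 2) * t powr (3 / 2) = t ^ 3"
        using t_pos by (simp add: powr_add[symmetric] powr_realpow[symmetric] del: powr_numeral)
      then show "(t powr (3 / 2) * r powr real CARD('d))\<^sup>2 = t * l * l"
        by (simp add: power_mult_distrib power2_eq_square l_def rp power3_eq_cube mult_ac)
    qed (use t_pos in simp)
    ultimately have "scale = max (sqrt (t * l)) (sqrt (t * l * l))" by (simp add: scale_def)
    also have "\<dots> = sqrt (max (t * l) (t * l * l))"
      by (simp add: max_def)
    finally have "scale\<^sup>2 = max (t * l) (t * l * l)" using t_pos l by (simp add: le_max_iff_disj)
    then show ?thesis using t_pos l by (simp add: max_mult_distrib_left)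
  qed
  have s1: "\<alpha> i + \<alpha> j + real CARD('d) > 0" using \<alpha>_sum[of i j] by linarith
  have s2: "\<alpha> i + real CARD('d) > 0" "\<alpha> j + real CARD('d) > 0" using \<alpha>_gt[of i] \<alpha>_gt[of j] by linarith+
  define X where "X = radial_mass CARD('d) (\<alpha> i + \<alpha> j) r"
  define Y where "Y i = radial_mass CARD('d) (\<alpha> i) r" for i
  define a where "a = r powr (- \<alpha> i - \<alpha> j)"
  have 1: "coef i * coef j = a / scale\<^sup>2"
    by (simp add: a_def coef_eq power2_eq_square powr_diff powr_minus divide_simps)
  have 2: "a * X = real CARD('d) * unit_ball_vol (real CARD('d)) * r ^ CARD('d) / (\<alpha> i + \<alpha> j + real CARD('d))"
    by (simp add: a_def X_def radial_mass_def rp[symmetric] powr_add[symmetric])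
  have 3: "a * (Y i * Y j) = (real CARD('d))\<^sup>2 * (unit_ball_vol (real CARD('d)))\<^sup>2 * (r ^ CARD('d) * r ^ CARD('d)) / ((\<alpha> i + real CARD('d)) * (\<alpha> j + real CARD('d)))"
  proof -
    have "a * (r powr (\<alpha> i + real CARD('d)) * r powr (\<alpha> j + real CARD('d))) = r ^ CARD('d) * r ^ CARD('d)"
      by (simp add: a_def rp[symmetric] powr_add[symmetric])
    then show ?thesis by (simp add: Y_def radial_mass_def power2_eq_square mult_ac)
  qed
  have "coef i * coef j * (t * (1 / 2 * (t * X) + t * Y i * (t * Y j)))
    = (t * (1 / 2 * (t * (a * X)) + t * t * (a * (Y i * Y j)))) / scale\<^sup>2"
    unfolding 1 using scale_pos by (simp add: field_simps)
  also have "\<dots> = cov_beta CARD('d) t r (\<alpha> i) (\<alpha> j)"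
  proof -
    have alg: "(t * (1 / 2 * (t * (P * R)) + t * t * (Q * (R * R)))) / (t * (t * R) * mx) = (P / 2 + Q * t * R) / mx"
      if "R > 0" "mx > 0" for P Q R mx :: real
      using that t_pos by (simp add: field_simps)
    have "\<bar>\<alpha> i + \<alpha> j + real CARD('d)\<bar> = \<alpha> i + \<alpha> j + real CARD('d)" using s1 by simp
    then show ?thesis
      using alg[of "r ^ CARD('d)" "max 1 (t * r ^ CARD('d))" "real CARD('d) * unit_ball_vol (real CARD('d)) / (\<alpha> i + \<alpha> j + real CARD('d))"
         "(real CARD('d))\<^sup>2 * (unit_ball_vol (real CARD('d)))\<^sup>2 / ((\<alpha> i + real CARD('d)) * (\<alpha> j + real CARD('d)))"] r_pos
      unfolding sc cov_beta_def sigma1_def sigma2_def 2 3 l_def by simp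
  qed
  finally show ?thesis by (simp add: X_def Y_def)
qed

end

section \<open>Boundary error and vanishing mesh\<close>

context edge_window
begin

lemma full_mass_nonneg: "0 \<le> 1 / 2 * (t * radial_mass CARD('d) (\<alpha> i + \<alpha> j) r) + t * radial_mass CARD('d) (\<alpha> i) r * (t * radial_mass CARD('d) (\<alpha> j) r)"
proof -
  note a = radial_mass_nonneg[OF r_pos \<alpha>_sum[of i j]] radial_mass_nonneg[OF r_pos \<alpha>_gt[of i]] radial_mass_nonneg[OF r_pos \<alpha>_gt[of j]]
  show ?thesis using t_pos a by simp
qed

text \<open>For x in V the inner integrals over W are the full radial masses; elsewhere in W the
  integrand lies between 0 and its full value. So the error is at most the volume of W minus V times
  the full value.\<close>

lemma covL_error:
  assumes V: "V \<in> sets borel" "V \<subseteq> W" "\<And>x. x \<in> V \<Longrightarrow> ball x r \<subseteq> W" and e: "w - measure lborel V \<le> e * r"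
  shows "\<bar>covL i j - w * cov_beta CARD('d) t r (\<alpha> i) (\<alpha> j)\<bar> \<le> e * r * cov_beta CARD('d) t r (\<alpha> i) (\<alpha> j)"
proof -
  let ?J = "\<lambda>b. radial_mass CARD('d) b r"
  define full where "full = 1 / 2 * (t * ?J (\<alpha> i + \<alpha> j)) + t * ?J (\<alpha> i) * (t * ?J (\<alpha> j))"
  define f where "f x = 1 / 2 * (t * A i j x) + t * B i x * (t * B j x)" for x
  have full0: "0 \<le> full" unfolding full_def by (rule full_mass_nonneg)
  have ab: "0 \<le> (\<integral>y. indicator W y * edge_kernel b r (norm (x - y)) \<partial>lborel)"
    "(\<integral>y. indicator W y * edge_kernel b r (norm (x - y)) \<partial>lborel) \<le> ?J b"
    "x \<in> V \<Longrightarrow> (\<integral>y. indicator W y * edge_kernel b r (norm (x - y)) \<partial>lborel) = ?J b"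
    if b: "b > - real CARD('d)" for b and x :: "real ^ 'd"
  proof -
    show "0 \<le> (\<integral>y. indicator W y * edge_kernel b r (norm (x - y)) \<partial>lborel)"
      by (intro Bochner_Integration.integral_nonneg) (simp add: edge_kernel_nonneg)
    have "(\<integral>y. indicator W y * edge_kernel b r (norm (x - y)) \<partial>lborel) \<le> (\<integral>y. edge_kernel b r (norm (x - y)) \<partial>lborel)"
      by (intro integral_mono' integrable_edge_kernel r_pos b) (auto simp: edge_kernel_nonneg indicator_def)
    then show "(\<integral>y. indicator W y * edge_kernel b r (norm (x - y)) \<partial>lborel) \<le> ?J b"
      by (simp add: integral_edge_kernel[OF r_pos b])
    assume x: "x \<in> V"
    have eq: "indicator W y * edge_kernel b r (norm (x - y)) = edge_kernel b r (norm (x - y))" for y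
      using V(3)[OF x] by (auto simp: edge_kernel_def indicator_def dist_norm)
    show "(\<integral>y. indicator W y * edge_kernel b r (norm (x - y)) \<partial>lborel) = ?J b"
      unfolding eq by (rule integral_edge_kernel[OF r_pos b])
  qed
  have f: "0 \<le> f x" "f x \<le> full" "x \<in> V \<Longrightarrow> f x = full" for x
  proof -
    note a = ab[OF \<alpha>_sum[of i j], of x, folded A_def] and bi = ab[OF \<alpha>_gt[of i], of x, folded B_def] and bj = ab[OF \<alpha>_gt[of j], of x, folded B_def]
    show "0 \<le> f x" unfolding f_def using t_pos a bi bj by simp
    show "f x \<le> full" unfolding f_def full_def using t_pos a bi bj
      by (intro add_mono mult_left_mono mult_mono mult_nonneg_nonneg) auto
    show "x \<in> V \<Longrightarrow> f x = full" unfolding f_def full_def using a bi bj by simp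
  qed
  note [measurable] = A_B_measurable
  have fm[measurable]: "f \<in> borel_measurable borel" unfolding f_def by measurable
  have iV: "integrable lborel (\<lambda>x. indicator V x * full)"
  proof -
    have "emeasure lborel V \<le> emeasure lborel W" using V W_borel by (intro emeasure_mono) auto
    then have "integrable lborel (indicat_real V)" using emeasure_W V(1) by (intro integrable_real_indicator) auto
    then show ?thesis by simp
  qed
  have iF: "integrable lborel (\<lambda>x. indicator W x * f x)"
    by (rule Bochner_Integration.integrable_bound[where f="\<lambda>x. indicator W x * full"])
       (use integrable_W f full0 in \<open>auto simp: abs_mult intro!: AE_I2 mult_left_mono\<close>)
  have up: "(\<integral>x. indicator W x * f x \<partial>lborel) \<le> w * full"
  proof -
    have "(\<integral>x. indicator W x * f x \<partial>lborel) \<le> (\<integral>x. indicator W x * full \<partial>lborel)"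
      by (intro integral_mono iF mult_left_mono f) (use integrable_W in auto)
    then show ?thesis by (simp add: w_def)
  qed
  have low: "measure lborel V * full \<le> (\<integral>x. indicator W x * f x \<partial>lborel)"
  proof -
    have "(\<integral>x. indicator V x * full \<partial>lborel) \<le> (\<integral>x. indicator W x * f x \<partial>lborel)"
      by (intro integral_mono iF iV) (use f V(2) in \<open>auto simp: indicator_def\<close>)
    then show ?thesis by simp
  qed
  define p where "p = coef i * coef j * t"
  have p: "p \<ge> 0" using coef_pos[of i] coef_pos[of j] t_pos by (simp add: p_def)
  have beta: "cov_beta CARD('d) t r (\<alpha> i) (\<alpha> j) = p * full"
    by (simp add: normalized_mass[symmetric] p_def full_def mult.assoc)
  have cov: "covL i j = p * (\<integral>x. indicator W x * f x \<partial>lborel)" by (simp add: covL_def p_def f_def mult.assoc)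
  have "w * full - (\<integral>x. indicator W x * f x \<partial>lborel) \<le> (w - measure lborel V) * full" using low by (simp add: left_diff_distrib)
  also have "\<dots> \<le> (e * r) * full" by (intro mult_right_mono e full0)
  finally have "\<bar>(\<integral>x. indicator W x * f x \<partial>lborel) - w * full\<bar> \<le> (e * r) * full" using up by linarith
  then have "p * \<bar>(\<integral>x. indicator W x * f x \<partial>lborel) - w * full\<bar> \<le> p * ((e * r) * full)" by (intro mult_left_mono p)
  moreover have "covL i j - w * (p * full) = p * ((\<integral>x. indicator W x * f x \<partial>lborel) - w * full)"
    unfolding cov by (simp add: algebra_simps)
  ultimately show ?thesis unfolding beta using p by (simp add: abs_mult mult_ac)
qed

abbreviation E :: "'m \<Rightarrow> 'w \<Rightarrow> real" where "E i \<omega> \<equiv> edge_sum W r (\<alpha> i) (\<eta> \<omega>)"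

lemma E_measurable[measurable]: "E i \<in> borel_measurable M"
  by (rule edge_sum_measurable[OF r_pos])

lemma grid_sum_measurable[measurable]: "grid_sum n (\<alpha> i) r \<in> borel_measurable M"
proof -
  interpret G: indep_poisson M "I n" "cnt n" "lam n" by (rule indep_poisson_grid)
  have "grid_sum n (\<alpha> i) r = (\<lambda>\<omega>. G.F (nk n i) (G.config \<omega>) / coef i)"
    using coef_pos[of i] by (intro ext) (simp add: F_grid_sum)
  then show ?thesis using G.config_fun_measurable[of "\<lambda>c. G.F (nk n i) c / coef i"] by (simp only:)
qed

text \<open>Up to normalisation the second moment is the mean of \<open>T\<close> plus the squared
  mean. The former converges as the mesh shrinks and the latter is bounded by first moments of the
  kernel, so the bound is uniform in n and Fatou's lemma transfers it to the edge sum.\<close>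

lemma grid_sum_second_moment:
  "\<exists>Bd. \<forall>n. integrable M (\<lambda>\<omega>. (grid_sum n (\<alpha> i) r \<omega>)\<^sup>2) \<and> expectation (\<lambda>\<omega>. (grid_sum n (\<alpha> i) r \<omega>)\<^sup>2) \<le> Bd"
proof -
  let ?mT = "\<lambda>n. indep_poisson.mean M (I n) (cnt n) (indep_poisson.T (I n) (lam n) (nk n i) (nk n i))"
  obtain T0 where T0: "\<And>n. \<bar>?mT n\<bar> \<le> T0"
    using mean_T_limit[of i i] convergent_imp_Bseq[of ?mT] unfolding Bseq_def convergent_def by auto
  define m0 where "m0 = moment_const CARD('d) \<alpha> 1 * (t * r ^ CARD('d) / scale powr 1)"
  define Bd where "Bd = (T0 + (1 / 2 * (t * w * m0))\<^sup>2) / (coef i)\<^sup>2"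
  have "integrable M (\<lambda>\<omega>. (grid_sum n (\<alpha> i) r \<omega>)\<^sup>2) \<and> expectation (\<lambda>\<omega>. (grid_sum n (\<alpha> i) r \<omega>)\<^sup>2) \<le> Bd" for n
  proof -
    interpret G: indep_poisson M "I n" "cnt n" "lam n" by (rule indep_poisson_grid)
    note pg = G.poly_growth_intros G.poly_growth_S G.poly_growth_F
    have gs: "(grid_sum n (\<alpha> i) r \<omega>)\<^sup>2 = (G.F (nk n i) (G.config \<omega>))\<^sup>2 / (coef i)\<^sup>2" for \<omega>
      using coef_pos[of i] by (simp add: F_grid_sum power_mult_distrib)
    have int: "integrable M (\<lambda>\<omega>. (G.F (nk n i) (G.config \<omega>))\<^sup>2)"
      by (rule G.poly_growth_integrable[where f="\<lambda>c. (G.F (nk n i) c)\<^sup>2"]) (intro pg)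
    have mle: "G.m (nk n i) a \<le> m0" if a: "a \<in> I n" for a
    proof -
      have "G.m (nk n i) a \<le> (\<Sum>b\<in>I n. lam n b * Ksum n a b powr 1)"
        unfolding G.m_def
      proof (rule sum_mono)
        fix b
        have "nk n i a b \<le> Ksum n a b" unfolding Ksum_def by (rule member_le_sum) (auto simp: nk_nonneg)
        then show "nk n i a b * lam n b \<le> lam n b * Ksum n a b powr 1"
          using lam_nonneg[of n b] Ksum_nonneg[of n a b] by (simp add: mult.commute mult_left_mono)
      qed
      also have "\<dots> \<le> m0" unfolding m0_def by (rule Ksum_moment[OF a]) (use \<alpha>_gt in auto)
      finally show ?thesis .
    qed
    have mF: "G.mean (G.F (nk n i)) = 1 / 2 * (\<Sum>a\<in>I n. lam n a * G.m (nk n i) a)" by (rule G.mean_F[OF kernel_nk])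
    have mF0: "0 \<le> G.mean (G.F (nk n i))" unfolding mF
      by (intro mult_nonneg_nonneg sum_nonneg lam_nonneg G.m_nonneg[OF kernel_nk]) auto
    have "G.mean (G.F (nk n i)) \<le> 1 / 2 * (\<Sum>a\<in>I n. lam n a * m0)"
      unfolding mF by (intro mult_left_mono sum_mono mle lam_nonneg) auto
    also have "\<dots> = 1 / 2 * (t * w * m0)" by (simp add: sum_distrib_right[symmetric] sum_lam w_def)
    finally have mF1: "(G.mean (G.F (nk n i)))\<^sup>2 \<le> (1 / 2 * (t * w * m0))\<^sup>2" using mF0 by (intro power_mono)
    have "G.mean (\<lambda>c. (G.F (nk n i) c)\<^sup>2) = G.mean (\<lambda>c. G.F (nk n i) c * G.F (nk n i) c)" by (simp add: power2_eq_square)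
    also have "\<dots> = (\<Sum>a\<in>I n. lam n a * G.mean (\<lambda>c. (G.F (nk n i) (G.up a c) - G.F (nk n i) c) * (1 / 2 * (G.S (nk n i) a c + G.m (nk n i) a))))
       + (G.mean (G.F (nk n i)))\<^sup>2"
      unfolding G.F_product_mean[OF kernel_nk G.poly_growth_F] mF[symmetric] by (simp add: mF power2_eq_square)
    also have "(\<Sum>a\<in>I n. lam n a * G.mean (\<lambda>c. (G.F (nk n i) (G.up a c) - G.F (nk n i) c) * (1 / 2 * (G.S (nk n i) a c + G.m (nk n i) a)))) = ?mT n"
    proof -
      have "(\<Sum>a\<in>I n. lam n a * G.mean (\<lambda>c. (G.F (nk n i) (G.up a c) - G.F (nk n i) c) * (1 / 2 * (G.S (nk n i) a c + G.m (nk n i) a))))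
        = (\<Sum>a\<in>I n. lam n a * G.mean (\<lambda>c. G.S (nk n i) a c * (1 / 2 * (G.S (nk n i) a c + G.m (nk n i) a))))"
        by (intro sum.cong refl) (simp add: G.F_up[OF kernel_nk])
      also have "\<dots> = ?mT n" unfolding G.T_def by (simp only: G.mean_sum G.mean_cmult pg)
      finally show ?thesis .
    qed
    finally have "G.mean (\<lambda>c. (G.F (nk n i) c)\<^sup>2) \<le> T0 + (1 / 2 * (t * w * m0))\<^sup>2"
      using T0[of n] mF1 by linarith
    then have "G.mean (\<lambda>c. (G.F (nk n i) c)\<^sup>2) / (coef i)\<^sup>2 \<le> Bd"
      unfolding Bd_def by (intro divide_right_mono) auto
    then show ?thesis unfolding gs using int by (simp add: G.mean_def)
  qed
  then show ?thesis by blast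
qed

lemma E_square_integrable: "integrable M (\<lambda>\<omega>. (E i \<omega>)\<^sup>2)" and E_integrable: "integrable M (E i)"
proof -
  obtain Bd where Bd: "\<And>n. integrable M (\<lambda>\<omega>. (grid_sum n (\<alpha> i) r \<omega>)\<^sup>2)" "\<And>n. expectation (\<lambda>\<omega>. (grid_sum n (\<alpha> i) r \<omega>)\<^sup>2) \<le> Bd"
    using grid_sum_second_moment[of i] by blast
  have "(\<integral>\<^sup>+\<omega>. ennreal ((E i \<omega>)\<^sup>2) \<partial>M) = (\<integral>\<^sup>+\<omega>. liminf (\<lambda>n. ennreal ((grid_sum n (\<alpha> i) r \<omega>)\<^sup>2)) \<partial>M)"
  proof (rule nn_integral_cong_AE)
    show "AE \<omega> in M. ennreal ((E i \<omega>)\<^sup>2) = liminf (\<lambda>n. ennreal ((grid_sum n (\<alpha> i) r \<omega>)\<^sup>2))"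
      using AE_grid_sum[of "\<alpha> i" r]
    proof eventually_elim
      case (elim \<omega>)
      then have "(\<lambda>n. ennreal ((grid_sum n (\<alpha> i) r \<omega>)\<^sup>2)) \<longlonglongrightarrow> ennreal ((E i \<omega>)\<^sup>2)"
        by (intro tendsto_ennrealI tendsto_power) auto
      from lim_imp_Liminf[OF sequentially_bot this] show ?case by (rule sym)
    qed
  qed
  also have "\<dots> \<le> liminf (\<lambda>n. \<integral>\<^sup>+\<omega>. ennreal ((grid_sum n (\<alpha> i) r \<omega>)\<^sup>2) \<partial>M)"
    by (rule nn_integral_liminf) measurable
  also have "\<dots> \<le> liminf (\<lambda>n. ennreal Bd)"
  proof (rule Liminf_mono, rule always_eventually, rule allI)
    fix n show "(\<integral>\<^sup>+\<omega>. ennreal ((grid_sum n (\<alpha> i) r \<omega>)\<^sup>2) \<partial>M) \<le> ennreal Bd"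
      by (subst nn_integral_eq_integral[OF Bd(1)]) (auto intro: ennreal_leI Bd(2))
  qed
  also have "\<dots> = ennreal Bd" by (simp add: Liminf_const)
  finally have "(\<integral>\<^sup>+\<omega>. ennreal ((E i \<omega>)\<^sup>2) \<partial>M) < \<infinity>" by (auto intro: le_less_trans)
  then show sq: "integrable M (\<lambda>\<omega>. (E i \<omega>)\<^sup>2)" by (intro integrableI_nonneg) auto
  show "integrable M (E i)"
  proof (rule Bochner_Integration.integrable_bound[where f="\<lambda>\<omega>. 1 + (E i \<omega>)\<^sup>2"])
    have "\<bar>a\<bar> \<le> 1 + a\<^sup>2" for a :: real using sum_squares_bound[of "\<bar>a\<bar>" 1] abs_ge_zero[of a]
      by (simp only: power2_abs power_one mult_1_right)
    then show "AE \<omega> in M. norm (E i \<omega>) \<le> norm (1 + (E i \<omega>)\<^sup>2)" by (auto intro!: AE_I2 order_trans[OF _ abs_ge_self])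
  qed (use sq in auto)
qed

lemma grid_expectation_limit: "(\<lambda>n. expectation (grid_sum n (\<alpha> i) r)) \<longlonglongrightarrow> expectation (E i)"
  and grid_expectation_bound: "\<bar>expectation (grid_sum n (\<alpha> i) r)\<bar> \<le> 2 powr \<bar>\<alpha> i\<bar> * expectation (E i)"
proof -
  have dom: "AE \<omega> in M. norm (grid_sum n (\<alpha> i) r \<omega>) \<le> 2 powr \<bar>\<alpha> i\<bar> * E i \<omega>" for n
    using AE_grid_sum[of "\<alpha> i" r] by eventually_elim auto
  show "(\<lambda>n. expectation (grid_sum n (\<alpha> i) r)) \<longlonglongrightarrow> expectation (E i)"
  proof (rule integral_dominated_convergence[where w="\<lambda>\<omega>. 2 powr \<bar>\<alpha> i\<bar> * E i \<omega>"])
    show "AE \<omega> in M. (\<lambda>n. grid_sum n (\<alpha> i) r \<omega>) \<longlonglongrightarrow> E i \<omega>" using AE_grid_sum[of "\<alpha> i" r] by eventually_elim auto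
  qed (use E_integrable dom in auto)
  have int: "integrable M (grid_sum n (\<alpha> i) r)"
    by (rule Bochner_Integration.integrable_bound[where f="\<lambda>\<omega>. 2 powr \<bar>\<alpha> i\<bar> * E i \<omega>"])
       (use E_integrable AE_mp[OF dom[of n]] in \<open>auto intro!: AE_I2\<close>)
  have "\<bar>expectation (grid_sum n (\<alpha> i) r)\<bar> \<le> expectation (\<lambda>\<omega>. \<bar>grid_sum n (\<alpha> i) r \<omega>\<bar>)" by (rule integral_abs_bound)
  also have "\<dots> \<le> expectation (\<lambda>\<omega>. 2 powr \<bar>\<alpha> i\<bar> * E i \<omega>)"
    by (rule integral_mono_AE) (use int E_integrable dom in auto)
  finally show "\<bar>expectation (grid_sum n (\<alpha> i) r)\<bar> \<le> 2 powr \<bar>\<alpha> i\<bar> * expectation (E i)" by simp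
qed

definition Lvec :: "'w \<Rightarrow> real ^ 'm" where "Lvec \<omega> = (\<chi> i. coef i * (E i \<omega> - expectation (E i)))"
definition Lgrid :: "nat \<Rightarrow> 'w \<Rightarrow> real ^ 'm" where
  "Lgrid n \<omega> = (\<chi> i. coef i * (grid_sum n (\<alpha> i) r \<omega> - expectation (grid_sum n (\<alpha> i) r)))"

lemma Lvec_eq: "normalized_edge_vector M \<eta> W t r \<alpha> = Lvec"
  by (simp add: fun_eq_iff normalized_edge_vector_def normalized_edge_sum_def Lvec_def coef_def)

lemma vec_measurable: "(\<And>i. (\<lambda>\<omega>. f \<omega> i) \<in> borel_measurable M) \<Longrightarrow> (\<lambda>\<omega>. (\<chi> i. f \<omega> i) :: real ^ 'm) \<in> borel_measurable M"
proof -
  assume [measurable]: "\<And>i. (\<lambda>\<omega>. f \<omega> i) \<in> borel_measurable M"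
  have "(\<chi> i. f \<omega> i) = (\<Sum>i\<in>UNIV. f \<omega> i *\<^sub>R axis i 1)" for \<omega>
    by (subst basis_expansion[symmetric]) (simp add: scalar_mult_eq_scaleR)
  then show ?thesis by simp
qed

text \<open>Test functions may grow quadratically, so domination uses the integrable square of the
  edge sum; each grid sum is at most a constant times the edge sum itself.\<close>

lemma test_function_limit:
  fixes h :: "real ^ 'm \<Rightarrow> real"
  assumes hc: "continuous_on UNIV h" and A0: "A0 \<ge> 0" and growth: "\<And>x. \<bar>h x\<bar> \<le> A0 * (1 + (norm x)\<^sup>2)"
  shows "(\<lambda>n. expectation (\<lambda>\<omega>. h (Lgrid n \<omega>))) \<longlonglongrightarrow> expectation (\<lambda>\<omega>. h (Lvec \<omega>))"
proof -
  have [measurable]: "h \<in> borel_measurable borel" by (rule borel_measurable_continuous_onI[OF hc])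
  have [measurable]: "Lgrid n \<in> borel_measurable M" "Lvec \<in> borel_measurable M" for n
    unfolding Lgrid_def Lvec_def by (intro vec_measurable; measurable)+
  define g where "g i \<omega> = (coef i)\<^sup>2 * (2 * ((2 powr \<bar>\<alpha> i\<bar>)\<^sup>2 * (E i \<omega>)\<^sup>2) + 2 * (2 powr \<bar>\<alpha> i\<bar> * expectation (E i))\<^sup>2)" for i \<omega>
  show ?thesis
  proof (rule integral_dominated_convergence[where w="\<lambda>\<omega>. A0 * (1 + (\<Sum>i\<in>UNIV. g i \<omega>))"])
    show "integrable M (\<lambda>\<omega>. A0 * (1 + (\<Sum>i\<in>UNIV. g i \<omega>)))"
      unfolding g_def using E_square_integrable by simp
    have ae: "AE \<omega> in M. \<forall>i. (\<forall>n. 0 \<le> grid_sum n (\<alpha> i) r \<omega> \<and> grid_sum n (\<alpha> i) r \<omega> \<le> 2 powr \<bar>\<alpha> i\<bar> * E i \<omega>)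
       \<and> (\<lambda>n. grid_sum n (\<alpha> i) r \<omega>) \<longlonglongrightarrow> E i \<omega>"
      using AE_finite_allI[of "UNIV :: 'm set" "\<lambda>i \<omega>. (\<forall>n. 0 \<le> grid_sum n (\<alpha> i) r \<omega> \<and> grid_sum n (\<alpha> i) r \<omega> \<le> 2 powr \<bar>\<alpha> i\<bar> * E i \<omega>)
       \<and> (\<lambda>n. grid_sum n (\<alpha> i) r \<omega>) \<longlonglongrightarrow> E i \<omega>" M] AE_grid_sum by simp
    show "AE \<omega> in M. (\<lambda>n. h (Lgrid n \<omega>)) \<longlonglongrightarrow> h (Lvec \<omega>)"
      using ae
    proof eventually_elim
      case (elim \<omega>)
      have "(\<lambda>n. Lgrid n \<omega>) \<longlonglongrightarrow> Lvec \<omega>"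
        unfolding Lgrid_def Lvec_def using elim by (intro vec_tendstoI) (auto intro!: tendsto_intros grid_expectation_limit)
      then show ?case using hc by (auto simp: continuous_on_eq_continuous_at intro: isCont_tendsto_compose)
    qed
    show "AE \<omega> in M. norm (h (Lgrid n \<omega>)) \<le> A0 * (1 + (\<Sum>i\<in>UNIV. g i \<omega>))" for n
      using ae
    proof eventually_elim
      case (elim \<omega>)
      have comp: "(Lgrid n \<omega> $ i)\<^sup>2 \<le> g i \<omega>" for i
      proof -
        let ?x = "grid_sum n (\<alpha> i) r \<omega>" and ?e = "expectation (grid_sum n (\<alpha> i) r)"
        have x: "?x\<^sup>2 \<le> (2 powr \<bar>\<alpha> i\<bar>)\<^sup>2 * (E i \<omega>)\<^sup>2"
          using elim unfolding power_mult_distrib[symmetric] by (intro power_mono) auto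
        have ee: "?e\<^sup>2 \<le> (2 powr \<bar>\<alpha> i\<bar> * expectation (E i))\<^sup>2"
          using power_mono[OF grid_expectation_bound[of n i], of 2] by simp
        have "(?x - ?e)\<^sup>2 \<le> 2 * ?x\<^sup>2 + 2 * ?e\<^sup>2"
          using zero_le_power2[of "?x + ?e"] by (simp add: power2_sum power2_diff)
        then have "(?x - ?e)\<^sup>2 \<le> 2 * ((2 powr \<bar>\<alpha> i\<bar>)\<^sup>2 * (E i \<omega>)\<^sup>2) + 2 * (2 powr \<bar>\<alpha> i\<bar> * expectation (E i))\<^sup>2"
          using x ee by linarith
        then show ?thesis by (simp add: Lgrid_def g_def power_mult_distrib mult_left_mono)
      qed
      have "(norm (Lgrid n \<omega>))\<^sup>2 = (\<Sum>i\<in>UNIV. (Lgrid n \<omega> $ i)\<^sup>2)"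
        unfolding power2_norm_eq_inner by (simp add: inner_vec_def power2_eq_square)
      also have "\<dots> \<le> (\<Sum>i\<in>UNIV. g i \<omega>)" by (intro sum_mono comp)
      finally have "A0 * (1 + (norm (Lgrid n \<omega>))\<^sup>2) \<le> A0 * (1 + (\<Sum>i\<in>UNIV. g i \<omega>))"
        using A0 by (intro mult_left_mono) auto
      then show ?case using growth[of "Lgrid n \<omega>"] by simp
    qed
  qed measurable
qed

text \<open>All components see the same distance u. After division by
  \<open>r powr \<alpha> i\<close> only the ratio u / r in (0, 1) is left, so each vector of kernel
  values is a multiple of a power vector.\<close>

lemma power_vector_multiple:
  assumes "subspace V" and pv: "\<And>\<rho>. 0 < \<rho> \<Longrightarrow> \<rho> < 1 \<Longrightarrow> (\<chi> i. \<rho> powr \<alpha> i) \<in> V"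
  shows "(\<chi> i. indep_poisson.S (I n) (nk n i) a c) \<in> V"
proof -
  interpret G: indep_poisson M "I n" "cnt n" "lam n" by (rule indep_poisson_grid)
  have k: "(\<chi> i. nk n i a b) \<in> V" for b
  proof -
    define u where "u = norm (corner n a - corner n b)"
    define g where "g = 4 * real CARD('d) / 2 ^ n"
    have g: "g > 0" by (simp add: g_def)
    show ?thesis
    proof (cases "g \<le> u \<and> u < r - g")
      case True
      have "nk n i a b = (1 / scale) * (u / r) powr \<alpha> i" for i
      proof -
        have "nk n i a b = coef i * u powr \<alpha> i"
          using True by (simp add: nk_def grid_kernel_def Let_def u_def[symmetric] g_def[symmetric])
        also have "\<dots> = (1 / scale) * (u powr \<alpha> i * r powr (- \<alpha> i))" by (simp add: coef_eq)
        also have "u powr \<alpha> i * r powr (- \<alpha> i) = (u / r) powr \<alpha> i"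
          using True g r_pos by (simp add: powr_divide powr_minus_divide)
        finally show ?thesis .
      qed
      then have "(\<chi> i. nk n i a b) = (1 / scale) *\<^sub>R (\<chi> i. (u / r) powr \<alpha> i)" by (simp add: vec_eq_iff)
      moreover have "0 < u / r" "u / r < 1" using True g r_pos by auto
      ultimately show ?thesis using assms by (simp add: subspace_scale)
    next
      case False
      then have "nk n i a b = 0" for i by (auto simp: nk_def grid_kernel_def Let_def u_def g_def)
      then have "(\<chi> i. nk n i a b) = 0" by (simp add: vec_eq_iff)
      then show ?thesis using assms(1) by (simp add: subspace_0)
    qed
  qed
  have "(\<chi> i. G.S (nk n i) a c) = (\<Sum>b\<in>I n. real (c b) *\<^sub>R (\<chi> i. nk n i a b))"
    by (simp add: vec_eq_iff G.S_def mult.commute)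
  also have "\<dots> \<in> V" by (intro subspace_sum subspace_scale assms(1) k)
  finally show ?thesis .
qed

text \<open>Insert M1 = C1 t^(-1/2), M2 = C2 / t, M3 = Cq t r^d / scale^q and \<Lambda> = t w into
  \<open>err_bound\<close>. Apart from the mean of \<open>T\<close>, which tends to
  \<open>covL\<close>, the resulting bound does not depend on the grid level, so the mesh can go to
  0.\<close>

theorem main_bound:
  fixes N :: "'v measure" and X :: "'v \<Rightarrow> real ^ 'm" and C :: "real ^ 'm ^ 'm" and C1 C2 Cq :: real
  assumes st: "smooth_test N X C h h1 h2 V Lc"
    and V: "subspace V" "\<And>\<rho>. 0 < \<rho> \<Longrightarrow> \<rho> < 1 \<Longrightarrow> (\<chi> i. \<rho> powr \<alpha> i) \<in> V"
    and q: "2 \<le> q" "q \<le> 3" "\<And>i. q * \<alpha> i > - real CARD('d)"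
  defines "C1 \<equiv> moment_const CARD('d) \<alpha> 1" and "C2 \<equiv> moment_const CARD('d) \<alpha> 2" and "Cq \<equiv> moment_const CARD('d) \<alpha> q"
  shows "\<bar>expectation (\<lambda>\<omega>. h (Lvec \<omega>)) - (\<integral>x. h (X x) \<partial>N)\<bar> \<le>
    ((2 + Lc) / 2 * (5 * w * C1 * (C2 + C1\<^sup>2) * t powr (-1/2) + 4 * w * Cq * (t\<^sup>2 * r ^ CARD('d)) powr (1 - q / 2))
     + (\<Sum>i\<in>UNIV. \<Sum>j\<in>UNIV. sqrt (w * C2 * C1\<^sup>2 + w * C2\<^sup>2 + 5 * w * C1 ^ 4) * t powr (-1/2) + \<bar>covL i j - C $ i $ j\<bar>)) * (pi / 2)"
proof -
  interpret S: smooth_test N X C h h1 h2 V Lc by (rule st)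
  have w0: "w \<ge> 0" by (simp add: w_def)
  have al2: "2 * \<alpha> i > - real CARD('d)" for i using \<alpha>_sum[of i i] by simp
  have Cn: "C1 \<ge> 0" "C2 \<ge> 0" "Cq \<ge> 0"
    unfolding C1_def C2_def Cq_def using \<alpha>_gt al2 q by (auto intro!: moment_const_nonneg)
  define \<tau> where "\<tau> = t powr (-1/2)"
  have tau: "\<tau>\<^sup>2 = 1 / t" "\<tau> \<ge> 0"
    using t_pos by (auto simp: \<tau>_def power2_eq_square powr_add[symmetric] powr_minus_divide)
  define D where "D = (2 + Lc) / 2 * (5 * w * C1 * (C2 + C1\<^sup>2) * \<tau> + 4 * w * Cq * (t\<^sup>2 * r ^ CARD('d)) powr (1 - q / 2))"
  define s where "s = sqrt (w * C2 * C1\<^sup>2 + w * C2\<^sup>2 + 5 * w * C1 ^ 4) * \<tau>"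
  let ?mT = "\<lambda>n i j. indep_poisson.mean M (I n) (cnt n) (indep_poisson.T (I n) (lam n) (nk n i) (nk n j))"
  have bound: "\<bar>expectation (\<lambda>\<omega>. h (Lgrid n \<omega>)) - (\<integral>x. h (X x) \<partial>N)\<bar> \<le> (D + (\<Sum>i\<in>UNIV. \<Sum>j\<in>UNIV. s + \<bar>?mT n i j - C $ i $ j\<bar>)) * (pi / 2)" for n
  proof -
    interpret G: indep_poisson M "I n" "cnt n" "lam n" by (rule indep_poisson_grid)
    interpret cmp: comparison N X C h h1 h2 V Lc M "I n" "cnt n" "lam n" "nk n"
      by unfold_locales (rule kernel_nk, rule power_vector_multiple[OF V])
    have K: "cmp.K = Ksum n" by (simp add: fun_eq_iff cmp.K_def Ksum_def)
    have Fc: "cmp.Fc (G.config \<omega>) = Lgrid n \<omega>" for \<omega>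
      by (simp add: cmp.Fc_def Lgrid_def vec_eq_iff F_grid_sum G.mean_def right_diff_distrib)
    have M1: "(\<Sum>b\<in>I n. lam n b * cmp.K a b) \<le> C1 * \<tau>" if a: "a \<in> I n" for a
    proof -
      have "(\<Sum>b\<in>I n. lam n b * cmp.K a b) = (\<Sum>b\<in>I n. lam n b * Ksum n a b powr 1)" by (simp add: K Ksum_nonneg)
      also have "\<dots> \<le> C1 * (t * r ^ CARD('d) / scale powr 1)" unfolding C1_def by (rule Ksum_moment[OF a]) (use \<alpha>_gt in auto)
      also have "\<dots> \<le> C1 * \<tau>" using scale_bounds(1) scale_pos Cn unfolding \<tau>_def by (intro mult_left_mono) auto
      finally show ?thesis .
    qed
    have M2: "(\<Sum>b\<in>I n. lam n b * (cmp.K a b)\<^sup>2) \<le> C2 * (1 / t)" if a: "a \<in> I n" for a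
    proof -
      have "(\<Sum>b\<in>I n. lam n b * (cmp.K a b)\<^sup>2) = (\<Sum>b\<in>I n. lam n b * Ksum n a b powr 2)" by (simp add: K Ksum_nonneg)
      also have "\<dots> \<le> C2 * (t * r ^ CARD('d) / scale powr 2)" unfolding C2_def by (rule Ksum_moment[OF a]) (use al2 in auto)
      also have "\<dots> \<le> C2 * (1 / t)" using scale_bounds(2) Cn by (intro mult_left_mono) auto
      finally show ?thesis .
    qed
    have M3: "(\<Sum>b\<in>I n. lam n b * (cmp.K a b * \<psi> (cmp.K a b))) \<le> Cq * (t * r ^ CARD('d) / scale powr q)" if a: "a \<in> I n" for a
    proof -
      have "(\<Sum>b\<in>I n. lam n b * (cmp.K a b * \<psi> (cmp.K a b))) \<le> (\<Sum>b\<in>I n. lam n b * Ksum n a b powr q)"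
        unfolding K by (intro sum_mono mult_left_mono lam_nonneg psi_le_powr Ksum_nonneg q)
      also have "\<dots> \<le> Cq * (t * r ^ CARD('d) / scale powr q)" unfolding Cq_def by (rule Ksum_moment[OF a]) (use q in auto)
      finally show ?thesis .
    qed
    have \<Lambda>: "t * w = (\<Sum>a\<in>I n. lam n a)" by (simp add: sum_lam w_def)
    have "cmp.err \<le> (2 + Lc) / 2 * ((t * w) * (5 * (C1 * \<tau>) * (C2 * (1 / t) + (C1 * \<tau>)\<^sup>2) + 4 * (Cq * (t * r ^ CARD('d) / scale powr q))))
      + (\<Sum>i\<in>UNIV. \<Sum>j\<in>UNIV. sqrt ((t * w) * (C2 * (1 / t)) * (C1 * \<tau>)\<^sup>2 + (t * w) * (C2 * (1 / t))\<^sup>2 + 5 * (t * w) * (C1 * \<tau>) ^ 4) + \<bar>?mT n i j - C $ i $ j\<bar>)"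
      by (rule cmp.err_bound[OF I_ne \<Lambda> M1 M2 M3])
    also have "\<dots> \<le> D + (\<Sum>i\<in>UNIV. \<Sum>j\<in>UNIV. s + \<bar>?mT n i j - C $ i $ j\<bar>)"
    proof (intro add_mono sum_mono order_refl)
      have eq: "(t * w) * (5 * (C1 * \<tau>) * (C2 * (1 / t) + (C1 * \<tau>)\<^sup>2)) = 5 * w * C1 * (C2 + C1\<^sup>2) * \<tau>"
        using t_pos by (simp add: power_mult_distrib tau(1) field_simps)
      have le: "(t * w) * (4 * (Cq * (t * r ^ CARD('d) / scale powr q))) \<le> 4 * w * Cq * (t\<^sup>2 * r ^ CARD('d)) powr (1 - q / 2)"
        using mult_left_mono[OF scale_bounds(3)[of q], of "4 * w * Cq"] q w0 Cn by (simp add: mult_ac)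
      show "(2 + Lc) / 2 * ((t * w) * (5 * (C1 * \<tau>) * (C2 * (1 / t) + (C1 * \<tau>)\<^sup>2) + 4 * (Cq * (t * r ^ CARD('d) / scale powr q)))) \<le> D"
        unfolding D_def distrib_left[of "t * w"] eq using S.L_nonneg by (intro mult_left_mono add_left_mono le) simp
      fix i j
      \<comment> \<open>As \<tau>^4 = 1/t^2, each of the three terms under the root is of order 1/t
        after multiplication by \<Lambda> = t w.\<close>
      have pow4: "(C1 * \<tau>) ^ 4 = C1 ^ 4 * (1 / t)\<^sup>2"
        unfolding tau(1)[symmetric] by (simp add: power_mult_distrib power_mult[symmetric])
      have "(t * w) * (C2 * (1 / t)) * (C1 * \<tau>)\<^sup>2 + (t * w) * (C2 * (1 / t))\<^sup>2 + 5 * (t * w) * (C1 * \<tau>) ^ 4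
         = (w * C2 * C1\<^sup>2 + w * C2\<^sup>2 + 5 * w * C1 ^ 4) * \<tau>\<^sup>2"
        unfolding pow4 unfolding power_mult_distrib tau(1) using t_pos by (simp add: field_simps power2_eq_square)
      then show "sqrt ((t * w) * (C2 * (1 / t)) * (C1 * \<tau>)\<^sup>2 + (t * w) * (C2 * (1 / t))\<^sup>2 + 5 * (t * w) * (C1 * \<tau>) ^ 4) \<le> s"
        using tau(2) by (simp add: s_def real_sqrt_mult)
    qed
    finally have "cmp.err * (pi / 2) \<le> (D + (\<Sum>i\<in>UNIV. \<Sum>j\<in>UNIV. s + \<bar>?mT n i j - C $ i $ j\<bar>)) * (pi / 2)"
      by (intro mult_right_mono) auto
    moreover have "G.mean (\<lambda>c. h (cmp.Fc c)) = expectation (\<lambda>\<omega>. h (Lgrid n \<omega>))"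
      unfolding G.mean_def by (simp add: Fc)
    ultimately show ?thesis using order_trans[OF cmp.interpolation] by (simp only: times_divide_eq_right)
  qed
  obtain A0 where A0: "A0 \<ge> 0" "\<And>x. \<bar>h x\<bar> \<le> A0 * (1 + (norm x)\<^sup>2)" using S.h_growth by blast
  have "(\<lambda>n. \<bar>expectation (\<lambda>\<omega>. h (Lgrid n \<omega>)) - (\<integral>x. h (X x) \<partial>N)\<bar>) \<longlonglongrightarrow> \<bar>expectation (\<lambda>\<omega>. h (Lvec \<omega>)) - (\<integral>x. h (X x) \<partial>N)\<bar>"
    by (intro tendsto_intros test_function_limit[OF S.h_cont A0])
  moreover have "(\<lambda>n. (D + (\<Sum>i\<in>UNIV. \<Sum>j\<in>UNIV. s + \<bar>?mT n i j - C $ i $ j\<bar>)) * (pi / 2))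
    \<longlonglongrightarrow> (D + (\<Sum>i\<in>UNIV. \<Sum>j\<in>UNIV. s + \<bar>covL i j - C $ i $ j\<bar>)) * (pi / 2)"
    by (intro tendsto_intros mean_T_limit)
  ultimately have "\<bar>expectation (\<lambda>\<omega>. h (Lvec \<omega>)) - (\<integral>x. h (X x) \<partial>N)\<bar> \<le> (D + (\<Sum>i\<in>UNIV. \<Sum>j\<in>UNIV. s + \<bar>covL i j - C $ i $ j\<bar>)) * (pi / 2)"
    by (rule LIMSEQ_le) (use bound in auto)
  then show ?thesis by (simp only: D_def s_def \<tau>_def)
qed

end

section \<open>Rates of convergence\<close>

text \<open>If C z = 0, then the quadratic form of \<open>C\<close> vanishes at z. Its
  \<open>sigma1\<close> part is a positive multiple of the integral over (0, 1) of x^(d-1) times the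
  square of the sum of z_i x^(\<alpha> i), its \<open>sigma2\<close> part a nonnegative multiple of
  a square. So the continuous integrand is zero, which says that z is orthogonal to every power
  vector; s0 > 0 is essential.\<close>

lemma (in centred_gaussian_vector) power_vector_in_range:
  fixes \<alpha> :: "'m \<Rightarrow> real"
  assumes C: "\<And>i j. C $ i $ j = w * (s0 * sigma1 d (\<alpha> i) (\<alpha> j) + s1 * sigma2 d (\<alpha> i) (\<alpha> j))"
    and w: "w > 0" and s: "s0 > 0" "s1 \<ge> 0" and d: "d > 0"
    and \<alpha>: "\<And>i j. \<alpha> i + \<alpha> j > - real d" and \<rho>: "0 < \<rho>" "\<rho> < 1"
  shows "(\<chi> i. \<rho> powr \<alpha> i) \<in> range ((*v) C)"
proof (rule orthogonal_to_null_in_range)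
  fix z assume z: "C *v z = 0"
  define \<kappa> where "\<kappa> = real d * unit_ball_vol (real d)"
  have \<kappa>: "\<kappa> > 0" using d by (simp add: \<kappa>_def)
  define S where "S = (\<Sum>i\<in>UNIV. \<Sum>j\<in>UNIV. z $ i * z $ j * (1 / (\<alpha> i + \<alpha> j + real d)))"
  define Q where "Q = (\<Sum>i\<in>UNIV. z $ i * (\<kappa> / (\<alpha> i + real d)))"
  have C': "C $ i $ j = (w * s0 * \<kappa> / 2) * (1 / (\<alpha> i + \<alpha> j + real d)) + (w * s1) * ((\<kappa> / (\<alpha> i + real d)) * (\<kappa> / (\<alpha> j + real d)))" for i j
  proof -
    have "\<bar>\<alpha> i + \<alpha> j + real d\<bar> = \<alpha> i + \<alpha> j + real d" using \<alpha>[of i j] by linarith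
    then show ?thesis unfolding C sigma1_def sigma2_def \<kappa>_def by (simp add: algebra_simps power2_eq_square)
  qed
  have "0 = z \<bullet> (C *v z)" by (simp add: z)
  also have "\<dots> = (\<Sum>i\<in>UNIV. \<Sum>j\<in>UNIV. z $ i * z $ j * C $ i $ j)"
    by (simp add: inner_vec_def matrix_vector_mult_def sum_distrib_left mult_ac)
  also have "\<dots> = (\<Sum>i\<in>UNIV. \<Sum>j\<in>UNIV. (w * s0 * \<kappa> / 2) * (z $ i * z $ j * (1 / (\<alpha> i + \<alpha> j + real d)))
      + (w * s1) * ((z $ i * (\<kappa> / (\<alpha> i + real d))) * (z $ j * (\<kappa> / (\<alpha> j + real d)))))"
    unfolding C' by (intro sum.cong refl) (simp only: distrib_left mult_ac)
  also have "\<dots> = (w * s0 * \<kappa> / 2) * S + (w * s1) * (Q * Q)"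
  proof -
    have "Q * Q = (\<Sum>i\<in>UNIV. \<Sum>j\<in>UNIV. (z $ i * (\<kappa> / (\<alpha> i + real d))) * (z $ j * (\<kappa> / (\<alpha> j + real d))))"
      unfolding Q_def by (rule sum_product)
    then show ?thesis unfolding S_def by (simp only: sum.distrib sum_distrib_left)
  qed
  finally have "(w * s0 * \<kappa> / 2) * S + (w * s1) * (Q * Q) = 0" by simp
  moreover have "0 \<le> (w * s1) * (Q * Q)" using w s by simp
  ultimately have "(w * s0 * \<kappa> / 2) * S \<le> 0" by linarith
  moreover have "w * s0 * \<kappa> / 2 > 0" using w s \<kappa> by simp
  ultimately have S0: "S \<le> 0" using mult_pos_pos[of "w * s0 * \<kappa> / 2" S] by linarith
  define f where "f x = (\<Sum>i\<in>UNIV. \<Sum>j\<in>UNIV. z $ i * z $ j * x powr (\<alpha> i + \<alpha> j + real d - 1))" for x :: real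
  have fI: "(f has_integral S) {0..1}"
    unfolding f_def S_def
  proof (intro has_integral_sum has_integral_mult_right finite)
    fix i j
    have "\<alpha> i + \<alpha> j + real d - 1 > -1" using \<alpha>[of i j] by linarith
    from has_integral_powr_from_0[OF this, of 1]
    show "((\<lambda>x. x powr (\<alpha> i + \<alpha> j + real d - 1)) has_integral 1 / (\<alpha> i + \<alpha> j + real d)) {0..1}" by simp
  qed
  have fsq: "f x = x powr (real d - 1) * (\<Sum>i\<in>UNIV. z $ i * x powr \<alpha> i)\<^sup>2" if "x \<ge> 0" for x
  proof -
    have "x powr (\<alpha> i + \<alpha> j + real d - 1) = x powr (real d - 1) * (x powr \<alpha> i * x powr \<alpha> j)" for i j
      unfolding powr_add[symmetric] by (simp add: algebra_simps)
    moreover have "(\<Sum>i\<in>UNIV. z $ i * x powr \<alpha> i)\<^sup>2 = (\<Sum>i\<in>UNIV. \<Sum>j\<in>UNIV. (z $ i * x powr \<alpha> i) * (z $ j * x powr \<alpha> j))"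
      unfolding power2_eq_square by (rule sum_product)
    ultimately show ?thesis
      unfolding f_def by (simp only: sum_distrib_left mult_ac)
  qed
  have f0: "0 \<le> f x" if "x \<ge> 0" for x using that by (simp add: fsq)
  \<comment> \<open>The powers can be singular at 0, so continuity is used only on [\<rho>/2, 1],
    which contains the point of interest.\<close>
  define a where "a = \<rho> / 2"
  have a: "0 < a" "a < \<rho>" using \<rho> by (auto simp: a_def)
  have fc: "continuous_on (cbox a 1) f"
    unfolding f_def using a by (intro continuous_intros) auto
  have fint: "f integrable_on cbox a 1" by (rule integrable_continuous[OF fc])
  have "integral (cbox a 1) f \<le> integral {0..1} f"
    by (rule integral_subset_le) (use a fint fI f0 in \<open>auto simp: has_integral_integrable\<close>)
  also have "\<dots> \<le> 0" using fI S0 by (simp add: integral_unique)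
  finally have "integral (cbox a 1) f \<le> 0" .
  moreover have "0 \<le> integral (cbox a 1) f" by (rule integral_nonneg[OF fint]) (use a f0 in auto)
  ultimately have "(f has_integral 0) (cbox a 1)" using fint by (simp add: has_integral_iff)
  then have "f \<rho> = 0"
    by (rule has_integral_0_cbox_imp_0[OF fc, rotated]) (use a \<rho> f0 in auto)
  then have "(\<Sum>i\<in>UNIV. z $ i * \<rho> powr \<alpha> i) = 0" using \<rho> by (simp add: fsq)
  then show "z \<bullet> (\<chi> i. \<rho> powr \<alpha> i) = 0" by (simp add: inner_vec_def)
qed

text \<open>What counts is s0 > 0. For infinite \<theta> the coefficient of \<open>sigma1\<close>
  would be 0, which is why the bound for \<open>d2\<close> is restricted to finite limits.\<close>

lemma cov_lim_combination:
  assumes "0 \<le> \<theta>" "\<theta> < \<infinity>"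
  obtains s0 s1 where "s0 > 0" "s1 \<ge> 0" "\<And>a b. cov_lim d \<theta> a b = s0 * sigma1 d a b + s1 * sigma2 d a b"
proof -
  obtain x where x: "\<theta> = ereal x" "x \<ge> 0" using assms by (cases \<theta>) auto
  consider "x = 0" | "x \<noteq> 0" "x \<le> 1" | "x > 1" by linarith
  then show ?thesis
  proof cases
    case 1 then show ?thesis using x by (intro that[of 1 0]) (auto simp: cov_lim_def zero_ereal_def)
  next
    case 2 then show ?thesis using x by (intro that[of 1 x]) (auto simp: cov_lim_def zero_ereal_def one_ereal_def)
  next
    case 3 then show ?thesis using x by (intro that[of "1 / x" 1]) (auto simp: cov_lim_def zero_ereal_def one_ereal_def)
  qed
qed

section \<open>The asymptotic setting and bounds uniform over test functions\<close>

locale edge_limit =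
  fixes W :: "(real ^ 'd::finite) set" and \<alpha> :: "'m::finite \<Rightarrow> real" and \<epsilon> :: "real \<Rightarrow> real" and \<theta> :: ereal
    and M :: "real \<Rightarrow> 'w measure" and \<eta> :: "real \<Rightarrow> 'w \<Rightarrow> (real ^ 'd) measure"
    and N :: "'v measure" and X :: "'v \<Rightarrow> real ^ 'm"
  assumes W: "convex_body W" and \<alpha>: "\<And>i j. \<alpha> i + \<alpha> j > - real CARD('d)"
    and \<epsilon>_pos: "\<And>t. t > 0 \<Longrightarrow> \<epsilon> t > 0"
    and \<theta>: "((\<lambda>t. ereal (t * \<epsilon> t ^ CARD('d))) \<longlongrightarrow> \<theta>) at_top"
    and \<eta>: "\<And>t. t > 0 \<Longrightarrow> poisson_measure (M t) (\<eta> t) (scale_measure (ennreal t) lborel)"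
    and N: "prob_space N"
    and X: "centred_gaussian N X (\<chi> i j. measure lborel W * cov_lim CARD('d) \<theta> (\<alpha> i) (\<alpha> j))"
begin

abbreviation L :: "real \<Rightarrow> 'w \<Rightarrow> real ^ 'm" where "L t \<equiv> normalized_edge_vector (M t) (\<eta> t) W t (\<epsilon> t) \<alpha>"
definition C :: "real ^ 'm ^ 'm" where "C = (\<chi> i j. measure lborel W * cov_lim CARD('d) \<theta> (\<alpha> i) (\<alpha> j))"
definition \<Delta> :: "real \<Rightarrow> real" where
  "\<Delta> t = (MAX (i, j) \<in> UNIV. \<bar>cov_beta CARD('d) t (\<epsilon> t) (\<alpha> i) (\<alpha> j) - cov_lim CARD('d) \<theta> (\<alpha> i) (\<alpha> j)\<bar>)"
definition rate :: "real \<Rightarrow> real \<Rightarrow> real" where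
  "rate q t = \<epsilon> t + \<Delta> t + t powr (-1/2) + (t\<^sup>2 * \<epsilon> t ^ CARD('d)) powr (1 - q / 2)"

sublocale centred_gaussian_vector N X C
  using N X by (simp add: centred_gaussian_vector_def centred_gaussian_vector_axioms_def C_def)

lemma \<Delta>_ge: "\<bar>cov_beta CARD('d) t (\<epsilon> t) (\<alpha> i) (\<alpha> j) - cov_lim CARD('d) \<theta> (\<alpha> i) (\<alpha> j)\<bar> \<le> \<Delta> t"
  unfolding \<Delta>_def by (rule Max_ge) (auto intro!: image_eqI[where x="(i, j)"])

lemma \<Delta>_nonneg: "0 \<le> \<Delta> t" using \<Delta>_ge order_trans abs_ge_zero by blast

lemma W_measure_pos: "measure lborel W > 0"
proof -
  have "interior W \<noteq> {}" "compact W" using W by (auto simp: convex_body_def)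
  then obtain a \<rho> where \<rho>: "\<rho> > 0" "ball a \<rho> \<subseteq> W" by (meson ex_in_conv mem_interior)
  have "0 < measure lborel (ball a \<rho>)" using \<rho> by (rule_tac content_ball_pos)
  also have "\<dots> \<le> measure lborel W"
    by (rule measure_mono_fmeasurable[OF \<rho>(2)]) (auto intro: fmeasurable_compact \<open>compact W\<close>)
  finally show ?thesis .
qed

lemma \<alpha>_pos: "\<alpha> i + real CARD('d) > 0"
  using \<alpha>[of i i] of_nat_0_le_iff[of "CARD('d)", where 'a=real] by linarith

lemma sigma_nonneg: "0 \<le> sigma1 CARD('d) (\<alpha> i) (\<alpha> j)" "0 \<le> sigma2 CARD('d) (\<alpha> i) (\<alpha> j)"
  using \<alpha>_pos[of i] \<alpha>_pos[of j] by (auto simp: sigma1_def sigma2_def)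

text \<open>The bound is uniform in t, so the boundary error, a multiple of \<epsilon> t times
  \<open>cov_beta\<close>, is of order \<epsilon> t.\<close>

lemma cov_beta_bounds:
  assumes "t > 0"
  shows "0 \<le> cov_beta CARD('d) t (\<epsilon> t) (\<alpha> i) (\<alpha> j)"
    and "cov_beta CARD('d) t (\<epsilon> t) (\<alpha> i) (\<alpha> j) \<le> sigma1 CARD('d) (\<alpha> i) (\<alpha> j) + sigma2 CARD('d) (\<alpha> i) (\<alpha> j)"
proof -
  have l: "t * \<epsilon> t ^ CARD('d) \<ge> 0" using assms \<epsilon>_pos[OF assms] by simp
  have *: "0 \<le> (a + b * l) / max 1 l" "(a + b * l) / max 1 l \<le> a + b" if "0 \<le> a" "0 \<le> b" "0 \<le> l" for a b l :: real
  proof -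
    show "0 \<le> (a + b * l) / max 1 l" using that by simp
    have "a + b * l \<le> a * max 1 l + b * max 1 l"
      using that mult_left_mono[of 1 "max 1 l" a] by (intro add_mono mult_left_mono) auto
    then show "(a + b * l) / max 1 l \<le> a + b" by (simp add: pos_divide_le_eq distrib_right)
  qed
  show "0 \<le> cov_beta CARD('d) t (\<epsilon> t) (\<alpha> i) (\<alpha> j)"
    "cov_beta CARD('d) t (\<epsilon> t) (\<alpha> i) (\<alpha> j) \<le> sigma1 CARD('d) (\<alpha> i) (\<alpha> j) + sigma2 CARD('d) (\<alpha> i) (\<alpha> j)"
    using *[OF sigma_nonneg(1) sigma_nonneg(2) l, of i j i j] by (simp_all add: cov_beta_def mult.assoc)
qed

text \<open>The constant is fixed before t and the test function: it is built from W, \<alpha>, q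
  and Lc alone, so the supremum over test functions can be taken afterwards.\<close>

lemma smooth_test_rate:
  assumes q: "2 \<le> q" "q \<le> 3" "\<And>i. q * \<alpha> i > - real CARD('d)" and Lc: "0 \<le> Lc"
    and V: "subspace V" "\<And>\<rho>. 0 < \<rho> \<Longrightarrow> \<rho> < 1 \<Longrightarrow> (\<chi> i. \<rho> powr \<alpha> i) \<in> V"
  shows "\<exists>c>0. \<forall>t>0. \<forall>h h1 h2. smooth_test N X C h h1 h2 V Lc \<longrightarrow>
    \<bar>(\<integral>\<omega>. h (L t \<omega>) \<partial>M t) - (\<integral>x. h (X x) \<partial>N)\<bar> \<le> c * rate q t"
proof -
  obtain e where e: "e > 0" and er: "\<And>r. r > 0 \<Longrightarrow> \<exists>V. V \<in> sets borel \<and> V \<subseteq> W \<and> (\<forall>x\<in>V. ball x r \<subseteq> W) \<and> measure lborel W - measure lborel V \<le> e * r"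
    using convex_body_erosion[OF W] by blast
  define w where "w = measure lborel W"
  define C1 C2 Cq where "C1 = moment_const CARD('d) \<alpha> 1" and "C2 = moment_const CARD('d) \<alpha> 2" and "Cq = moment_const CARD('d) \<alpha> q"
  have w0: "w \<ge> 0" by (simp add: w_def)
  have al2: "2 * \<alpha> i > - real CARD('d)" for i using \<alpha>[of i i] by simp
  have al1: "\<alpha> i > - real CARD('d)" for i using \<alpha>_pos[of i] by simp
  have Wne: "W \<noteq> {}" and Wc: "compact W" using W interior_subset[of W] by (auto simp: convex_body_def)
  have Cn: "C1 \<ge> 0" "C2 \<ge> 0" "Cq \<ge> 0"
  proof -
    \<comment> \<open>Any positive t would do; the instance only serves to obtain the signs of the
      constants.\<close>
    interpret E: edge_window "M 1" "\<eta> 1" 1 W "\<epsilon> 1" \<alpha>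
      by (intro edge_window.intro poisson_window.intro poisson_window_axioms.intro edge_window_axioms.intro \<eta> \<epsilon>_pos \<alpha> Wc Wne) auto
    show "C1 \<ge> 0" "C2 \<ge> 0" "Cq \<ge> 0"
      unfolding C1_def C2_def Cq_def using al1 al2 q by (auto intro!: E.moment_const_nonneg)
  qed
  define a1 where "a1 = (2 + Lc) / 2 * (5 * w * C1 * (C2 + C1\<^sup>2))"
  define a2 where "a2 = (2 + Lc) / 2 * (4 * w * Cq)"
  define b where "b = sqrt (w * C2 * C1\<^sup>2 + w * C2\<^sup>2 + 5 * w * C1 ^ 4)"
  define g where "g i j = sigma1 CARD('d) (\<alpha> i) (\<alpha> j) + sigma2 CARD('d) (\<alpha> i) (\<alpha> j)" for i j
  define m2 where "m2 = real CARD('m) * real CARD('m)"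
  define gs where "gs = (\<Sum>i\<in>UNIV. \<Sum>j\<in>UNIV. g i j)"
  have nn: "0 \<le> a1" "0 \<le> a2" "0 \<le> b" "0 \<le> m2" "0 \<le> gs"
    using Cn w0 Lc sigma_nonneg by (auto simp: a1_def a2_def b_def m2_def gs_def g_def intro!: sum_nonneg add_nonneg_nonneg)
  \<comment> \<open>Dominates the coefficients of all four terms of \<open>rate\<close>; the summand
    1 makes it positive.\<close>
  define K where "K = a1 + m2 * b + a2 + e * gs + m2 * w + 1"
  have K: "K > 0" using nn e w0 by (simp add: K_def add_nonneg_pos)
  have "\<bar>(\<integral>\<omega>. h (L t \<omega>) \<partial>M t) - (\<integral>x. h (X x) \<partial>N)\<bar> \<le> (K * (pi / 2)) * rate q t"
    if t: "t > 0" and st: "smooth_test N X C h h1 h2 V Lc" for t h h1 h2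
  proof -
    interpret E: edge_window "M t" "\<eta> t" t W "\<epsilon> t" \<alpha>
      by (intro edge_window.intro poisson_window.intro poisson_window_axioms.intro edge_window_axioms.intro \<eta> \<epsilon>_pos \<alpha> Wc Wne t)
    define \<tau> where "\<tau> = t powr (-1/2)"
    define s where "s = (t\<^sup>2 * \<epsilon> t ^ CARD('d)) powr (1 - q / 2)"
    obtain U where U: "U \<in> sets borel" "U \<subseteq> W" "\<And>x. x \<in> U \<Longrightarrow> ball x (\<epsilon> t) \<subseteq> W" "E.w - measure lborel U \<le> e * \<epsilon> t"
      using er[OF \<epsilon>_pos[OF t]] unfolding E.w_def by blast
    have cov: "\<bar>E.covL i j - C $ i $ j\<bar> \<le> e * \<epsilon> t * g i j + w * \<Delta> t" for i j
    proof -
      let ?b = "cov_beta CARD('d) t (\<epsilon> t) (\<alpha> i) (\<alpha> j)"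
      have "\<bar>E.covL i j - w * ?b\<bar> \<le> e * \<epsilon> t * ?b"
        using E.covL_error[OF U, of i j] by (simp add: E.w_def w_def)
      also have "\<dots> \<le> e * \<epsilon> t * g i j"
        unfolding g_def using e \<epsilon>_pos[OF t] by (intro mult_left_mono cov_beta_bounds t) simp
      finally have 1: "\<bar>E.covL i j - w * ?b\<bar> \<le> e * \<epsilon> t * g i j" .
      have "w * ?b - C $ i $ j = w * (?b - cov_lim CARD('d) \<theta> (\<alpha> i) (\<alpha> j))"
        by (simp add: C_def w_def right_diff_distrib)
      then have "\<bar>w * ?b - C $ i $ j\<bar> = w * \<bar>?b - cov_lim CARD('d) \<theta> (\<alpha> i) (\<alpha> j)\<bar>"
        using w0 by (simp add: abs_mult)
      also have "\<dots> \<le> w * \<Delta> t" by (intro mult_left_mono \<Delta>_ge w0)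
      finally show ?thesis using 1 by linarith
    qed
    have "\<bar>(\<integral>\<omega>. h (E.Lvec \<omega>) \<partial>M t) - (\<integral>x. h (X x) \<partial>N)\<bar> \<le>
      ((2 + Lc) / 2 * (5 * w * C1 * (C2 + C1\<^sup>2) * \<tau> + 4 * w * Cq * s)
        + (\<Sum>i\<in>UNIV. \<Sum>j\<in>UNIV. b * \<tau> + \<bar>E.covL i j - C $ i $ j\<bar>)) * (pi / 2)"
      unfolding C1_def C2_def Cq_def \<tau>_def s_def b_def w_def E.w_def[symmetric]
      by (rule E.main_bound[OF st V q])
    also have "\<dots> \<le> (a1 * \<tau> + a2 * s + (\<Sum>i\<in>UNIV. \<Sum>j\<in>UNIV. b * \<tau> + (e * \<epsilon> t * g i j + w * \<Delta> t))) * (pi / 2)"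
      unfolding a1_def a2_def by (intro mult_right_mono add_mono sum_mono cov order_refl) (auto simp: algebra_simps)
    also have "(\<Sum>i\<in>UNIV. \<Sum>j\<in>UNIV. b * \<tau> + (e * \<epsilon> t * g i j + w * \<Delta> t)) = m2 * (b * \<tau>) + (e * \<epsilon> t * gs + m2 * (w * \<Delta> t))"
      by (simp add: sum.distrib sum_distrib_left[symmetric] gs_def m2_def)
    also have "(a1 * \<tau> + a2 * s + (m2 * (b * \<tau>) + (e * \<epsilon> t * gs + m2 * (w * \<Delta> t)))) * (pi / 2)
      = (e * gs * \<epsilon> t + m2 * w * \<Delta> t + (a1 + m2 * b) * \<tau> + a2 * s) * (pi / 2)" by (simp add: algebra_simps)
    also have "\<dots> \<le> (K * \<epsilon> t + K * \<Delta> t + K * \<tau> + K * s) * (pi / 2)"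
      using nn e w0 \<epsilon>_pos[OF t] \<Delta>_nonneg[of t]
      by (intro mult_right_mono add_mono) (auto simp: K_def \<tau>_def s_def add_nonneg_nonneg)
    also have "\<dots> = (K * (pi / 2)) * rate q t" by (simp add: rate_def \<tau>_def s_def algebra_simps)
    finally show ?thesis by (simp only: E.Lvec_eq)
  qed
  moreover have "K * (pi / 2) > 0" using K by simp
  ultimately show ?thesis by blast
qed

lemma d3_rate:
  assumes q: "2 \<le> q" "q \<le> 3" "\<And>i. q * \<alpha> i > - real CARD('d)"
  shows "\<exists>c>0. \<forall>t>0. d3 (M t) (L t) N X \<le> ereal (c * rate q t)"
proof -
  have "\<exists>c>0. \<forall>t>0. \<forall>h h1 h2. smooth_test N X C h h1 h2 UNIV (real CARD('m)) \<longrightarrow>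
      \<bar>(\<integral>\<omega>. h (L t \<omega>) \<partial>M t) - (\<integral>x. h (X x) \<partial>N)\<bar> \<le> c * rate q t"
    by (rule smooth_test_rate[OF q of_nat_0_le_iff subspace_UNIV UNIV_I])
  then obtain c where c: "c > 0" "\<And>t h h1 h2. t > 0 \<Longrightarrow> smooth_test N X C h h1 h2 UNIV (real CARD('m)) \<Longrightarrow>
      \<bar>(\<integral>\<omega>. h (L t \<omega>) \<partial>M t) - (\<integral>x. h (X x) \<partial>N)\<bar> \<le> c * rate q t"
    by blast
  have "d3 (M t) (L t) N X \<le> ereal (c * rate q t)" if "t > 0" for t
    unfolding d3_def test_dist_def by (intro SUP_least) (use c(2)[OF that smooth_test_H3] in simp)
  then show ?thesis using c(1) by blast
qed

lemma d2_rate: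
  assumes q: "2 \<le> q" "q \<le> 3" "\<And>i. q * \<alpha> i > - real CARD('d)" and fin: "\<theta> < \<infinity>"
  shows "\<exists>c>0. \<forall>t>0. d2 (M t) (L t) N X \<le> ereal (c * rate q t)"
proof -
  have "0 \<le> \<theta>"
  proof (rule tendsto_lowerbound[OF \<theta>])
    show "\<forall>\<^sub>F t in at_top. 0 \<le> ereal (t * \<epsilon> t ^ CARD('d))"
      using eventually_gt_at_top[of 0] by eventually_elim (use \<epsilon>_pos in \<open>auto intro!: mult_nonneg_nonneg zero_le_power less_imp_le\<close>)
  qed simp
  then obtain s0 s1 where s: "s0 > 0" "s1 \<ge> 0" "\<And>a b. cov_lim CARD('d) \<theta> a b = s0 * sigma1 CARD('d) a b + s1 * sigma2 CARD('d) a b"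
    using cov_lim_combination[OF _ fin] by metis
  let ?V = "range ((*v) C)"
  have sub: "subspace ?V"
    by (intro linear_subspace_image matrix_vector_mul_linear subspace_UNIV)
  have pv: "(\<chi> i. \<rho> powr \<alpha> i) \<in> ?V" if "0 < \<rho>" "\<rho> < 1" for \<rho>
    by (rule power_vector_in_range[OF _ W_measure_pos s(1,2) _ \<alpha> that]) (simp_all add: C_def s(3))
  obtain Lc where Lc: "Lc \<ge> 0" "\<And>v. v \<in> ?V \<Longrightarrow> \<exists>w. v = C *v w \<and> sqrt (w \<bullet> v) \<le> Lc * norm v"
    using range_covariance by blast
  obtain c where c: "c > 0" "\<And>t h h1 h2. t > 0 \<Longrightarrow> smooth_test N X C h h1 h2 ?V Lc \<Longrightarrow>
      \<bar>(\<integral>\<omega>. h (L t \<omega>) \<partial>M t) - (\<integral>x. h (X x) \<partial>N)\<bar> \<le> c * rate q t"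
    using smooth_test_rate[OF q Lc(1) sub pv] by blast
  have "d2 (M t) (L t) N X \<le> ereal (c * rate q t)" if t: "t > 0" for t
    unfolding d2_def test_dist_def
  proof (rule SUP_least)
    fix h :: "real ^ 'm \<Rightarrow> real" assume h: "h \<in> H2"
    have "smooth_test N X C h (\<lambda>i. partial i h) (\<lambda>i j. partial j (partial i h)) ?V Lc"
      by (rule smooth_test_H2[OF h subspace_scale[OF sub] Lc(1) Lc(2)])
    from c(2)[OF t this] show "ereal \<bar>(\<integral>\<omega>. h (L t \<omega>) \<partial>M t) - (\<integral>x. h (X x) \<partial>N)\<bar> \<le> ereal (c * rate q t)" by simp
  qed
  then show ?thesis using c(1) by blast
qed

lemma rate_3_le: "rate 3 t \<le> 2 * (\<epsilon> t + \<Delta> t + max (t powr (-1/2)) ((t\<^sup>2 * \<epsilon> t ^ CARD('d)) powr (-1/2)))" if "t > 0"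
  using \<epsilon>_pos[OF that] \<Delta>_nonneg[of t] unfolding rate_def by (simp add: max_def)

text \<open>For q = 2 p the exponent 1 - p is at most -1 + 1/p because (p - 1)^2 >= 0; for q = 3 and
  for t^(-1/2) the condition p <= 2 gives -1/2 <= -1 + 1/p. Both bases are at least 1, so powers are
  ordered like their exponents.\<close>

lemma rate_min_le:
  assumes p: "1 < p" "p \<le> 2" and t: "t \<ge> 1" and s: "t\<^sup>2 * \<epsilon> t ^ CARD('d) \<ge> 1"
  shows "rate (min (2 * p) 3) t \<le> 2 * (\<epsilon> t + \<Delta> t + max (t powr (-1 + 1/p)) ((t\<^sup>2 * \<epsilon> t ^ CARD('d)) powr (-1 + 1/p)))"
proof -
  have half: "-1/2 \<le> -1 + 1/p" using p by (simp add: field_simps)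
  have "1 - p \<le> -1 + 1/p"
    using p zero_le_power2[of "p - 1"] by (simp add: field_simps power2_eq_square)
  then have "1 - min (2 * p) 3 / 2 \<le> -1 + 1/p" using half p by (auto simp: min_def)
  then have 1: "(t\<^sup>2 * \<epsilon> t ^ CARD('d)) powr (1 - min (2 * p) 3 / 2) \<le> (t\<^sup>2 * \<epsilon> t ^ CARD('d)) powr (-1 + 1/p)"
    using s by (rule powr_mono)
  have 2: "t powr (-1/2) \<le> t powr (-1 + 1/p)" using half t by (rule powr_mono)
  have "\<epsilon> t > 0" using t by (intro \<epsilon>_pos) simp
  moreover have "a + b + u + v \<le> 2 * (a + b + max x y)" if "0 < a" "0 \<le> b" "u \<le> x" "v \<le> y" for a b u v x y :: real
    using that by (auto simp: max_def)
  ultimately show ?thesis unfolding rate_def using 1 2 \<Delta>_nonneg[of t] by blast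
qed

end

lemma eventually_bound_by_rate:
  fixes f :: "real \<Rightarrow> ereal"
  assumes "\<exists>c>0. \<forall>t>0. f t \<le> ereal (c * g t)" and "\<forall>\<^sub>F t in at_top. g t \<le> 2 * b t"
  shows "\<exists>c>0. \<forall>\<^sub>F t in at_top. f t \<le> ereal (c * b t)"
proof -
  obtain c where c: "c > 0" "\<And>t. t > 0 \<Longrightarrow> f t \<le> ereal (c * g t)" using assms(1) by blast
  have "\<forall>\<^sub>F t in at_top. f t \<le> ereal ((c * 2) * b t)"
    using assms(2) eventually_gt_at_top[of 0]
  proof eventually_elim
    case (elim t)
    have "c * g t \<le> c * (2 * b t)" using elim c by (intro mult_left_mono) auto
    then show ?case using c(2)[OF elim(2)] by (simp add: mult.assoc) (meson ereal_less_eq(3) order_trans)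
  qed
  then show ?thesis using c(1) by (intro exI[of _ "c * 2"]) auto
qed

theorem theorem2:
  fixes W :: "(real ^ 'd::finite) set"
    and \<alpha> :: "'m::finite \<Rightarrow> real"
    and \<epsilon> :: "real \<Rightarrow> real"
    and \<theta> :: ereal
    and M :: "real \<Rightarrow> 'w measure"
    and \<eta> :: "real \<Rightarrow> 'w \<Rightarrow> (real ^ 'd) measure"
    and N :: "'v measure"
    and X :: "'v \<Rightarrow> real ^ 'm"
  defines "d \<equiv> CARD('d)"
  defines "L \<equiv> \<lambda>t. normalized_edge_vector (M t) (\<eta> t) W t (\<epsilon> t) \<alpha>"
  defines "\<Delta> \<equiv> \<lambda>t. MAX (i, j) \<in> UNIV. \<bar>cov_beta d t (\<epsilon> t) (\<alpha> i) (\<alpha> j) - cov_lim d \<theta> (\<alpha> i) (\<alpha> j)\<bar>"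
  defines "bound1 \<equiv> \<lambda>t. \<epsilon> t + \<Delta> t + max (t powr (-1/2)) ((t\<^sup>2 * \<epsilon> t ^ d) powr (-1/2))"
  defines "bound2 \<equiv> \<lambda>p t. \<epsilon> t + \<Delta> t + max (t powr (-1 + 1/p)) ((t\<^sup>2 * \<epsilon> t ^ d) powr (-1 + 1/p))"
  assumes W: "convex_body W"
    and \<alpha>: "\<And>i j. \<alpha> i + \<alpha> j > - real d"
    and \<epsilon>_pos: "\<And>t. t > 0 \<Longrightarrow> \<epsilon> t > 0"
    and \<epsilon>_lim: "(\<epsilon> \<longlongrightarrow> 0) at_top"
    and \<theta>: "((\<lambda>t. ereal (t * \<epsilon> t ^ d)) \<longlongrightarrow> \<theta>) at_top"
    and infinite_edges: "filterlim (\<lambda>t. t\<^sup>2 * \<epsilon> t ^ d) at_top at_top"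
    and \<eta>: "\<And>t. t > 0 \<Longrightarrow> poisson_measure (M t) (\<eta> t) (scale_measure (ennreal t) lborel)"
    and N: "prob_space N"
    and X: "centred_gaussian N X (\<chi> i j. measure lborel W * cov_lim d \<theta> (\<alpha> i) (\<alpha> j))"
  shows
    "((\<forall>i. \<alpha> i > - real d / 4) \<longrightarrow>
        (\<exists>c1>0. \<forall>\<^sub>F t in at_top. d3 (M t) (L t) N X \<le> ereal (c1 * bound1 t))) \<and>
     (- real d / 2 < Min (range \<alpha>) \<and> Min (range \<alpha>) \<le> - real d / 4 \<longrightarrow>
        (\<forall>p. 1 < p \<and> p < - real d / 2 * inverse (Min (range \<alpha>)) \<longrightarrow>
          (\<exists>c2>0. \<forall>\<^sub>F t in at_top. d3 (M t) (L t) N X \<le> ereal (c2 * bound2 p t)))) \<and>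
     (\<theta> < \<infinity> \<longrightarrow>
        ((\<forall>i. \<alpha> i > - real d / 4) \<longrightarrow>
          (\<exists>c1>0. \<forall>\<^sub>F t in at_top. d2 (M t) (L t) N X \<le> ereal (c1 * bound1 t))) \<and>
        (- real d / 2 < Min (range \<alpha>) \<and> Min (range \<alpha>) \<le> - real d / 4 \<longrightarrow>
          (\<forall>p. 1 < p \<and> p < - real d / 2 * inverse (Min (range \<alpha>)) \<longrightarrow>
            (\<exists>c2>0. \<forall>\<^sub>F t in at_top. d2 (M t) (L t) N X \<le> ereal (c2 * bound2 p t)))))"
proof -
  interpret E: edge_limit W \<alpha> \<epsilon> \<theta> M \<eta> N X
    by (intro edge_limit.intro W \<epsilon>_pos \<eta> N \<alpha>[unfolded d_def] \<theta>[unfolded d_def] X[unfolded d_def])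
  have \<Delta>: "\<Delta> = E.\<Delta>" by (simp add: fun_eq_iff \<Delta>_def E.\<Delta>_def d_def)
  have d: "real d > 0" by (simp add: d_def)
  have q3: "2 \<le> (3::real)" "3 \<le> (3::real)" by auto
  \<comment> \<open>Three times -d/4 exceeds -d, so the third moment of the kernel is
    finite.\<close>
  have al3: "3 * \<alpha> i > - real CARD('d)" if "\<forall>i. \<alpha> i > - real d / 4" for i
    using spec[OF that, of i] d by (simp add: d_def)
  have r1: "\<forall>\<^sub>F t in at_top. E.rate 3 t \<le> 2 * bound1 t"
    using eventually_gt_at_top[of 0]
    by eventually_elim (use E.rate_3_le in \<open>simp add: bound1_def \<Delta> d_def\<close>)
  \<comment> \<open>As the minimum m is at most -d/4, the upper bound on p is at most 2. That bound
    also says p m > -d/2, hence q \<alpha> i > -d for q = min (2 p) 3 and negative \<alpha> i;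
    nonnegative ones are trivial.\<close>
  have p2: "p \<le> 2 \<and> 2 \<le> min (2 * p) 3 \<and> (\<forall>i. min (2 * p) 3 * \<alpha> i > - real CARD('d))"
    if m: "- real d / 2 < Min (range \<alpha>)" "Min (range \<alpha>) \<le> - real d / 4"
      and p: "1 < p" "p < - real d / 2 * inverse (Min (range \<alpha>))" for p
  proof -
    define m where "m = Min (range \<alpha>)"
    have m0: "m < 0" using m d by (simp add: m_def)
    have pm: "p * m > - real d / 2"
    proof -
      have "p < - real d / 2 * inverse m" using p(2) unfolding m_def .
      also have "\<dots> = (real d / 2) / (- m)" using m0 by (simp add: field_simps)
      finally have "p < (real d / 2) / (- m)" .
      then have "p * (- m) < real d / 2" using m0 by (simp only: pos_less_divide_eq neg_0_less_iff_less)
      then show ?thesis by simp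
    qed
    have "p \<le> 2"
    proof (rule ccontr)
      assume "\<not> p \<le> 2"
      then have "p * m \<le> 2 * m" using m0 by (intro mult_right_mono_neg) auto
      then show False using pm m(2)[folded m_def] by linarith
    qed
    moreover have "min (2 * p) 3 * \<alpha> i > - real CARD('d)" for i
    proof (cases "\<alpha> i \<ge> 0")
      case True
      then have "0 \<le> min (2 * p) 3 * \<alpha> i" using p by simp
      then show ?thesis using d unfolding d_def by linarith
    next
      case False
      have "m \<le> \<alpha> i" unfolding m_def by (rule Min_le) auto
      then have "2 * p * m \<le> 2 * p * \<alpha> i" using p by (intro mult_left_mono) auto
      also have "\<dots> \<le> min (2 * p) 3 * \<alpha> i" using False by (intro mult_right_mono_neg) auto
      finally show ?thesis using pm by (simp add: d_def)
    qed
    ultimately show ?thesis using p by simp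
  qed
  \<comment> \<open>The divergence of t^2 \<epsilon>^d enters here: eventually this base is at least
    1.\<close>
  have r2: "\<forall>\<^sub>F t in at_top. E.rate (min (2 * p) 3) t \<le> 2 * bound2 p t" if "1 < p" "p \<le> 2" for p
    using eventually_ge_at_top[of 1] filterlim_at_top[THEN iffD1, OF infinite_edges, rule_format, of 1]
    by eventually_elim (use E.rate_min_le[OF that] in \<open>simp add: bound2_def \<Delta> d_def\<close>)
  show ?thesis
  proof (intro conjI impI allI)
    assume a: "\<forall>i. \<alpha> i > - real d / 4"
    show "\<exists>c1>0. \<forall>\<^sub>F t in at_top. d3 (M t) (L t) N X \<le> ereal (c1 * bound1 t)"
      unfolding L_def by (rule eventually_bound_by_rate[OF E.d3_rate[OF q3 al3[OF a]] r1])
  next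
    fix p assume "- real d / 2 < Min (range \<alpha>) \<and> Min (range \<alpha>) \<le> - real d / 4"
      and "1 < p \<and> p < - real d / 2 * inverse (Min (range \<alpha>))"
    then have p: "1 < p" "p \<le> 2" "2 \<le> min (2 * p) 3" "\<And>i. min (2 * p) 3 * \<alpha> i > - real CARD('d)" using p2[of p] by auto
    show "\<exists>c2>0. \<forall>\<^sub>F t in at_top. d3 (M t) (L t) N X \<le> ereal (c2 * bound2 p t)"
      unfolding L_def by (rule eventually_bound_by_rate[OF E.d3_rate[OF p(3) min.cobounded2 p(4)] r2[OF p(1,2)]])
  next
    assume fin: "\<theta> < \<infinity>" and a: "\<forall>i. \<alpha> i > - real d / 4"
    show "\<exists>c1>0. \<forall>\<^sub>F t in at_top. d2 (M t) (L t) N X \<le> ereal (c1 * bound1 t)"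
      unfolding L_def by (rule eventually_bound_by_rate[OF E.d2_rate[OF q3 al3[OF a] fin] r1])
  next
    fix p assume fin: "\<theta> < \<infinity>" and "- real d / 2 < Min (range \<alpha>) \<and> Min (range \<alpha>) \<le> - real d / 4"
      and "1 < p \<and> p < - real d / 2 * inverse (Min (range \<alpha>))"
    then have p: "1 < p" "p \<le> 2" "2 \<le> min (2 * p) 3" "\<And>i. min (2 * p) 3 * \<alpha> i > - real CARD('d)" using p2[of p] by auto
    show "\<exists>c2>0. \<forall>\<^sub>F t in at_top. d2 (M t) (L t) N X \<le> ereal (c2 * bound2 p t)"
      unfolding L_def by (rule eventually_bound_by_rate[OF E.d2_rate[OF p(3) min.cobounded2 p(4) fin] r2[OF p(1,2)]])
  qed
qed

end
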